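(* Let $\omega$ be a weight function on a locally compact group $G$. Then the following assertions are equivalent. (a) $M_*(G,\omega)^*$ is amenable. (b) $M(G,\omega)$ is amenable. (c) $G$ is a discrete amenable group and $\omega^*$ is bounded. In this case, $M_*(G,\omega)^*=L^1(G)$.
   Context: All groups are Hausdorff locally compact. A weight (weight function) on $G$ is a continuous function $\omega:G\to[1,\infty)$ with $\omega(e)=1$ and $\omega(xy)\le\omega(x)\omega(y)$ for all $x,y\in G$; $\omega^*(x)=\omega(x)\omega(x^{-1})$ for $x\in G$. $L^1(G,\omega)$ is the Banach algebra (under convolution) of measurable $\phi$ with $\omega\phi\in L^1(G)$. $M(G,\omega)$ is the Banach algebra (under convolution, norm $\|\mu\|_\omega=\|\omega\mu\|$) of complex regular Borel measures $\mu$ on $G$ with $\omega\mu\in M(G)$. A functional $\lambda\in M(G,\omega)^*$ vanishes at infinity if for every $\varepsilon>0$ there is a compact $K\subseteq G$ with $|\langle\lambda,\mu\rangle|<\varepsilon$ for all $\mu\in M(G,\omega)$ with $|\mu|(K)=0$ and $\|\mu\|_\omega=1$. $M_*(G,\omega)$ is the (norm closed) subspace of $M(G,\omega)^*$ of all functionals that vanish at infinity. $L^1(G,\omega)$ is regarded as a subspace of $M_*(G,\omega)^*$ via $\langle\phi,\lambda\rangle:=\langle\lambda,\phi\rangle$. $M_*(G,\omega)^*$ is a Banach algebra under the first Arens product: for $\lambda\in M_*(G,\omega)$, $\mu,\nu\in M(G,\omega)$, $\Phi,\Psi\in M_*(G,\omega)^*$, put $\langle\lambda\mu,\nu\rangle=\langle\lambda,\mu*\nu\rangle$,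 $\langle\Psi\lambda,\mu\rangle=\langle\Psi,\lambda\mu\rangle$, $\langle\Phi\diamond\Psi,\lambda\rangle=\langle\Phi,\Psi\lambda\rangle$ ($M_*(G,\omega)$ is left introverted in $M(G,\omega)^*$). A Banach algebra $\mathfrak A$ is amenable if every continuous derivation from $\mathfrak A$ into $E^*$ is inner for every Banach $\mathfrak A$-(bi)module $E$. *)

theory Defs
  imports "HOL-Analysis.Analysis" "HOL-Algebra.Module"
begin

section \<open>Complex Banach spaces, Banach algebras, bimodules and amenability\<close>

text \<open>
  The spaces involved (measures, functionals, arbitrary Banach bimodules) are subsets of types,
  so normed spaces are carrier-based: a module over the field of complex numbers in the sense of
  HOL-Algebra, extended by a norm.  The ring components mult and one that such a record
  inherits carry a meaning only when the record is used as a Banach algebra; one is never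
  referred to, since Banach algebras need not be unital.
\<close>

definition complex_field :: "complex ring" where
  "complex_field = \<lparr>carrier = UNIV, mult = (*), one = 1, zero = 0, add = (+)\<rparr>"

record 'e nspace = "(complex, 'e) module" +
  nrm :: "'e \<Rightarrow> real"

definition normed_space :: "'e nspace \<Rightarrow> bool" where
  "normed_space E \<longleftrightarrow>
     module complex_field E \<and>
     (\<forall>x\<in>carrier E. 0 \<le> nrm E x \<and> (nrm E x = 0 \<longleftrightarrow> x = \<zero>\<^bsub>E\<^esub>)) \<and>
     (\<forall>c. \<forall>x\<in>carrier E. nrm E (c \<odot>\<^bsub>E\<^esub> x) = cmod c * nrm E x) \<and>
     (\<forall>x\<in>carrier E. \<forall>y\<in>carrier E. nrm E (x \<oplus>\<^bsub>E\<^esub> y) \<le> nrm E x + nrm E y)"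

definition banach_space :: "'e nspace \<Rightarrow> bool" where
  "banach_space E \<longleftrightarrow>
     normed_space E \<and>
     (\<forall>s :: nat \<Rightarrow> 'e.
        (\<forall>n. s n \<in> carrier E) \<and>
        (\<forall>\<epsilon>>0. \<exists>N. \<forall>m\<ge>N. \<forall>n\<ge>N. nrm E (s m \<ominus>\<^bsub>E\<^esub> s n) < \<epsilon>) \<longrightarrow>
        (\<exists>x\<in>carrier E. (\<lambda>n. nrm E (s n \<ominus>\<^bsub>E\<^esub> x)) \<longlonglongrightarrow> 0))"

definition linear_into :: "'e nspace \<Rightarrow> 'f nspace \<Rightarrow> ('e \<Rightarrow> 'f) \<Rightarrow> bool" where
  "linear_into E F T \<longleftrightarrow>
     T \<in> carrier E \<rightarrow> carrier F \<and>
     (\<forall>x\<in>carrier E. \<forall>y\<in>carrier E. T (x \<oplus>\<^bsub>E\<^esub> y) = T x \<oplus>\<^bsub>F\<^esub> T y) \<and>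
     (\<forall>c. \<forall>x\<in>carrier E. T (c \<odot>\<^bsub>E\<^esub> x) = c \<odot>\<^bsub>F\<^esub> T x)"

definition bounded_linear_into :: "'e nspace \<Rightarrow> 'f nspace \<Rightarrow> ('e \<Rightarrow> 'f) \<Rightarrow> bool" where
  "bounded_linear_into E F T \<longleftrightarrow>
     linear_into E F T \<and> (\<exists>C. \<forall>x\<in>carrier E. nrm F (T x) \<le> C * nrm E x)"

definition scalars :: "complex nspace" where
  "scalars = \<lparr>carrier = UNIV, mult = (*), one = 1, zero = 0, add = (+), smult = (*), nrm = cmod\<rparr>"

text \<open>
  Functionals are total functions on the underlying type; setting them to 0 outside the
  carrier makes equality of functionals the equality of functions.
\<close>

definition dual_space :: "'e nspace \<Rightarrow> ('e \<Rightarrow> complex) nspace" where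
  "dual_space E =
     \<lparr>carrier = {f. bounded_linear_into E scalars f \<and> (\<forall>x. x \<notin> carrier E \<longrightarrow> f x = 0)},
      mult = undefined, one = undefined,
      zero = (\<lambda>x. 0), add = (\<lambda>f g x. f x + g x), smult = (\<lambda>c f x. c * f x),
      nrm = (\<lambda>f. SUP x\<in>{x\<in>carrier E. nrm E x \<le> 1}. cmod (f x))\<rparr>"

definition banach_algebra :: "'b nspace \<Rightarrow> bool" where
  "banach_algebra A \<longleftrightarrow>
     banach_space A \<and>
     (\<forall>a\<in>carrier A. linear_into A A (\<lambda>b. a \<otimes>\<^bsub>A\<^esub> b) \<and> linear_into A A (\<lambda>b. b \<otimes>\<^bsub>A\<^esub> a)) \<and>
     (\<forall>a\<in>carrier A. \<forall>b\<in>carrier A. \<forall>c\<in>carrier A.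
        (a \<otimes>\<^bsub>A\<^esub> b) \<otimes>\<^bsub>A\<^esub> c = a \<otimes>\<^bsub>A\<^esub> (b \<otimes>\<^bsub>A\<^esub> c)) \<and>
     (\<forall>a\<in>carrier A. \<forall>b\<in>carrier A. nrm A (a \<otimes>\<^bsub>A\<^esub> b) \<le> nrm A a * nrm A b)"

definition banach_bimodule ::
  "'b nspace \<Rightarrow> 'e nspace \<Rightarrow> ('b \<Rightarrow> 'e \<Rightarrow> 'e) \<Rightarrow> ('e \<Rightarrow> 'b \<Rightarrow> 'e) \<Rightarrow> bool" where
  "banach_bimodule A E l r \<longleftrightarrow>
     banach_space E \<and>
     (\<forall>a\<in>carrier A. linear_into E E (\<lambda>x. l a x) \<and> linear_into E E (\<lambda>x. r x a)) \<and>
     (\<forall>x\<in>carrier E. linear_into A E (\<lambda>a. l a x) \<and> linear_into A E (\<lambda>a. r x a)) \<and>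
     (\<forall>a\<in>carrier A. \<forall>b\<in>carrier A. \<forall>x\<in>carrier E.
        l (a \<otimes>\<^bsub>A\<^esub> b) x = l a (l b x) \<and>
        r x (a \<otimes>\<^bsub>A\<^esub> b) = r (r x a) b \<and>
        r (l a x) b = l a (r x b)) \<and>
     (\<exists>C. \<forall>a\<in>carrier A. \<forall>x\<in>carrier E.
        nrm E (l a x) \<le> C * nrm A a * nrm E x \<and> nrm E (r x a) \<le> C * nrm A a * nrm E x)"

definition dual_lact :: "'e nspace \<Rightarrow> ('e \<Rightarrow> 'b \<Rightarrow> 'e) \<Rightarrow> 'b \<Rightarrow> ('e \<Rightarrow> complex) \<Rightarrow> 'e \<Rightarrow> complex" where
  "dual_lact E r a f = (\<lambda>x. if x \<in> carrier E then f (r x a) else 0)"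

definition dual_ract :: "'e nspace \<Rightarrow> ('b \<Rightarrow> 'e \<Rightarrow> 'e) \<Rightarrow> ('e \<Rightarrow> complex) \<Rightarrow> 'b \<Rightarrow> 'e \<Rightarrow> complex" where
  "dual_ract E l f a = (\<lambda>x. if x \<in> carrier E then f (l a x) else 0)"

definition continuous_derivation ::
  "'b nspace \<Rightarrow> 'e nspace \<Rightarrow> ('b \<Rightarrow> 'e \<Rightarrow> 'e) \<Rightarrow> ('e \<Rightarrow> 'b \<Rightarrow> 'e) \<Rightarrow> ('b \<Rightarrow> 'e \<Rightarrow> complex) \<Rightarrow> bool"
where
  "continuous_derivation A E l r D \<longleftrightarrow>
     bounded_linear_into A (dual_space E) D \<and>
     (\<forall>a\<in>carrier A. \<forall>b\<in>carrier A.
        D (a \<otimes>\<^bsub>A\<^esub> b) = dual_lact E r a (D b) \<oplus>\<^bsub>dual_space E\<^esub> dual_ract E l (D a) b)"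

definition inner_derivation ::
  "'b nspace \<Rightarrow> 'e nspace \<Rightarrow> ('b \<Rightarrow> 'e \<Rightarrow> 'e) \<Rightarrow> ('e \<Rightarrow> 'b \<Rightarrow> 'e) \<Rightarrow> ('b \<Rightarrow> 'e \<Rightarrow> complex) \<Rightarrow> bool"
where
  "inner_derivation A E l r D \<longleftrightarrow>
     (\<exists>f\<in>carrier (dual_space E). \<forall>a\<in>carrier A.
        D a = dual_lact E r a f \<ominus>\<^bsub>dual_space E\<^esub> dual_ract E l f a)"

text \<open>
  HOL cannot quantify over types inside a formula.  The bimodules range over all Banach
  bimodules whose underlying set is a subset of the universe type 'e, which is a parameter; it
  has to be sufficiently large for the notion to be the usual one.
\<close>

definition amenable :: "'e itself \<Rightarrow> 'b nspace \<Rightarrow> bool" where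
  "amenable _ A \<longleftrightarrow>
     banach_algebra A \<and>
     (\<forall>(E :: 'e nspace) l r. banach_bimodule A E l r \<longrightarrow>
        (\<forall>D. continuous_derivation A E l r D \<longrightarrow> inner_derivation A E l r D))"


section \<open>Complex regular Borel measures\<close>

text \<open>
  A complex measure is a countably additive function on the Borel sets, set to 0 on all other
  sets so that equality of measures is equality of functions.
\<close>

type_synonym 'g cmeasure = "'g set \<Rightarrow> complex"

definition complex_measure :: "('g::topological_space) cmeasure \<Rightarrow> bool" where
  "complex_measure \<mu> \<longleftrightarrow>
     (\<forall>A. A \<notin> sets borel \<longrightarrow> \<mu> A = 0) \<and>
     (\<forall>F :: nat \<Rightarrow> 'g set. range F \<subseteq> sets borel \<and> disjoint_family F \<longrightarrow>
        (\<lambda>i. \<mu> (F i)) sums \<mu> (\<Union>i. F i))"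

text \<open>The total variation measure.\<close>

definition variation :: "('g::topological_space) cmeasure \<Rightarrow> 'g measure" where
  "variation \<mu> = measure_of UNIV (sets borel)
     (\<lambda>A. SUP F\<in>{F :: nat \<Rightarrow> 'g set. range F \<subseteq> sets borel \<and> disjoint_family F \<and> (\<Union>i. F i) = A}.
            \<Sum>i. ennreal (cmod (\<mu> (F i))))"

definition regular_measures :: "('g::t2_space) cmeasure set" where
  "regular_measures =
     {\<mu>. complex_measure \<mu> \<and>
         (\<forall>A\<in>sets borel.
            emeasure (variation \<mu>) A = (INF U\<in>{U. open U \<and> A \<subseteq> U}. emeasure (variation \<mu>) U) \<and>
            emeasure (variation \<mu>) A = (SUP K\<in>{K. compact K \<and> K \<subseteq> A}. emeasure (variation \<mu>) K))}"

text \<open>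
  Integration against a complex measure goes through the polar decomposition
  \<open>d\<mu> = h d|\<mu>|\<close> with \<open>|h| = 1\<close>; the density h exists and is unique almost everywhere.
\<close>

definition polar_density :: "('g::topological_space) cmeasure \<Rightarrow> 'g \<Rightarrow> complex" where
  "polar_density \<mu> = (SOME h. h \<in> borel_measurable borel \<and> (\<forall>x. cmod (h x) = 1) \<and>
     (\<forall>A\<in>sets borel. \<mu> A = (LINT x:A|variation \<mu>. h x)))"

definition cintegral :: "('g::topological_space) cmeasure \<Rightarrow> ('g \<Rightarrow> complex) \<Rightarrow> complex" where
  "cintegral \<mu> f = (LINT x|variation \<mu>. f x * polar_density \<mu> x)"

text \<open>
  Topological groups are written additively, because that is how the library class
  topological_group_add does it; this class does not assume commutativity.

  Convolution: \<open>(\<mu> * \<nu>)(A) = \<integral> \<nu>(x\<^sup>-\<^sup>1 A) d\<mu>(x)\<close>.  (The set function is used instead of a product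
  measure because the product of two Borel \<open>\<sigma>\<close>-algebras is in general smaller than the Borel
  \<open>\<sigma>\<close>-algebra of the product space.)
\<close>

definition conv ::
  "('g::topological_group_add) cmeasure \<Rightarrow> 'g cmeasure \<Rightarrow> 'g cmeasure" where
  "conv \<mu> \<nu> = (\<lambda>A. if A \<in> sets borel then cintegral \<mu> (\<lambda>x. \<nu> {y. x + y \<in> A}) else 0)"

definition point_mass :: "'g::topological_space \<Rightarrow> 'g cmeasure" where
  "point_mass a = (\<lambda>A. if A \<in> sets borel \<and> a \<in> A then 1 else 0)"


section \<open>Weighted measure algebras and their Arens duals\<close>

definition weight :: "('g::topological_group_add \<Rightarrow> real) \<Rightarrow> bool" where
  "weight \<omega> \<longleftrightarrow> continuous_on UNIV \<omega> \<and> (\<forall>x. 1 \<le> \<omega> x) \<and> \<omega> 0 = 1 \<and>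
     (\<forall>x y. \<omega> (x + y) \<le> \<omega> x * \<omega> y)"

definition weight_star :: "('g::group_add \<Rightarrow> real) \<Rightarrow> 'g \<Rightarrow> real" where
  "weight_star \<omega> x = \<omega> x * \<omega> (- x)"

definition weighted :: "('g::topological_space \<Rightarrow> real) \<Rightarrow> 'g cmeasure \<Rightarrow> 'g cmeasure" where
  "weighted \<omega> \<mu> =
     (\<lambda>A. if A \<in> sets borel then cintegral \<mu> (\<lambda>x. indicator A x * complex_of_real (\<omega> x)) else 0)"

text \<open>
  The integrability condition is what makes the product of the weight and the measure exist as a
  complex measure; it has to be explicit because the Bochner integral of a non-integrable
  function is 0 by convention.
\<close>

definition weighted_measure_algebra ::
  "('g::{topological_group_add,t2_space} \<Rightarrow> real) \<Rightarrow> 'g cmeasure nspace" where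
  "weighted_measure_algebra \<omega> =
     \<lparr>carrier = {\<mu>\<in>regular_measures. integrable (variation \<mu>) \<omega> \<and> weighted \<omega> \<mu> \<in> regular_measures},
      mult = conv, one = point_mass 0,
      zero = (\<lambda>A. 0), add = (\<lambda>\<mu> \<nu> A. \<mu> A + \<nu> A), smult = (\<lambda>c \<mu> A. c * \<mu> A),
      nrm = (\<lambda>\<mu>. measure (variation (weighted \<omega> \<mu>)) UNIV)\<rparr>"

type_synonym 'g cmeasure_functional = "'g cmeasure \<Rightarrow> complex"
type_synonym 'g cmeasure_bifunctional = "'g cmeasure_functional \<Rightarrow> complex"

definition vanishes_at_infinity ::
  "('g::{topological_group_add,t2_space} \<Rightarrow> real) \<Rightarrow> 'g cmeasure_functional \<Rightarrow> bool" where
  "vanishes_at_infinity \<omega> \<theta> \<longleftrightarrow>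
     (\<forall>\<epsilon>>0. \<exists>K. compact K \<and>
        (\<forall>\<mu>\<in>carrier (weighted_measure_algebra \<omega>).
           emeasure (variation \<mu>) K = 0 \<and> nrm (weighted_measure_algebra \<omega>) \<mu> = 1 \<longrightarrow>
           cmod (\<theta> \<mu>) < \<epsilon>))"

definition M_star ::
  "('g::{topological_group_add,t2_space} \<Rightarrow> real) \<Rightarrow> 'g cmeasure_functional nspace" where
  "M_star \<omega> = (dual_space (weighted_measure_algebra \<omega>))
     \<lparr>carrier := {\<theta>\<in>carrier (dual_space (weighted_measure_algebra \<omega>)). vanishes_at_infinity \<omega> \<theta>}\<rparr>"

text \<open>The three steps of the first Arens product: the functionals
  \<open>\<theta>\<mu>\<close>, \<open>\<Psi>\<theta>\<close> and \<open>\<Phi> \<diamond> \<Psi>\<close>.\<close>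

definition functional_measure ::
  "('g::{topological_group_add,t2_space} \<Rightarrow> real) \<Rightarrow> 'g cmeasure_functional \<Rightarrow> 'g cmeasure \<Rightarrow>
     'g cmeasure_functional" where
  "functional_measure \<omega> \<theta> \<mu> =
     (\<lambda>\<nu>. if \<nu> \<in> carrier (weighted_measure_algebra \<omega>) then \<theta> (conv \<mu> \<nu>) else 0)"

definition bifunctional_functional ::
  "('g::{topological_group_add,t2_space} \<Rightarrow> real) \<Rightarrow> 'g cmeasure_bifunctional \<Rightarrow>
     'g cmeasure_functional \<Rightarrow> 'g cmeasure_functional" where
  "bifunctional_functional \<omega> \<Psi> \<theta> =
     (\<lambda>\<mu>. if \<mu> \<in> carrier (weighted_measure_algebra \<omega>) then \<Psi> (functional_measure \<omega> \<theta> \<mu>) else 0)"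

definition arens ::
  "('g::{topological_group_add,t2_space} \<Rightarrow> real) \<Rightarrow> 'g cmeasure_bifunctional \<Rightarrow>
     'g cmeasure_bifunctional \<Rightarrow> 'g cmeasure_bifunctional" where
  "arens \<omega> \<Phi> \<Psi> =
     (\<lambda>\<theta>. if \<theta> \<in> carrier (M_star \<omega>) then \<Phi> (bifunctional_functional \<omega> \<Psi> \<theta>) else 0)"

definition evaluation ::
  "('g::{topological_group_add,t2_space} \<Rightarrow> real) \<Rightarrow> 'g cmeasure \<Rightarrow> 'g cmeasure_bifunctional" where
  "evaluation \<omega> \<mu> = (\<lambda>\<theta>. if \<theta> \<in> carrier (M_star \<omega>) then \<theta> \<mu> else 0)"

definition M_star_dual ::
  "('g::{topological_group_add,t2_space} \<Rightarrow> real) \<Rightarrow> 'g cmeasure_bifunctional nspace" where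
  "M_star_dual \<omega> = (dual_space (M_star \<omega>))
     \<lparr>mult := arens \<omega>, one := evaluation \<omega> (point_mass 0)\<rparr>"


section \<open>Haar measure and the group algebra\<close>

definition left_haar :: "('g::{topological_group_add,t2_space}) measure \<Rightarrow> bool" where
  "left_haar m \<longleftrightarrow>
     sets m = sets borel \<and>
     emeasure m UNIV \<noteq> 0 \<and>
     (\<forall>K. compact K \<longrightarrow> emeasure m K < \<infinity>) \<and>
     (\<forall>A\<in>sets borel. emeasure m A = (INF U\<in>{U. open U \<and> A \<subseteq> U}. emeasure m U)) \<and>
     (\<forall>U. open U \<longrightarrow> emeasure m U = (SUP K\<in>{K. compact K \<and> K \<subseteq> U}. emeasure m K)) \<and>
     (\<forall>a. \<forall>A\<in>sets borel. emeasure m ((+) a ` A) = emeasure m A)"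

definition L1 :: "'g measure \<Rightarrow> ('g \<Rightarrow> real) \<Rightarrow> ('g \<Rightarrow> complex) set" where
  "L1 m \<omega> = {\<phi>\<in>borel_measurable m. integrable m (\<lambda>x. complex_of_real (\<omega> x) * \<phi> x)}"

definition L1_measure :: "('g::topological_space) measure \<Rightarrow> ('g \<Rightarrow> complex) \<Rightarrow> 'g cmeasure" where
  "L1_measure m \<phi> = (\<lambda>A. if A \<in> sets borel then (LINT x:A|m. \<phi> x) else 0)"

definition L1_conv ::
  "('g::group_add) measure \<Rightarrow> ('g \<Rightarrow> complex) \<Rightarrow> ('g \<Rightarrow> complex) \<Rightarrow> 'g \<Rightarrow> complex" where
  "L1_conv m \<phi> \<psi> x = (LINT y|m. \<phi> y * \<psi> (- y + x))"

text \<open>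
  The functional \<open>\<theta> \<mapsto> \<langle>\<theta>, \<phi>\<rangle>\<close>, through which an integrable function is regarded as an element
  of the dual of \<open>M\<^sub>*(G,\<omega>)\<close>.
\<close>

definition L1_embed ::
  "('g::{topological_group_add,t2_space} \<Rightarrow> real) \<Rightarrow> 'g measure \<Rightarrow> ('g \<Rightarrow> complex) \<Rightarrow>
     'g cmeasure_bifunctional" where
  "L1_embed \<omega> m \<phi> = evaluation \<omega> (L1_measure m \<phi>)"

text \<open>
  Equality of \<open>M\<^sub>*(G,\<omega>)\<^sup>*\<close> with the group algebra as Banach algebras up to equivalence of norms:
  \<open>L\<^sup>1(G,\<omega>)\<close> is \<open>L\<^sup>1(G)\<close>, and the embedding above is onto, injective modulo equality almost
  everywhere, an algebra homomorphism, and bounded above and below for the norm of \<open>L\<^sup>1(G)\<close>.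
\<close>

definition M_star_dual_is_L1 ::
  "('g::{topological_group_add,t2_space} \<Rightarrow> real) \<Rightarrow> 'g measure \<Rightarrow> bool" where
  "M_star_dual_is_L1 \<omega> m \<longleftrightarrow>
     L1 m \<omega> = L1 m (\<lambda>x. 1) \<and>
     L1_embed \<omega> m ` L1 m (\<lambda>x. 1) = carrier (M_star_dual \<omega>) \<and>
     (\<forall>\<phi>\<in>L1 m (\<lambda>x. 1). \<forall>\<psi>\<in>L1 m (\<lambda>x. 1).
        (L1_embed \<omega> m \<phi> = L1_embed \<omega> m \<psi> \<longleftrightarrow> (AE x in m. \<phi> x = \<psi> x)) \<and>
        L1_embed \<omega> m (\<lambda>x. \<phi> x + \<psi> x) = L1_embed \<omega> m \<phi> \<oplus>\<^bsub>M_star_dual \<omega>\<^esub> L1_embed \<omega> m \<psi> \<and>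
        L1_embed \<omega> m (L1_conv m \<phi> \<psi>) = L1_embed \<omega> m \<phi> \<otimes>\<^bsub>M_star_dual \<omega>\<^esub> L1_embed \<omega> m \<psi>) \<and>
     (\<forall>c. \<forall>\<phi>\<in>L1 m (\<lambda>x. 1).
        L1_embed \<omega> m (\<lambda>x. c * \<phi> x) = c \<odot>\<^bsub>M_star_dual \<omega>\<^esub> L1_embed \<omega> m \<phi>) \<and>
     (\<exists>b>0. \<exists>C. \<forall>\<phi>\<in>L1 m (\<lambda>x. 1).
        b * (LINT x|m. cmod (\<phi> x)) \<le> nrm (M_star_dual \<omega>) (L1_embed \<omega> m \<phi>) \<and>
        nrm (M_star_dual \<omega>) (L1_embed \<omega> m \<phi>) \<le> C * (LINT x|m. cmod (\<phi> x)))"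


section \<open>Discrete and amenable groups\<close>

definition discrete_group :: "('g::topological_group_add) itself \<Rightarrow> bool" where
  "discrete_group _ \<longleftrightarrow> (euclidean :: 'g topology) = discrete_topology UNIV"

text \<open>
  A left invariant mean on the bounded continuous functions; on a discrete group these are all
  bounded functions.
\<close>

definition amenable_group :: "('g::topological_group_add) itself \<Rightarrow> bool" where
  "amenable_group _ \<longleftrightarrow>
     (\<exists>M :: ('g \<Rightarrow>\<^sub>C real) \<Rightarrow> real. linear M \<and>
        (\<forall>f. (\<forall>x. 0 \<le> apply_bcontfun f x) \<longrightarrow> 0 \<le> M f) \<and>
        M (const_bcontfun 1) = 1 \<and>
        (\<forall>a f g. (\<forall>x. apply_bcontfun g x = apply_bcontfun f (a + x)) \<longrightarrow> M g = M f))"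

end

theory Submission
 imports Defs
begin

text \<open>
 If \<open>G\<close> is discrete and \<open>\<omega>\<^sup>*\<close> is bounded, then \<open>\<omega>\<close> is bounded, since \<open>\<omega> \<le> \<omega>\<^sup>*\<close>. Hence \<open>M(G, \<omega>)\<close> is
 \<open>l\<^sup>1(G)\<close> with an equivalent norm, it coincides with \<open>M_*(G, \<omega>)\<^sup>*\<close>, and an invariant mean on \<open>G\<close>
 turns every derivation into an inner one.

 Conversely, amenability of either algebra, applied to the bimodule of bounded bilinear forms, yields
 a functional \<open>\<Theta>\<close> on forms with \<open>- F(e, a) = \<Theta>(F a) - \<Theta>(a F)\<close>; each necessary condition comes
 from a choice of \<open>F\<close>. In a non-discrete group there are a compact subgroup \<open>N\<close> and a Cantor-like compact
 set \<open>P = N + P\<close> that carries a Radon measure not charging the cosets of \<open>N\<close> nor the translates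
 \<open>- k + P\<close> with \<open>k \<notin> N\<close>; a form built from these sets contradicts the identity. For every \<open>G\<close>,
 the forms \<open>\<Sum>\<^sub>k \<phi>(k) x(k) y(- k + g)\<close> turn \<open>\<Theta>\<close> into an invariant functional on the functions dominated
 by \<open>\<omega>\<^sup>*\<close>; its mere existence forces \<open>\<omega>\<^sup>*\<close> to be bounded and \<open>G\<close> to be amenable.
\<close>

section \<open>Carrier-based Banach spaces\<close>

text \<open>An element of the dual of \<open>M_star\<close> is seen only through its values on
  functionals that vanish at infinity, typically \<open>\<nu> \<mapsto> \<nu> K\<close> with
  \<open>K\<close> compact. A product can be evaluated at such a \<open>K\<close> once the space
  splits into disjoint compact cells on which \<open>x \<mapsto> - x + K\<close> is constant, and
  translates of a compact subgroup \<open>N\<close> provide such cells. \<open>N\<close> is an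
  intersection of countably many neighbourhoods of 0, so it may be larger than \<open>{0}\<close>
  when \<open>G\<close> is not metrizable; it need not be normal either, which is why translates
  \<open>g + N + h\<close> on both sides occur.

  The point mass at 0 is not known to be a unit of both algebras. It commutes with every element as
  far as the cosets can see, and this suffices because the forms are required to see no more than
  that in their first argument.

  The definition of amenability includes the Banach algebra laws. The necessity half therefore takes
  associativity and bilinearity from its hypothesis; they are proved only for discrete groups, where
  every measure is atomic.\<close>

lemma complex_field_simps [simp]:
 "carrier complex_field = UNIV" "mult complex_field = (*)" "one complex_field = 1"
 "zero complex_field = 0" "add complex_field = (+)"
 by (simp_all add: complex_field_def)

lemma cring_complex_field: "cring complex_field"
proof (rule cringI)
 show "abelian_group complex_field"
  by (rule abelian_groupI) (auto simp: algebra_simps intro: exI[of _ "- x" for x] ab_left_minus)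
 show "comm_monoid complex_field"
  by (rule comm_monoidI) auto
qed (auto simp: algebra_simps)

lemma normed_space_module: "normed_space E ==> module complex_field E"
 by (simp add: normed_space_def)

lemma banach_space_normed: "banach_space E ==> normed_space E"
 by (simp add: banach_space_def)

lemma banach_algebra_normed: "banach_algebra A ==> normed_space A"
 by (simp add: banach_algebra_def banach_space_normed)

context
 fixes E :: "'e nspace" (structure)
 assumes E: "normed_space E"
begin

interpretation module complex_field E
 using E by (rule normed_space_module)

lemma ns_add_closed: "x : carrier E ==> y : carrier E ==> x \<oplus> y : carrier E"
 by simp

lemma ns_zero_closed: "\<zero> : carrier E"
 by simp

lemma ns_smult_closed: "x : carrier E ==> c \<odot> x : carrier E"
 using smult_closed[of c x] by simp

lemma ns_minus_closed: "x : carrier E ==> y : carrier E ==> x \<ominus> y : carrier E"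
 by simp

lemma ns_nonneg: "x : carrier E ==> 0 <= nrm E x"
 using E by (simp add: normed_space_def)

lemma ns_eq_0: "x : carrier E ==> nrm E x = 0 \<longleftrightarrow> x = \<zero>"
 using E by (simp add: normed_space_def)

lemma ns_smult: "x : carrier E ==> nrm E (c \<odot> x) = cmod c * nrm E x"
 using E by (simp add: normed_space_def)

lemma ns_uminus_eq: "x : carrier E ==> \<ominus> x = (-1) \<odot> x"
proof -
 assume x: "x : carrier E"
 have "(-1) \<odot> x \<oplus> x = (-1 + 1) \<odot> x"
  using smult_l_distr[of "-1" 1 x] smult_one[of x] x by simp
 also have "... = \<zero>"
  using smult_l_null[of x] x by simp
 finally show ?thesis
  using x ns_smult_closed[OF x] by (metis minus_equality)
qed

lemma ns_minus_eq: "x : carrier E ==> y : carrier E ==> x \<ominus> y = x \<oplus> (-1) \<odot> y"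
 by (simp add: a_minus_def ns_uminus_eq)

end

subsection \<open>Spaces of functions with pointwise operations\<close>

definition pointwise_space :: "('x => complex) nspace => bool" where
 "pointwise_space E \<longleftrightarrow>
  zero E = (%x. 0) & add E = (%f g x. f x + g x) & smult E = (%c f x. c * f x) &
  (%x. 0) : carrier E &
  (ALL f:carrier E. ALL g:carrier E. (%x. f x + g x) : carrier E) &
  (ALL c. ALL f:carrier E. (%x. c * f x) : carrier E)"

lemma pointwise_module:
 assumes "pointwise_space E" shows "module complex_field E"
proof (rule moduleI[OF cring_complex_field])
 show "abelian_group E"
 proof (rule abelian_groupI)
  fix f assume f: "f : carrier E"
  have "(%x. -1 * f x) : carrier E" using assms f unfolding pointwise_space_def by blast
  then show "EX g:carrier E. g \<oplus>\<^bsub>E\<^esub> f = \<zero>\<^bsub>E\<^esub>"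
   using assms by (auto simp: pointwise_space_def intro!: bexI[of _ "%x. -1 * f x"])
 qed (use assms in \<open>auto simp: pointwise_space_def algebra_simps\<close>)
qed (use assms in \<open>auto simp: pointwise_space_def algebra_simps\<close>)

lemma pointwise_minus:
 assumes E: "pointwise_space E" and f: "f : carrier E" and g: "g : carrier E"
 shows "f \<ominus>\<^bsub>E\<^esub> g = (%x. f x - g x)"
proof -
 interpret module complex_field E using E by (rule pointwise_module)
 have m: "(%x. -1 * g x) : carrier E" using E g unfolding pointwise_space_def by blast
 have "(%x. -1 * g x) \<oplus>\<^bsub>E\<^esub> g = \<zero>\<^bsub>E\<^esub>"
  using E by (auto simp: pointwise_space_def)
 then have "\<ominus>\<^bsub>E\<^esub> g = (%x. -1 * g x)"
  using m g minus_equality by blast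
 then show ?thesis
  using E by (simp add: a_minus_def pointwise_space_def)
qed

text \<open>Bounded point evaluations (\<open>pt\<close>) make a Cauchy sequence converge pointwise.
  \<open>fatou\<close> states that balls are closed under pointwise limits; applied to the
  differences with a fixed \<open>s n\<close>, it puts the limit into the space and bounds its
  distance from \<open>s n\<close>.\<close>

lemma pointwise_banachI:
 assumes E: "pointwise_space E"
  and nonneg: "!!f. f : carrier E ==> 0 <= nrm E f"
  and smult: "!!f c. f : carrier E ==> nrm E (%x. c * f x) = cmod c * nrm E f"
  and triangle: "!!f g. f : carrier E ==> g : carrier E ==> nrm E (%x. f x + g x) <= nrm E f + nrm E g"
  and pt: "!!f x. f : carrier E ==> cmod (f x) <= nrm E f * w x"
  and fatou: "!!s f K. (!!n::nat. s n : carrier E) ==> (!!n. nrm E (s n) <= K) ==>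
    (!!x. (%n. s n x) \<longlonglongrightarrow> f x) ==> f : carrier E & nrm E f <= K"
 shows "banach_space E"
proof -
 note E' = E[unfolded pointwise_space_def]
 have addc: "(%x. f x + g x) : carrier E" if "f : carrier E" "g : carrier E" for f g
  using E' that by blast
 have diff: "(%x. f x - g x) : carrier E" if "f : carrier E" "g : carrier E" for f g
 proof -
  have "(%x. -1 * g x) : carrier E" using E' that by blast
  from addc[OF that(1) this] show ?thesis by simp
 qed
 have eq0: "nrm E f = 0 \<longleftrightarrow> f = (%x. 0)" if f: "f : carrier E" for f
 proof
  assume "nrm E f = 0" then show "f = (%x. 0)" using pt[OF f] by auto
 next
  assume "f = (%x. 0)" then show "nrm E f = 0" using smult[OF f, of 0] by simp
 qed
 have ns: "normed_space E"
  unfolding normed_space_def using pointwise_module[OF E] nonneg smult triangle eq0 E' by auto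
 show ?thesis unfolding banach_space_def
 proof (intro conjI ns allI impI, elim conjE)
  fix s :: "nat => 'a => complex"
  assume s: "ALL n. s n : carrier E"
   and C: "ALL ep>0. EX N. ALL m>=N. ALL n>=N. nrm E (s m \<ominus>\<^bsub>E\<^esub> s n) < ep"
  have C': "ALL ep>0. EX N. ALL m>=N. ALL n>=N. nrm E (%x. s m x - s n x) < ep"
   using C s by (simp add: pointwise_minus[OF E])
  have "Cauchy (%n. s n x)" for x
  proof (rule metric_CauchyI)
   fix e :: real assume e: "0 < e"
   obtain N where N: "ALL m>=N. ALL n>=N. nrm E (%x. s m x - s n x) < e / (\<bar>w x\<bar> + 1)"
    using C' e by (meson abs_ge_zero add_nonneg_pos divide_pos_pos zero_less_one)
   have "dist (s m x) (s n x) < e" if "m >= N" "n >= N" for m n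
   proof -
    have "dist (s m x) (s n x) <= nrm E (%x. s m x - s n x) * w x"
     using pt[OF diff, of "s m" "s n" x] s by (simp add: dist_norm)
    also have "... <= nrm E (%x. s m x - s n x) * (\<bar>w x\<bar> + 1)"
     using nonneg[OF diff, of "s m" "s n"] s by (intro mult_left_mono) auto
    also have "... < e / (\<bar>w x\<bar> + 1) * (\<bar>w x\<bar> + 1)"
     using N that by (intro mult_strict_right_mono) auto
    also have "... = e" by (simp add: add_nonneg_eq_0_iff)
    finally show ?thesis .
   qed
   then show "EX M. ALL m>=M. ALL n>=M. dist (s m x) (s n x) < e" by blast
  qed
  then have conv: "(%n. s n x) \<longlonglongrightarrow> lim (%n. s n x)" for x
   using Cauchy_convergent convergent_LIMSEQ_iff by blast
  define f where "f x = lim (%n. s n x)" for x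
  have lim: "(%n. s n x) \<longlonglongrightarrow> f x" for x using conv by (simp add: f_def)
  have tail: "(%x. f x - s n x) : carrier E & nrm E (%x. f x - s n x) <= e"
   if N: "ALL m>=N. ALL n>=N. nrm E (%x. s m x - s n x) < e" and n: "n >= N" for e N n
  proof (rule fatou)
   show "(%x. s (m + N) x - s n x) : carrier E" for m using s diff by blast
   show "nrm E (%x. s (m + N) x - s n x) <= e" for m using N n by (simp add: less_imp_le)
   show "(%m. s (m + N) x - s n x) \<longlonglongrightarrow> f x - s n x" for x
    by (intro tendsto_diff tendsto_const LIMSEQ_ignore_initial_segment lim)
  qed
  obtain N where "ALL m>=N. ALL n>=N. nrm E (%x. s m x - s n x) < 1" using C' zero_less_one by blast
  then have "(%x. f x - s N x) : carrier E" using tail by blast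
  then have "(%x. (f x - s N x) + s N x) : carrier E" using s by (intro addc) auto
  then have f: "f : carrier E" by simp
  have eq: "nrm E (s n \<ominus>\<^bsub>E\<^esub> f) = nrm E (%x. f x - s n x)" for n
   using smult[OF diff[of f "s n"], of "-1"] f s by (simp add: pointwise_minus[OF E])
  have "(%n. nrm E (s n \<ominus>\<^bsub>E\<^esub> f)) \<longlonglongrightarrow> 0"
  proof (rule LIMSEQ_I)
   fix r :: real assume r: "0 < r"
   obtain N where N: "ALL m>=N. ALL n>=N. nrm E (%x. s m x - s n x) < r / 2"
    using C' r half_gt_zero by blast
   have "norm (nrm E (s n \<ominus>\<^bsub>E\<^esub> f) - 0) < r" if "n >= N" for n
    using tail[OF N that] nonneg[of "%x. f x - s n x"] r by (simp add: eq)
   then show "EX no. ALL n>=no. norm (nrm E (s n \<ominus>\<^bsub>E\<^esub> f) - 0) < r" by blast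
  qed
  with f show "EX x:carrier E. (%n. nrm E (s n \<ominus>\<^bsub>E\<^esub> x)) \<longlonglongrightarrow> 0" by blast
 qed
qed

lemma pointwise_dual_space: "pointwise_space (dual_space E)"
proof -
 have "bounded_linear_into E scalars (%x. f x + g x)"
  if fg: "bounded_linear_into E scalars f" "bounded_linear_into E scalars g" for f g
 proof -
  obtain C D where "ALL x:carrier E. cmod (f x) <= C * nrm E x" "ALL x:carrier E. cmod (g x) <= D * nrm E x"
   using fg by (force simp: bounded_linear_into_def scalars_def)
  then have "ALL x:carrier E. cmod (f x + g x) <= (C + D) * nrm E x"
   by (metis distrib_right norm_triangle_mono)
  then have "EX B. ALL x:carrier E. cmod (f x + g x) <= B * nrm E x" by blast
  moreover have "linear_into E scalars (%x. f x + g x)"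
   using fg by (auto simp: bounded_linear_into_def linear_into_def scalars_def algebra_simps)
  ultimately show ?thesis
   unfolding bounded_linear_into_def by (simp add: scalars_def)
 qed
 moreover have "bounded_linear_into E scalars (%x. c * f x)"
  if f: "bounded_linear_into E scalars f" for f c
 proof -
  obtain C where "ALL x:carrier E. cmod (f x) <= C * nrm E x"
   using f by (auto simp: bounded_linear_into_def scalars_def)
  then have "ALL x:carrier E. cmod (c * f x) <= (cmod c * C) * nrm E x"
   by (metis mult.assoc mult_left_mono norm_ge_zero norm_mult)
  then have "EX B. ALL x:carrier E. cmod (c * f x) <= B * nrm E x" by blast
  moreover have "linear_into E scalars (%x. c * f x)"
   using f by (auto simp: bounded_linear_into_def linear_into_def scalars_def algebra_simps)
  ultimately show ?thesis
   unfolding bounded_linear_into_def by (simp add: scalars_def)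
 qed
 moreover have "bounded_linear_into E scalars (%x. 0)"
  by (auto simp: bounded_linear_into_def linear_into_def scalars_def intro: exI[of _ 0])
 ultimately show ?thesis
  by (auto simp: pointwise_space_def dual_space_def)
qed

lemma dual_simps:
 "\<zero>\<^bsub>dual_space E\<^esub> = (%x. 0)" "f \<oplus>\<^bsub>dual_space E\<^esub> g = (%x. f x + g x)"
 "c \<odot>\<^bsub>dual_space E\<^esub> f = (%x. c * f x)"
 by (simp_all add: dual_space_def)

lemma dual_carrierD:
 assumes "f : carrier (dual_space E)"
 shows "x : carrier E ==> y : carrier E ==> f (x \<oplus>\<^bsub>E\<^esub> y) = f x + f y"
  "x : carrier E ==> f (c \<odot>\<^bsub>E\<^esub> x) = c * f x"
  "x ~: carrier E ==> f x = 0"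
  "EX C. ALL x:carrier E. cmod (f x) <= C * nrm E x"
 using assms by (auto simp: dual_space_def bounded_linear_into_def linear_into_def scalars_def)

lemma dual_carrierI:
 assumes "!!x y. x : carrier E ==> y : carrier E ==> f (x \<oplus>\<^bsub>E\<^esub> y) = f x + f y"
  "!!c x. x : carrier E ==> f (c \<odot>\<^bsub>E\<^esub> x) = c * f x"
  "!!x. x ~: carrier E ==> f x = 0"
  "!!x. x : carrier E ==> cmod (f x) <= C * nrm E x"
 shows "f : carrier (dual_space E)"
proof -
 have "EX C. ALL x:carrier E. cmod (f x) <= C * nrm E x" using assms(4) by blast
 then show ?thesis
  using assms(1-3) by (auto simp: dual_space_def bounded_linear_into_def linear_into_def scalars_def)
qed

text \<open>
 The next two lemmas only use the norm of the dual, so they also apply to \<open>M_star\<close>, whose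
 carrier is smaller.
\<close>

lemma dual_nrm_bound:
 assumes E: "normed_space E" and f: "f : carrier (dual_space E)" and x: "x : carrier E"
 shows "cmod (f x) <= nrm (dual_space E) f * nrm E x"
proof -
 let ?B = "{x : carrier E. nrm E x <= 1}"
 obtain C where C: "ALL x:carrier E. cmod (f x) <= C * nrm E x" using dual_carrierD(4)[OF f] by blast
 have bdd: "bdd_above ((%x. cmod (f x)) ` ?B)"
 proof (rule bdd_aboveI2)
  fix y assume "y : ?B"
  then have "cmod (f y) <= C * nrm E y" "0 <= nrm E y" "nrm E y <= 1" using C ns_nonneg[OF E] by auto
  then show "cmod (f y) <= \<bar>C\<bar>"
   by (smt (verit) mult_left_le mult_right_mono)
 qed
 show ?thesis
 proof (cases "nrm E x = 0")
  case True then show ?thesis using C x by fastforce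
 next
  case False
  then have p: "0 < nrm E x" using ns_nonneg[OF E x] by simp
  let ?y = "of_real (1 / nrm E x) \<odot>\<^bsub>E\<^esub> x"
  have y: "?y : ?B" using x p by (simp add: ns_smult_closed[OF E] ns_smult[OF E] norm_divide)
  then have "cmod (f ?y) <= nrm (dual_space E) f"
   unfolding dual_space_def using bdd by (auto intro: cSUP_upper)
  moreover have "cmod (f ?y) = cmod (f x) / nrm E x"
   using x p by (simp add: dual_carrierD(2)[OF f] norm_mult norm_divide)
  ultimately show ?thesis using p by (metis pos_divide_le_eq)
 qed
qed

lemma dual_nrm_le:
 assumes E: "normed_space E" and K: "0 <= K" "!!x. x : carrier E ==> cmod (f x) <= K * nrm E x"
 shows "nrm (dual_space E) f <= K"
proof -
 have "\<zero>\<^bsub>E\<^esub> : carrier E" "nrm E \<zero>\<^bsub>E\<^esub> = 0" using ns_zero_closed[OF E] ns_eq_0[OF E] by auto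
 then have ne: "{x : carrier E. nrm E x <= 1} ~= {}" by force
 have "cmod (f x) <= K" if "x : carrier E" "nrm E x <= 1" for x
  using K(2)[OF that(1)] mult_left_mono[OF that(2) K(1)] by simp
 then show ?thesis unfolding dual_space_def using ne by (auto intro!: cSUP_least)
qed

lemma dual_nrm_nonneg:
 assumes E: "normed_space E" and f: "f : carrier (dual_space E)"
 shows "0 <= nrm (dual_space E) f"
proof -
 have z: "\<zero>\<^bsub>E\<^esub> : carrier E" "nrm E \<zero>\<^bsub>E\<^esub> = 0" using ns_zero_closed[OF E] ns_eq_0[OF E] by auto
 obtain C where C: "ALL x:carrier E. cmod (f x) <= C * nrm E x" using dual_carrierD(4)[OF f] by blast
 have "bdd_above ((%x. cmod (f x)) ` {x : carrier E. nrm E x <= 1})"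
 proof (rule bdd_aboveI2)
  fix y assume "y : {x : carrier E. nrm E x <= 1}"
  then have "cmod (f y) <= C * nrm E y" "0 <= nrm E y" "nrm E y <= 1" using C ns_nonneg[OF E] by auto
  then show "cmod (f y) <= \<bar>C\<bar>"
   by (smt (verit) mult_left_le mult_right_mono)
 qed
 then have "cmod (f \<zero>\<^bsub>E\<^esub>) <= nrm (dual_space E) f"
  unfolding dual_space_def using z by (auto intro!: cSUP_upper)
 then show ?thesis using norm_ge_zero order_trans by blast
qed

lemma normed_dual_space:
 assumes E: "normed_space E" shows "normed_space (dual_space E)"
proof -
 let ?N = "nrm (dual_space E)"
 have le: "?N (%x. c * f x) <= cmod c * ?N f" if "f : carrier (dual_space E)" for f c
  using dual_nrm_bound[OF E that] dual_nrm_nonneg[OF E that]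
  by (intro dual_nrm_le[OF E] mult_nonneg_nonneg)
   (auto simp: norm_mult mult.assoc intro!: mult_left_mono)
 have cl: "(%x. c * f x) : carrier (dual_space E)" if "f : carrier (dual_space E)" for f c
  using pointwise_dual_space[of E] that by (auto simp: pointwise_space_def)
 have smult: "?N (%x. c * f x) = cmod c * ?N f" if f: "f : carrier (dual_space E)" for f c
 proof (cases "c = 0")
  case True
  then show ?thesis using le[OF f, of c] dual_nrm_nonneg[OF E cl[OF f, of c]] by simp
 next
  case False
  have "?N (%x. inverse c * (c * f x)) <= cmod (inverse c) * ?N (%x. c * f x)"
   using le[OF cl[OF f]] .
  then have "cmod c * ?N f <= ?N (%x. c * f x)"
   using False mult_left_mono[of "?N f" "cmod (inverse c) * ?N (%x. c * f x)" "cmod c"]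
   by (simp add: norm_inverse flip: mult.assoc)
  then show ?thesis using le[OF f, of c] by simp
 qed
 have zero: "?N f = 0 \<longleftrightarrow> f = (%x. 0)" if f: "f : carrier (dual_space E)" for f
 proof
  assume "?N f = 0"
  then show "f = (%x. 0)" using dual_nrm_bound[OF E f] dual_carrierD(3)[OF f] by fastforce
 next
  assume "f = (%x. 0)" then show "?N f = 0" using smult[OF f, of 0] by simp
 qed
 have tri: "?N (%x. f x + g x) <= ?N f + ?N g"
  if f: "f : carrier (dual_space E)" and g: "g : carrier (dual_space E)" for f g
 proof (rule dual_nrm_le[OF E])
  show "0 <= ?N f + ?N g" using f g dual_nrm_nonneg[OF E] by simp
  fix x assume x: "x : carrier E"
  show "cmod (f x + g x) <= (?N f + ?N g) * nrm E x"
   using norm_triangle_ineq[of "f x" "g x"] dual_nrm_bound[OF E f x] dual_nrm_bound[OF E g x]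
   by (simp add: algebra_simps)
 qed
 show ?thesis
  unfolding normed_space_def
  using pointwise_module[OF pointwise_dual_space[of E]] smult zero tri dual_nrm_nonneg[OF E]
  by (auto simp: dual_simps)
qed

subsection \<open>Isometric isomorphisms\<close>

text \<open>\<open>F\<close> is any record, not a normed space by assumption: the axioms are carried
  from \<open>E\<close> to \<open>F\<close> along \<open>T\<close>, so zero and all operations of
  \<open>F\<close> have to be tied to those of \<open>E\<close>.\<close>

definition isometry :: "'e nspace => 'f nspace => ('e => 'f) => bool" where
 "isometry E F T \<longleftrightarrow> bij_betw T (carrier E) (carrier F) & T \<zero>\<^bsub>E\<^esub> = \<zero>\<^bsub>F\<^esub> &
  (ALL x:carrier E. ALL y:carrier E. T (x \<oplus>\<^bsub>E\<^esub> y) = T x \<oplus>\<^bsub>F\<^esub> T y) &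
  (ALL c. ALL x:carrier E. T (c \<odot>\<^bsub>E\<^esub> x) = c \<odot>\<^bsub>F\<^esub> T x) &
  (ALL x:carrier E. nrm F (T x) = nrm E x)"

lemma isometry_normed:
 assumes E: "normed_space E" and T: "isometry E F T"
 shows "normed_space F"
proof -
 interpret module complex_field E using E by (rule normed_space_module)
 have im: "carrier F = T ` carrier E" using T by (auto simp: isometry_def bij_betw_def)
 have inj: "x : carrier E ==> y : carrier E ==> T x = T y \<longleftrightarrow> x = y" for x y
  using T by (auto simp: isometry_def bij_betw_def inj_on_def)
 have add: "T x \<oplus>\<^bsub>F\<^esub> T y = T (x \<oplus>\<^bsub>E\<^esub> y)" if "x : carrier E" "y : carrier E" for x y
  using T that by (simp add: isometry_def)
 have sm: "c \<odot>\<^bsub>F\<^esub> T x = T (c \<odot>\<^bsub>E\<^esub> x)" if "x : carrier E" for x c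
  using T that by (simp add: isometry_def)
 have z: "\<zero>\<^bsub>F\<^esub> = T \<zero>\<^bsub>E\<^esub>" using T by (simp add: isometry_def)
 have cl: "c \<odot>\<^bsub>E\<^esub> x : carrier E" if "x : carrier E" for c x using ns_smult_closed[OF E that] .
 have "module complex_field F"
 proof (rule moduleI[OF cring_complex_field])
  show "abelian_group F"
  proof (rule abelian_groupI)
   fix x assume "x : carrier F"
   then obtain y where y: "y : carrier E" "x = T y" using im by auto
   show "EX u:carrier F. u \<oplus>\<^bsub>F\<^esub> x = \<zero>\<^bsub>F\<^esub>"
    using y im by (intro bexI[of _ "T (\<ominus>\<^bsub>E\<^esub> y)"]) (auto simp: add z l_neg)
  qed (auto simp: im add z a_ac)
 next
  fix a b :: complex and x assume "x : carrier F"
  then obtain y where y: "y : carrier E" "x = T y" using im by auto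
  show "a \<odot>\<^bsub>F\<^esub> x : carrier F" using y im by (simp add: sm cl)
  show "(a \<oplus>\<^bsub>complex_field\<^esub> b) \<odot>\<^bsub>F\<^esub> x = a \<odot>\<^bsub>F\<^esub> x \<oplus>\<^bsub>F\<^esub> b \<odot>\<^bsub>F\<^esub> x"
   using y smult_l_distr[of a b y] by (simp add: sm cl add)
  show "(a \<otimes>\<^bsub>complex_field\<^esub> b) \<odot>\<^bsub>F\<^esub> x = a \<odot>\<^bsub>F\<^esub> (b \<odot>\<^bsub>F\<^esub> x)"
   using y smult_assoc1[of a b y] by (simp add: sm cl)
  show "\<one>\<^bsub>complex_field\<^esub> \<odot>\<^bsub>F\<^esub> x = x" using y smult_one[of y] by (simp add: sm)
  fix x' assume "x' : carrier F"
  then obtain y' where y': "y' : carrier E" "x' = T y'" using im by auto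
  show "a \<odot>\<^bsub>F\<^esub> (x \<oplus>\<^bsub>F\<^esub> x') = a \<odot>\<^bsub>F\<^esub> x \<oplus>\<^bsub>F\<^esub> a \<odot>\<^bsub>F\<^esub> x'"
   using y y' smult_r_distr[of a y y'] by (simp add: sm cl add)
 qed
 moreover have "nrm F (T x) = nrm E x" if "x : carrier E" for x
  using T that by (simp add: isometry_def)
 ultimately show ?thesis
  using E inj by (auto simp: normed_space_def im add sm cl z)
qed

lemma isometry_minus:
 assumes E: "normed_space E" and T: "isometry E F T" and "x : carrier E" "y : carrier E"
 shows "T (x \<ominus>\<^bsub>E\<^esub> y) = T x \<ominus>\<^bsub>F\<^esub> T y"
proof -
 have "T x : carrier F" "T y : carrier F" using T assms by (auto simp: isometry_def bij_betw_def)
 then show ?thesis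
  using assms ns_smult_closed[OF E] T
  by (simp add: ns_minus_eq[OF E] ns_minus_eq[OF isometry_normed[OF E T]] isometry_def)
qed

lemma isometry_banach:
 assumes E: "banach_space E" and T: "isometry E F T"
 shows "banach_space F"
proof -
 note nE = banach_space_normed[OF E]
 have nF: "normed_space F" using isometry_normed[OF nE T] .
 have bij: "bij_betw T (carrier E) (carrier F)" using T by (simp add: isometry_def)
 show ?thesis unfolding banach_space_def
 proof (intro conjI nF allI impI, elim conjE)
  fix s :: "nat => 'b"
  assume s: "ALL n. s n : carrier F"
   and C: "ALL ep>0. EX N. ALL m>=N. ALL n>=N. nrm F (s m \<ominus>\<^bsub>F\<^esub> s n) < ep"
  define t where "t n = the_inv_into (carrier E) T (s n)" for n
  have t: "t n : carrier E" "T (t n) = s n" for n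
   using s bij f_the_inv_into_f_bij_betw[OF bij] bij_betwE[OF bij_betw_the_inv_into[OF bij]]
   by (auto simp: t_def)
  have eq: "nrm F (s m \<ominus>\<^bsub>F\<^esub> T x) = nrm E (t m \<ominus>\<^bsub>E\<^esub> x)" if "x : carrier E" for m x
   using isometry_minus[OF nE T t(1) that, of m] t(2) T ns_minus_closed[OF nE t(1) that]
   unfolding isometry_def by metis
  have "ALL ep>0. EX N. ALL m>=N. ALL n>=N. nrm E (t m \<ominus>\<^bsub>E\<^esub> t n) < ep"
   using C eq[OF t(1)] t(2) by simp
  then obtain x where x: "x : carrier E" "(%n. nrm E (t n \<ominus>\<^bsub>E\<^esub> x)) \<longlonglongrightarrow> 0"
   using E t(1) unfolding banach_space_def by blast
  then show "EX x:carrier F. (%n. nrm F (s n \<ominus>\<^bsub>F\<^esub> x)) \<longlonglongrightarrow> 0"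
   using bij by (intro bexI[of _ "T x"]) (auto simp: eq bij_betw_def)
 qed
qed

lemma bounded_linear_dual:
 assumes E: "normed_space E"
  and cl: "!!a. a : carrier A ==> D a : carrier (dual_space E)"
  and add: "!!a b x. a : carrier A ==> b : carrier A ==> x : carrier E ==> D (a \<oplus>\<^bsub>A\<^esub> b) x = D a x + D b x"
  and sm: "!!a c x. a : carrier A ==> x : carrier E ==> D (c \<odot>\<^bsub>A\<^esub> a) x = c * D a x"
  and A: "normed_space A"
  and bd: "!!a x. a : carrier A ==> x : carrier E ==> cmod (D a x) <= C * nrm A a * nrm E x" and C: "0 <= C"
 shows "bounded_linear_into A (dual_space E) D"
proof -
 have "D (a \<oplus>\<^bsub>A\<^esub> b) = (%x. D a x + D b x)" if "a : carrier A" "b : carrier A" for a b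
 proof
  fix x show "D (a \<oplus>\<^bsub>A\<^esub> b) x = D a x + D b x"
   using add[OF that, of x] dual_carrierD(3)[OF cl, of _ x] that ns_add_closed[OF A that]
   by (cases "x : carrier E") auto
 qed
 moreover have "D (c \<odot>\<^bsub>A\<^esub> a) = (%x. c * D a x)" if "a : carrier A" for a c
 proof
  fix x show "D (c \<odot>\<^bsub>A\<^esub> a) x = c * D a x"
   using sm[OF that, of x c] dual_carrierD(3)[OF cl, of _ x] that ns_smult_closed[OF A that]
   by (cases "x : carrier E") auto
 qed
 moreover have "ALL a:carrier A. nrm (dual_space E) (D a) <= C * nrm A a"
  using bd C ns_nonneg[OF A] by (auto intro!: dual_nrm_le[OF E])
 then have "EX C. ALL a:carrier A. nrm (dual_space E) (D a) <= C * nrm A a" by blast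
 ultimately show ?thesis
  unfolding bounded_linear_into_def linear_into_def by (auto simp: dual_simps cl)
qed

section \<open>Amenability\<close>

lemma banach_bimoduleD:
 assumes "banach_bimodule A E l r"
 shows "banach_space E"
  and "a : carrier A ==> x : carrier E ==> l a x : carrier E"
  and "a : carrier A ==> x : carrier E ==> r x a : carrier E"
  and "a : carrier A ==> x : carrier E ==> y : carrier E ==> l a (x \<oplus>\<^bsub>E\<^esub> y) = l a x \<oplus>\<^bsub>E\<^esub> l a y"
  and "a : carrier A ==> x : carrier E ==> y : carrier E ==> r (x \<oplus>\<^bsub>E\<^esub> y) a = r x a \<oplus>\<^bsub>E\<^esub> r y a"
  and "a : carrier A ==> x : carrier E ==> l a (c \<odot>\<^bsub>E\<^esub> x) = c \<odot>\<^bsub>E\<^esub> l a x"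
  and "a : carrier A ==> x : carrier E ==> r (c \<odot>\<^bsub>E\<^esub> x) a = c \<odot>\<^bsub>E\<^esub> r x a"
  and "a : carrier A ==> b : carrier A ==> x : carrier E ==> l (a \<oplus>\<^bsub>A\<^esub> b) x = l a x \<oplus>\<^bsub>E\<^esub> l b x"
  and "a : carrier A ==> b : carrier A ==> x : carrier E ==> r x (a \<oplus>\<^bsub>A\<^esub> b) = r x a \<oplus>\<^bsub>E\<^esub> r x b"
  and "a : carrier A ==> x : carrier E ==> l (c \<odot>\<^bsub>A\<^esub> a) x = c \<odot>\<^bsub>E\<^esub> l a x"
  and "a : carrier A ==> x : carrier E ==> r x (c \<odot>\<^bsub>A\<^esub> a) = c \<odot>\<^bsub>E\<^esub> r x a"
  and "a : carrier A ==> b : carrier A ==> x : carrier E ==> l (a \<otimes>\<^bsub>A\<^esub> b) x = l a (l b x)"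
  and "a : carrier A ==> b : carrier A ==> x : carrier E ==> r x (a \<otimes>\<^bsub>A\<^esub> b) = r (r x a) b"
  and "a : carrier A ==> b : carrier A ==> x : carrier E ==> r (l a x) b = l a (r x b)"
  and "EX C. ALL a:carrier A. ALL x:carrier E.
    nrm E (l a x) <= C * nrm A a * nrm E x & nrm E (r x a) <= C * nrm A a * nrm E x"
 using assms by (simp_all add: banach_bimodule_def linear_into_def Pi_iff)

lemma dual_actions_closed:
 assumes mod: "banach_bimodule A E l r" and f: "f : carrier (dual_space E)" and a: "a : carrier A"
 shows "dual_lact E r a f : carrier (dual_space E)" "dual_ract E l f a : carrier (dual_space E)"
proof -
 note bm = banach_bimoduleD[OF mod]
 note nE = banach_space_normed[OF bm(1)]
 let ?N = "nrm (dual_space E) f"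
 obtain C where C: "ALL a:carrier A. ALL x:carrier E.
    nrm E (l a x) <= C * nrm A a * nrm E x & nrm E (r x a) <= C * nrm A a * nrm E x"
  using bm(15) by blast
 have b: "cmod (f (l a x)) <= (?N * (C * nrm A a)) * nrm E x" "cmod (f (r x a)) <= (?N * (C * nrm A a)) * nrm E x"
  if x: "x : carrier E" for x
 proof -
  have "cmod (f (l a x)) <= ?N * nrm E (l a x)" using dual_nrm_bound[OF nE f bm(2)[OF a x]] .
  also have "... <= ?N * (C * nrm A a * nrm E x)"
   using C a x dual_nrm_nonneg[OF nE f] by (intro mult_left_mono) auto
  finally show "cmod (f (l a x)) <= (?N * (C * nrm A a)) * nrm E x" by (simp add: mult.assoc)
  have "cmod (f (r x a)) <= ?N * nrm E (r x a)" using dual_nrm_bound[OF nE f bm(3)[OF a x]] .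
  also have "... <= ?N * (C * nrm A a * nrm E x)"
   using C a x dual_nrm_nonneg[OF nE f] by (intro mult_left_mono) auto
  finally show "cmod (f (r x a)) <= (?N * (C * nrm A a)) * nrm E x" by (simp add: mult.assoc)
 qed
 show "dual_lact E r a f : carrier (dual_space E)"
  by (rule dual_carrierI[of _ _ "?N * (C * nrm A a)"])
   (use a b in \<open>auto simp: dual_lact_def ns_add_closed[OF nE] ns_smult_closed[OF nE] dual_carrierD[OF f] bm\<close>)
 show "dual_ract E l f a : carrier (dual_space E)"
  by (rule dual_carrierI[of _ _ "?N * (C * nrm A a)"])
   (use a b in \<open>auto simp: dual_ract_def ns_add_closed[OF nE] ns_smult_closed[OF nE] dual_carrierD[OF f] bm\<close>)
qed

text \<open>The hypothesis \<open>am\<close> speaks only of bimodules carried by the universe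
  \<open>'e\<close>. A bimodule on a type that injects into \<open>'e\<close> is copied there
  together with the derivation, and the implementing functional is pulled back along
  \<open>j\<close>.\<close>

lemma inner_derivation_transfer:
 fixes A :: "'b nspace" and E :: "'x nspace" and j :: "'x => 'e"
 assumes am: "amenable TYPE('e) A" and j: "inj j"
  and mod: "banach_bimodule A E l r" and der: "continuous_derivation A E l r D"
 shows "inner_derivation A E l r D"
proof -
 let ?k = "inv_into UNIV j"
 note [simp] = inj_eq[OF j]
 have k [simp]: "?k (j x) = x" for x using j by simp
 define E' :: "'e nspace" where "E' = \<lparr>carrier = j ` carrier E, mult = undefined, one = undefined,
  zero = j (zero E), add = (%x y. j (?k x \<oplus>\<^bsub>E\<^esub> ?k y)), smult = (%c x. j (c \<odot>\<^bsub>E\<^esub> ?k x)),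
  nrm = (%x. nrm E (?k x))\<rparr>"
 define l' where "l' a x = j (l a (?k x))" for a x
 define r' where "r' x a = j (r (?k x) a)" for a x
 define D' where "D' a = (%x. if x : j ` carrier E then D a (?k x) else 0)" for a
 note bm = banach_bimoduleD[OF mod]
 have nA: "normed_space A" using am by (simp add: amenable_def banach_algebra_normed)
 have E'_simps [simp]: "carrier E' = j ` carrier E" "zero E' = j (zero E)"
  "j x \<oplus>\<^bsub>E'\<^esub> j y = j (x \<oplus>\<^bsub>E\<^esub> y)" "c \<odot>\<^bsub>E'\<^esub> j x = j (c \<odot>\<^bsub>E\<^esub> x)" "nrm E' (j x) = nrm E x" for x y c
  by (simp_all add: E'_def)
 have l'r' [simp]: "l' a (j x) = j (l a x)" "r' (j x) a = j (r x a)" for a x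
  by (simp_all add: l'_def r'_def)
 have iso: "isometry E E' j"
  using j by (auto simp: isometry_def bij_betw_def inj_on_def)
 have bE': "banach_space E'" using isometry_banach[OF bm(1) iso] .
 note nE = banach_space_normed[OF bm(1)] and nE' = banach_space_normed[OF bE']
 have mod': "banach_bimodule A E' l' r'"
  using mod bE' by (simp add: banach_bimodule_def linear_into_def Pi_iff)
 have D: "D a : carrier (dual_space E)" if "a : carrier A" for a
  using der that by (auto simp: continuous_derivation_def bounded_linear_into_def linear_into_def)
 have D': "D' a : carrier (dual_space E')" if a: "a : carrier A" for a
 proof -
  obtain C where C: "ALL x:carrier E. cmod (D a x) <= C * nrm E x" using dual_carrierD(4)[OF D[OF a]] by blast
  show ?thesis
   by (rule dual_carrierI[of _ _ C])
    (use C in \<open>auto simp: D'_def inj_eq[OF j] dual_carrierD[OF D[OF a]] ns_add_closed[OF nE] ns_smult_closed[OF nE]\<close>)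
 qed
 obtain C where C: "ALL a:carrier A. nrm (dual_space E) (D a) <= C * nrm A a"
  using der by (auto simp: continuous_derivation_def bounded_linear_into_def)
 have Dlin: "D (a \<oplus>\<^bsub>A\<^esub> b) x = D a x + D b x" "D (c \<odot>\<^bsub>A\<^esub> a) x = c * D a x"
  if "a : carrier A" "b : carrier A" for a b c x
  using der that by (auto simp: continuous_derivation_def bounded_linear_into_def linear_into_def dual_simps)
 have "bounded_linear_into A (dual_space E') D'"
 proof (rule bounded_linear_dual[OF nE' D' _ _ nA, of _ "\<bar>C\<bar>"])
  fix a x assume a: "a : carrier A" and "x : carrier E'"
  then obtain y where y: "y : carrier E" "x = j y" by auto
  have "cmod (D a y) <= nrm (dual_space E) (D a) * nrm E y" using dual_nrm_bound[OF nE D[OF a] y(1)] .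
  also have "... <= (\<bar>C\<bar> * nrm A a) * nrm E y"
  proof (rule mult_right_mono)
   have "C * nrm A a <= \<bar>C\<bar> * nrm A a" using ns_nonneg[OF nA a] by (intro mult_right_mono) auto
   then show "nrm (dual_space E) (D a) <= \<bar>C\<bar> * nrm A a" using C a by fastforce
  qed (use ns_nonneg[OF nE y(1)] in simp)
  finally show "cmod (D' a x) <= \<bar>C\<bar> * nrm A a * nrm E' x" using y by (simp add: D'_def)
 qed (auto simp: D'_def Dlin)
 moreover have "D' (a \<otimes>\<^bsub>A\<^esub> b) = dual_lact E' r' a (D' b) \<oplus>\<^bsub>dual_space E'\<^esub> dual_ract E' l' (D' a) b"
  if ab: "a : carrier A" "b : carrier A" for a b
 proof
  fix x
  have "D (a \<otimes>\<^bsub>A\<^esub> b) = dual_lact E r a (D b) \<oplus>\<^bsub>dual_space E\<^esub> dual_ract E l (D a) b"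
   using der ab by (simp add: continuous_derivation_def)
  then show "D' (a \<otimes>\<^bsub>A\<^esub> b) x = (dual_lact E' r' a (D' b) \<oplus>\<^bsub>dual_space E'\<^esub> dual_ract E' l' (D' a) b) x"
   using ab bm(2,3) by (auto simp: D'_def dual_lact_def dual_ract_def dual_simps)
 qed
 ultimately have "continuous_derivation A E' l' r' D'" by (simp add: continuous_derivation_def)
 then obtain f' where f': "f' : carrier (dual_space E')"
  "ALL a:carrier A. D' a = dual_lact E' r' a f' \<ominus>\<^bsub>dual_space E'\<^esub> dual_ract E' l' f' a"
  using am mod' unfolding amenable_def inner_derivation_def by blast
 have eq': "D a x = f' (j (r x a)) - f' (j (l a x))" if "a : carrier A" "x : carrier E" for a x
 proof -
  have "dual_lact E' r' a f' : carrier (dual_space E')" "dual_ract E' l' f' a : carrier (dual_space E')"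
   using dual_actions_closed[OF mod' f'(1) that(1)] by auto
  then have "D' a (j x) = dual_lact E' r' a f' (j x) - dual_ract E' l' f' a (j x)"
   using f'(2) that by (simp add: pointwise_minus[OF pointwise_dual_space])
  then show ?thesis using that by (simp add: D'_def dual_lact_def dual_ract_def)
 qed
 define f where "f x = (if x : carrier E then f' (j x) else 0)" for x
 have f: "f : carrier (dual_space E)"
 proof -
  obtain C where C: "ALL x:carrier E'. cmod (f' x) <= C * nrm E' x" using dual_carrierD(4)[OF f'(1)] by blast
  have "f' (j (x \<oplus>\<^bsub>E\<^esub> y)) = f' (j x) + f' (j y)" if "x : carrier E" "y : carrier E" for x y
   using dual_carrierD(1)[OF f'(1), of "j x" "j y"] that by simp
  moreover have "f' (j (c \<odot>\<^bsub>E\<^esub> x)) = c * f' (j x)" if "x : carrier E" for x c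
   using dual_carrierD(2)[OF f'(1), of "j x" c] that by simp
  ultimately show ?thesis
   using C by (intro dual_carrierI[of _ _ C]) (auto simp: f_def ns_add_closed[OF nE] ns_smult_closed[OF nE])
 qed
 have "D a = dual_lact E r a f \<ominus>\<^bsub>dual_space E\<^esub> dual_ract E l f a" if a: "a : carrier A" for a
 proof
  fix x
  show "D a x = (dual_lact E r a f \<ominus>\<^bsub>dual_space E\<^esub> dual_ract E l f a) x"
   using dual_actions_closed[OF mod f a] eq'[OF a] bm(2,3) a dual_carrierD(3)[OF D[OF a], of x]
   by (auto simp: pointwise_minus[OF pointwise_dual_space] dual_lact_def dual_ract_def f_def)
 qed
 then show ?thesis using f unfolding inner_derivation_def by blast
qed


lemma banach_algebra_isometry:
 assumes A: "banach_algebra A" and T: "isometry A B T"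
  and mult: "!!a b. a : carrier A ==> b : carrier A ==> T (a \<otimes>\<^bsub>A\<^esub> b) = T a \<otimes>\<^bsub>B\<^esub> T b"
 shows "banach_algebra B"
proof -
 have bA: "banach_space A" using A by (simp add: banach_algebra_def)
 note nA = banach_space_normed[OF bA]
 have im: "carrier B = T ` carrier A" using T by (auto simp: isometry_def bij_betw_def)
 have add: "T x \<oplus>\<^bsub>B\<^esub> T y = T (x \<oplus>\<^bsub>A\<^esub> y)" if "x : carrier A" "y : carrier A" for x y
  using T that by (simp add: isometry_def)
 have sm: "c \<odot>\<^bsub>B\<^esub> T x = T (c \<odot>\<^bsub>A\<^esub> x)" if "x : carrier A" for x c
  using T that by (simp add: isometry_def)
 have nr: "nrm B (T x) = nrm A x" if "x : carrier A" for x
  using T that by (simp add: isometry_def)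
 have cl: "x \<otimes>\<^bsub>A\<^esub> y : carrier A" if "x : carrier A" "y : carrier A" for x y
  using A that by (auto simp: banach_algebra_def linear_into_def)
 show ?thesis
  using A isometry_banach[OF bA T]
  by (auto simp: banach_algebra_def linear_into_def im Pi_iff add sm nr mult[symmetric] cl
    ns_add_closed[OF nA] ns_smult_closed[OF nA])
qed

text \<open>A bimodule over \<open>B\<close> becomes one over \<open>A\<close> when \<open>a\<close>
  acts as \<open>T a\<close>, and a derivation is composed with \<open>T\<close>. A functional that
  implements the composite implements the derivation itself, because \<open>T\<close> is
  onto.\<close>

lemma amenable_isometry:
 assumes A: "amenable TYPE('e) A" and T: "isometry A B T"
  and mult: "!!a b. a : carrier A ==> b : carrier A ==> T (a \<otimes>\<^bsub>A\<^esub> b) = T a \<otimes>\<^bsub>B\<^esub> T b"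
 shows "amenable TYPE('e) B"
proof -
 have bA: "banach_algebra A" using A by (simp add: amenable_def)
 have bB: "banach_algebra B" using banach_algebra_isometry[OF bA T mult] .
 have im: "carrier B = T ` carrier A" using T by (auto simp: isometry_def bij_betw_def)
 have Tcl: "T x : carrier B" if "x : carrier A" for x using im that by simp
 have add: "T (x \<oplus>\<^bsub>A\<^esub> y) = T x \<oplus>\<^bsub>B\<^esub> T y" if "x : carrier A" "y : carrier A" for x y
  using T that by (simp add: isometry_def)
 have sm: "T (c \<odot>\<^bsub>A\<^esub> x) = c \<odot>\<^bsub>B\<^esub> T x" if "x : carrier A" for x c
  using T that by (simp add: isometry_def)
 have nr: "nrm A x = nrm B (T x)" if "x : carrier A" for x
  using T that by (simp add: isometry_def)
 have "inner_derivation B E l r D"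
  if mod: "banach_bimodule B E l r" and der: "continuous_derivation B E l r D"
  for E :: "'e nspace" and l r D
 proof -
  note bm = banach_bimoduleD[OF mod]
  have "EX C. ALL a:carrier A. ALL x:carrier E.
    nrm E (l (T a) x) <= C * nrm A a * nrm E x & nrm E (r x (T a)) <= C * nrm A a * nrm E x"
   using bm(15) Tcl nr by (metis (no_types, lifting))
  then have "banach_bimodule A E (%a. l (T a)) (%x a. r x (T a))"
   unfolding banach_bimodule_def linear_into_def
   using bm(1) by (auto simp: bm add sm mult Tcl)
  moreover have "EX C. ALL x:carrier A. nrm (dual_space E) (D (T x)) <= C * nrm A x"
   using der Tcl nr unfolding continuous_derivation_def bounded_linear_into_def by metis
  then have "bounded_linear_into A (dual_space E) (%a. D (T a))"
   using der Tcl add sm unfolding continuous_derivation_def bounded_linear_into_def linear_into_def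
   by auto
  then have "continuous_derivation A E (%a. l (T a)) (%x a. r x (T a)) (%a. D (T a))"
   using der Tcl by (auto simp: continuous_derivation_def mult dual_lact_def dual_ract_def)
  ultimately have "inner_derivation A E (%a. l (T a)) (%x a. r x (T a)) (%a. D (T a))"
   using A by (simp add: amenable_def)
  then show ?thesis
   by (auto simp: inner_derivation_def im dual_lact_def dual_ract_def)
 qed
 then show ?thesis using bB by (simp add: amenable_def)
qed

subsection \<open>A derivation into the dual of a space of bilinear forms\<close>

text \<open>Bounded bilinear forms, that is, functionals on the projective tensor square. The
  relation \<open>R\<close> restricts what a form sees of its first argument; it absorbs the failure
  of \<open>e\<close> to commute with \<open>A\<close> in the derivation below.\<close>

definition bforms :: "'a nspace => ('a => 'a => bool) => ('a \<times> 'a => complex) set" where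
 "bforms A R = {F. (ALL x y. x ~: carrier A \<or> y ~: carrier A --> F (x, y) = 0) &
  (ALL x:carrier A. ALL x':carrier A. ALL y:carrier A. F (x \<oplus>\<^bsub>A\<^esub> x', y) = F (x, y) + F (x', y)) &
  (ALL x:carrier A. ALL y:carrier A. ALL y':carrier A. F (x, y \<oplus>\<^bsub>A\<^esub> y') = F (x, y) + F (x, y')) &
  (ALL c. ALL x:carrier A. ALL y:carrier A. F (c \<odot>\<^bsub>A\<^esub> x, y) = c * F (x, y)) &
  (ALL c. ALL x:carrier A. ALL y:carrier A. F (x, c \<odot>\<^bsub>A\<^esub> y) = c * F (x, y)) &
  (ALL x:carrier A. ALL x':carrier A. ALL y:carrier A. R x x' --> F (x, y) = F (x', y)) &
  (EX K>=0. ALL x:carrier A. ALL y:carrier A. cmod (F (x, y)) <= K * (nrm A x * nrm A y))}"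

definition bform_norm :: "'a nspace => ('a \<times> 'a => complex) => real" where
 "bform_norm A F = Inf {K. 0 <= K & (ALL x:carrier A. ALL y:carrier A. cmod (F (x, y)) <= K * (nrm A x * nrm A y))}"

definition bform_space :: "'a nspace => ('a => 'a => bool) => ('a \<times> 'a => complex) nspace" where
 "bform_space A R = \<lparr>carrier = bforms A R, mult = undefined, one = undefined,
   zero = (%x. 0), add = (%f g x. f x + g x), smult = (%c f x. c * f x), nrm = bform_norm A\<rparr>"

text \<open>The tensor of \<open>x\<close> and \<open>y\<close> stands for the noncommutative
  differential \<open>x dy\<close>. The subtracted term is the Leibniz rule
  \<open>(x dy) a = x d(y a) - (x y) da\<close>, turned into an action on forms.\<close>

definition bform_lact :: "'a nspace => 'a => ('a \<times> 'a => complex) => 'a \<times> 'a => complex" where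
 "bform_lact A a F = (%(x, y). if x : carrier A & y : carrier A
  then F (x, y \<otimes>\<^bsub>A\<^esub> a) - F (x \<otimes>\<^bsub>A\<^esub> y, a) else 0)"

definition bform_ract :: "'a nspace => ('a \<times> 'a => complex) => 'a => 'a \<times> 'a => complex" where
 "bform_ract A F a = (%(x, y). if x : carrier A & y : carrier A then F (a \<otimes>\<^bsub>A\<^esub> x, y) else 0)"

context
 fixes A :: "'a nspace" (structure) and R :: "'a => 'a => bool"
 assumes A: "banach_algebra A"
  and R: "!!x x' a. x : carrier A ==> x' : carrier A ==> a : carrier A ==> R x x' ==>
   R (a \<otimes> x) (a \<otimes> x') & R (x \<otimes> a) (x' \<otimes> a)"
begin

lemma bform_norm_le:
 assumes "0 <= K" "!!x y. x : carrier A ==> y : carrier A ==> cmod (F (x, y)) <= K * (nrm A x * nrm A y)"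
 shows "bform_norm A F <= K"
 unfolding bform_norm_def using assms by (intro cInf_lower bdd_belowI[of _ 0]) auto

lemma bform_norm_bound:
 assumes F: "F : bforms A R"
 shows "0 <= bform_norm A F"
  and "x : carrier A ==> y : carrier A ==> cmod (F (x, y)) <= bform_norm A F * (nrm A x * nrm A y)"
proof -
 let ?S = "{K. 0 <= K & (ALL x:carrier A. ALL y:carrier A. cmod (F (x, y)) <= K * (nrm A x * nrm A y))}"
 have ne: "?S ~= {}" using F by (auto simp: bforms_def)
 show "0 <= bform_norm A F" unfolding bform_norm_def using ne by (intro cInf_greatest) auto
 assume x: "x : carrier A" and y: "y : carrier A"
 let ?w = "nrm A x * nrm A y"
 have w: "0 <= ?w" using x y ns_nonneg[OF banach_algebra_normed[OF A]] by simp
 show "cmod (F (x, y)) <= bform_norm A F * ?w"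
 proof (cases "?w = 0")
  case True
  then show ?thesis using ne x y by force
 next
  case False
  then have "cmod (F (x, y)) / ?w <= Inf ?S"
   using w x y ne by (intro cInf_greatest) (auto simp: divide_le_eq)
  then show ?thesis using False w unfolding bform_norm_def by (simp add: pos_divide_le_eq)
 qed
qed

lemma pointwise_bform_space: "pointwise_space (bform_space A R)"
proof -
 have "(%x. F x + G x) : bforms A R" if F: "F : bforms A R" and G: "G : bforms A R" for F G
 proof -
  have "EX K>=0. ALL x:carrier A. ALL y:carrier A. cmod (F (x, y) + G (x, y)) <= K * (nrm A x * nrm A y)"
   using bform_norm_bound[OF F] bform_norm_bound[OF G]
   by (intro exI[of _ "bform_norm A F + bform_norm A G"])
    (auto intro!: norm_triangle_le add_mono simp: distrib_right)
  then show ?thesis using F G by (simp add: bforms_def algebra_simps)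
 qed
 moreover have "(%x. c * F x) : bforms A R" if F: "F : bforms A R" for F c
 proof -
  have "EX K>=0. ALL x:carrier A. ALL y:carrier A. cmod (c * F (x, y)) <= K * (nrm A x * nrm A y)"
   using bform_norm_bound[OF F]
   by (intro exI[of _ "cmod c * bform_norm A F"])
    (auto simp: norm_mult mult.assoc intro!: mult_left_mono)
  then show ?thesis using F by (simp add: bforms_def algebra_simps)
 qed
 moreover have "(%x. 0) : bforms A R" by (auto simp: bforms_def)
 ultimately show ?thesis by (simp add: pointwise_space_def bform_space_def)
qed

lemma banach_bform_space: "banach_space (bform_space A R)"
proof (rule pointwise_banachI[OF pointwise_bform_space,
  where w = "%(x, y). if x : carrier A & y : carrier A then nrm A x * nrm A y else 0"],
  unfold bform_space_def nspace.simps partial_object.simps)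
 note nA = banach_algebra_normed[OF A]
 have le: "bform_norm A (%x. c * F x) <= cmod c * bform_norm A F" if "F : bforms A R" for F c
  using bform_norm_bound[OF that] by (intro bform_norm_le) (auto simp: norm_mult mult.assoc intro!: mult_left_mono)
 have cl: "(%x. c * F x) : bforms A R" if "F : bforms A R" for F c
  using pointwise_bform_space that by (simp add: pointwise_space_def bform_space_def)
 show "bform_norm A (%x. c * F x) = cmod c * bform_norm A F" if F: "F : bforms A R" for F c
 proof (cases "c = 0")
  case True
  then show ?thesis using le[OF F, of c] bform_norm_bound(1)[OF cl[OF F, of c]] by simp
 next
  case False
  have "bform_norm A (%x. inverse c * (c * F x)) <= cmod (inverse c) * bform_norm A (%x. c * F x)"
   using le[OF cl[OF F]] .
  then have "cmod c * bform_norm A F <= bform_norm A (%x. c * F x)"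
   using False mult_left_mono[of "bform_norm A F" "cmod (inverse c) * bform_norm A (%x. c * F x)" "cmod c"]
   by (simp add: norm_inverse flip: mult.assoc)
  then show ?thesis using le[OF F, of c] by simp
 qed
 show "bform_norm A (%x. F x + G x) <= bform_norm A F + bform_norm A G"
  if F: "F : bforms A R" and G: "G : bforms A R" for F G
  using bform_norm_bound[OF F] bform_norm_bound[OF G]
  by (intro bform_norm_le) (auto intro!: norm_triangle_le add_mono simp: distrib_right)
 show "cmod (F p) <= bform_norm A F *
   (case p of (x, y) => if x : carrier A & y : carrier A then nrm A x * nrm A y else 0)"
  if F: "F : bforms A R" for F p
  using bform_norm_bound(2)[OF F] F by (cases p) (auto simp: bforms_def)
 show "F : bforms A R & bform_norm A F <= K"
  if s: "!!n. s n : bforms A R" and K: "!!n. bform_norm A (s n) <= K" and lim: "!!p. (%n. s n p) \<longlonglongrightarrow> F p"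
  for s F K
 proof -
  have K0: "0 <= K" using K[of 0] bform_norm_bound(1)[OF s, of 0] by simp
  have bd: "cmod (F (x, y)) <= K * (nrm A x * nrm A y)" if "x : carrier A" "y : carrier A" for x y
  proof (rule LIMSEQ_le_const2[OF tendsto_norm[OF lim]])
   have "cmod (s n (x, y)) <= K * (nrm A x * nrm A y)" for n
    using bform_norm_bound(2)[OF s that, of n] mult_right_mono[OF K, of "nrm A x * nrm A y" n]
     ns_nonneg[OF nA that(1)] ns_nonneg[OF nA that(2)] by simp
   then show "EX N. ALL n>=N. cmod (s n (x, y)) <= K * (nrm A x * nrm A y)" by blast
  qed
  have eqI: "F p = c" if "!!n. s n p = g n" "g \<longlonglongrightarrow> c" for p g c
   using LIMSEQ_unique[OF lim[of p]] that by simp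
  have "F : bforms A R"
   unfolding bforms_def
  proof (intro CollectI conjI ballI allI impI)
   fix x y assume "x ~: carrier A \<or> y ~: carrier A"
   then show "F (x, y) = 0" using s by (intro eqI[of _ "%n. 0"]) (auto simp: bforms_def)
  next
   fix x x' y assume "x : carrier A" "x' : carrier A" "y : carrier A"
   then show "F (x \<oplus> x', y) = F (x, y) + F (x', y)" "F (y, x \<oplus> x') = F (y, x) + F (y, x')"
    using s by (auto intro!: eqI tendsto_add lim simp: bforms_def)
  next
   fix c x y assume "x : carrier A" "y : carrier A"
   then show "F (c \<odot> x, y) = c * F (x, y)" "F (x, c \<odot> y) = c * F (x, y)"
    using s by (auto intro!: eqI tendsto_mult lim simp: bforms_def)
  next
   fix x x' y assume "x : carrier A" "x' : carrier A" "y : carrier A" "R x x'"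
   then have "!!n. s n (x, y) = s n (x', y)" using s by (simp add: bforms_def)
   then show "F (x, y) = F (x', y)" using lim by (intro eqI[of _ "%n. s n (x', y)"]) auto
  qed (use bd K0 in blast)
  then show ?thesis using bform_norm_le[OF K0 bd] by blast
 qed
qed (use bform_norm_bound in blast)

lemma bform_simps:
 assumes "F : bforms A R"
 shows "x : carrier A ==> x' : carrier A ==> y : carrier A ==> F (x \<oplus> x', y) = F (x, y) + F (x', y)"
  "x : carrier A ==> x' : carrier A ==> y : carrier A ==> F (y, x \<oplus> x') = F (y, x) + F (y, x')"
  "x : carrier A ==> y : carrier A ==> F (c \<odot> x, y) = c * F (x, y)"
  "x : carrier A ==> y : carrier A ==> F (x, c \<odot> y) = c * F (x, y)"
  "x ~: carrier A \<or> y ~: carrier A ==> F (x, y) = 0"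
  "x : carrier A ==> x' : carrier A ==> y : carrier A ==> R x x' ==> F (x, y) = F (x', y)"
 using assms by (auto simp: bforms_def)

lemma alg_simps:
 "x : carrier A ==> y : carrier A ==> x \<otimes> y : carrier A"
 "x : carrier A ==> y : carrier A ==> x \<oplus> y : carrier A"
 "x : carrier A ==> c \<odot> x : carrier A"
 "x : carrier A ==> y : carrier A ==> nrm A (x \<otimes> y) <= nrm A x * nrm A y"
 "x : carrier A ==> 0 <= nrm A x"
 "x : carrier A ==> y : carrier A ==> z : carrier A ==>
  x \<otimes> (y \<oplus> z) = x \<otimes> y \<oplus> x \<otimes> z"
 "x : carrier A ==> y : carrier A ==> z : carrier A ==>
  (x \<oplus> y) \<otimes> z = x \<otimes> z \<oplus> y \<otimes> z"
 "x : carrier A ==> y : carrier A ==> x \<otimes> (c \<odot> y) = c \<odot> (x \<otimes> y)"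
 "x : carrier A ==> y : carrier A ==> (c \<odot> x) \<otimes> y = c \<odot> (x \<otimes> y)"
 "x : carrier A ==> y : carrier A ==> z : carrier A ==>
  (x \<otimes> y) \<otimes> z = x \<otimes> (y \<otimes> z)"
 using A ns_add_closed[OF banach_algebra_normed[OF A]] ns_smult_closed[OF banach_algebra_normed[OF A]]
  ns_nonneg[OF banach_algebra_normed[OF A]]
 by (simp_all add: banach_algebra_def linear_into_def Pi_iff)

lemma bform_ract_bound:
 assumes F: "F : bforms A R" and a: "a : carrier A" and x: "x : carrier A" and y: "y : carrier A"
 shows "cmod (F (a \<otimes> x, y)) <= (bform_norm A F * nrm A a) * (nrm A x * nrm A y)"
proof -
 have "cmod (F (a \<otimes> x, y)) <= bform_norm A F * (nrm A (a \<otimes> x) * nrm A y)"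
  using bform_norm_bound(2)[OF F] alg_simps(1)[OF a x] y by blast
 also have "... <= bform_norm A F * ((nrm A a * nrm A x) * nrm A y)"
  using bform_norm_bound(1)[OF F] alg_simps(4)[OF a x] alg_simps(5)[OF y]
  by (intro mult_left_mono mult_right_mono) auto
 finally show ?thesis by (simp add: mult_ac)
qed

lemma bform_lact_bound:
 assumes F: "F : bforms A R" and a: "a : carrier A" and x: "x : carrier A" and y: "y : carrier A"
 shows "cmod (F (x, y \<otimes> a) - F (x \<otimes> y, a)) <= (2 * bform_norm A F * nrm A a) * (nrm A x * nrm A y)"
proof -
 have "cmod (F (x, y \<otimes> a)) <= bform_norm A F * (nrm A x * nrm A (y \<otimes> a))"
  using bform_norm_bound(2)[OF F] alg_simps(1)[OF y a] x by blast
 also have "... <= bform_norm A F * (nrm A x * (nrm A y * nrm A a))"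
  using bform_norm_bound(1)[OF F] alg_simps(4)[OF y a] alg_simps(5)[OF x]
  by (intro mult_left_mono) auto
 finally have 1: "cmod (F (x, y \<otimes> a)) <= (bform_norm A F * nrm A a) * (nrm A x * nrm A y)" by (simp add: mult_ac)
 have "cmod (F (x \<otimes> y, a)) <= (bform_norm A F * nrm A a) * (nrm A x * nrm A y)"
  using bform_ract_bound[OF F x y a] by (simp add: mult_ac)
 then show ?thesis using 1 norm_triangle_ineq4[of "F (x, y \<otimes> a)" "F (x \<otimes> y, a)"] by simp
qed

lemma bform_act_closed:
 assumes F: "F : bforms A R" and a: "a : carrier A"
 shows "bform_lact A a F : bforms A R" "bform_ract A F a : bforms A R"
proof -
 have "EX K>=0. ALL x:carrier A. ALL y:carrier A. cmod (bform_lact A a F (x, y)) <= K * (nrm A x * nrm A y)"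
  using bform_lact_bound[OF F a] bform_norm_bound(1)[OF F] alg_simps(5)[OF a]
  by (intro exI[of _ "2 * bform_norm A F * nrm A a"]) (simp add: bform_lact_def)
 moreover have "bform_lact A a F (x, y) = bform_lact A a F (x', y)"
  if "x : carrier A" "x' : carrier A" "y : carrier A" "R x x'" for x x' y
  using bform_simps(6)[OF F that(1,2) alg_simps(1)[OF that(3) a] that(4)] that a
   bform_simps(6)[OF F alg_simps(1)[OF that(1,3)] alg_simps(1)[OF that(2,3)] a] R[OF that(1-4)]
  by (simp add: bform_lact_def)
 ultimately show "bform_lact A a F : bforms A R"
  using a unfolding bforms_def
  by (auto simp add: bform_lact_def alg_simps bform_simps(1-5)[OF F] algebra_simps)
 have "EX K>=0. ALL x:carrier A. ALL y:carrier A. cmod (bform_ract A F a (x, y)) <= K * (nrm A x * nrm A y)"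
  using bform_ract_bound[OF F a] bform_norm_bound(1)[OF F] alg_simps(5)[OF a]
  by (intro exI[of _ "bform_norm A F * nrm A a"]) (simp add: bform_ract_def)
 moreover have "bform_ract A F a (x, y) = bform_ract A F a (x', y)"
  if "x : carrier A" "x' : carrier A" "y : carrier A" "R x x'" for x x' y
  using that a bform_simps(6)[OF F alg_simps(1)[OF a that(1)] alg_simps(1)[OF a that(2)] that(3)]
   R[OF that(1,2) a that(4)]
  by (simp add: bform_ract_def)
 ultimately show "bform_ract A F a : bforms A R"
  using a unfolding bforms_def
  by (simp add: bform_ract_def alg_simps bform_simps(1-5)[OF F])
qed

lemma bform_bimodule: "banach_bimodule A (bform_space A R) (bform_lact A) (bform_ract A)"
proof -
 let ?E = "bform_space A R"
 have [simp]: "carrier ?E = bforms A R" "F \<oplus>\<^bsub>?E\<^esub> G = (%x. F x + G x)" "c \<odot>\<^bsub>?E\<^esub> F = (%x. c * F x)"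
  "nrm ?E = bform_norm A" for F G c
  by (simp_all add: bform_space_def)
 have b1: "bform_norm A (bform_lact A a F) <= 2 * nrm A a * bform_norm A F"
  if a: "a : carrier A" and F: "F : bforms A R" for a F
  using bform_norm_bound(1)[OF F] alg_simps(5)[OF a] bform_lact_bound[OF F a]
  by (intro bform_norm_le) (auto simp: bform_lact_def mult_ac)
 have b2: "bform_norm A (bform_ract A F a) <= 2 * nrm A a * bform_norm A F"
  if a: "a : carrier A" and F: "F : bforms A R" for a F
 proof -
  have "bform_norm A (bform_ract A F a) <= nrm A a * bform_norm A F"
   using bform_norm_bound(1)[OF F] alg_simps(5)[OF a] bform_ract_bound[OF F a]
   by (intro bform_norm_le) (auto simp: bform_ract_def mult_ac)
  also have "... <= 2 * (nrm A a * bform_norm A F)"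
   using bform_norm_bound(1)[OF F] alg_simps(5)[OF a] by simp
  finally show ?thesis by simp
 qed
 have l1: "linear_into ?E ?E (bform_lact A a)" "linear_into ?E ?E (%x. bform_ract A x a)"
  if "a : carrier A" for a
  using bform_act_closed that
  by (auto simp: linear_into_def bform_lact_def bform_ract_def fun_eq_iff algebra_simps)
 have l2: "linear_into A ?E (%a. bform_lact A a F)" "linear_into A ?E (bform_ract A F)"
  if F: "F : bforms A R" for F
  using bform_act_closed[OF F]
  by (auto simp: linear_into_def bform_lact_def bform_ract_def fun_eq_iff algebra_simps alg_simps bform_simps(1-5)[OF F])
 have m: "bform_lact A (a \<otimes> b) F = bform_lact A a (bform_lact A b F)"
  "bform_ract A F (a \<otimes> b) = bform_ract A (bform_ract A F a) b"
  "bform_ract A (bform_lact A a F) b = bform_lact A a (bform_ract A F b)"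
  if "a : carrier A" "b : carrier A" for a b F
  using that by (auto simp: bform_lact_def bform_ract_def fun_eq_iff alg_simps)
 show ?thesis
  unfolding banach_bimodule_def using banach_bform_space l1 l2 m b1 b2
  by (auto intro!: exI[of _ 2])
qed

text \<open>
 This is the derivation that yields a virtual diagonal when \<open>A\<close> is unital with unit \<open>e\<close>.
 Here \<open>e\<close> only has to commute with \<open>A\<close> up to the relation \<open>R\<close> that the forms respect.
\<close>

lemma amenable_bforms:
 fixes j :: "('a \<times> 'a => complex) => 'e"
 assumes am: "amenable TYPE('e) A" and j: "inj j"
  and e: "e : carrier A" "!!a. a : carrier A ==> R (a \<otimes> e) (e \<otimes> a)"
 obtains \<Theta> C where "!!F G. F : bforms A R ==> G : bforms A R ==> \<Theta> (%p. F p + G p) = \<Theta> F + \<Theta> G"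
  "!!F c. F : bforms A R ==> \<Theta> (%p. c * F p) = c * \<Theta> F"
  "!!F K. F : bforms A R ==> 0 <= K ==>
   (!!x y. x : carrier A ==> y : carrier A ==> cmod (F (x, y)) <= K * (nrm A x * nrm A y)) ==>
   cmod (\<Theta> F) <= C * K"
  "!!F a. F : bforms A R ==> a : carrier A ==> - F (e, a) = \<Theta> (bform_ract A F a) - \<Theta> (bform_lact A a F)"
proof -
 let ?E = "bform_space A R"
 have [simp]: "carrier ?E = bforms A R" "F \<oplus>\<^bsub>?E\<^esub> G = (%x. F x + G x)" "c \<odot>\<^bsub>?E\<^esub> F = (%x. c * F x)"
  "nrm ?E = bform_norm A" for F G c
  by (simp_all add: bform_space_def)
 note nA = banach_algebra_normed[OF A] and nE = banach_space_normed[OF banach_bform_space]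
 \<comment> \<open>Up to the sign this is the universal differential
   \<open>a \<mapsto> e da\<close>, viewed as a functional on forms.\<close>
 define D where "D a = (%F. if F : bforms A R then - F (e, a) else 0)" for a
 have addcl: "(%x. F x + G x) : bforms A R" if "F : bforms A R" "G : bforms A R" for F G
  using pointwise_bform_space that by (simp add: pointwise_space_def)
 have smcl: "(%x. c * F x) : bforms A R" if "F : bforms A R" for F c
  using pointwise_bform_space that by (simp add: pointwise_space_def)
 have bd: "cmod (D a F) <= nrm A e * nrm A a * bform_norm A F" if "a : carrier A" "F : bforms A R" for a F
  using bform_norm_bound(2)[OF that(2) e(1) that(1)] that by (simp add: D_def mult_ac)
 have D: "D a : carrier (dual_space ?E)" if a: "a : carrier A" for a
  by (rule dual_carrierI[of _ _ "nrm A e * nrm A a"]) (use bd[OF a] addcl smcl in \<open>auto simp: D_def\<close>)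
 have "bounded_linear_into A (dual_space ?E) D"
  by (rule bounded_linear_dual[OF nE D _ _ nA, of _ "nrm A e"])
   (use D e bd in \<open>auto simp: D_def bform_simps(1-5) alg_simps(5)\<close>)
 \<comment> \<open>The right action contributes \<open>- F (a e, b)\<close>, the left one
   \<open>- F (e, a b) + F (e a, b)\<close>. The terms with \<open>a e\<close> and
   \<open>e a\<close> cancel because \<open>F\<close> respects \<open>R\<close>.\<close>
 moreover have "D (a \<otimes> b) = dual_lact ?E (bform_ract A) a (D b) \<oplus>\<^bsub>dual_space ?E\<^esub> dual_ract ?E (bform_lact A) (D a) b"
  if a: "a : carrier A" and b: "b : carrier A" for a b
 proof
  fix F
  have "F (a \<otimes> e, b) = F (e \<otimes> a, b)" if "F : bforms A R"
   using bform_simps(6)[OF that _ _ b e(2)[OF a]] alg_simps(1) a e(1) by blast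
  moreover have "bform_ract A F a (e, b) = F (a \<otimes> e, b)"
   "bform_lact A b F (e, a) = F (e, a \<otimes> b) - F (e \<otimes> a, b)"
   using a b e(1) by (simp_all add: bform_ract_def bform_lact_def)
  ultimately show "D (a \<otimes> b) F = (dual_lact ?E (bform_ract A) a (D b) \<oplus>\<^bsub>dual_space ?E\<^esub> dual_ract ?E (bform_lact A) (D a) b) F"
   using a b by (simp add: D_def dual_lact_def dual_ract_def dual_simps bform_act_closed)
 qed
 ultimately have "continuous_derivation A ?E (bform_lact A) (bform_ract A) D"
  by (simp add: continuous_derivation_def)
 then obtain \<Theta> where \<Theta>: "\<Theta> : carrier (dual_space ?E)"
  "!!a. a : carrier A ==> D a = dual_lact ?E (bform_ract A) a \<Theta> \<ominus>\<^bsub>dual_space ?E\<^esub> dual_ract ?E (bform_lact A) \<Theta> a"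
  using inner_derivation_transfer[OF am j bform_bimodule] unfolding inner_derivation_def by blast
 show thesis
 proof
  show "\<Theta> (%p. F p + G p) = \<Theta> F + \<Theta> G" if "F : bforms A R" "G : bforms A R" for F G
   using dual_carrierD(1)[OF \<Theta>(1)] that by simp
  show "\<Theta> (%p. c * F p) = c * \<Theta> F" if "F : bforms A R" for F c
   using dual_carrierD(2)[OF \<Theta>(1)] that by simp
  show "cmod (\<Theta> F) <= nrm (dual_space ?E) \<Theta> * K" if F: "F : bforms A R" and K: "0 <= K"
   "!!x y. x : carrier A ==> y : carrier A ==> cmod (F (x, y)) <= K * (nrm A x * nrm A y)" for F K
   using dual_nrm_bound[OF nE \<Theta>(1), of F] F mult_left_mono[OF bform_norm_le[OF K] dual_nrm_nonneg[OF nE \<Theta>(1)]]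
   by simp
  show "- F (e, a) = \<Theta> (bform_ract A F a) - \<Theta> (bform_lact A a F)" if F: "F : bforms A R" and a: "a : carrier A" for F a
   using fun_cong[OF \<Theta>(2)[OF a], of F] F dual_actions_closed[OF bform_bimodule \<Theta>(1) a]
   by (simp add: pointwise_minus[OF pointwise_dual_space] D_def dual_lact_def dual_ract_def)
 qed
qed

end

section \<open>Complex Borel measures\<close>

lemma ennreal_suminf_swap: "(\<Sum>i. \<Sum>j. f i j) = (\<Sum>j. \<Sum>i. f i j)" for f :: "nat => nat => ennreal"
proof -
 have "(\<Sum>i. \<Sum>j. f i j) = (\<integral>\<^sup>+i. (\<Sum>j. f i j) \<partial>count_space UNIV)"
  by (simp add: nn_integral_count_space_nat)
 also have "... = (\<Sum>j. \<integral>\<^sup>+i. f i j \<partial>count_space UNIV)"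
  by (rule nn_integral_suminf) simp
 finally show ?thesis by (simp add: nn_integral_count_space_nat)
qed

lemma sums_norm_le_ennreal:
 fixes f :: "nat => complex"
 assumes "f sums s" shows "ennreal (cmod s) <= (\<Sum>i. ennreal (cmod (f i)))"
proof (rule LIMSEQ_le_const2)
 show "(%n. ennreal (cmod (\<Sum>i<n. f i))) \<longlonglongrightarrow> ennreal (cmod s)"
  using assms unfolding sums_def by (intro tendsto_ennrealI tendsto_norm)
 have "ennreal (cmod (\<Sum>i<n. f i)) <= (\<Sum>i. ennreal (cmod (f i)))" for n
 proof -
  have "ennreal (cmod (\<Sum>i<n. f i)) <= ennreal (\<Sum>i<n. cmod (f i))" by (intro ennreal_leI norm_sum)
  also have "... = (\<Sum>i<n. ennreal (cmod (f i)))" by simp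
  also have "... <= (\<Sum>i. ennreal (cmod (f i)))" by (intro sum_le_suminf) auto
  finally show ?thesis .
 qed
 then show "EX N. ALL n>=N. ennreal (cmod (\<Sum>i<n. f i)) <= (\<Sum>i. ennreal (cmod (f i)))" by blast
qed

lemma complex_measure_zero: "complex_measure mu ==> A ~: sets borel ==> mu A = 0"
 by (simp add: complex_measure_def)

lemma complex_measure_sums:
 "complex_measure mu ==> (!!i. F i : sets borel) ==> disjoint_family F ==> (%i. mu (F i)) sums mu (\<Union>i. F i)"
 by (auto simp: complex_measure_def)

lemma complex_measure_empty: "complex_measure mu ==> mu {} = 0"
proof -
 assume "complex_measure mu"
 then have "(%i::nat. mu {}) sums mu (\<Union>i::nat. {})"
  by (intro complex_measure_sums) (auto simp: disjoint_family_on_def)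
 then show ?thesis by (metis sums_summable summable_const_iff)
qed

lemma complex_measure_Un:
 assumes mu: "complex_measure mu" and "A : sets borel" "B : sets borel" "A Int B = {}"
 shows "mu (A Un B) = mu A + mu B"
proof -
 have "(%i. mu (binaryset A B i)) sums mu (\<Union>i. binaryset A B i)"
  using assms by (intro complex_measure_sums) (auto simp: binaryset_def disjoint_family_on_def)
 moreover have "(%i. mu (binaryset A B i)) sums (mu A + mu B)"
  by (rule binaryset_sums) (rule complex_measure_empty[OF mu])
 ultimately show ?thesis by (simp add: UN_binaryset_eq sums_iff)
qed

definition borel_partitions :: "'g::topological_space set => (nat => 'g set) set" where
 "borel_partitions A = {F. range F \<subseteq> sets borel & disjoint_family F & (\<Union>i. F i) = A}"

definition total_var :: "('g::topological_space) cmeasure => 'g set => ennreal" where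
 "total_var mu A = (SUP F\<in>borel_partitions A. \<Sum>i. ennreal (cmod (mu (F i))))"

lemma space_variation [simp]: "space (variation mu) = UNIV"
 by (simp add: variation_def space_measure_of)

lemma sets_variation [simp, measurable_cong]: "sets (variation mu) = sets borel"
 unfolding variation_def using sets.sigma_sets_eq[of borel] by (simp add: sets_measure_of)

lemma trivial_partition:
 assumes "A : sets borel" shows "(%i::nat. if i = 0 then A else {}) : borel_partitions A"
 using assms by (auto simp: borel_partitions_def disjoint_family_on_def)

text \<open>A partition of \<open>A\<close> and one of \<open>B\<close> together form a partition of
  \<open>A Un B\<close>; the suprema over the two are then taken one after the other.\<close>

lemma total_var_superadd:
 assumes mu: "complex_measure mu" and AB: "A : sets borel" "B : sets borel" "A Int B = {}"
 shows "total_var mu A + total_var mu B <= total_var mu (A Un B)"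
proof -
 let ?s = "%F. \<Sum>i. ennreal (cmod (mu (F i)))"
 have ne: "borel_partitions A ~= {}" "borel_partitions B ~= {}"
  using trivial_partition AB by blast+
 have "?s F + ?s G <= total_var mu (A Un B)"
  if F: "F : borel_partitions A" and G: "G : borel_partitions B" for F G
 proof -
  \<comment> \<open>Rows 0 and 1 of the pair grid hold the two partitions, all other rows are empty,
    so \<open>prod_decode\<close> lists both in one sequence.\<close>
  define f where "f p = (if fst p = 0 then F (snd p) else if fst p = 1 then G (snd p) else {})" for p :: "nat \<times> nat"
  have fs: "f p : sets borel" for p using F G by (auto simp: f_def borel_partitions_def)
  have disj: "f p Int f q = {}" if "p ~= q" for p q
  proof -
   obtain i j k l where pq: "p = (i, j)" "q = (k, l)" by (cases p, cases q) auto
   have 1: "F a \<subseteq> A" "G a \<subseteq> B" for a using F G by (auto simp: borel_partitions_def)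
   have 2: "a ~= b ==> F a Int F b = {}" "a ~= b ==> G a Int G b = {}" for a b
    using F G by (auto simp: borel_partitions_def disjoint_family_on_def)
   have 3: "F a Int G b = {}" "G b Int F a = {}" for a b using 1[of a] 1[of b] AB(3) by auto
   show ?thesis using that by (auto simp: f_def pq 2 3)
  qed
  have "(\<Union>p. f p) = A Un B"
  proof -
   have "(\<Union>p. f p) = (\<Union>j. F j) Un (\<Union>j. G j)"
   proof (intro equalityI subsetI)
    fix x assume "x : (\<Union>p. f p)"
    then show "x : (\<Union>j. F j) Un (\<Union>j. G j)" by (auto simp: f_def split: if_splits)
   next
    fix x assume "x : (\<Union>j. F j) Un (\<Union>j. G j)"
    then obtain j where "x : f (0, j) \<or> x : f (1, j)" by (auto simp: f_def)
    then show "x : (\<Union>p. f p)" by blast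
   qed
   then show ?thesis using F G by (simp add: borel_partitions_def)
  qed
  moreover have "(\<Union>i. f (prod_decode i)) = (\<Union>p\<in>range prod_decode. f p)" by simp
  ultimately have un: "(\<Union>i. f (prod_decode i)) = A Un B"
   by (simp only: surj_prod_decode)
  have "(%i. f (prod_decode i)) : borel_partitions (A Un B)"
   unfolding borel_partitions_def
   using un fs disj[of "prod_decode i" "prod_decode j" for i j]
   by (simp add: disjoint_family_on_def inj_eq[OF inj_prod_decode] image_subset_iff del: surj_pair split_paired_All)
  then have le: "?s (%i. f (prod_decode i)) <= total_var mu (A Un B)"
   unfolding total_var_def by (rule SUP_upper)
  define g where "g m = (\<Sum>n. ennreal (cmod (mu (f (m, n)))))" for m
  have "(\<Sum>i. ennreal (cmod (mu (f (prod_decode i))))) = suminf g"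
   unfolding g_def by (rule suminf_ennreal_2dimen) (rule refl)
  also have "suminf g = (\<Sum>m\<in>{0,1}. g m)"
   by (rule suminf_finite) (auto simp: g_def f_def complex_measure_empty[OF mu])
  also have "... = ?s F + ?s G" by (simp add: g_def f_def)
  finally show ?thesis using le by metis
 qed
 then have "?s F + total_var mu B <= total_var mu (A Un B)" if "F : borel_partitions A" for F
  unfolding total_var_def[of mu B] using ne(2) that
  by (subst ennreal_SUP_add_right) (auto intro!: SUP_least)
 then show ?thesis
  unfolding total_var_def[of mu A] using ne(1)
  by (subst ennreal_SUP_add_left[symmetric]) (auto intro!: SUP_least)
qed

text \<open>One inequality is superadditivity applied to finite partial unions. For the other, an
  arbitrary partition \<open>F\<close> of the union is refined by the sets \<open>A i\<close>, and
  the double sum is exchanged.\<close>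

lemma total_var_countably_additive:
 assumes mu: "complex_measure mu" shows "countably_additive (sets borel) (total_var mu)"
proof (rule countably_additiveI)
 fix A :: "nat => 'a set" assume A: "range A \<subseteq> sets borel" "disjoint_family A"
 have As: "A i : sets borel" for i using A by auto
 have mono: "total_var mu B <= total_var mu C" if "B : sets borel" "C : sets borel" "B \<subseteq> C" for B C
 proof -
  have "total_var mu B + total_var mu (C - B) <= total_var mu (B Un (C - B))"
   using that by (intro total_var_superadd[OF mu]) auto
  then show ?thesis using that(3) by (simp add: Un_absorb1 add_increasing2 order_trans[OF add_increasing2[OF zero_le order_refl]])
 qed
 show "(\<Sum>i. total_var mu (A i)) = total_var mu (\<Union>i. A i)"
 proof (rule antisym)
  have fin: "(\<Sum>i<n. total_var mu (A i)) <= total_var mu (\<Union>i<n. A i)" for n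
  proof (induction n)
   case (Suc n)
   have "(\<Union>i<n. A i) Int A n = {}" 
    using disjoint_family_onD[OF A(2), of _ n] by fastforce
   then have "total_var mu (\<Union>i<n. A i) + total_var mu (A n) <= total_var mu ((\<Union>i<n. A i) Un A n)"
    using As by (intro total_var_superadd[OF mu]) auto
   moreover have "(\<Union>i<n. A i) Un A n = (\<Union>i<Suc n. A i)" by (auto simp: less_Suc_eq)
   moreover have "(\<Sum>i<Suc n. total_var mu (A i)) <= total_var mu (\<Union>i<n. A i) + total_var mu (A n)"
    using add_right_mono[OF Suc] by (simp only: sum.lessThan_Suc)
   ultimately show ?case by (metis order_trans)
  qed simp
  show "(\<Sum>i. total_var mu (A i)) <= total_var mu (\<Union>i. A i)"
  proof (rule suminf_le_const[OF summableI])
   fix n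
   have "total_var mu (\<Union>i<n. A i) <= total_var mu (\<Union>i. A i)"
    using As by (intro mono) auto
   with fin[of n] show "(\<Sum>i<n. total_var mu (A i)) <= total_var mu (\<Union>i. A i)" by (rule order_trans)
  qed
 next
  show "total_var mu (\<Union>i. A i) <= (\<Sum>i. total_var mu (A i))"
   unfolding total_var_def[of mu "\<Union>i. A i"]
  proof (rule SUP_least)
   fix F assume F: "F : borel_partitions (\<Union>i. A i)"
   then have Fs: "F j : sets borel" for j by (auto simp: borel_partitions_def)
   have "ennreal (cmod (mu (F j))) <= (\<Sum>i. ennreal (cmod (mu (F j Int A i))))" for j
   proof (rule sums_norm_le_ennreal)
    have "(%i. mu (F j Int A i)) sums mu (\<Union>i. F j Int A i)"
     using Fs As disjoint_family_subset[OF A(2), of "%i. F j Int A i"]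
     by (intro complex_measure_sums[OF mu]) auto
    moreover have "(\<Union>i. F j Int A i) = F j" using F by (auto simp: borel_partitions_def)
    ultimately show "(%i. mu (F j Int A i)) sums mu (F j)" by simp
   qed
   then have "(\<Sum>j. ennreal (cmod (mu (F j)))) <= (\<Sum>j. \<Sum>i. ennreal (cmod (mu (F j Int A i))))"
    by (intro suminf_le) auto
   also have "... = (\<Sum>i. \<Sum>j. ennreal (cmod (mu (F j Int A i))))" by (rule ennreal_suminf_swap)
   also have "... <= (\<Sum>i. total_var mu (A i))"
   proof (intro suminf_le allI summableI)
    fix i
    have "(%j. F j Int A i) : borel_partitions (A i)"
     unfolding borel_partitions_def
    proof (intro CollectI conjI)
     show "range (%j. F j Int A i) \<subseteq> sets borel" using Fs As by auto
     show "disjoint_family (%j. F j Int A i)" using F by (auto simp: borel_partitions_def disjoint_family_on_def)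
     have "(\<Union>j. F j) Int A i = A i" using F by (auto simp: borel_partitions_def)
     then show "(\<Union>j. F j Int A i) = A i" by blast
    qed
    then show "(\<Sum>j. ennreal (cmod (mu (F j Int A i)))) <= total_var mu (A i)"
     unfolding total_var_def by (rule SUP_upper)
   qed
   finally show "(\<Sum>j. ennreal (cmod (mu (F j)))) <= (\<Sum>i. total_var mu (A i))" .
  qed
 qed
qed

lemma emeasure_variation:
 assumes mu: "complex_measure mu" and A: "A : sets borel"
 shows "emeasure (variation mu) A = total_var mu A"
proof -
 have "total_var mu {} <= 0"
  unfolding total_var_def by (rule SUP_least) (auto simp: borel_partitions_def complex_measure_empty[OF mu])
 then have "total_var mu {} = 0" by simp
 then have pos: "positive (sets borel) (total_var mu)" by (simp add: positive_def)
 have eq: "variation mu = measure_of UNIV (sets borel) (total_var mu)"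
  by (simp add: variation_def total_var_def[abs_def] borel_partitions_def)
 show ?thesis
  unfolding eq
  by (rule emeasure_measure_of_sigma[OF _ pos total_var_countably_additive[OF mu] A])
   (use sets.sigma_algebra_axioms[of borel] in simp)
qed

lemma cmod_le_variation:
 assumes mu: "complex_measure mu" shows "ennreal (cmod (mu A)) <= emeasure (variation mu) A"
proof (cases "A : sets borel")
 case True
 let ?F = "%i::nat. if i = 0 then A else {}"
 have "(\<Sum>i. ennreal (cmod (mu (?F i)))) = (\<Sum>i\<in>{0}. ennreal (cmod (mu (?F i))))"
  by (rule suminf_finite) (auto simp: complex_measure_empty[OF mu])
 then have "ennreal (cmod (mu A)) = (\<Sum>i. ennreal (cmod (mu (?F i))))" by simp
 also have "... <= total_var mu A"
  unfolding total_var_def by (rule SUP_upper[OF trivial_partition[OF True]])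
 finally show ?thesis by (simp add: emeasure_variation[OF mu True])
qed (simp add: complex_measure_zero[OF mu])

text \<open>Minimality of the variation among the measures that dominate \<open>cmod (mu B)\<close>;
  it yields the mass estimate of the polar decomposition and the bound for convolutions.\<close>

lemma variation_le:
 assumes mu: "complex_measure mu" and m: "sets m = sets borel"
  and le: "!!B. B : sets borel ==> ennreal (cmod (mu B)) <= emeasure m B"
 shows "emeasure (variation mu) A <= emeasure m A"
proof (cases "A : sets borel")
 case True
 have "(\<Sum>i. ennreal (cmod (mu (F i)))) <= emeasure m A" if F: "F : borel_partitions A" for F
 proof -
  have "(\<Sum>i. ennreal (cmod (mu (F i)))) <= (\<Sum>i. emeasure m (F i))"
   using F by (intro suminf_le le) (auto simp: borel_partitions_def)
  also have "... = emeasure m (\<Union>i. F i)"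
   using F m by (intro suminf_emeasure) (auto simp: borel_partitions_def)
  finally show ?thesis using F by (simp add: borel_partitions_def)
 qed
 then show ?thesis by (simp add: emeasure_variation[OF mu True] total_var_def SUP_least)
qed (simp add: emeasure_notin_sets)

subsection \<open>Densities and the polar decomposition\<close>

lemma real_density:
 assumes fin: "finite_measure m" "finite_measure n" and sets: "sets n = sets m"
  and null: "!!A. A : sets m ==> emeasure m A = 0 ==> emeasure n A = 0"
 obtains D :: "'a => real" where "integrable m D" "!!x. 0 <= D x" "n = density m (%x. ennreal (D x))"
proof -
 interpret finite_measure m by fact
 have ac: "absolutely_continuous m n" using null sets by (auto simp: absolutely_continuous_def null_sets_def)
 obtain D where D: "D : borel_measurable m" "AE x in m. RN_deriv m n x = ennreal (D x)" "!!x. 0 <= D x"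
  using real_RN_deriv[OF fin(2) ac sets] by metis
 have "density m (RN_deriv m n) = density m (%x. ennreal (D x))"
  using D by (intro density_cong) auto
 then have n: "n = density m (%x. ennreal (D x))" by (simp only: density_RN_deriv[OF ac sets])
 have "integrable n (%_. 1::real)" using finite_measure.integrable_const[OF fin(2)] .
 then have "integrable m D" unfolding n using D by (subst (asm) integrable_density) auto
 then show thesis using that D(3) n by blast
qed

text \<open>The set function \<open>s + measure m\<close> is a positive measure between 0 and
  \<open>2 m\<close>. Its Radon-Nikodym density minus 1 is the density of \<open>s\<close>.\<close>

lemma signed_density:
 fixes s :: "'a set => real"
 assumes fin: "finite_measure m"
  and s: "!!F :: nat => 'a set. range F \<subseteq> sets m ==> disjoint_family F ==> (%i. s (F i)) sums s (\<Union>i. F i)"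
  and le: "!!A. A : sets m ==> \<bar>s A\<bar> <= measure m A"
 obtains g where "integrable m g" "!!A. A : sets m ==> s A = (LINT x:A|m. g x)"
proof -
 interpret finite_measure m by fact
 let ?p = "%A. ennreal (s A + measure m A)"
 define n where "n = measure_of (space m) (sets m) ?p"
 have nn: "0 <= s A + measure m A" if "A : sets m" for A using le[OF that] by linarith
 have "countably_additive (sets m) ?p"
 proof (rule countably_additiveI)
  fix F :: "nat => 'a set" assume F: "range F \<subseteq> sets m" "disjoint_family F"
  have "(%i. s (F i) + measure m (F i)) sums (s (\<Union>i. F i) + measure m (\<Union>i. F i))"
   using s[OF F] finite_measure_UNION[OF F] by (intro sums_add) auto
  then show "(\<Sum>i. ?p (F i)) = ?p (\<Union>i. F i)"
   using nn F by (subst suminf_ennreal2) (auto simp: sums_iff)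
 qed
 moreover have "positive (sets m) ?p" using le[of "{}"] by (simp add: positive_def)
 ultimately have em: "emeasure n A = ?p A" if "A : sets m" for A
  unfolding n_def using emeasure_measure_of_sigma[OF sets.sigma_algebra_axioms _ _ that] by blast
 have sn: "sets n = sets m" "space n = space m" by (simp_all add: n_def)
 have fn: "finite_measure n" by (rule finite_measureI) (simp add: em sn)
 obtain D where D: "integrable m D" "!!x. 0 <= D x" "n = density m (%x. ennreal (D x))"
 proof (rule real_density[OF fin fn sn(1)])
  show "emeasure n A = 0" if "A : sets m" "emeasure m A = 0" for A
   using le[OF that(1)] that by (simp add: em measure_def)
 qed (rule that)
 show thesis
 proof
  show "integrable m (%x. D x - 1)" using D(1) by simp
  show "s A = (LINT x:A|m. D x - 1)" if A: "A : sets m" for A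
  proof -
   have "(LINT x:A|m. D x - 1) = (LINT x:A|m. D x) - (LINT x:A|m. 1)"
    by (intro set_integral_diff) (use integrable_mult_indicator[OF A D(1)]
      integrable_mult_indicator[OF A, of "%_. 1::real"] in \<open>simp_all add: set_integrable_def\<close>)
   also have "(LINT x:A|m. (1::real)) = measure m A" using A by (simp add: set_integral_const)
   also have "(LINT x:A|m. D x) = (LINT x|n. indicator A x)"
    unfolding D(3) set_lebesgue_integral_def using D(1,2) A by (subst integral_density) (auto simp: mult.commute)
   also have "... = s A + measure m A"
    using A sets.sets_into_space[OF A] em[OF A] nn[OF A] by (simp add: sn Int_absorb2 measure_def)
   finally show ?thesis by simp
  qed
 qed
qed

lemma sums_set_integral:
 fixes f :: "'a => 'b::{banach, second_countable_topology}"
 assumes F: "!!i::nat. F i : sets m" and disj: "disjoint_family F" and f: "integrable m f"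
 shows "(%i. LINT x:F i|m. f x) sums (LINT x:(\<Union>i. F i)|m. f x)"
proof -
 have fi: "set_integrable m A f" if "A : sets m" for A
  unfolding set_integrable_def using integrable_mult_indicator[OF that f] .
 have eq: "(\<Sum>i<n. LINT x:F i|m. f x) = (LINT x:(\<Union>i<n. F i)|m. f x)" for n
  using F disj fi by (subst set_integral_finite_Union) (auto simp: disjoint_family_on_def)
 have "(%n. LINT x:(\<Union>i<n. F i)|m. f x) \<longlonglongrightarrow> (LINT x:(\<Union>i. F i)|m. f x)"
  unfolding set_lebesgue_integral_def
 proof (rule integral_dominated_convergence[where w = "%x. norm (f x)"])
  show "AE x in m. (%n. indicat_real (\<Union>i<n. F i) x *\<^sub>R f x) \<longlonglongrightarrow> indicat_real (\<Union>i. F i) x *\<^sub>R f x"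
   by (intro AE_I2 tendsto_scaleR tendsto_const LIMSEQ_indicator_UN)
  have "(\<Union>i. F i) : sets m" "!!n. (\<Union>i<n. F i) : sets m" using F by auto
  then show "(%x. indicat_real (\<Union>i. F i) x *\<^sub>R f x) : borel_measurable m"
   "(%x. indicat_real (\<Union>i<n. F i) x *\<^sub>R f x) : borel_measurable m" for n
   using f by measurable
 qed (use f in \<open>auto simp: indicator_def\<close>)
 then show ?thesis by (simp add: sums_def eq)
qed

text \<open>Let \<open>h\<close> be the density of \<open>mu\<close> with respect to its variation.
  Averages of \<open>h\<close> lie in the unit disc, so \<open>cmod (h x) <= 1\<close> almost
  everywhere. By minimality the variation has at most the mass of \<open>cmod h\<close> times the
  variation, which forces equality almost everywhere.\<close>

lemma polar_exists:
 assumes mu: "complex_measure mu" and fin: "finite_measure (variation mu)"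
 shows "EX h. h : borel_measurable borel & (ALL x. cmod (h x) = 1) &
  (ALL A:sets borel. mu A = (LINT x:A|variation mu. h x))"
proof -
 let ?m = "variation mu"
 interpret finite_measure ?m by fact
 have le: "cmod (mu A) <= measure ?m A" for A
  using cmod_le_variation[OF mu, of A] by (simp add: emeasure_eq_measure)
 have sums: "(%i. mu (F i)) sums mu (\<Union>i. F i)" if "range F \<subseteq> sets ?m" "disjoint_family F" for F :: "nat => _"
  using that by (intro complex_measure_sums[OF mu]) auto
 obtain f where f: "integrable ?m f" "!!A. A : sets ?m ==> Re (mu A) = (LINT x:A|?m. f x)"
 proof (rule signed_density[OF fin])
  show "\<bar>Re (mu A)\<bar> <= measure ?m A" for A using abs_Re_le_cmod le order_trans by blast
 qed (use sums sums_Re in blast)+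
 obtain g where g: "integrable ?m g" "!!A. A : sets ?m ==> Im (mu A) = (LINT x:A|?m. g x)"
 proof (rule signed_density[OF fin])
  show "\<bar>Im (mu A)\<bar> <= measure ?m A" for A using abs_Im_le_cmod le order_trans by blast
 qed (use sums sums_Im in blast)+
 define h where "h x = Complex (f x) (g x)" for x
 have h_eq: "h = (%x. complex_of_real (f x) + \<i> * complex_of_real (g x))"
  by (simp add: h_def fun_eq_iff complex_eq_iff)
 have h: "integrable ?m h" unfolding h_eq using f g by simp
 have hA: "integrable ?m (%x. indicator A x *\<^sub>R h x)" if "A : sets borel" for A
  using integrable_mult_indicator[OF _ h] that by simp
 have muh: "mu A = (LINT x:A|?m. h x)" if A: "A : sets borel" for A
 proof -
  have "Re (LINT x:A|?m. h x) = (LINT x:A|?m. f x)" "Im (LINT x:A|?m. h x) = (LINT x:A|?m. g x)"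
   unfolding set_lebesgue_integral_def using integral_Re[OF hA[OF A]] integral_Im[OF hA[OF A]]
   by (simp_all add: h_def)
  then show ?thesis using f(2) g(2) A by (simp add: complex_eq_iff)
 qed
 have ae1: "AE x in ?m. h x : cball 0 1"
 proof (rule averaging_theorem[OF h])
  fix A assume A: "A : sets ?m" "0 < measure ?m A"
  then show "(1 / measure ?m A) *\<^sub>R (LINT x:A|?m. h x) : cball 0 1"
   using le[of A] muh[of A] by (simp add: dist_norm divide_simps)
 qed simp
 have "emeasure ?m UNIV <= emeasure (density ?m (%x. ennreal (cmod (h x)))) UNIV"
 proof (rule variation_le[OF mu])
  fix B :: "'a set" assume B: "B : sets borel"
  have "cmod (mu B) <= (LINT x|?m. cmod (indicator B x *\<^sub>R h x))"
   unfolding muh[OF B] set_lebesgue_integral_def by (rule integral_norm_bound)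
  then have "ennreal (cmod (mu B)) <= ennreal (LINT x|?m. cmod (indicator B x *\<^sub>R h x))"
   by (rule ennreal_leI)
  also have "... = (\<integral>\<^sup>+x. ennreal (cmod (indicator B x *\<^sub>R h x)) \<partial>?m)"
   by (rule nn_integral_eq_integral[OF integrable_norm[OF hA[OF B]], symmetric]) simp
  also have "... = emeasure (density ?m (%x. ennreal (cmod (h x)))) B"
   using B h by (subst emeasure_density) (auto intro!: nn_integral_cong split: split_indicator)
  finally show "ennreal (cmod (mu B)) <= emeasure (density ?m (%x. ennreal (cmod (h x)))) B" .
 qed simp
 also have "... = (\<integral>\<^sup>+x. ennreal (cmod (h x)) \<partial>?m)"
  using h by (subst emeasure_density) (auto intro!: nn_integral_cong)
 also have "... = ennreal (LINT x|?m. cmod (h x))"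
  using h by (subst nn_integral_eq_integral) auto
 finally have "measure ?m UNIV <= (LINT x|?m. cmod (h x))"
  by (simp add: emeasure_eq_measure)
 then have "(LINT x|?m. 1 - cmod (h x)) <= 0"
  using h by (subst Bochner_Integration.integral_diff) auto
 moreover have ae2: "AE x in ?m. 0 <= 1 - cmod (h x)" using ae1 by (simp add: dist_norm)
 then have "0 <= (LINT x|?m. 1 - cmod (h x))" by (rule integral_nonneg_AE)
 ultimately have "(LINT x|?m. 1 - cmod (h x)) = 0" by simp
 moreover have "integrable ?m (%x. 1 - cmod (h x))" using h by simp
 ultimately have ae: "AE x in ?m. 1 - cmod (h x) = 0"
  using integral_nonneg_eq_0_iff_AE[OF _ ae2] by blast
 \<comment> \<open>The polar density is required to have modulus 1 at every point, so
   \<open>h\<close> is corrected on the exceptional null set.\<close>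
 define h' where "h' x = (if cmod (h x) = 1 then h x else 1)" for x
 have hm [measurable]: "h : borel_measurable borel"
  using borel_measurable_integrable[OF h] by (simp cong: measurable_cong_sets)
 have h'm: "h' : borel_measurable borel" unfolding h'_def by measurable
 moreover have "cmod (h' x) = 1" for x by (simp add: h'_def)
 moreover have "mu A = (LINT x:A|?m. h' x)" if A: "A : sets borel" for A
  unfolding muh[OF A] set_lebesgue_integral_def
 proof (rule integral_cong_AE)
  note [measurable] = A h'm
  show "(%x. indicat_real A x *\<^sub>R h x) : borel_measurable ?m"
   "(%x. indicat_real A x *\<^sub>R h' x) : borel_measurable ?m"
   by measurable
  show "AE x in ?m. indicat_real A x *\<^sub>R h x = indicat_real A x *\<^sub>R h' x"
   using ae by eventually_elim (simp add: h'_def)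
 qed
 ultimately show ?thesis by blast
qed

lemma polar_density:
 assumes "complex_measure mu" "finite_measure (variation mu)"
 shows "polar_density mu : borel_measurable borel" "cmod (polar_density mu x) = 1"
  "A : sets borel ==> mu A = (LINT x:A|variation mu. polar_density mu x)"
 using someI_ex[OF polar_exists[OF assms]] unfolding polar_density_def by blast+

text \<open>The variation is at most \<open>m\<close>, hence has a density \<open>D\<close> with
  respect to \<open>m\<close>. Comparing the two representations of \<open>mu\<close> gives
  \<open>h = D * polar_density mu\<close> almost everywhere, and taking absolute values gives
  \<open>D = 1\<close>.\<close>

lemma density_variation:
 fixes m :: "'g::topological_space measure"
 assumes m: "sets m = sets borel" "finite_measure m"
  and h: "h : borel_measurable borel" "!!x. cmod (h x) = 1"
 defines "mu == %A. if A : sets borel then (LINT x:A|m. h x) else 0"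
 shows "complex_measure mu" "variation mu = m"
proof -
 interpret m: finite_measure m by fact
 have sp: "space m = UNIV" using sets_eq_imp_space_eq[OF m(1)] by simp
 have hm [measurable]: "h : borel_measurable m" using h(1) m(1) by (simp cong: measurable_cong_sets)
 have hint: "integrable m h" by (rule m.integrable_const_bound[of _ 1]) (auto simp: h(2))
 show cm: "complex_measure mu"
  unfolding complex_measure_def
 proof (intro conjI allI impI)
  fix F :: "nat => 'g set" assume F: "range F \<subseteq> sets borel & disjoint_family F"
  have "(%i. LINT x:F i|m. h x) sums (LINT x:(\<Union>i. F i)|m. h x)"
   using F m(1) hint by (intro sums_set_integral) auto
  then show "(%i. mu (F i)) sums mu (\<Union>i. F i)" using F by (simp add: mu_def image_subset_iff sets.countable_UN)
 qed (simp add: mu_def)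
 let ?v = "variation mu"
 have le: "emeasure ?v A <= emeasure m A" for A
 proof (rule variation_le[OF cm m(1)])
  fix B :: "'g set" assume B: "B : sets borel"
  have "cmod (mu B) <= (LINT x|m. cmod (indicator B x *\<^sub>R h x))"
   using B by (simp add: mu_def set_lebesgue_integral_def integral_norm_bound del: norm_scaleR)
  also have "... = (LINT x|m. indicator B x)" by (simp add: h(2))
  also have "... = measure m B" using B m(1) sp by simp
  finally show "ennreal (cmod (mu B)) <= emeasure m B" by (simp add: m.emeasure_eq_measure)
 qed
 have fin: "finite_measure ?v"
 proof (rule finite_measureI)
  show "emeasure ?v (space ?v) ~= \<infinity>" using le[of UNIV] m.emeasure_finite[of UNIV] by (auto simp: top_unique)
 qed
 note pol = polar_density[OF cm fin]
 obtain D where D: "integrable m D" "!!x. 0 <= D x" "?v = density m (%x. ennreal (D x))"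
 proof (rule real_density[OF m(2) fin])
  show "emeasure ?v A = 0" if "emeasure m A = 0" for A using le[of A] that by simp
 qed (use m(1) in auto)
 have [measurable]: "D : borel_measurable m" using D(1) by auto
 have pm [measurable]: "polar_density mu : borel_measurable m" using pol(1) m(1) by (simp cong: measurable_cong_sets)
 have "AE x in m. h x = D x *\<^sub>R polar_density mu x"
 proof (rule m.density_unique_banach[OF hint])
  show "integrable m (%x. D x *\<^sub>R polar_density mu x)"
   by (rule Bochner_Integration.integrable_bound[OF D(1)]) (auto simp: pol(2))
  fix A assume "A : sets m"
  then have A: "A : sets borel" using m(1) by simp
  have "(LINT x:A|m. h x) = mu A" using A by (simp add: mu_def)
  also have "... = (LINT x:A|?v. polar_density mu x)" using pol(3)[OF A] .
  also have "... = (LINT x|m. D x *\<^sub>R (indicator A x *\<^sub>R polar_density mu x))"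
   unfolding D(3) set_lebesgue_integral_def using A m(1) D(1,2) by (intro integral_density) auto
  also have "... = (LINT x:A|m. D x *\<^sub>R polar_density mu x)"
   unfolding set_lebesgue_integral_def by (simp add: mult_ac)
  finally show "(LINT x:A|m. h x) = (LINT x:A|m. D x *\<^sub>R polar_density mu x)" .
 qed
 then have "AE x in m. ennreal (D x) = 1"
 proof eventually_elim
  case (elim x)
  then have "cmod (h x) = D x * cmod (polar_density mu x)" by (simp add: D(2))
  then show ?case by (simp add: h(2) pol(2))
 qed
 then have "density m (%x. ennreal (D x)) = density m (%x. 1)" by (intro density_cong) auto
 then show "variation mu = m" by (simp add: D(3) density_1)
qed

section \<open>Radon measures and the algebra \<open>M(G, \<omega>)\<close>\<close>

text \<open>Inner and outer regularity in a single estimate. For finite measures this is the usual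
  regularity (\<open>regular_iff_radon\<close>), in a form that passes easily through complements
  and countable unions.\<close>

definition radon :: "'g::topological_space measure => bool" where
 "radon m \<longleftrightarrow> sets m = sets borel & finite_measure m &
  (ALL A:sets borel. ALL e>0. EX K U. compact K & open U & K \<subseteq> A & A \<subseteq> U & measure m (U - K) < e)"

lemma radon_sets: "radon m ==> sets m = sets borel"
 by (simp add: radon_def)

lemma radon_finite: "radon m ==> finite_measure m"
 by (simp add: radon_def)

lemma radon_space: "radon m ==> space m = UNIV"
 using sets_eq_imp_space_eq[of m borel] by (simp add: radon_def)

lemma radonD:
 assumes "radon m" "A : sets borel" "0 < e"
 obtains K U where "compact K" "open U" "K \<subseteq> A" "A \<subseteq> U" "measure m (U - K) < e"
 using assms unfolding radon_def by blast

text \<open>The sets with a two-sided approximation form a sigma-algebra, so it is enough that open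
  sets are approximated by compact sets from inside.\<close>

lemma radonI_open:
 fixes m :: "'g::t2_space measure"
 assumes m: "sets m = sets borel" "finite_measure m"
  and inner: "!!U e. open U ==> 0 < e ==> EX K. compact K & K \<subseteq> U & measure m (U - K) < e"
 shows "radon m"
proof -
 interpret finite_measure m by fact
 have bs: "A : sets m \<longleftrightarrow> A : sets borel" for A using m(1) by simp
 let ?P = "%A. ALL e>0. EX K U. compact K & open U & K \<subseteq> A & A \<subseteq> U & measure m (U - K) < e"
 have "?P A" if "A : sigma_sets UNIV {S. open S}" for A
  using that
 proof induction
  case (Basic U)
  then have U: "open U" by simp
  show ?case
  proof (intro allI impI)
   fix e :: real assume "0 < e"
   then obtain K where "compact K" "K \<subseteq> U" "measure m (U - K) < e" using inner[OF U] by blast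
   then show "EX K V. compact K & open V & K \<subseteq> U & U \<subseteq> V & measure m (V - K) < e"
    using U by (intro exI[of _ K] exI[of _ U]) auto
  qed
 next
  case Empty
  show ?case by (intro allI impI exI[of _ "{}"]) simp
 next
  case (Compl A)
  show ?case
  proof (intro allI impI)
   fix e :: real assume e: "0 < e"
   obtain K U where KU: "compact K" "open U" "K \<subseteq> A" "A \<subseteq> U" "measure m (U - K) < e / 2"
    using Compl.IH[rule_format, OF half_gt_zero[OF e]] by blast
   \<comment> \<open>The complement of an open set is closed but rarely compact; cutting with a
     compact \<open>L\<close> of almost full mass repairs this.\<close>
   obtain L where L: "compact L" "measure m (UNIV - L) < e / 2"
    using inner[OF open_UNIV half_gt_zero[OF e]] by blast
   note cl = compact_imp_closed[OF KU(1)] compact_imp_closed[OF L(1)]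
   have "measure m ((- K) - (L - U)) <= measure m ((U - K) Un (UNIV - L))"
    using cl KU(2) by (intro finite_measure_mono) (auto simp: bs)
   also have "... <= measure m (U - K) + measure m (UNIV - L)"
    using cl KU(2) by (intro measure_Un_le) (auto simp: bs)
   also have "... < e" using KU(5) L(2) by simp
   finally show "EX K U. compact K & open U & K \<subseteq> UNIV - A & UNIV - A \<subseteq> U & measure m (U - K) < e"
    using KU cl compact_diff[OF L(1) KU(2)]
    by (intro exI[of _ "L - U"] exI[of _ "- K"]) auto
  qed
 next
  case (Union A)
  show ?case
  proof (intro allI impI)
   fix e :: real assume e: "0 < e"
   \<comment> \<open>The errors add up to \<open>e / 2\<close>; the other half pays for replacing
     the infinite union of compact sets by a finite one, which alone is compact.\<close>
   have "EX K U. compact K & open U & K \<subseteq> A i & A i \<subseteq> U & measure m (U - K) < e / 4 * (1/2)^i" for i :: nat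
    by (rule Union.IH[rule_format]) (use e in simp)
   then obtain K U where KU: "!!i. compact (K i)" "!!i. open (U i)" "!!i. K i \<subseteq> A i" "!!i. A i \<subseteq> U i"
    "!!i. measure m (U i - K i) < e / 4 * (1/2)^i" by metis
   have Ks: "K i : sets m" "U i : sets m" for i
    using borel_closed[OF compact_imp_closed[OF KU(1)]] borel_open[OF KU(2)] by (simp_all add: bs)
   have geo: "(%i. e / 4 * (1/2)^i) sums (e / 4 * 2)"
    using geometric_sums[of "1/2::real"] by (intro sums_mult) simp
   have sm: "summable (%i. measure m (U i - K i))"
    by (rule summable_comparison_test[OF _ sums_summable[OF geo]]) (use KU(5) in \<open>auto intro!: less_imp_le\<close>)
   have "measure m (\<Union>i. U i - K i) <= (\<Sum>i. measure m (U i - K i))"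
    using Ks sm by (intro finite_measure_subadditive_countably) auto
   also have "... <= e / 4 * 2"
    unfolding sums_unique[OF geo] using sm sums_summable[OF geo] KU(5) by (intro suminf_le) (auto intro: less_imp_le)
   finally have 1: "measure m (\<Union>i. U i - K i) <= e / 2" by simp
   let ?K = "%n. \<Union>i<n. K i"
   have "(%n. measure m (?K n)) \<longlonglongrightarrow> measure m (\<Union>n. ?K n)"
    using Ks by (intro finite_Lim_measure_incseq) (auto simp: incseq_def intro: less_le_trans)
   then have "eventually (%n. dist (measure m (?K n)) (measure m (\<Union>n. ?K n)) < e / 2) sequentially"
    using e by (intro tendstoD) auto
   then obtain n where n: "dist (measure m (?K n)) (measure m (\<Union>n. ?K n)) < e / 2"
    by (auto simp: eventually_sequentially)
   have Kn: "?K n : sets m" "(\<Union>n. ?K n) : sets m" using Ks by auto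
   have "measure m ((\<Union>n. ?K n) - ?K n) = measure m (\<Union>n. ?K n) - measure m (?K n)"
    using Kn by (intro finite_measure_Diff) auto
   then have 2: "measure m ((\<Union>n. ?K n) - ?K n) < e / 2" using n unfolding dist_real_def by linarith
   have "measure m ((\<Union>i. U i) - ?K n) <= measure m ((\<Union>i. U i - K i) Un ((\<Union>n. ?K n) - ?K n))"
   proof (rule finite_measure_mono)
    show "(\<Union>i. U i) - ?K n \<subseteq> (\<Union>i. U i - K i) Un ((\<Union>n. ?K n) - ?K n)" by blast
    show "(\<Union>i. U i - K i) Un ((\<Union>n. ?K n) - ?K n) : sets m" using Ks Kn by auto
   qed
   also have "... <= measure m (\<Union>i. U i - K i) + measure m ((\<Union>n. ?K n) - ?K n)"
    using Ks Kn by (intro measure_Un_le) auto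
   also have "... < e" using 1 2 by simp
   finally have "measure m ((\<Union>i. U i) - ?K n) < e" .
   moreover have "compact (?K n)" using KU(1) by (intro compact_UN) auto
   moreover have "?K n \<subseteq> (\<Union>i. A i)" "(\<Union>i. A i) \<subseteq> (\<Union>i. U i)" using KU(3,4) by blast+
   moreover have "open (\<Union>i. U i)" using KU(2) by auto
   ultimately show "EX K V. compact K & open V & K \<subseteq> (\<Union>i. A i) & (\<Union>i. A i) \<subseteq> V & measure m (V - K) < e"
    by blast
  qed
 qed
 then show ?thesis using m unfolding radon_def sets_borel by blast
qed

text \<open>Intersecting approximations of \<open>A\<close> with errors tending to 0 gives
  decreasing gaps \<open>W i\<close> whose intersection is null for \<open>m\<close>, hence for
  \<open>m'\<close>. Continuity from above makes the gaps small for \<open>m'\<close>.\<close>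

lemma radon_absolutely_continuous:
 fixes m m' :: "'g::t2_space measure"
 assumes m: "radon m" and m': "sets m' = sets borel" "finite_measure m'"
  and ac: "!!A. A : sets borel ==> emeasure m A = 0 ==> emeasure m' A = 0"
 shows "radon m'"
 unfolding radon_def
proof (intro conjI m' ballI allI impI)
 interpret m: finite_measure m using radon_finite[OF m] .
 interpret m': finite_measure m' by fact
 fix A :: "'g set" and e :: real assume A: "A : sets borel" and e: "0 < e"
 have "EX K U. compact K & open U & K \<subseteq> A & A \<subseteq> U & measure m (U - K) < inverse (real (Suc i))" for i
  using m A unfolding radon_def by simp
 then obtain K U where KU: "!!i. compact (K i)" "!!i. open (U i)" "!!i. K i \<subseteq> A" "!!i. A \<subseteq> U i"
  "!!i. measure m (U i - K i) < inverse (real (Suc i))" by metis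
 define W where "W i = (\<Inter>j\<in>{..i}. U j) - (\<Union>j\<in>{..i}. K j)" for i
 have W: "W i : sets borel" for i
  unfolding W_def using KU(2) compact_imp_closed[OF KU(1)] by (intro sets.Diff borel_open borel_closed) auto
 then have W_lim: "(\<Inter>i. W i) : sets borel" by auto
 have "(%i. measure m' (W i)) \<longlonglongrightarrow> measure m' (\<Inter>i. W i)"
  using W m'(1) by (intro m'.finite_Lim_measure_decseq) (auto simp: W_def decseq_def)
 moreover have "measure m (\<Inter>i. W i) <= inverse (real (Suc i))" for i
 proof -
  have "U i - K i : sets m" using KU(2) compact_imp_closed[OF KU(1)] radon_sets[OF m] by auto
  then have "measure m (\<Inter>i. W i) <= measure m (U i - K i)"
   by (intro m.finite_measure_mono) (auto simp: W_def)
  then show ?thesis using KU(5)[of i] by simp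
 qed
 then have "measure m (\<Inter>i. W i) <= 0" by (intro LIMSEQ_le_const[OF LIMSEQ_inverse_real_of_nat]) auto
 then have "measure m' (\<Inter>i. W i) = 0"
  using ac[OF W_lim] measure_nonneg[of m "\<Inter>i. W i"] by (simp add: m.emeasure_eq_measure m'.emeasure_eq_measure)
 ultimately have "eventually (%i. measure m' (W i) < e) sequentially"
  using e by (intro order_tendstoD(2)) auto
 then obtain i where i: "measure m' (W i) < e" by (auto simp: eventually_sequentially)
 show "EX K U. compact K & open U & K \<subseteq> A & A \<subseteq> U & measure m' (U - K) < e"
  by (rule exI[of _ "\<Union>j\<in>{..i}. K j"], rule exI[of _ "\<Inter>j\<in>{..i}. U j"])
   (use KU(1-3) subsetD[OF KU(4)] i in \<open>auto simp: W_def intro!: compact_UN\<close>)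
qed

lemma radon_add_le:
 fixes m n m' :: "'g::t2_space measure"
 assumes m: "radon m" and n: "radon n" and m': "sets m' = sets borel"
  and le: "!!A. A : sets borel ==> emeasure m' A <= emeasure m A + emeasure n A"
 shows "radon m'"
proof -
 interpret m: finite_measure m using radon_finite[OF m] .
 interpret n: finite_measure n using radon_finite[OF n] .
 have fin: "finite_measure m'"
 proof (rule finite_measureI)
  have "space m' = UNIV" using m' sets_eq_imp_space_eq by fastforce
  then show "emeasure m' (space m') ~= \<infinity>"
   using le[of UNIV] m.emeasure_finite[of UNIV] n.emeasure_finite[of UNIV] by (auto simp: top_unique)
 qed
 interpret m': finite_measure m' by fact
 have le': "measure m' A <= measure m A + measure n A" if "A : sets borel" for A
  using le[OF that] by (simp add: m.emeasure_eq_measure n.emeasure_eq_measure m'.emeasure_eq_measure flip: ennreal_plus)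
 show ?thesis
  unfolding radon_def
 proof (intro conjI m' fin ballI allI impI)
  fix A :: "'g set" and e :: real assume A: "A : sets borel" and e: "0 < e"
  obtain K U where KU: "compact K" "open U" "K \<subseteq> A" "A \<subseteq> U" "measure m (U - K) < e / 2"
   using radonD[OF m A half_gt_zero[OF e]] .
  obtain L V where LV: "compact L" "open V" "L \<subseteq> A" "A \<subseteq> V" "measure n (V - L) < e / 2"
   using radonD[OF n A half_gt_zero[OF e]] .
  note cl = compact_imp_closed[OF KU(1)] compact_imp_closed[OF LV(1)]
  have s: "U - K : sets borel" "V - L : sets borel" "(U Int V) - (K Un L) : sets borel" using cl KU LV by auto
  have "measure m' ((U Int V) - (K Un L)) <= measure m ((U Int V) - (K Un L)) + measure n ((U Int V) - (K Un L))"
   using le' s by blast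
  also have "... <= measure m (U - K) + measure n (V - L)"
   using s radon_sets[OF m] radon_sets[OF n] by (intro add_mono m.finite_measure_mono n.finite_measure_mono) auto
  also have "... < e" using KU LV by simp
  finally show "EX K U. compact K & open U & K \<subseteq> A & A \<subseteq> U & measure m' (U - K) < e"
   using KU LV by (intro exI[of _ "K Un L"] exI[of _ "U Int V"]) auto
 qed
qed

lemma radon_null: "radon (null_measure borel)"
 unfolding radon_def
proof (intro conjI ballI allI impI)
 fix A :: "'a set" and e :: real assume "0 < e"
 then show "EX K U. compact K & open U & K \<subseteq> A & A \<subseteq> U & measure (null_measure borel) (U - K) < e"
  by (intro exI[of _ "{}"] exI[of _ UNIV]) (simp add: measure_def)
qed (auto intro!: finite_measureI)

lemma radon_le:
 fixes m m' :: "'g::t2_space measure"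
 assumes "radon m" "sets m' = sets borel" "!!A. A : sets borel ==> emeasure m' A <= emeasure m A"
 shows "radon m'"
 using radon_add_le[OF assms(1) radon_null assms(2)] assms(3) by simp

lemma radon_density:
 fixes m :: "'g::t2_space measure"
 assumes m: "radon m" and f: "integrable m f" "!!x. 0 <= f x"
 shows "radon (density m (%x. ennreal (f x)))"
proof (rule radon_absolutely_continuous[OF m])
 let ?n = "density m (%x. ennreal (f x))"
 have s: "sets m = sets borel" using radon_sets[OF m] .
 then show "sets ?n = sets borel" by simp
 have fm: "(%x. ennreal (f x)) : borel_measurable m" using f by auto
 have "emeasure ?n (space ?n) = (\<integral>\<^sup>+x. ennreal (f x) \<partial>m)"
  using fm by (subst emeasure_density) (auto intro!: nn_integral_cong)
 then show "finite_measure ?n"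
  by (intro finite_measureI) (simp add: nn_integral_eq_integral f)
 show "emeasure ?n A = 0" if "A : sets borel" "emeasure m A = 0" for A
  using absolutely_continuousI_density[OF fm] that s by (auto simp: absolutely_continuous_def null_sets_def)
qed

lemma regular_iff_radon:
 fixes mu :: "('g::t2_space) cmeasure"
 assumes mu: "complex_measure mu" and fin: "finite_measure (variation mu)"
 shows "mu : regular_measures \<longleftrightarrow> radon (variation mu)"
proof -
 let ?m = "variation mu"
 interpret finite_measure ?m by fact
 have cs: "K : sets borel" if "compact K" for K :: "'g set" using compact_imp_closed[OF that] by auto
 show ?thesis
 proof
  assume r: "mu : regular_measures"
  show "radon ?m"
   unfolding radon_def
  proof (intro conjI fin sets_variation ballI allI impI)
   fix A :: "'g set" and e :: real assume A: "A : sets borel" and e: "0 < e"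
   have I: "emeasure ?m A = (INF U\<in>{U. open U & A \<subseteq> U}. emeasure ?m U)"
    and S: "emeasure ?m A = (SUP K\<in>{K. compact K & K \<subseteq> A}. emeasure ?m K)"
    using r A unfolding regular_measures_def by blast+
   have "(INF U\<in>{U. open U & A \<subseteq> U}. emeasure ?m U) < ennreal (measure ?m A + e / 2)"
    unfolding I[symmetric] using e by (simp add: emeasure_eq_measure ennreal_less_iff)
   then obtain U where U: "open U" "A \<subseteq> U" "emeasure ?m U < ennreal (measure ?m A + e / 2)"
    by (auto simp: INF_less_iff)
   have K: "EX K. compact K & K \<subseteq> A & measure ?m A - e / 2 < measure ?m K"
   proof (cases "measure ?m A - e / 2 < 0")
    case True
    then show ?thesis by (intro exI[of _ "{}"]) simp
   next
    case False
    have "ennreal (measure ?m A - e / 2) < (SUP K\<in>{K. compact K & K \<subseteq> A}. emeasure ?m K)"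
     unfolding S[symmetric] using e False by (simp add: emeasure_eq_measure ennreal_less_iff)
    then show ?thesis
     using False by (auto simp: less_SUP_iff emeasure_eq_measure ennreal_less_iff)
   qed
   then obtain K where K: "compact K" "K \<subseteq> A" "measure ?m A - e / 2 < measure ?m K" by blast
   have "measure ?m (U - K) = measure ?m U - measure ?m K"
    using K U cs[OF K(1)] by (intro finite_measure_Diff) auto
   also have "... < e"
   proof -
    have "measure ?m U < measure ?m A + e / 2"
     using U(3) by (simp add: emeasure_eq_measure ennreal_less_iff del: ennreal_plus)
    then show ?thesis using K(3) by simp
   qed
   finally show "EX K U. compact K & open U & K \<subseteq> A & A \<subseteq> U & measure ?m (U - K) < e"
    using K U by blast
  qed
 next
  assume r: "radon ?m"
  have "emeasure ?m A = (INF U\<in>{U. open U & A \<subseteq> U}. emeasure ?m U)"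
   "emeasure ?m A = (SUP K\<in>{K. compact K & K \<subseteq> A}. emeasure ?m K)" if A: "A : sets borel" for A
  proof -
   have e: "EX K U. compact K & open U & K \<subseteq> A & A \<subseteq> U & emeasure ?m A <= emeasure ?m K + ennreal e &
     emeasure ?m U <= emeasure ?m A + ennreal e" if e: "0 < e" for e
   proof -
    obtain K U where KU: "compact K" "open U" "K \<subseteq> A" "A \<subseteq> U" "measure ?m (U - K) < e"
     using radonD[OF r A e] .
    have "measure ?m (U - K) = measure ?m U - measure ?m K"
     using KU cs[OF KU(1)] by (intro finite_measure_Diff) auto
    moreover have "measure ?m K <= measure ?m A" "measure ?m A <= measure ?m U"
     using KU A by (auto intro!: finite_measure_mono)
    ultimately have "measure ?m A <= measure ?m K + e" "measure ?m U <= measure ?m A + e"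
     using KU(5) by auto
    then show ?thesis
     using KU e by (intro exI[of _ K] exI[of _ U]) (simp add: emeasure_eq_measure flip: ennreal_plus)
   qed
   show "emeasure ?m A = (INF U\<in>{U. open U & A \<subseteq> U}. emeasure ?m U)"
   proof (rule antisym)
    show "(INF U\<in>{U. open U & A \<subseteq> U}. emeasure ?m U) <= emeasure ?m A"
    proof (rule ennreal_le_epsilon)
     fix e :: real assume "0 < e"
     then obtain U where "open U" "A \<subseteq> U" "emeasure ?m U <= emeasure ?m A + ennreal e" using e by blast
     then show "(INF U\<in>{U. open U & A \<subseteq> U}. emeasure ?m U) <= emeasure ?m A + ennreal e"
      by (auto intro: INF_lower2)
    qed
   qed (auto intro!: INF_greatest emeasure_mono)
   show "emeasure ?m A = (SUP K\<in>{K. compact K & K \<subseteq> A}. emeasure ?m K)"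
   proof (rule antisym)
    show "emeasure ?m A <= (SUP K\<in>{K. compact K & K \<subseteq> A}. emeasure ?m K)"
    proof (rule ennreal_le_epsilon)
     fix e :: real assume "0 < e"
     then obtain K where K: "compact K" "K \<subseteq> A" "emeasure ?m A <= emeasure ?m K + ennreal e" using e by blast
     then have "emeasure ?m K <= (SUP K\<in>{K. compact K & K \<subseteq> A}. emeasure ?m K)" by (intro SUP_upper) auto
     with K(3) show "emeasure ?m A <= (SUP K\<in>{K. compact K & K \<subseteq> A}. emeasure ?m K) + ennreal e"
      by (meson add_right_mono order_trans)
    qed
   qed (use A in \<open>auto intro!: SUP_least emeasure_mono\<close>)
  qed
  then show "mu : regular_measures" unfolding regular_measures_def using mu by blast
 qed
qed

abbreviation (input) malg :: "('g::{topological_group_add,t2_space} => real) => 'g cmeasure nspace" where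
 "malg == weighted_measure_algebra"

lemma radon_mult_le:
 fixes m m' :: "'g::t2_space measure"
 assumes m: "radon m" and m': "sets m' = sets borel" and c: "0 <= c"
  and le: "!!A. A : sets borel ==> emeasure m' A <= ennreal c * emeasure m A"
 shows "radon m'"
proof (rule radon_absolutely_continuous[OF m m'])
 interpret m: finite_measure m using radon_finite[OF m] .
 show fin: "finite_measure m'"
 proof (rule finite_measureI)
  have "space m' = UNIV" using m' sets_eq_imp_space_eq by fastforce
  then show "emeasure m' (space m') ~= \<infinity>"
   using le[of UNIV] by (auto simp: top_unique m.emeasure_eq_measure simp flip: ennreal_mult'')
 qed
 show "emeasure m' A = 0" if "A : sets borel" "emeasure m A = 0" for A using le[OF that(1)] that(2) by simp
qed

text \<open>Turns a comparison of measures set by set into one of integrals. With the weight as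
  integrand it gives the norm estimates for sums, multiples and convolutions.\<close>

lemma nn_integral_le_combination:
 fixes m m1 m2 :: "'a measure"
 assumes s: "sets m1 = sets m" "sets m2 = sets m"
  and le: "!!A. A : sets m ==> emeasure m A <= c1 * emeasure m1 A + c2 * emeasure m2 A"
  and f: "f : borel_measurable m"
 shows "(\<integral>\<^sup>+x. f x \<partial>m) <= c1 * (\<integral>\<^sup>+x. f x \<partial>m1) + c2 * (\<integral>\<^sup>+x. f x \<partial>m2)"
 using f
proof (induction rule: borel_measurable_induct)
 case (cong f g)
 moreover have sp: "space m1 = space m" "space m2 = space m" using s sets_eq_imp_space_eq by blast+
 moreover have "(\<integral>\<^sup>+x. f x \<partial>n) = (\<integral>\<^sup>+x. g x \<partial>n)" if "space n = space m" for n :: "'a measure"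
  using cong(3) that by (intro nn_integral_cong) simp
 ultimately show ?case using cong by simp
next
 case (set A)
 then show ?case using le s by simp
next
 case (mult f c)
 note [measurable_cong] = s
 have "c * (\<integral>\<^sup>+x. f x \<partial>m) <= c * (c1 * (\<integral>\<^sup>+x. f x \<partial>m1) + c2 * (\<integral>\<^sup>+x. f x \<partial>m2))"
  using mult.IH by (rule mult_left_mono) simp
 then show ?case using mult.hyps by (simp add: nn_integral_cmult s cong: measurable_cong_sets) (simp add: algebra_simps)
next
 case (add f g)
 note [measurable_cong] = s
 have "(\<integral>\<^sup>+x. g x \<partial>m) + (\<integral>\<^sup>+x. f x \<partial>m) <= (c1 * (\<integral>\<^sup>+x. g x \<partial>m1) + c2 * (\<integral>\<^sup>+x. g x \<partial>m2)) + (c1 * (\<integral>\<^sup>+x. f x \<partial>m1) + c2 * (\<integral>\<^sup>+x. f x \<partial>m2))"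
  using add.IH by (intro add_mono) auto
 then show ?case using add.hyps by (simp add: nn_integral_add s cong: measurable_cong_sets) (simp add: algebra_simps)
next
 case (seq U)
 have U: "U i : borel_measurable m" "U i : borel_measurable m1" "U i : borel_measurable m2" for i
  using seq(1) s by (simp_all cong: measurable_cong_sets)
 have eq: "(\<integral>\<^sup>+x. (SUP i. U i) x \<partial>n) = (SUP i. \<integral>\<^sup>+x. U i x \<partial>n)" if "!!i. U i : borel_measurable n" for n
  using nn_integral_monotone_convergence_SUP[OF seq(3) that] by (simp add: image_comp)
 have "(\<integral>\<^sup>+x. U i x \<partial>m) <= c1 * (SUP i. \<integral>\<^sup>+x. U i x \<partial>m1) + c2 * (SUP i. \<integral>\<^sup>+x. U i x \<partial>m2)" for i
  using seq.IH[of i] by (rule order_trans) (intro add_mono mult_left_mono SUP_upper, auto)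
 then show ?case unfolding eq[OF U(1)] eq[OF U(2)] eq[OF U(3)] by (rule SUP_least)
qed

lemma variation_add_le:
 assumes mu: "complex_measure mu" and nu: "complex_measure nu"
 shows "complex_measure (%A. mu A + nu A)"
  and "A : sets borel ==> emeasure (variation (%A. mu A + nu A)) A <= emeasure (variation mu) A + emeasure (variation nu) A"
proof -
 show c: "complex_measure (%A. mu A + nu A)"
  using mu nu by (auto simp: complex_measure_def intro!: sums_add)
 assume A: "A : sets borel"
 have "(\<Sum>i. ennreal (cmod (mu (F i) + nu (F i)))) <= total_var mu A + total_var nu A" if F: "F : borel_partitions A" for F
 proof -
  have "(\<Sum>i. ennreal (cmod (mu (F i) + nu (F i)))) <= (\<Sum>i. ennreal (cmod (mu (F i))) + ennreal (cmod (nu (F i))))"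
   by (intro suminf_le) (auto simp: norm_triangle_ineq simp flip: ennreal_plus)
  also have "... = (\<Sum>i. ennreal (cmod (mu (F i)))) + (\<Sum>i. ennreal (cmod (nu (F i))))"
   by (rule suminf_add[symmetric]) auto
  also have "... <= total_var mu A + total_var nu A"
   unfolding total_var_def using F by (intro add_mono SUP_upper)
  finally show ?thesis .
 qed
 then show "emeasure (variation (%A. mu A + nu A)) A <= emeasure (variation mu) A + emeasure (variation nu) A"
  using A by (simp add: emeasure_variation c mu nu) (simp add: total_var_def[of "%A. mu A + nu A"] SUP_least)
qed

lemma variation_smult_le:
 assumes mu: "complex_measure mu"
 shows "complex_measure (%A. c * mu A)"
  and "A : sets borel ==> emeasure (variation (%A. c * mu A)) A <= ennreal (cmod c) * emeasure (variation mu) A"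
proof -
 show cm: "complex_measure (%A. c * mu A)"
  using mu by (auto simp: complex_measure_def intro!: sums_mult)
 assume A: "A : sets borel"
 have "(\<Sum>i. ennreal (cmod (c * mu (F i)))) <= ennreal (cmod c) * total_var mu A" if F: "F : borel_partitions A" for F
 proof -
  have "(\<Sum>i. ennreal (cmod (c * mu (F i)))) = ennreal (cmod c) * (\<Sum>i. ennreal (cmod (mu (F i))))"
   by (simp add: norm_mult ennreal_mult)
  also have "... <= ennreal (cmod c) * total_var mu A"
   unfolding total_var_def using F by (intro mult_left_mono SUP_upper) auto
  finally show ?thesis .
 qed
 then show "emeasure (variation (%A. c * mu A)) A <= ennreal (cmod c) * emeasure (variation mu) A"
  using A by (simp add: emeasure_variation cm mu) (simp add: total_var_def[of "%A. c * mu A"] SUP_least)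
qed

section \<open>The weighted measures as a normed space\<close>

locale weighted_group =
 fixes om :: "'g::{topological_group_add,t2_space} => real"
 assumes w: "weight om"
begin

abbreviation "\<M> == carrier (malg om)"

abbreviation "\<N> == nrm (malg om)"

abbreviation "\<P> == carrier (M_star om)"

lemma weightD:
 shows "1 <= om x" "0 < om x" "om 0 = 1" "om (x + y) <= om x * om y" "om : borel_measurable borel"
proof -
 show "1 <= om x" using w by (simp add: weight_def)
 then show "0 < om x" by linarith
qed (use w in \<open>auto simp: weight_def intro: borel_measurable_continuous_onI\<close>)

text \<open>With \<open>mu = h d|mu|\<close> the weighted measure is \<open>h\<close> times the
  positive measure with density \<open>om\<close>, and \<open>h\<close> is still unimodular, so
  \<open>density_variation\<close> reads off its variation. Finiteness of \<open>|mu|\<close>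
  follows from \<open>om >= 1\<close>.\<close>

lemma weighted_variation:
 assumes mu: "complex_measure mu" and int: "integrable (variation mu) om"
 shows "finite_measure (variation mu)" "complex_measure (weighted om mu)"
  "variation (weighted om mu) = density (variation mu) (%x. ennreal (om x))"
  "measure (variation (weighted om mu)) UNIV = (LINT x|variation mu. om x)"
proof -
 let ?m = "variation mu" and ?n = "density (variation mu) (%x. ennreal (om x))"
 have wp: "0 <= om x" for x using weightD(2) less_imp_le by blast
 have nn: "(\<integral>\<^sup>+x. ennreal (om x) \<partial>?m) = ennreal (LINT x|?m. om x)"
  by (rule nn_integral_eq_integral[OF int]) (simp add: wp)
 show fin: "finite_measure ?m"
 proof (rule finite_measureI)
  have "emeasure ?m UNIV = (\<integral>\<^sup>+x. 1 \<partial>?m)" by simp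
  also have "... <= (\<integral>\<^sup>+x. ennreal (om x) \<partial>?m)" by (intro nn_integral_mono) (simp add: weightD(1))
  finally show "emeasure ?m (space ?m) ~= \<infinity>" using nn by (auto simp: top_unique)
 qed
 note pol = polar_density[OF mu fin]
 have [measurable]: "om : borel_measurable borel" "polar_density mu : borel_measurable borel"
  using weightD(5) pol(1) by auto
 have nU: "emeasure ?n UNIV = ennreal (LINT x|?m. om x)"
  using nn by (subst emeasure_density) auto
 have sn: "sets ?n = sets borel" and fn: "finite_measure ?n"
  using nU by (auto intro!: finite_measureI)
 have eq: "weighted om mu = (%A. if A : sets borel then (LINT x:A|?n. polar_density mu x) else 0)"
 proof
  fix A
  have "cintegral mu (%x. indicator A x * complex_of_real (om x)) = (LINT x:A|?n. polar_density mu x)" if "A : sets borel"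
  proof -
   have "(LINT x:A|?n. polar_density mu x) = (LINT x|?m. om x *\<^sub>R (indicator A x *\<^sub>R polar_density mu x))"
    unfolding set_lebesgue_integral_def using that wp by (intro integral_density) auto
   also have "... = cintegral mu (%x. indicator A x * complex_of_real (om x))"
    unfolding cintegral_def by (intro Bochner_Integration.integral_cong) (auto simp: indicator_def scaleR_conv_of_real)
   finally show ?thesis by simp
  qed
  then show "weighted om mu A = (if A : sets borel then (LINT x:A|?n. polar_density mu x) else 0)"
   by (simp add: weighted_def)
 qed
 show "complex_measure (weighted om mu)" and v: "variation (weighted om mu) = ?n"
  unfolding eq using density_variation[OF sn fn pol(1,2)] by auto
 show "measure (variation (weighted om mu)) UNIV = (LINT x|?m. om x)"
  unfolding v measure_def nU using integral_nonneg_AE[of om ?m] wp by simp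
qed

text \<open>A Radon measure times an integrable density is again Radon, and by
  \<open>weighted_variation\<close> the weighted variation has this form. Membership thereby becomes
  a condition on \<open>variation mu\<close>.\<close>

lemma M_carrier_iff:
 "mu : \<M> \<longleftrightarrow>
  complex_measure mu & radon (variation mu) & integrable (variation mu) om"
proof
 assume "mu : \<M>"
 then have r: "mu : regular_measures" "integrable (variation mu) om" by (simp_all add: weighted_measure_algebra_def)
 then have "complex_measure mu" unfolding regular_measures_def by blast
 then show "complex_measure mu & radon (variation mu) & integrable (variation mu) om"
  using weighted_variation(1) regular_iff_radon[of mu] r by blast
next
 assume r: "complex_measure mu & radon (variation mu) & integrable (variation mu) om"
 then have m: "mu : regular_measures" using regular_iff_radon radon_finite by blast
 have "radon (variation (weighted om mu))"
  using r radon_density[of "variation mu" om] weighted_variation(3) weightD(2) less_imp_le by metis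
 then have "weighted om mu : regular_measures"
  using regular_iff_radon[of "weighted om mu"] weighted_variation(2) r radon_finite by blast
 then show "mu : \<M>"
  using m r by (simp add: weighted_measure_algebra_def)
qed

lemma M_simps:
 "\<zero>\<^bsub>weighted_measure_algebra om\<^esub> = (%A. 0)"
 "mu \<oplus>\<^bsub>weighted_measure_algebra om\<^esub> nu = (%A. mu A + nu A)"
 "c \<odot>\<^bsub>weighted_measure_algebra om\<^esub> mu = (%A. c * mu A)"
 "mu \<otimes>\<^bsub>weighted_measure_algebra om\<^esub> nu = conv mu nu"
 by (simp_all add: weighted_measure_algebra_def)

lemma M_carrierD:
 assumes "mu : \<M>"
 shows "complex_measure mu" "radon (variation mu)" "finite_measure (variation mu)" "integrable (variation mu) om"
 using assms radon_finite by (auto simp: M_carrier_iff)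

lemma M_nrm: "mu : \<M> ==> \<N> mu = (LINT x|variation mu. om x)"
 using weighted_variation(4)[OF M_carrierD(1,4)] by (simp add: weighted_measure_algebra_def)

lemma M_nrm_nn: "mu : \<M> ==> ennreal (\<N> mu) = (\<integral>\<^sup>+x. ennreal (om x) \<partial>variation mu)"
 using nn_integral_eq_integral[OF M_carrierD(4)] weightD(2) by (simp add: M_nrm less_imp_le)

lemma M_nrm_nonneg: "mu : \<M> ==> 0 <= \<N> mu"
 using integral_nonneg_AE[of om "variation mu"] weightD(2) by (auto simp: M_nrm intro: less_imp_le)

lemma M_variation_le_nrm:
 assumes mu: "mu : \<M>" shows "measure (variation mu) A <= \<N> mu"
proof -
 interpret finite_measure "variation mu" using M_carrierD(3)[OF mu] .
 have "measure (variation mu) A <= measure (variation mu) UNIV" using bounded_measure[of A] by simp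
 also have "... = (LINT x|variation mu. 1)" by simp
 also have "... <= \<N> mu"
  unfolding M_nrm[OF mu] using M_carrierD(4)[OF mu] weightD(1) by (intro integral_mono) auto
 finally show ?thesis .
qed

lemma cmod_le_measure:
 assumes mu: "mu : \<M>" shows "cmod (mu A) <= measure (variation mu) A"
proof -
 interpret finite_measure "variation mu" using M_carrierD(3)[OF mu] .
 show ?thesis using cmod_le_variation[OF M_carrierD(1)[OF mu], of A] by (simp add: emeasure_eq_measure)
qed

lemma M_combination:
 assumes m: "complex_measure ka" and mu: "mu : \<M>" and nu: "nu : \<M>" and c: "0 <= c" "0 <= d"
  and le: "!!A. A : sets borel ==>
   emeasure (variation ka) A <= ennreal c * emeasure (variation mu) A + ennreal d * emeasure (variation nu) A"
 shows "integrable (variation ka) om & (LINT x|variation ka. om x) <= c * \<N> mu + d * \<N> nu"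
proof -
 have wp: "0 <= om x" for x using weightD(2) less_imp_le by blast
 have "(\<integral>\<^sup>+x. ennreal (om x) \<partial>variation ka) <=
   ennreal c * (\<integral>\<^sup>+x. ennreal (om x) \<partial>variation mu) + ennreal d * (\<integral>\<^sup>+x. ennreal (om x) \<partial>variation nu)"
  using le weightD(5) by (intro nn_integral_le_combination) auto
 also have "... = ennreal (c * \<N> mu + d * \<N> nu)"
  using c M_nrm_nonneg[OF mu] M_nrm_nonneg[OF nu]
  by (simp add: M_nrm_nn[OF mu, symmetric] M_nrm_nn[OF nu, symmetric] ennreal_mult ennreal_plus)
 finally have b: "(\<integral>\<^sup>+x. ennreal (om x) \<partial>variation ka) <= ennreal (c * \<N> mu + d * \<N> nu)" .
 have i: "integrable (variation ka) om"
  using b weightD(5) wp by (intro integrableI_nonneg) (auto simp: less_top[symmetric] top_unique)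
 moreover have "ennreal (LINT x|variation ka. om x) <= ennreal (c * \<N> mu + d * \<N> nu)"
  using b nn_integral_eq_integral[OF i] wp by simp
 then have "(LINT x|variation ka. om x) <= c * \<N> mu + d * \<N> nu"
  using c M_nrm_nonneg[OF mu] M_nrm_nonneg[OF nu] by (subst (asm) ennreal_le_iff) auto
 ultimately show ?thesis by blast
qed

lemma M_add:
 assumes mu: "mu : \<M>" and nu: "nu : \<M>"
 shows "(%A. mu A + nu A) : \<M>" "\<N> (%A. mu A + nu A) <= \<N> mu + \<N> nu"
proof -
 note v = variation_add_le[OF M_carrierD(1)[OF mu] M_carrierD(1)[OF nu]]
 have "radon (variation (%A. mu A + nu A))"
  using radon_add_le[OF M_carrierD(2)[OF mu] M_carrierD(2)[OF nu]] v(2) by simp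
 moreover have c: "integrable (variation (%A. mu A + nu A)) om & (LINT x|variation (%A. mu A + nu A). om x) <= 1 * \<N> mu + 1 * \<N> nu"
  using v(2) by (intro M_combination[OF v(1) mu nu]) auto
 ultimately show cl: "(%A. mu A + nu A) : \<M>" using v(1) by (simp add: M_carrier_iff)
 show "\<N> (%A. mu A + nu A) <= \<N> mu + \<N> nu" using c by (simp add: M_nrm[OF cl])
qed

lemma M_smult:
 assumes mu: "mu : \<M>"
 shows "(%A. c * mu A) : \<M>" and "\<N> (%A. c * mu A) = cmod c * \<N> mu"
proof -
 have cl: "(%A. c * mu A) : \<M> & \<N> (%A. c * mu A) <= cmod c * \<N> mu"
  if mu: "mu : \<M>" for mu and c :: complex
 proof -
  note v = variation_smult_le[OF M_carrierD(1)[OF mu], where c = c]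
  have "radon (variation (%A. c * mu A))"
   using radon_mult_le[OF M_carrierD(2)[OF mu], of _ "cmod c"] v(2) by simp
  moreover have c: "integrable (variation (%A. c * mu A)) om & (LINT x|variation (%A. c * mu A). om x) <= cmod c * \<N> mu + 0 * \<N> mu"
   using v(2) by (intro M_combination[OF v(1) mu mu]) auto
  ultimately have cl: "(%A. c * mu A) : \<M>" using v(1) by (simp add: M_carrier_iff)
  then show ?thesis using c by (simp add: M_nrm[OF cl])
 qed
 show cl1: "(%A. c * mu A) : \<M>" using cl[OF mu] by blast
 show "\<N> (%A. c * mu A) = cmod c * \<N> mu"
 proof (cases "c = 0")
  case True
  then show ?thesis using cl[OF mu, of 0] M_nrm_nonneg[OF cl1] by simp
 next
  case False
  have "\<N> (%A. inverse c * (c * mu A)) <= cmod (inverse c) * \<N> (%A. c * mu A)"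
   using cl[OF cl1] by blast
  then have "cmod c * \<N> mu <= \<N> (%A. c * mu A)"
   using False mult_left_mono[of "\<N> mu" "cmod (inverse c) * \<N> (%A. c * mu A)" "cmod c"]
   by (simp add: norm_inverse flip: mult.assoc)
  then show ?thesis using cl[OF mu, of c] by simp
 qed
qed

lemma pointwise_M: "pointwise_space (malg om)"
proof -
 have "variation (%A::'g set. 0) = null_measure borel"
 proof (rule measure_eqI)
  fix A assume "A : sets (variation (%A::'g set. 0))"
  have c: "complex_measure (%A::'g set. 0)" by (simp add: complex_measure_def)
  show "emeasure (variation (%A::'g set. 0)) A = emeasure (null_measure borel) A"
   using variation_le[OF c, of "null_measure borel" A] by simp
 qed simp
 then have "(%A::'g set. 0) : \<M>"
  using weightD(5) by (simp add: M_carrier_iff radon_null complex_measure_def integrable_null_measure_iff)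
 then show ?thesis
  using M_add M_smult by (simp add: pointwise_space_def weighted_measure_algebra_def M_carrier_iff)
qed

lemma normed_M: "normed_space (malg om)"
proof -
 have "\<N> mu = 0 \<longleftrightarrow> mu = (%A. 0)" if mu: "mu : \<M>" for mu
 proof
  assume "\<N> mu = 0"
  then show "mu = (%A. 0)"
   using cmod_le_measure[OF mu] M_variation_le_nrm[OF mu] by (metis norm_le_zero_iff order_trans)
 next
  assume "mu = (%A. 0)" then show "\<N> mu = 0" using M_smult(2)[OF mu, of 0] by simp
 qed
 then show ?thesis
  unfolding normed_space_def using pointwise_module[OF pointwise_M] M_nrm_nonneg M_add(2) M_smult(2)
  by (simp add: M_simps)
qed

end

section \<open>Convolution\<close>

subsection \<open>Translates in a locally compact group\<close>

lemma continuous_on_plus_pair: "continuous_on S (%p. fst p + snd p :: 'g::topological_group_add)"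
 by (intro continuous_intros)

lemma compact_setsum:
 fixes S T :: "'g::topological_group_add set"
 assumes "compact S" "compact T" shows "compact {x + y | x y. x : S & y : T}"
proof -
 have "{x + y | x y. x : S & y : T} = (%p. fst p + snd p) ` (S \<times> T)" by force
 then show ?thesis
  using compact_continuous_image[OF continuous_on_plus_pair compact_Times[OF assms]] by simp
qed

lemma compact_uminus:
 fixes S :: "'g::topological_group_add set"
 assumes "compact S" shows "compact (uminus ` S)"
 by (intro compact_continuous_image assms continuous_intros)

lemma compact_translate:
 fixes S :: "'g::topological_group_add set"
 assumes "compact S" shows "compact ((+) a ` S)"
 by (intro compact_continuous_image assms continuous_intros)

lemma translate_vimage: "{y. x + y : A} = (+) x -` A" for x :: "'g::group_add"
 by auto

lemma plus_measurable: "(%y. x + y) : borel_measurable borel" for x :: "'g::topological_group_add"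
 by (intro borel_measurable_continuous_onI continuous_intros)

lemma translate_borel:
 fixes x :: "'g::topological_group_add"
 assumes "A : sets borel" shows "{y. x + y : A} : sets borel"
proof -
 from measurable_sets[OF plus_measurable assms, of x] show ?thesis by (simp add: translate_vimage)
qed

lemma uminus_translate: "{y. x + y : A} = (+) (- x) ` A" for x :: "'g::group_add"
proof -
 have "y : (+) (- x) ` A" if "x + y : A" for y
  using that by (intro image_eqI[of _ _ "x + y"]) (simp_all add: add.assoc[symmetric])
 then show ?thesis by (auto simp: add.assoc[symmetric])
qed

lemma compact_translate':
 fixes x :: "'g::topological_group_add"
 assumes "compact A" shows "compact {y. x + y : A}"
 unfolding uminus_translate by (rule compact_translate[OF assms])

lemma compact_nhd:
 fixes W :: "'g::t2_space set"
 assumes lc: "locally_compact_space (euclidean :: 'g topology)" and "open W" "x : W"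
 obtains V C where "open V" "compact C" "x : V" "V \<subseteq> C" "C \<subseteq> W"
proof -
 have "Hausdorff_space (euclidean :: 'g topology)"
  unfolding Hausdorff_space_def using hausdorff by (metis disjnt_def open_openin)
 then have "neighbourhood_base_of (compactin euclidean) (euclidean :: 'g topology)"
  using lc locally_compact_space_neighbourhood_base by blast
 then show thesis
  using that assms(2,3) unfolding neighbourhood_base_of by (metis compactin_euclidean_iff open_openin)
qed

lemma tube_translate:
 fixes x :: "'g::topological_group_add"
 assumes K: "compact K" and U: "open U" and KU: "K \<subseteq> {y. x + y : U}"
 obtains X where "x : X" "open X" "ALL z:X. ALL y:K. z + y : U"
proof -
 have W: "open ((%p. fst p + snd p :: 'g) -` U)" by (rule open_vimage[OF U continuous_on_plus_pair])
 have "{x} \<times> K \<subseteq> (%p. fst p + snd p) -` U" using KU by auto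
 then have "EX X. x : X & open X & X \<times> K \<subseteq> (%p. fst p + snd p) -` U"
  by (rule Elementary_Topology.tube_lemma[OF K W])
 then obtain X where X: "x : X" "open X" "X \<times> K \<subseteq> (%p. fst p + snd p) -` U" by blast
 show thesis
 proof (rule that[OF X(1,2)])
  show "ALL z:X. ALL y:K. z + y : U"
  proof (intro ballI)
  fix z y assume "z : X" "y : K"
  then have "(z, y) : (%p. fst p + snd p) -` U" using X(3) by blast
  then show "z + y : U" by simp
  qed
 qed
qed

subsection \<open>Convolution of positive Radon measures\<close>

text \<open>A compact subset of \<open>- x + U\<close> that carries almost all of its mass is, by
  the tube lemma, still contained in \<open>- z + U\<close> for \<open>z\<close> near
  \<open>x\<close>.\<close>

lemma measure_translate_lsc:
 fixes n :: "'g::{topological_group_add,t2_space} measure"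
 assumes n: "radon n" and U: "open U"
 shows "open {x. t < measure n {y. x + y : U}}"
proof (rule Topological_Spaces.openI)
 interpret finite_measure n using radon_finite[OF n] .
 fix x assume "x : {x. t < measure n {y. x + y : U}}"
 then have t: "t < measure n {y. x + y : U}" by simp
 have b: "{y. x + y : U} : sets borel" for x by (intro translate_borel borel_open U)
 obtain K V where K: "compact K" "open V" "K \<subseteq> {y. x + y : U}" "{y. x + y : U} \<subseteq> V" "measure n (V - K) < measure n {y. x + y : U} - t"
  using radonD[OF n b, of "measure n {y. x + y : U} - t"] t by auto
 have Ks: "K : sets n" "V : sets n" using compact_imp_closed[OF K(1)] K(2) radon_sets[OF n] by auto
 have "measure n {y. x + y : U} <= measure n V" using Ks K by (intro finite_measure_mono) auto
 moreover have "measure n (V - K) = measure n V - measure n K" using K Ks by (intro finite_measure_Diff) auto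
 ultimately have Kt: "t < measure n K" using K by simp
 obtain X where X: "x : X" "open X" "ALL z:X. ALL y:K. z + y : U"
  by (rule tube_translate[OF K(1) U K(3)]) blast
 have "X \<subseteq> {x. t < measure n {y. x + y : U}}"
 proof
  fix z assume "z : X"
  then have "K \<subseteq> {y. z + y : U}" using X(3) by auto
  then have "measure n K <= measure n {y. z + y : U}"
   using b[of z] radon_sets[OF n] by (intro finite_measure_mono) auto
  then show "z : {x. t < measure n {y. x + y : U}}" using Kt by simp
 qed
 then show "EX T. open T & x : T & T \<subseteq> {x. t < measure n {y. x + y : U}}" using X by blast
qed

text \<open>Lower semicontinuity settles open sets, and the sets with a measurable translation
  function form a Dynkin system. In this way the iterated integral of a convolution makes sense
  without a product sigma-algebra.\<close>

lemma measurable_measure_translate: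
 fixes n :: "'g::{topological_group_add,t2_space} measure"
 assumes n: "radon n" and A: "A : sets borel"
 shows "(%x. measure n {y. x + y : A}) : borel_measurable borel"
proof -
 interpret finite_measure n using radon_finite[OF n] .
 note ns = radon_sets[OF n] radon_space[OF n]
 have "Int_stable {S :: 'g set. open S}" "{S :: 'g set. open S} \<subseteq> Pow UNIV" "A : sigma_sets UNIV {S. open S}"
  using A by (auto simp: Int_stable_def sets_borel)
 then show ?thesis
 proof (induction rule: sigma_sets_induct_disjoint)
  case (basic A)
  then have "open {x. t < measure n {y. x + y : A}}" for t using measure_translate_lsc[OF n] by simp
  then show ?case by (intro borel_measurableI_greater) simp
 next
  case empty then show ?case by simp
 next
  case (compl A)
  have "measure n {y. x + y : UNIV - A} = measure n UNIV - measure n {y. x + y : A}" for x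
  proof -
   have "A : sets borel" using compl(1) by (simp only: sets_borel)
   then have "{y. x + y : A} : sets n" using ns by (simp add: translate_borel)
   then have "measure n (space n - {y. x + y : A}) = measure n (space n) - measure n {y. x + y : A}"
    by (rule finite_measure_compl)
   moreover have "space n - {y. x + y : A} = {y. x + y : UNIV - A}" using ns by auto
   ultimately show ?thesis using ns by simp
  qed
  then show ?case using compl(2) by simp
 next
  case (union F)
  have "(%i. measure n {y. x + y : F i}) sums measure n {y. x + y : (\<Union>i. F i)}" for x
  proof -
   have "range (%i. {y. x + y : F i}) \<subseteq> sets n"
    using union(2) ns unfolding sets_borel[symmetric] by (auto intro!: translate_borel)
   moreover have "disjoint_family (%i. {y. x + y : F i})"
    using union(1) by (auto simp: disjoint_family_on_def)
   ultimately have "(%i. measure n {y. x + y : F i}) sums measure n (\<Union>i. {y. x + y : F i})"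
    by (rule finite_measure_UNION)
   moreover have "(\<Union>i. {y. x + y : F i}) = {y. x + y : (\<Union>i. F i)}" by auto
   ultimately show ?thesis by simp
  qed
  then have "(%x. measure n {y. x + y : (\<Union>i. F i)}) = (%x. \<Sum>i. measure n {y. x + y : F i})"
   by (auto simp: sums_iff)
  then show ?case using union(3) by simp
 qed
qed

text \<open>Convolution of positive measures. It dominates the variation of a complex convolution
  (\<open>variation_conv_le\<close>) and thus carries both its regularity and its norm
  estimate.\<close>

definition posconv :: "'g::topological_group_add measure => 'g measure => 'g measure" where
 "posconv m n = measure_of UNIV (sets borel) (%A. \<integral>\<^sup>+x. emeasure n {y. x + y : A} \<partial>m)"

lemma sets_posconv [simp, measurable_cong]: "sets (posconv m n) = sets borel"
 unfolding posconv_def using sets.sigma_sets_eq[of borel] by (simp add: sets_measure_of)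

lemma space_posconv [simp]: "space (posconv m n) = UNIV"
 by (simp add: posconv_def space_measure_of)

context
 fixes m n :: "'g::{topological_group_add,t2_space} measure"
 assumes m: "radon m" and n: "radon n"
begin

interpretation m: finite_measure m using radon_finite[OF m] .
interpretation n: finite_measure n using radon_finite[OF n] .

lemma emeasure_translate_measurable:
 assumes "A : sets borel" shows "(%x. emeasure n {y. x + y : A}) : borel_measurable borel"
 unfolding n.emeasure_eq_measure using measurable_measure_translate[OF n assms] by simp

lemma emeasure_posconv:
 assumes A: "A : sets borel"
 shows "emeasure (posconv m n) A = (\<integral>\<^sup>+x. emeasure n {y. x + y : A} \<partial>m)"
proof -
 have "countably_additive (sets borel) (%A. \<integral>\<^sup>+x. emeasure n {y. x + y : A} \<partial>m)"
 proof (rule countably_additiveI)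
  fix F :: "nat => 'g set" assume F: "range F \<subseteq> sets borel" "disjoint_family F"
  have "(\<Sum>i. emeasure n {y. x + y : F i}) = emeasure n {y. x + y : (\<Union>i. F i)}" for x
  proof -
   have "(\<Sum>i. emeasure n {y. x + y : F i}) = emeasure n (\<Union>i. {y. x + y : F i})"
    using F radon_sets[OF n] by (intro suminf_emeasure) (auto simp: disjoint_family_on_def intro!: translate_borel)
   also have "(\<Union>i. {y. x + y : F i}) = {y. x + y : (\<Union>i. F i)}" by auto
   finally show ?thesis .
  qed
  moreover have "(\<Sum>i. \<integral>\<^sup>+x. emeasure n {y. x + y : F i} \<partial>m) = (\<integral>\<^sup>+x. (\<Sum>i. emeasure n {y. x + y : F i}) \<partial>m)"
   using F emeasure_translate_measurable radon_sets[OF m]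
   by (intro nn_integral_suminf[symmetric]) (auto cong: measurable_cong_sets)
  ultimately show "(\<Sum>i. \<integral>\<^sup>+x. emeasure n {y. x + y : F i} \<partial>m) = (\<integral>\<^sup>+x. emeasure n {y. x + y : (\<Union>i. F i)} \<partial>m)"
   by simp
 qed
 moreover have "positive (sets borel) (%A. \<integral>\<^sup>+x. emeasure n {y. x + y : A} \<partial>m)"
  by (simp add: positive_def)
 ultimately show ?thesis
  unfolding posconv_def using sets.sigma_algebra_axioms[of borel]
  by (intro emeasure_measure_of_sigma A) auto
qed

lemma nn_integral_posconv:
 assumes f: "f : borel_measurable borel"
 shows "(%x. \<integral>\<^sup>+y. f (x + y) \<partial>n) : borel_measurable borel &
  (\<integral>\<^sup>+z. f z \<partial>posconv m n) = (\<integral>\<^sup>+x. (\<integral>\<^sup>+y. f (x + y) \<partial>n) \<partial>m)"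
 using f
proof (induction rule: borel_measurable_induct)
 case (cong f g)
 then have "f = g" by auto
 then show ?case using cong by simp
next
 case (set A)
 have "(\<integral>\<^sup>+y. indicator A (x + y) \<partial>n) = emeasure n {y. x + y : A}" for x
 proof -
  have "(%y. indicator A (x + y)) = (indicator {y. x + y : A} :: _ => ennreal)" by (auto simp: indicator_def)
  then show ?thesis using translate_borel[OF set, of x] radon_sets[OF n] by simp
 qed
 then show ?case using emeasure_translate_measurable[OF set] emeasure_posconv[OF set] set by simp
next
 case (mult f c)
 have tm: "(%y. f (x + y)) : borel_measurable n" for x
  using measurable_compose[OF plus_measurable mult.hyps(2)] radon_sets[OF n] by (simp cong: measurable_cong_sets)
 then show ?case
  using mult radon_sets[OF m] by (auto simp add: nn_integral_cmult borel_measurable_times cong: measurable_cong_sets)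
next
 case (add f g)
 have tm: "(%y. h (x + y)) : borel_measurable n" if "h : borel_measurable borel" for x and h :: "'g => ennreal"
  using measurable_compose[OF plus_measurable that] radon_sets[OF n] by (simp cong: measurable_cong_sets)
 show ?case
  using add radon_sets[OF m] by (auto simp add: nn_integral_add tm cong: measurable_cong_sets)
next
 case (seq U)
 have tm: "(%y. U i (x + y)) : borel_measurable n" for x i
  using measurable_compose[OF plus_measurable seq(1)] radon_sets[OF n] by (simp cong: measurable_cong_sets)
 have e1: "(\<integral>\<^sup>+y. (SUP i. U i) (x + y) \<partial>n) = (SUP i. \<integral>\<^sup>+y. U i (x + y) \<partial>n)" for x
 proof -
  have "incseq (%i y. U i (x + y))" using seq(3) by (auto simp: incseq_def le_fun_def)
  from nn_integral_monotone_convergence_SUP[OF this tm] show ?thesis by (simp add: image_comp)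
 qed
 have "(\<integral>\<^sup>+z. (SUP i. U i) z \<partial>posconv m n) = (SUP i. \<integral>\<^sup>+z. U i z \<partial>posconv m n)"
  using nn_integral_monotone_convergence_SUP[OF seq(3), of "posconv m n"] seq(1) by (simp add: image_comp cong: measurable_cong_sets)
 also have "... = (SUP i. \<integral>\<^sup>+x. (\<integral>\<^sup>+y. U i (x + y) \<partial>n) \<partial>m)" using seq.IH by simp
 also have "... = (\<integral>\<^sup>+x. (SUP i. \<integral>\<^sup>+y. U i (x + y) \<partial>n) \<partial>m)"
 proof (rule nn_integral_monotone_convergence_SUP[symmetric])
  show "incseq (%i x. \<integral>\<^sup>+y. U i (x + y) \<partial>n)"
   using seq(3) by (auto simp: incseq_def le_fun_def intro!: nn_integral_mono)
  show "(%x. \<integral>\<^sup>+y. U i (x + y) \<partial>n) : borel_measurable m" for i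
   using seq.IH[of i] radon_sets[OF m] by (simp cong: measurable_cong_sets)
 qed
 finally have e2: "(\<integral>\<^sup>+z. (SUP i. U i) z \<partial>posconv m n) = (\<integral>\<^sup>+x. (SUP i. \<integral>\<^sup>+y. U i (x + y) \<partial>n) \<partial>m)" .
 have "(%x. SUP i. \<integral>\<^sup>+y. U i (x + y) \<partial>n) : borel_measurable borel"
  using seq.IH by (intro borel_measurable_SUP) auto
 then show ?case unfolding e1 e2 by blast
qed

lemma posconv_UNIV: "emeasure (posconv m n) UNIV = ennreal (measure m UNIV * measure n UNIV)"
proof -
 have "emeasure (posconv m n) UNIV = emeasure n UNIV * emeasure m UNIV"
  using radon_space[OF m] by (simp add: emeasure_posconv)
 then show ?thesis
  by (simp add: n.emeasure_eq_measure m.emeasure_eq_measure ennreal_mult mult.commute)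
qed

end

lemma radon_inner:
 fixes m :: "'g::t2_space measure"
 assumes m: "radon m" and A: "A : sets borel" and e: "0 < e"
 obtains K where "compact K" "K \<subseteq> A" "measure m (A - K) < e"
proof -
 interpret finite_measure m using radon_finite[OF m] .
 obtain K U where K: "compact K" "open U" "K \<subseteq> A" "A \<subseteq> U" "measure m (U - K) < e" using radonD[OF m A e] .
 have "measure m (A - K) <= measure m (U - K)"
  using K compact_imp_closed[OF K(1)] radon_sets[OF m] by (intro finite_measure_mono) auto
 then show thesis using that K by auto
qed

text \<open>A compact set that almost exhausts \<open>- x + U\<close> also serves for nearby
  \<open>w\<close>, provided that \<open>- w + U\<close> has about the same measure. That measure is
  only lower semicontinuous in \<open>w\<close>, so the group is first cut into strips on which it
  varies by less than \<open>d\<close>, and each strip is replaced by a compact part; finitely many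
  local choices then suffice.\<close>

lemma radon_posconv:
 fixes m n :: "'g::{topological_group_add,t2_space} measure"
 assumes lc: "locally_compact_space (euclidean :: 'g topology)" and m: "radon m" and n: "radon n"
 shows "radon (posconv m n)"
proof (rule radonI_open)
 interpret m: finite_measure m using radon_finite[OF m] .
 interpret n: finite_measure n using radon_finite[OF n] .
 note ms = radon_sets[OF m] radon_space[OF m] and ns = radon_sets[OF n] radon_space[OF n]
 show "finite_measure (posconv m n)" by (rule finite_measureI) (simp add: posconv_UNIV[OF m n])
 then interpret c: finite_measure "posconv m n" .
 fix U :: "'g set" and e :: real assume U: "open U" and e: "0 < e"
 define T where "T = measure n UNIV"
 \<comment> \<open>Chosen so that the final error \<open>2 * d * measure m UNIV + T * d\<close>
   stays below \<open>e\<close>; the summand 1 makes the inequality strict and the denominator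
   positive.\<close>
 define d where "d = e / (2 * measure m UNIV + T + 1)"
 have T0: "0 <= T" by (simp add: T_def)
 have d0: "0 < d" using e T0 unfolding d_def by (intro divide_pos_pos add_nonneg_pos) auto
 define f where "f x = measure n {y. x + y : U}" for x
 have fm [measurable]: "f : borel_measurable borel"
  unfolding f_def using measurable_measure_translate[OF n] U by simp
 have f0: "0 <= f x" "f x <= T" for x
  unfolding f_def T_def using ns n.bounded_measure by auto
 obtain N where N: "T / d < real N" using reals_Archimedean2 by blast
 have N1: "1 <= N" using N T0 d0 by (cases N) (auto simp: divide_less_eq)
 \<comment> \<open>Since \<open>f <= T < N * d\<close>, the strips with \<open>k < N\<close> cover
   the whole group.\<close>
 define A where "A k = {x. real k * d <= f x & f x < (real k + 1) * d}" for k
 have Ab: "A k : sets borel" for k unfolding A_def by measurable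
 have "EX C. compact C & C \<subseteq> A k & measure m (A k - C) < d / real N" for k
  using radon_inner[OF m Ab[of k], of "d / real N"] d0 N1 by (metis divide_pos_pos of_nat_0_less_iff less_le_trans zero_less_one)
 then obtain C where C: "!!k. compact (C k)" "!!k. C k \<subseteq> A k" "!!k. measure m (A k - C k) < d / real N" by metis
 have L: "EX L. compact L & L \<subseteq> U & (ALL w:C k. measure n ({y. w + y : U} - {y. w + y : L}) <= 2 * d)" for k
 proof -
  have "EX V K. open V & x : V & compact K & K \<subseteq> U &
    (ALL w:V Int C k. measure n ({y. w + y : U} - {y. w + y : K}) <= 2 * d)" if x: "x : C k" for x
  proof -
   have b: "{y. x + y : U} : sets borel" for x by (intro translate_borel borel_open U)
   obtain K where K: "compact K" "K \<subseteq> {y. x + y : U}" "measure n ({y. x + y : U} - K) < d"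
    using radon_inner[OF n b d0] .
   obtain X where X: "x : X" "open X" "ALL z:X. ALL y:K. z + y : U"
    by (rule tube_translate[OF K(1) U K(2)]) blast
   obtain V Q where V: "open V" "compact Q" "x : V" "V \<subseteq> Q" "Q \<subseteq> X" using compact_nhd[OF lc X(2,1)] .
   let ?K = "{w + y | w y. w : Q & y : K}"
   have "measure n ({y. w + y : U} - {y. w + y : ?K}) <= 2 * d" if w: "w : V Int C k" for w
   proof -
    have Kn: "K : sets n" "{y. w + y : U} : sets n" "{y. x + y : U} : sets n"
     using compact_imp_closed[OF K(1)] b ns by auto
    have KU: "K \<subseteq> {y. w + y : U}" using w V(4,5) X(3) by auto
    have "K \<subseteq> {y. w + y : ?K}" using w V by auto
    then have "measure n ({y. w + y : U} - {y. w + y : ?K}) <= measure n ({y. w + y : U} - K)"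
     using Kn by (intro n.finite_measure_mono) auto
    also have "... = f w - measure n K"
     unfolding f_def using Kn KU by (intro n.finite_measure_Diff)
    also have "measure n ({y. x + y : U} - K) = f x - measure n K"
     unfolding f_def using Kn K by (intro n.finite_measure_Diff)
    then have "f w - measure n K < f w - f x + d" using K(3) by simp
    \<comment> \<open>Both \<open>w\<close> and \<open>x\<close> lie in strip \<open>k\<close>, so
      \<open>f w\<close> exceeds \<open>f x\<close> by less than \<open>d\<close>; the second
      \<open>d\<close> is the loss in the choice of \<open>K\<close>.\<close>
    also have "f w < (real k + 1) * d" "real k * d <= f x" using w x C(2)[of k] by (auto simp: A_def)
    then have "f w - f x + d <= 2 * d" by (simp add: algebra_simps)
    finally show ?thesis by simp
   qed
   moreover have "compact ?K" by (rule compact_setsum[OF V(2) K(1)])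
   moreover have "?K \<subseteq> U" using V(5) X(3) by auto
   ultimately show ?thesis using V(1,3) by blast
  qed
  then have "ALL x:C k. EX p. open (fst p) & x : fst p & compact (snd p) & snd p \<subseteq> U &
    (ALL w:fst p Int C k. measure n ({y. w + y : U} - {y. w + y : snd p}) <= 2 * d)"
   by (metis fst_conv snd_conv)
  from bchoice[OF this] obtain p where p: "ALL x:C k. open (fst (p x)) & x : fst (p x) & compact (snd (p x)) & snd (p x) \<subseteq> U &
    (ALL w:fst (p x) Int C k. measure n ({y. w + y : U} - {y. w + y : snd (p x)}) <= 2 * d)" ..
  define V K where "V x = fst (p x)" and "K x = snd (p x)" for x
  have VK: "open (V x)" "x : V x" "compact (K x)" "K x \<subseteq> U"
   "!!w. w : V x Int C k ==> measure n ({y. w + y : U} - {y. w + y : K x}) <= 2 * d" if "x : C k" for x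
   using p that by (auto simp: V_def K_def)
  have "\<exists>F\<subseteq>C k. finite F & C k \<subseteq> (\<Union>x\<in>F. V x)"
   by (rule compactE_image[OF C(1)[of k], of "C k" V]) (use VK(1,2) in auto)
  then obtain F where F: "F \<subseteq> C k" "finite F" "C k \<subseteq> (\<Union>x\<in>F. V x)" by blast
  have Kc: "compact (\<Union>x\<in>F. K x)" using F VK(3) by (intro compact_UN) auto
  have "measure n ({y. w + y : U} - {y. w + y : (\<Union>x\<in>F. K x)}) <= 2 * d" if w: "w : C k" for w
  proof -
   obtain x where x: "x : F" "w : V x" using F(3) w by blast
   have xC: "x : C k" using x F by blast
   have "measure n ({y. w + y : U} - {y. w + y : (\<Union>x\<in>F. K x)}) <= measure n ({y. w + y : U} - {y. w + y : K x})"
    using x U compact_imp_closed[OF VK(3)[OF xC]] ns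
    by (intro n.finite_measure_mono) (auto intro!: sets.Diff translate_borel)
   also have "... <= 2 * d" using VK(5)[OF xC, of w] x(2) w by blast
   finally show ?thesis .
  qed
  then show ?thesis using Kc F(1) VK(4) by (intro exI[of _ "\<Union>x\<in>F. K x"]) blast
 qed
 then obtain L where L: "!!k. compact (L k)" "!!k. L k \<subseteq> U"
  "!!k w. w : C k ==> measure n ({y. w + y : U} - {y. w + y : L k}) <= 2 * d" by metis
 define LL where "LL = (\<Union>k<N. L k)"
 have LLc: "compact LL" unfolding LL_def using L(1) by (intro compact_UN) auto
 have LLs: "LL : sets borel" "U - LL : sets borel" using compact_imp_closed[OF LLc] U by auto
 define B where "B = (\<Union>k<N. A k - C k)"
 have Cb: "C k : sets borel" for k using compact_imp_closed[OF C(1)] by auto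
 have Bs: "B : sets m" unfolding B_def using Ab Cb ms by auto
 have mB: "measure m B <= d"
 proof -
  have "measure m B <= (\<Sum>k<N. measure m (A k - C k))"
   unfolding B_def using Ab Cb ms by (intro measure_UNION_le) auto
  also have "... <= (\<Sum>k<N. d / real N)" using C(3) by (intro sum_mono less_imp_le)
  also have "... = d" using N1 by simp
  finally show ?thesis .
 qed
 \<comment> \<open>The set \<open>B\<close> collects the points lost when strips were replaced by
   compact sets. There only the trivial bound \<open>T\<close> holds, but
   \<open>measure m B <= d\<close>.\<close>
 have pt: "measure n {y. x + y : U - LL} <= 2 * d + T * indicator B x" for x
 proof (cases "x : B")
  case True
  then show ?thesis using d0 n.bounded_measure[of "{y. x + y : U - LL}"] ns by (simp add: T_def)
 next
  case False
  define k where "k = nat \<lfloor>f x / d\<rfloor>"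
  have "0 <= f x / d" using f0 d0 by simp
  then have k: "real k <= f x / d" "f x / d < real k + 1" unfolding k_def by linarith+
  then have xA: "x : A k" using d0 by (simp add: A_def field_simps)
  have "f x / d <= T / d" using f0 d0 by (intro divide_right_mono) auto
  then have kN: "k < N" using k(1) N by linarith
  then have "x : C k" using False xA by (auto simp: B_def)
  have "measure n {y. x + y : U - LL} <= measure n ({y. x + y : U} - {y. x + y : L k})"
   using kN U compact_imp_closed[OF L(1)] ns
   by (intro n.finite_measure_mono) (auto simp: LL_def intro!: sets.Diff translate_borel)
  also have "... <= 2 * d" using L(3)[OF \<open>x : C k\<close>] .
  finally show ?thesis using False by simp
 qed
 have "emeasure (posconv m n) (U - LL) = (\<integral>\<^sup>+x. ennreal (measure n {y. x + y : U - LL}) \<partial>m)"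
  unfolding emeasure_posconv[OF m n LLs(2)] by (simp add: n.emeasure_eq_measure)
 also have "... <= (\<integral>\<^sup>+x. ennreal (2 * d) + ennreal T * indicator B x \<partial>m)"
 proof (rule nn_integral_mono)
  fix x
  have "ennreal (measure n {y. x + y : U - LL}) <= ennreal (2 * d + T * indicator B x)" using pt by (rule ennreal_leI)
  also have "... = ennreal (2 * d) + ennreal T * indicator B x"
   using d0 T0 by (cases "x : B") auto
  finally show "ennreal (measure n {y. x + y : U - LL}) <= ennreal (2 * d) + ennreal T * indicator B x" .
 qed
 also have "... = ennreal (2 * d * measure m UNIV + T * measure m B)"
  using Bs d0 T0 ms by (simp add: nn_integral_add nn_integral_cmult m.emeasure_eq_measure ennreal_mult ennreal_plus)
 finally have "measure (posconv m n) (U - LL) <= 2 * d * measure m UNIV + T * measure m B"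
  unfolding c.emeasure_eq_measure using d0 T0 by (subst (asm) ennreal_le_iff) auto
 also have "... <= 2 * d * measure m UNIV + T * d" using mB T0 by (intro add_left_mono mult_left_mono) auto
 also have "... < d * (2 * measure m UNIV + T + 1)" using d0 by (simp add: algebra_simps)
 also have "... = e"
 proof -
  have "0 < 2 * measure m UNIV + T + 1" using T0 by (intro add_nonneg_pos add_nonneg_nonneg) auto
  then show ?thesis by (simp add: d_def)
 qed
 finally have "measure (posconv m n) (U - LL) < e" .
 moreover have "LL \<subseteq> U" using L(2) by (auto simp: LL_def)
 ultimately show "EX K. compact K & K \<subseteq> U & measure (posconv m n) (U - K) < e" using LLc by blast
qed simp

subsection \<open>Convolution of complex measures\<close>

context weighted_group
begin

lemma cintegral_props:
 assumes mu: "mu : \<M>"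
 shows polar_measurable: "polar_density mu : borel_measurable borel"
  and cmod_polar: "cmod (polar_density mu x) = 1"
  and cmod_cintegral: "cmod (cintegral mu f) <= (LINT x|variation mu. cmod (f x))"
proof -
 note pol = polar_density[OF M_carrierD(1,3)[OF mu]]
 show "polar_density mu : borel_measurable borel" "cmod (polar_density mu x) = 1" using pol by auto
 show "cmod (cintegral mu f) <= (LINT x|variation mu. cmod (f x))"
  unfolding cintegral_def
  using integral_norm_bound[of "variation mu" "%x. f x * polar_density mu x"] by (simp add: norm_mult pol(2))
qed

lemma cintegral_integrable:
 assumes mu: "mu : \<M>" and f: "f : borel_measurable borel" "!!x. cmod (f x) <= B"
 shows "integrable (variation mu) (%x. f x * polar_density mu x)"
proof -
 interpret finite_measure "variation mu" using M_carrierD(3)[OF mu] .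
 have [measurable]: "f : borel_measurable borel" "polar_density mu : borel_measurable borel"
  using f(1) polar_measurable[OF mu] by auto
 show ?thesis
  by (rule integrable_const_bound[of _ B]) (auto simp: norm_mult cmod_polar[OF mu] f(2))
qed

lemma cintegral_add:
 assumes mu: "mu : \<M>" and f: "f : borel_measurable borel" "!!x. cmod (f x) <= B"
  and g: "g : borel_measurable borel" "!!x. cmod (g x) <= C"
 shows "cintegral mu (%x. f x + g x) = cintegral mu f + cintegral mu g"
 unfolding cintegral_def using cintegral_integrable[OF mu f] cintegral_integrable[OF mu g]
 by (simp add: distrib_right)

lemma cintegral_mult: "cintegral mu (%x. c * f x) = c * cintegral mu f"
 unfolding cintegral_def by (simp add: mult.assoc)

lemma cintegral_indicator:
 assumes mu: "mu : \<M>" and A: "A : sets borel"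
 shows "cintegral mu (indicator A) = mu A"
proof -
 have "mu A = (LINT x:A|variation mu. polar_density mu x)"
  using polar_density(3)[OF M_carrierD(1,3)[OF mu] A] .
 then show ?thesis
  by (auto simp: cintegral_def set_lebesgue_integral_def indicator_def intro!: Bochner_Integration.integral_cong)
qed

lemma cmod_cintegral_le:
 assumes mu: "mu : \<M>" and f: "!!x. cmod (f x) <= g x" and g: "integrable (variation mu) g"
 shows "cmod (cintegral mu f) <= (LINT x|variation mu. g x)"
proof -
 have "cmod (cintegral mu f) <= (LINT x|variation mu. cmod (f x))" by (rule cmod_cintegral[OF mu])
 also have "... <= (LINT x|variation mu. g x)"
 proof (cases "integrable (variation mu) (%x. cmod (f x))")
  case True then show ?thesis using g f by (intro integral_mono)
 next
  case False
  have "0 <= g x" for x using f[of x] norm_ge_zero order_trans by blast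
  then show ?thesis using False by (simp add: not_integrable_integral_eq)
 qed
 finally show ?thesis .
qed

text \<open>Positive and negative parts of the real and imaginary parts of the polar density. It
  reduces measurability of \<open>x \<mapsto> nu (- x + A)\<close> to positive Radon
  measures.\<close>

lemma M_four_measures:
 assumes nu: "nu : \<M>"
 obtains m1 m2 m3 m4 where "radon m1" "radon m2" "radon m3" "radon m4"
  "ALL A:sets borel. nu A = Complex (measure m1 A - measure m2 A) (measure m3 A - measure m4 A)"
proof -
 let ?v = "variation nu" and ?h = "polar_density nu"
 interpret finite_measure ?v using M_carrierD(3)[OF nu] .
 have hm [measurable]: "?h : borel_measurable borel" using polar_measurable[OF nu] .
 define d where "d f = density ?v (%x. ennreal (f x))" for f :: "'g => real"
 have d: "radon (d f) & (ALL A:sets borel. measure (d f) A = (LINT x|?v. indicator A x * f x))"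
  if f: "f : borel_measurable borel" "!!x. 0 <= f x" "!!x. f x <= 1" for f
 proof
  note [measurable] = f(1)
  have i: "integrable ?v f" by (rule integrable_const_bound[of _ 1]) (use f in auto)
  show "radon (d f)" unfolding d_def using radon_density[OF M_carrierD(2)[OF nu] i f(2)] .
  show "ALL A:sets borel. measure (d f) A = (LINT x|?v. indicator A x * f x)"
  proof
   fix A :: "'g set" assume A: "A : sets borel"
   have ia: "integrable ?v (%x. indicator A x * f x)" using integrable_mult_indicator[OF _ i, of A] A by simp
   have "emeasure (d f) A = (\<integral>\<^sup>+x. ennreal (indicator A x * f x) \<partial>?v)"
    unfolding d_def using A by (subst emeasure_density) (auto intro!: nn_integral_cong split: split_indicator)
   also have "... = ennreal (LINT x|?v. indicator A x * f x)"
    using ia by (rule nn_integral_eq_integral) (simp add: f)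
   finally show "measure (d f) A = (LINT x|?v. indicator A x * f x)"
    by (simp add: measure_def integral_nonneg_AE f)
  qed
 qed
 have h1: "\<bar>Re (?h x)\<bar> <= 1" "\<bar>Im (?h x)\<bar> <= 1" for x
  using abs_Re_le_cmod[of "?h x"] abs_Im_le_cmod[of "?h x"] cmod_polar[OF nu, of x] by auto
 have m: "(%x. Re (?h x)) : borel_measurable borel" "(%x. Im (?h x)) : borel_measurable borel" by measurable
 have rep: "radon (d (%x. max 0 (f x))) & radon (d (%x. max 0 (- f x))) & (ALL A:sets borel.
   (LINT x|?v. indicator A x * f x) = measure (d (%x. max 0 (f x))) A - measure (d (%x. max 0 (- f x))) A)"
  if f: "f : borel_measurable borel" "!!x. \<bar>f x\<bar> <= 1" for f
 proof -
  note [measurable] = f(1)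
  have f1: "f x <= 1" "- f x <= 1" for x using f(2)[of x] by auto
  have d1: "radon (d (%x. max 0 (f x))) & (ALL A:sets borel. measure (d (%x. max 0 (f x))) A = (LINT x|?v. indicator A x * max 0 (f x)))"
   and d2: "radon (d (%x. max 0 (- f x))) & (ALL A:sets borel. measure (d (%x. max 0 (- f x))) A = (LINT x|?v. indicator A x * max 0 (- f x)))"
   by (rule d; use f1 in simp)+
  have "(LINT x|?v. indicator A x * f x) = (LINT x|?v. indicator A x * max 0 (f x)) - (LINT x|?v. indicator A x * max 0 (- f x))"
   if A: "A : sets borel" for A
  proof -
   have i: "integrable ?v (%x. indicator A x * max 0 (g x))" if g: "g : borel_measurable borel" "!!x. g x <= 1" for g :: "'g => real"
    using A g by (intro integrable_const_bound[of _ 1]) (auto simp: indicator_def)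
   have "(LINT x|?v. indicator A x * f x) = (LINT x|?v. indicator A x * max 0 (f x) - indicator A x * max 0 (- f x))"
    by (intro Bochner_Integration.integral_cong) (auto simp: max_def indicator_def)
   also have "... = (LINT x|?v. indicator A x * max 0 (f x)) - (LINT x|?v. indicator A x * max 0 (- f x))"
    using f1 f(1) by (intro Bochner_Integration.integral_diff i) auto
   finally show ?thesis .
  qed
  then show ?thesis using d1 d2 by simp
 qed
 show thesis
 proof (rule that, rule_tac [5] ballI)
  fix A :: "'g set" assume A: "A : sets borel"
  have i: "integrable ?v (%x. indicator A x *\<^sub>R ?h x)"
   by (rule integrable_const_bound[of _ 1]) (use A cmod_polar[OF nu] in \<open>auto simp: indicator_def\<close>)
  have "nu A = (LINT x|?v. indicator A x *\<^sub>R ?h x)"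
   using polar_density(3)[OF M_carrierD(1,3)[OF nu] A] by (simp add: set_lebesgue_integral_def)
  then have "Re (nu A) = (LINT x|?v. indicator A x * Re (?h x))" "Im (nu A) = (LINT x|?v. indicator A x * Im (?h x))"
   using integral_Re[OF i] integral_Im[OF i] by auto
  then show "nu A = Complex (measure (d (%x. max 0 (Re (?h x)))) A - measure (d (%x. max 0 (- Re (?h x)))) A)
    (measure (d (%x. max 0 (Im (?h x)))) A - measure (d (%x. max 0 (- Im (?h x)))) A)"
   using rep[OF m(1) h1(1)] rep[OF m(2) h1(2)] A by (simp add: complex_eq_iff)
 qed (use rep[OF m(1) h1(1)] rep[OF m(2) h1(2)] in auto)
qed

lemma measurable_translate:
 assumes nu: "nu : \<M>" and A: "A : sets borel"
 shows "(%x. nu {y. x + y : A}) : borel_measurable borel"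
proof -
 obtain m1 m2 m3 m4 where m: "radon m1" "radon m2" "radon m3" "radon m4"
  "ALL A:sets borel. nu A = Complex (measure m1 A - measure m2 A) (measure m3 A - measure m4 A)"
  using M_four_measures[OF nu] .
 note [measurable] = measurable_measure_translate[OF m(1) A] measurable_measure_translate[OF m(2) A]
  measurable_measure_translate[OF m(3) A] measurable_measure_translate[OF m(4) A]
 have "(%x. nu {y. x + y : A}) = (%x. complex_of_real (measure m1 {y. x + y : A} - measure m2 {y. x + y : A})
   + \<i> * complex_of_real (measure m3 {y. x + y : A} - measure m4 {y. x + y : A}))"
  by (simp add: m(5) translate_borel A complex_eq_iff fun_eq_iff)
 then show ?thesis by simp
qed

lemma translate_bound:
 assumes nu: "nu : \<M>" shows "cmod (nu A) <= measure (variation nu) UNIV"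
proof -
 interpret finite_measure "variation nu" using M_carrierD(3)[OF nu] .
 show ?thesis using cmod_le_measure[OF nu, of A] bounded_measure[of A] by simp
qed

text \<open>Countable additivity of \<open>nu\<close> on translates is carried under the integral by
  dominated convergence; the total mass of \<open>variation nu\<close> is a constant dominating
  function.\<close>

lemma conv_complex_measure:
 assumes mu: "mu : \<M>" and nu: "nu : \<M>"
 shows "complex_measure (conv mu nu)"
 unfolding complex_measure_def
proof (intro conjI allI impI)
 show "conv mu nu A = 0" if "A ~: sets borel" for A using that by (simp add: conv_def)
 fix F :: "nat => 'g set" assume F: "range F \<subseteq> sets borel & disjoint_family F"
 then have Fb: "F i : sets borel" for i by auto
 let ?h = "polar_density mu" and ?B = "measure (variation nu) UNIV"
 interpret finite_measure "variation mu" using M_carrierD(3)[OF mu] .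
 note hm [measurable] = polar_measurable[OF mu]
 have Un: "(\<Sum>i<n. nu {y. x + y : F i}) = nu {y. x + y : (\<Union>i<n. F i)}" for x n
 proof (induction n)
  case 0 then show ?case by (simp add: complex_measure_empty[OF M_carrierD(1)[OF nu]])
 next
  case (Suc n)
  have "{y. x + y : (\<Union>i<Suc n. F i)} = {y. x + y : (\<Union>i<n. F i)} Un {y. x + y : F n}" by (auto simp: less_Suc_eq)
  moreover have "{y. x + y : (\<Union>i<n. F i)} Int {y. x + y : F n} = {}"
  proof -
   have "F i Int F n = {}" if "i < n" for i
    using F that by (simp add: disjoint_family_on_def)
   then show ?thesis by (auto simp: disjoint_iff)
  qed
  moreover have "(\<Union>i<n. F i) : sets borel" using Fb by auto
  ultimately have "nu {y. x + y : (\<Union>i<Suc n. F i)} = nu {y. x + y : (\<Union>i<n. F i)} + nu {y. x + y : F n}"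
   using complex_measure_Un[OF M_carrierD(1)[OF nu] translate_borel translate_borel[OF Fb]] by (simp only:)
  then show ?case using Suc by (simp only: sum.lessThan_Suc)
 qed
 have "(%n. LINT x|variation mu. nu {y. x + y : (\<Union>i<n. F i)} * ?h x) \<longlonglongrightarrow>
   (LINT x|variation mu. nu {y. x + y : (\<Union>i. F i)} * ?h x)"
 proof (rule integral_dominated_convergence[where w = "%x. ?B"])
  have "(%x. nu {y. x + y : A} * ?h x) : borel_measurable (variation mu)" if "A : sets borel" for A
   using measurable_translate[OF nu that] by simp
  moreover have "(\<Union>i. F i) : sets borel" "!!n. (\<Union>i<n. F i) : sets borel" using Fb by auto
  ultimately show "(%x. nu {y. x + y : (\<Union>i. F i)} * ?h x) : borel_measurable (variation mu)"
   "(%x. nu {y. x + y : (\<Union>i<n. F i)} * ?h x) : borel_measurable (variation mu)" for n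
   by blast+
  show "AE x in variation mu. (%n. nu {y. x + y : (\<Union>i<n. F i)} * ?h x) \<longlonglongrightarrow> nu {y. x + y : (\<Union>i. F i)} * ?h x"
  proof (intro AE_I2 tendsto_mult tendsto_const)
   fix x
   have "(%i. nu {y. x + y : F i}) sums nu (\<Union>i. {y. x + y : F i})"
    using F by (intro complex_measure_sums[OF M_carrierD(1)[OF nu]] translate_borel) (auto simp: disjoint_family_on_def)
   moreover have "(\<Union>i. {y. x + y : F i}) = {y. x + y : (\<Union>i. F i)}" by auto
   ultimately show "(%n. nu {y. x + y : (\<Union>i<n. F i)}) \<longlonglongrightarrow> nu {y. x + y : (\<Union>i. F i)}"
    by (simp only: sums_def Un)
  qed
  show "AE x in variation mu. cmod (nu {y. x + y : (\<Union>i<n. F i)} * ?h x) <= ?B" for n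
   using translate_bound[OF nu] by (simp add: norm_mult cmod_polar[OF mu])
 qed simp
 moreover have "(LINT x|variation mu. nu {y. x + y : (\<Union>i<n. F i)} * ?h x) = (\<Sum>i<n. conv mu nu (F i))" for n
 proof -
  have "(LINT x|variation mu. nu {y. x + y : (\<Union>i<n. F i)} * ?h x) = (LINT x|variation mu. (\<Sum>i<n. nu {y. x + y : F i} * ?h x))"
   by (simp only: Un[symmetric] sum_distrib_right)
  also have "... = (\<Sum>i<n. LINT x|variation mu. nu {y. x + y : F i} * ?h x)"
   using cintegral_integrable[OF mu measurable_translate[OF nu Fb] translate_bound[OF nu]]
   by (intro Bochner_Integration.integral_sum)
  finally show ?thesis using Fb by (simp add: conv_def cintegral_def)
 qed
 moreover have "(\<Union>i. F i) : sets borel" using Fb by auto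
 ultimately show "(%i. conv mu nu (F i)) sums conv mu nu (\<Union>i. F i)"
  by (simp add: sums_def conv_def cintegral_def)
qed

lemma variation_conv_le:
 assumes mu: "mu : \<M>" and nu: "nu : \<M>"
 shows "emeasure (variation (conv mu nu)) A <= emeasure (posconv (variation mu) (variation nu)) A"
proof (rule variation_le[OF conv_complex_measure[OF mu nu]])
 fix A :: "'g set" assume A: "A : sets borel"
 interpret m: finite_measure "variation mu" using M_carrierD(3)[OF mu] .
 interpret n: finite_measure "variation nu" using M_carrierD(3)[OF nu] .
 note [measurable] = measurable_measure_translate[OF M_carrierD(2)[OF nu] A]
 have i: "integrable (variation mu) (%x. measure (variation nu) {y. x + y : A})"
  by (rule m.integrable_const_bound[of _ "measure (variation nu) UNIV"]) (use n.bounded_measure in auto)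
 have "cmod (conv mu nu A) <= (LINT x|variation mu. measure (variation nu) {y. x + y : A})"
  unfolding conv_def using A cmod_le_measure[OF nu] by (simp add: cmod_cintegral_le[OF mu _ i])
 then have "ennreal (cmod (conv mu nu A)) <= ennreal (LINT x|variation mu. measure (variation nu) {y. x + y : A})"
  by (rule ennreal_leI)
 also have "... = (\<integral>\<^sup>+x. ennreal (measure (variation nu) {y. x + y : A}) \<partial>variation mu)"
  by (rule nn_integral_eq_integral[OF i, symmetric]) simp
 also have "... = emeasure (posconv (variation mu) (variation nu)) A"
  by (simp add: emeasure_posconv[OF M_carrierD(2)[OF mu] M_carrierD(2)[OF nu] A] n.emeasure_eq_measure)
 finally show "ennreal (cmod (conv mu nu A)) <= emeasure (posconv (variation mu) (variation nu)) A" .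
qed simp

lemma conv_add_right:
 assumes mu: "mu : \<M>" and nu: "nu : \<M>" and nu': "nu' : \<M>"
 shows "conv mu (%A. nu A + nu' A) = (%A. conv mu nu A + conv mu nu' A)"
 using cintegral_add[OF mu measurable_translate[OF nu] translate_bound[OF nu] measurable_translate[OF nu'] translate_bound[OF nu']]
 by (auto simp: conv_def)

lemma conv_smult_right: "conv mu (%A. c * nu A) = (%A. c * conv mu nu A)"
 by (auto simp: conv_def cintegral_mult)

lemma cmod_conv_le:
 assumes mu: "mu : \<M>" and nu: "nu : \<M>" and A: "A : sets borel"
 shows "integrable (variation mu) (%x. measure (variation nu) {y. x + y : A})"
  "measure (variation (conv mu nu)) A <= (LINT x|variation mu. measure (variation nu) {y. x + y : A})"
proof -
 interpret m: finite_measure "variation mu" using M_carrierD(3)[OF mu] .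
 interpret n: finite_measure "variation nu" using M_carrierD(3)[OF nu] .
 note [measurable] = measurable_measure_translate[OF M_carrierD(2)[OF nu] A]
 show i: "integrable (variation mu) (%x. measure (variation nu) {y. x + y : A})"
  by (rule m.integrable_const_bound[of _ "measure (variation nu) UNIV"]) (use n.bounded_measure in auto)
 have "emeasure (variation (conv mu nu)) A <= ennreal (LINT x|variation mu. measure (variation nu) {y. x + y : A})"
  using variation_conv_le[OF mu nu, of A] nn_integral_eq_integral[OF i]
  by (simp add: emeasure_posconv[OF M_carrierD(2)[OF mu] M_carrierD(2)[OF nu] A] n.emeasure_eq_measure)
 then show "measure (variation (conv mu nu)) A <= (LINT x|variation mu. measure (variation nu) {y. x + y : A})"
  unfolding measure_def by (intro enn2real_leI) auto
qed

end

locale locally_compact_weighted = weighted_group om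
 for om :: "'g::{topological_group_add,t2_space} => real" +
 assumes lc: "locally_compact_space (euclidean :: 'g topology)"

text \<open>Everything is read off from the dominating positive convolution: it is Radon, and
  \<open>om (x + y) <= om x * om y\<close> inside its iterated integral bounds the norm by the
  product of the norms.\<close>

lemma (in locally_compact_weighted) conv_closed:
 assumes mu: "mu : \<M>" and nu: "nu : \<M>"
 shows "conv mu nu : \<M>" "\<N> (conv mu nu) <= \<N> mu * \<N> nu"
proof -
 let ?m = "variation mu" and ?n = "variation nu"
 note m = M_carrierD(2)[OF mu] and n = M_carrierD(2)[OF nu]
 have wp: "0 <= om x" for x using weightD(2) less_imp_le by blast
 note [measurable] = weightD(5)
 have r: "radon (variation (conv mu nu))"
  using radon_le[OF radon_posconv[OF lc m n]] variation_conv_le[OF mu nu] by simp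
 have "(\<integral>\<^sup>+x. ennreal (om x) \<partial>variation (conv mu nu)) <=
   1 * (\<integral>\<^sup>+x. ennreal (om x) \<partial>posconv ?m ?n) + 0 * (\<integral>\<^sup>+x. ennreal (om x) \<partial>posconv ?m ?n)"
  using variation_conv_le[OF mu nu] by (intro nn_integral_le_combination) auto
 also have "... = (\<integral>\<^sup>+x. (\<integral>\<^sup>+y. ennreal (om (x + y)) \<partial>?n) \<partial>?m)"
  using nn_integral_posconv[OF m n, of "%x. ennreal (om x)"] by simp
 also have "... <= (\<integral>\<^sup>+x. (\<integral>\<^sup>+y. ennreal (om x) * ennreal (om y) \<partial>?n) \<partial>?m)"
  using weightD(4) wp by (intro nn_integral_mono) (simp add: ennreal_mult[symmetric] ennreal_leI)
 also have "... = (\<integral>\<^sup>+x. ennreal (om x) * ennreal (\<N> nu) \<partial>?m)"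
  by (simp add: nn_integral_cmult M_nrm_nn[OF nu])
 also have "... = ennreal (\<N> mu) * ennreal (\<N> nu)"
  by (simp add: nn_integral_multc M_nrm_nn[OF mu])
 also have "... = ennreal (\<N> mu * \<N> nu)" by (simp add: ennreal_mult M_nrm_nonneg[OF mu] M_nrm_nonneg[OF nu])
 finally have b: "(\<integral>\<^sup>+x. ennreal (om x) \<partial>variation (conv mu nu)) <= ennreal (\<N> mu * \<N> nu)" .
 have "integrable (variation (conv mu nu)) om"
  using b wp by (intro integrableI_nonneg) (auto simp: less_top[symmetric] top_unique)
 then show cl: "conv mu nu : \<M>"
  using r conv_complex_measure[OF mu nu] by (simp add: M_carrier_iff)
 have "ennreal (\<N> (conv mu nu)) <= ennreal (\<N> mu * \<N> nu)" using b by (simp add: M_nrm_nn[OF cl])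
 then show "\<N> (conv mu nu) <= \<N> mu * \<N> nu"
  using M_nrm_nonneg[OF mu] M_nrm_nonneg[OF nu] by (subst (asm) ennreal_le_iff) auto
qed

section \<open>The predual \<open>M_*(G, \<omega>)\<close>\<close>

definition cm_of :: "'g::topological_space measure => 'g cmeasure" where
 "cm_of m = (%A. if A : sets borel then complex_of_real (measure m A) else 0)"

lemma cm_of_variation:
 fixes m :: "'g::t2_space measure"
 assumes m: "radon m" shows "complex_measure (cm_of m)" "variation (cm_of m) = m"
proof -
 interpret finite_measure m using radon_finite[OF m] .
 have "(LINT x:A|m. (1::complex)) = complex_of_real (measure m A)" if "A : sets borel" for A
  using set_integral_const[of A m "1::complex"] that radon_sets[OF m]
  by (simp add: emeasure_eq_measure of_real_def)
 then have "cm_of m = (%A. if A : sets borel then (LINT x:A|m. (1::complex)) else 0)"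
  by (auto simp: cm_of_def)
 then show "complex_measure (cm_of m)" "variation (cm_of m) = m"
  using density_variation[OF radon_sets[OF m] radon_finite[OF m], of "%_. 1"] by auto
qed

definition dirac :: "'g::topological_space => 'g measure" where
 "dirac x = distr (count_space {x}) borel (%y. y)"

lemma dirac_simps [simp]: "sets (dirac x) = sets borel" "A : sets borel ==> emeasure (dirac x) A = indicator A x"
proof -
 show "emeasure (dirac x) A = indicator A x" if "A : sets borel"
 proof -
  have "emeasure (dirac x) A = emeasure (count_space {x}) (A Int {x})"
   using that unfolding dirac_def by (subst emeasure_distr) auto
  then show ?thesis by (cases "x : A") auto
 qed
qed (simp add: dirac_def)

lemma radon_dirac: "radon (dirac x)" for x :: "'g::t2_space"
proof (rule radonI_open)
 have sp: "space (dirac x) = UNIV" by (simp add: dirac_def)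
 show "finite_measure (dirac x)" by (rule finite_measureI) (simp add: sp)
 fix U :: "'g set" and e :: real assume U: "open U" "0 < e"
 then show "EX K. compact K & K \<subseteq> U & measure (dirac x) (U - K) < e"
  by (cases "x : U") (auto intro!: exI[of _ "if x : U then {x} else {}"] simp: measure_def)
qed simp

lemma point_mass_eq: "point_mass x = cm_of (dirac x)"
 by (auto simp: point_mass_def cm_of_def measure_def fun_eq_iff)

lemma infsum_tail_less:
 fixes f :: "'i => real"
 assumes f: "f summable_on I" "!!i. i : I ==> 0 <= f i" and e: "0 < e"
 obtains F where "finite F" "F \<subseteq> I" "(\<Sum>\<^sub>\<infinity>i\<in>I - F. f i) < e"
proof -
 have "(sum f \<longlongrightarrow> infsum f I) (finite_subsets_at_top I)"
  using f(1) has_sum_infsum has_sum_def by blast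
 then have "eventually (%F. dist (sum f F) (infsum f I) < e) (finite_subsets_at_top I)"
  using e by (rule tendstoD)
 then obtain F where F: "finite F" "F \<subseteq> I" "dist (sum f F) (infsum f I) < e"
  unfolding eventually_finite_subsets_at_top by blast
 have "infsum f (I - F) = infsum f I - infsum f F"
  using F f(1) by (intro infsum_Diff) auto
 then have "infsum f (I - F) < e" using F by (simp add: dist_real_def)
 then show thesis using that F by blast
qed

context weighted_group
begin

lemma point_mass_carrier: "point_mass x : \<M>" "\<N> (point_mass x) = om x"
proof -
 note v = cm_of_variation[OF radon_dirac[of x]]
 have nn: "(\<integral>\<^sup>+y. ennreal (om y) \<partial>dirac x) = ennreal (om x)"
  unfolding dirac_def using weightD(5) by (subst nn_integral_distr) (auto simp: nn_integral_count_space_finite)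
 have wp: "0 <= om y" for y using weightD(2) less_imp_le by blast
 have "integrable (dirac x) om"
  using nn wp weightD(5) by (intro integrableI_nonneg) (auto simp: dirac_def)
 then show c: "point_mass x : \<M>"
  using v radon_dirac[of x] by (simp add: M_carrier_iff point_mass_eq)
 have "ennreal (\<N> (point_mass x)) = ennreal (om x)"
  using M_nrm_nn[OF c] v nn by (simp add: point_mass_eq)
 then show "\<N> (point_mass x) = om x" using wp M_nrm_nonneg[OF c] by simp
qed

lemma M_star_carrier: "th : \<P> \<longleftrightarrow> th : carrier (dual_space (malg om)) & vanishes_at_infinity om th"
 by (simp add: M_star_def)

lemma M_star_simps:
 "\<zero>\<^bsub>M_star om\<^esub> = (%x. 0)" "f \<oplus>\<^bsub>M_star om\<^esub> g = (%x. f x + g x)" "c \<odot>\<^bsub>M_star om\<^esub> f = (%x. c * f x)"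
 "nrm (M_star om) = nrm (dual_space (malg om))"
 by (simp_all add: M_star_def dual_space_def)

lemma normed_M_star: "normed_space (M_star om)"
proof -
 note nd = normed_dual_space[OF normed_M] and pd = pointwise_dual_space[of "malg om"]
 have va: "vanishes_at_infinity om (%x. f x + g x)" if f: "vanishes_at_infinity om f" and g: "vanishes_at_infinity om g" for f g
  unfolding vanishes_at_infinity_def
 proof (intro allI impI)
  fix e :: real assume e: "0 < e"
  obtain K where K: "compact K" "ALL mu:\<M>. emeasure (variation mu) K = 0 & \<N> mu = 1 --> cmod (f mu) < e / 2"
   using f half_gt_zero[OF e] unfolding vanishes_at_infinity_def by blast
  obtain L where L: "compact L" "ALL mu:\<M>. emeasure (variation mu) L = 0 & \<N> mu = 1 --> cmod (g mu) < e / 2"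
   using g half_gt_zero[OF e] unfolding vanishes_at_infinity_def by blast
  have "cmod (f mu + g mu) < e" if mu: "mu : \<M>" "emeasure (variation mu) (K Un L) = 0" "\<N> mu = 1" for mu
  proof -
   have s: "K Un L : sets (variation mu)" using compact_imp_closed[OF K(1)] compact_imp_closed[OF L(1)] by auto
   have "emeasure (variation mu) K = 0" "emeasure (variation mu) L = 0"
    using emeasure_mono[OF _ s, of K] emeasure_mono[OF _ s, of L] mu(2) by auto
   then have "cmod (f mu) < e / 2" "cmod (g mu) < e / 2" using K L mu by auto
   then show ?thesis using norm_triangle_ineq[of "f mu" "g mu"] by linarith
  qed
  then show "EX K. compact K & (ALL mu:\<M>. emeasure (variation mu) K = 0 & \<N> mu = 1 --> cmod (f mu + g mu) < e)"
   using K(1) L(1) by (intro exI[of _ "K Un L"]) auto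
 qed
 have vc: "vanishes_at_infinity om (%x. c * f x)" if f: "vanishes_at_infinity om f" for f c
  unfolding vanishes_at_infinity_def
 proof (intro allI impI)
  fix e :: real assume e: "0 < e"
  have e': "0 < e / (cmod c + 1)" using e by (intro divide_pos_pos) (auto intro: add_nonneg_pos)
  obtain K where K: "compact K" "ALL mu:\<M>. emeasure (variation mu) K = 0 & \<N> mu = 1 --> cmod (f mu) < e / (cmod c + 1)"
   using f e' unfolding vanishes_at_infinity_def by blast
  have "cmod (c * z) < e" if "cmod z < e / (cmod c + 1)" for z
  proof -
   have "cmod (c * z) <= (cmod c + 1) * cmod z" by (simp add: norm_mult mult_right_mono)
   also have "... < e" using that by (simp add: pos_less_divide_eq add_nonneg_pos mult.commute)
   finally show ?thesis .
  qed
  then show "EX K. compact K & (ALL mu:\<M>. emeasure (variation mu) K = 0 & \<N> mu = 1 --> cmod (c * f mu) < e)"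
   using K by blast
 qed
 have v0: "vanishes_at_infinity om (%x. 0)" by (auto simp: vanishes_at_infinity_def)
 have p: "pointwise_space (M_star om)"
 proof -
  have "add (M_star om) = add (dual_space (malg om))" "smult (M_star om) = smult (dual_space (malg om))"
   "zero (M_star om) = zero (dual_space (malg om))"
   by (simp_all add: M_star_def)
  then show ?thesis
   using pd va vc v0 by (simp add: pointwise_space_def M_star_carrier)
 qed
 show ?thesis
  unfolding normed_space_def using pointwise_module[OF p] nd
  by (simp add: M_star_simps M_star_carrier normed_space_def dual_simps)
qed

lemma M_starI:
 assumes add: "!!mu nu. mu : \<M> ==> nu : \<M> ==> f (%A. mu A + nu A) = f mu + f nu"
  and sm: "!!c mu. mu : \<M> ==> f (%A. c * mu A) = c * f mu"
  and z: "!!mu. mu ~: \<M> ==> f mu = 0"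
  and bd: "!!mu. mu : \<M> ==> cmod (f mu) <= C * \<N> mu"
  and van: "!!e. 0 < e ==> EX K. compact K & (ALL mu:\<M>. emeasure (variation mu) K = 0 --> \<N> mu = 1 --> cmod (f mu) < e)"
 shows "f : \<P>"
proof -
 have "f : carrier (dual_space (malg om))"
  by (rule dual_carrierI[where C = C]) (use add sm z bd in \<open>auto simp: M_simps\<close>)
 moreover have "vanishes_at_infinity om f" unfolding vanishes_at_infinity_def
 proof (intro allI impI)
  fix e :: real assume "0 < e"
  from van[OF this] show "EX K. compact K & (ALL mu:\<M>. emeasure (variation mu) K = 0 & \<N> mu = 1 --> cmod (f mu) < e)"
   by (simp add: imp_conjL)
 qed
 ultimately show ?thesis by (simp add: M_star_carrier)
qed

lemma M_starD:
 assumes "f : \<P>"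
 shows "mu : \<M> ==> nu : \<M> ==> f (%A. mu A + nu A) = f mu + f nu"
  "mu : \<M> ==> f (%A. c * mu A) = c * f mu"
  "mu ~: \<M> ==> f mu = 0"
  "mu : \<M> ==> cmod (f mu) <= nrm (M_star om) f * \<N> mu"
 using assms dual_carrierD[of f "malg om"] dual_nrm_bound[OF normed_M, of f]
 by (auto simp: M_star_carrier M_simps M_star_simps)

definition theta :: "'g set => 'g cmeasure_functional" where
 "theta K = (%nu. if nu : \<M> then nu K else 0)"

definition theta_series :: "'i set => ('i => complex) => ('i => 'g set) => 'g cmeasure_functional" where
 "theta_series I be S = (%nu. if nu : \<M> then (\<Sum>\<^sub>\<infinity>i\<in>I. be i * nu (S i)) else 0)"

lemma cmod_le_nrm: "mu : \<M> ==> cmod (mu A) <= \<N> mu"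
 using cmod_le_measure M_variation_le_nrm order_trans by blast

lemma theta_series_summable:
 assumes be: "(%i. norm (be i)) summable_on I" and nu: "nu : \<M>"
 shows "(%i. norm (be i * nu (S i))) summable_on I"
  "norm (\<Sum>\<^sub>\<infinity>i\<in>I. be i * nu (S i)) <= (\<Sum>\<^sub>\<infinity>i\<in>I. norm (be i)) * \<N> nu"
proof -
 have b: "norm (be i * nu (S i)) <= norm (be i) * \<N> nu" for i
  using cmod_le_nrm[OF nu] by (simp add: norm_mult mult_left_mono)
 have s: "(%i. norm (be i) * \<N> nu) summable_on I" using be by (rule summable_on_cmult_left)
 then show a: "(%i. norm (be i * nu (S i))) summable_on I"
  by (rule summable_on_comparison_test) (use b in auto)
 have "norm (\<Sum>\<^sub>\<infinity>i\<in>I. be i * nu (S i)) <= (\<Sum>\<^sub>\<infinity>i\<in>I. norm (be i * nu (S i)))" using a by (rule norm_infsum_bound)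
 also have "... <= (\<Sum>\<^sub>\<infinity>i\<in>I. norm (be i) * \<N> nu)" using a s b by (intro infsum_mono) auto
 also have "... = (\<Sum>\<^sub>\<infinity>i\<in>I. norm (be i)) * \<N> nu" by (rule infsum_cmult_left) (use be in auto)
 finally show "norm (\<Sum>\<^sub>\<infinity>i\<in>I. be i * nu (S i)) <= (\<Sum>\<^sub>\<infinity>i\<in>I. norm (be i)) * \<N> nu" .
qed

text \<open>A measure that does not charge the sets \<open>S i\<close> for \<open>i\<close> in a
  finite \<open>F\<close> meets only the tail of the series. The finite union of these compact sets
  is the compact set required for vanishing at infinity.\<close>

lemma theta_series_M_star:
 assumes be: "(%i. norm (be i)) summable_on I" and S: "!!i. i : I ==> compact (S i)"
 shows "theta_series I be S : \<P>"
proof (rule M_starI[where C = "\<Sum>\<^sub>\<infinity>i\<in>I. norm (be i)"])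
 note sm = theta_series_summable(1)[OF be, THEN abs_summable_summable]
 show "theta_series I be S (%A. mu A + nu A) = theta_series I be S mu + theta_series I be S nu"
  if "mu : \<M>" "nu : \<M>" for mu nu
  using that M_add(1)[OF that] infsum_add[OF sm[OF that(1)] sm[OF that(2)], of S S]
  by (simp add: theta_series_def distrib_left)
 show "theta_series I be S (%A. c * mu A) = c * theta_series I be S mu" if "mu : \<M>" for mu c
  using that M_smult(1)[OF that, of c] infsum_cmult_right'[of c "%i. be i * mu (S i)" I]
  by (simp add: theta_series_def mult.left_commute)
 show "theta_series I be S mu = 0" if "mu ~: \<M>" for mu using that by (simp add: theta_series_def)
 show "cmod (theta_series I be S mu) <= (\<Sum>\<^sub>\<infinity>i\<in>I. norm (be i)) * \<N> mu" if "mu : \<M>" for mu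
  using that theta_series_summable(2)[OF be that, of S] by (simp add: theta_series_def)
 fix e :: real assume e: "0 < e"
 obtain F where F: "finite F" "F \<subseteq> I" "(\<Sum>\<^sub>\<infinity>i\<in>I - F. norm (be i)) < e"
  using infsum_tail_less[OF be _ e] by auto
 let ?K = "\<Union>i\<in>F. S i"
 have "cmod (theta_series I be S mu) < e" if mu: "mu : \<M>" "emeasure (variation mu) ?K = 0" "\<N> mu = 1" for mu
 proof -
  have Kc: "compact ?K" using F S by (intro compact_UN) auto
  have "mu (S i) = 0" if "i : F" for i
  proof -
   have "emeasure (variation mu) (S i) <= emeasure (variation mu) ?K"
    using that compact_imp_closed[OF Kc] by (intro emeasure_mono) auto
   then have "measure (variation mu) (S i) = 0" using mu(2) by (simp add: measure_def)
   then show ?thesis using cmod_le_measure[OF mu(1), of "S i"] by simp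
  qed
  then have "(\<Sum>\<^sub>\<infinity>i\<in>I. be i * mu (S i)) = (\<Sum>\<^sub>\<infinity>i\<in>I - F. be i * mu (S i))"
   by (intro infsum_cong_neutral) auto
  also have "norm ... <= (\<Sum>\<^sub>\<infinity>i\<in>I - F. norm (be i)) * \<N> mu"
   using summable_on_subset_banach[OF be, of "I - F"] mu(1) by (intro theta_series_summable(2)) auto
  finally show ?thesis using F(3) mu by (simp add: theta_series_def)
 qed
 then show "EX K. compact K & (ALL mu:\<M>. emeasure (variation mu) K = 0 --> \<N> mu = 1 --> cmod (theta_series I be S mu) < e)"
  using F S by (intro exI[of _ ?K]) (auto intro!: compact_UN)
qed

lemma theta_eq_series: "theta K = theta_series {()} (%_. 1) (%_. K)"
 by (simp add: theta_def theta_series_def fun_eq_iff)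

lemma theta_M_star: "compact K ==> theta K : \<P>"
 unfolding theta_eq_series by (intro theta_series_M_star) auto

text \<open>On each cell the integrand \<open>x \<mapsto> nu (- x + S)\<close> is constant, so the
  convolution integral becomes a sum. There may be uncountably many cells, hence no appeal to
  countable additivity: summability of \<open>nu (T i)\<close> makes the integrand a uniform limit
  of finite step functions.\<close>

lemma conv_cells:
 assumes mu: "mu : \<M>" and nu: "nu : \<M>"
  and c: "!!i. i : I ==> c i : sets borel" "disjoint_family_on c I" "(\<Union>i\<in>I. c i) = UNIV"
  and S: "S : sets borel" and T: "!!i x. i : I ==> x : c i ==> {y. x + y : S} = T i"
  and sm: "(%i. norm (nu (T i))) summable_on I"
 shows "((%i. mu (c i) * nu (T i)) has_sum conv mu nu S) I"
 unfolding has_sum_def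
proof (rule tendstoI)
 fix e :: real assume e: "0 < e"
 let ?m = "variation mu"
 interpret m: finite_measure ?m using M_carrierD(3)[OF mu] .
 define d where "d = e / (measure ?m UNIV + 1)"
 have d: "0 < d" unfolding d_def using e by (intro divide_pos_pos add_nonneg_pos) auto
 obtain F where F: "finite F" "F \<subseteq> I" "(\<Sum>\<^sub>\<infinity>i\<in>I - F. norm (nu (T i))) < d"
  by (rule infsum_tail_less[OF sm _ d]) auto
 have "dist (\<Sum>i\<in>Y. mu (c i) * nu (T i)) (conv mu nu S) < e" if Y: "finite Y" "F \<subseteq> Y" "Y \<subseteq> I" for Y
 proof -
  let ?f = "%x. nu {y. x + y : S}" and ?g = "%x. \<Sum>i\<in>Y. nu (T i) * indicator (c i) x :: complex"
  have cb: "c i : sets borel" if "i : Y" for i using c(1) that Y by auto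
  have gm: "?g : borel_measurable borel" using cb by (intro borel_measurable_sum borel_measurable_times) auto
  have gsum: "cintegral mu ?g = (\<Sum>i\<in>Y. mu (c i) * nu (T i))"
   using Y(1) cb
  proof (induction Y)
   case empty then show ?case by (simp add: cintegral_def)
  next
   case (insert j Y)
   have b: "cmod (\<Sum>i\<in>Y. nu (T i) * indicator (c i) x) <= (\<Sum>i\<in>Y. cmod (nu (T i)))" for x
    by (rule order_trans[OF norm_sum sum_mono]) (auto simp: norm_mult indicator_def)
   have "cintegral mu (%x. nu (T j) * indicator (c j) x + (\<Sum>i\<in>Y. nu (T i) * indicator (c i) x)) =
     cintegral mu (%x. nu (T j) * indicator (c j) x) + cintegral mu (%x. \<Sum>i\<in>Y. nu (T i) * indicator (c i) x)"
   proof (rule cintegral_add[OF mu _ _ _ b])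
    show "(%x. nu (T j) * indicator (c j) x) : borel_measurable borel" using insert by auto
    show "(%x. \<Sum>i\<in>Y. nu (T i) * indicator (c i) x :: complex) : borel_measurable borel"
     using insert by (intro borel_measurable_sum borel_measurable_times) auto
    show "cmod (nu (T j) * indicator (c j) x) <= cmod (nu (T j))" for x by (auto simp: norm_mult indicator_def)
   qed
   moreover have "cintegral mu (%x. nu (T j) * indicator (c j) x) = mu (c j) * nu (T j)"
    using cintegral_indicator[OF mu, of "c j"] insert by (simp add: cintegral_mult mult.commute)
   moreover have "cintegral mu (%x. \<Sum>i\<in>Y. nu (T i) * indicator (c i) x) = (\<Sum>i\<in>Y. mu (c i) * nu (T i))"
    using insert by blast
   ultimately show ?case by (simp only: sum.insert[OF insert(1,2)])
  qed
  have gb: "cmod (?g x) <= (\<Sum>i\<in>Y. cmod (nu (T i)))" for x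
   by (rule order_trans[OF norm_sum sum_mono]) (auto simp: norm_mult indicator_def)
  have "conv mu nu S + (- 1) * cintegral mu ?g = cintegral mu ?f + cintegral mu (%x. (- 1) * ?g x)"
   using S by (simp only: conv_def cintegral_mult if_True)
  also have "... = cintegral mu (%x. ?f x + (- 1) * ?g x)"
  proof (rule cintegral_add[OF mu, symmetric])
   show "?f : borel_measurable borel" by (rule measurable_translate[OF nu S])
   show "cmod (?f x) <= measure (variation nu) UNIV" for x by (rule translate_bound[OF nu])
   show "(%x. (- 1) * ?g x) : borel_measurable borel" using gm by (intro borel_measurable_times) auto
   show "cmod ((- 1) * ?g x) <= (\<Sum>i\<in>Y. cmod (nu (T i)))" for x using gb[of x] by simp
  qed
  finally have eq: "conv mu nu S - (\<Sum>i\<in>Y. mu (c i) * nu (T i)) = cintegral mu (%x. ?f x - ?g x)"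
   using gsum by simp
  \<comment> \<open>On a cell in \<open>Y\<close> both functions agree. On any other cell
    \<open>?g\<close> is 0 and \<open>?f\<close> is a single term of the tail outside
    \<open>F\<close>.\<close>
  have "cmod (?f x - ?g x) <= d" for x
  proof -
   obtain i where i: "i : I" "x : c i" using c(3) by blast
   have other: "x ~: c j" if "j : I" "j ~= i" for j using disjoint_family_onD[OF c(2), of j i] that i by auto
   have fx: "?f x = nu (T i)" using T[OF i] by simp
   show ?thesis
   proof (cases "i : Y")
    case True
    have "?g x = (\<Sum>j\<in>Y. if j = i then nu (T i) else 0)" using i other Y by (intro sum.cong) auto
    then have "?g x = nu (T i)" using True Y by simp
    then show ?thesis using d fx by simp
   next
    case False
    then have "x ~: c j" if "j : Y" for j using other[of j] that Y(3) by auto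
    then have "?g x = 0" by (intro sum.neutral) auto
    moreover have "norm (nu (T i)) <= (\<Sum>\<^sub>\<infinity>i\<in>I - F. norm (nu (T i)))"
    proof -
     have "(\<Sum>\<^sub>\<infinity>i\<in>{i}. norm (nu (T i))) <= (\<Sum>\<^sub>\<infinity>i\<in>I - F. norm (nu (T i)))"
      using summable_on_subset_banach[OF sm] i False Y by (intro infsum_mono_neutral) auto
     then show ?thesis by simp
    qed
    ultimately show ?thesis using F fx by simp
   qed
  qed
  then have "cmod (cintegral mu (%x. ?f x - ?g x)) <= (LINT x|?m. d)" by (intro cmod_cintegral_le[OF mu]) auto
  also have "... = d * measure ?m UNIV" by simp
  also have "... < d * (measure ?m UNIV + 1)" using d by (simp add: algebra_simps)
  also have "... = e"
  proof -
   have "0 < measure ?m UNIV + 1" by (rule add_nonneg_pos) auto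
   then show ?thesis by (simp add: d_def)
  qed
  finally show ?thesis by (simp add: dist_norm norm_minus_commute flip: eq)
 qed
 then show "\<forall>\<^sub>F Y in finite_subsets_at_top I. dist (\<Sum>i\<in>Y. mu (c i) * nu (T i)) (conv mu nu S) < e"
  using F unfolding eventually_finite_subsets_at_top by blast
qed

end

section \<open>Algebras paired with \<open>M_*(G, \<omega>)\<close>\<close>

text \<open>
 Both \<open>M(G, \<omega>)\<close> and \<open>M_*(G, \<omega>)\<^sup>*\<close> act on \<open>M_*(G, \<omega>)\<close>; the locale collects what the two
 actions have in common, so that both algebras are treated at once.
\<close>

locale paired = locally_compact_weighted om
 for om :: "'g::{topological_group_add,t2_space} => real" +
 fixes A :: "'a nspace" (structure)
  and pair :: "'a => 'g cmeasure_functional => complex" and io :: "'g cmeasure => 'a"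
 assumes bA: "banach_algebra A"
  and pair_add1: "a : carrier A ==> b : carrier A ==> th : \<P> ==> pair (a \<oplus> b) th = pair a th + pair b th"
  and pair_smult1: "a : carrier A ==> th : \<P> ==> pair (c \<odot> a) th = c * pair a th"
  and pair_add2: "a : carrier A ==> th : \<P> ==> th' : \<P> ==>
   pair a (%nu. th nu + th' nu) = pair a th + pair a th'"
  and pair_smult2: "a : carrier A ==> th : \<P> ==> pair a (%nu. c * th nu) = c * pair a th"
  and pair_bound: "a : carrier A ==> th : \<P> ==> 0 <= K ==>
   (!!nu. nu : \<M> ==> cmod (th nu) <= K * \<N> nu) ==> cmod (pair a th) <= K * nrm A a"
  and pair_mult: "a : carrier A ==> b : carrier A ==> th : \<P> ==> pair (a \<otimes> b) th =
   pair a (%mu. if mu : \<M> then pair b (functional_measure om th mu) else 0)"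
  and iota_closed: "mu : \<M> ==> io mu : carrier A"
  and pair_iota: "mu : \<M> ==> th : \<P> ==> pair (io mu) th = th mu"
begin

lemma normed_A: "normed_space A"
 using banach_algebra_normed[OF bA] .

lemma mult_closed: "a : carrier A ==> b : carrier A ==> a \<otimes> b : carrier A"
 using bA by (auto simp: banach_algebra_def linear_into_def)

lemma pair_zero: "a : carrier A ==> pair a (%nu. 0) = 0"
 using pair_smult2[of a "%nu. 0" 0] ns_zero_closed[OF normed_M_star] by (simp add: M_star_simps)

lemma pair_series_finite:
 assumes a: "a : carrier A" and F: "finite F" and S: "!!i. i : F ==> compact (S i)"
 shows "pair a (theta_series F be S) = (\<Sum>i\<in>F. be i * pair a (theta (S i)))"
 using F S
proof (induction F)
 case empty
 have "theta_series {} be S = (%nu. 0)" by (auto simp: theta_series_def)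
 then show ?case using pair_zero[OF a] by simp
next
 case (insert i F)
 have "theta_series (insert i F) be S = (%nu. be i * theta (S i) nu + theta_series F be S nu)"
  using insert(1,2) by (auto simp: theta_series_def theta_def fun_eq_iff)
 moreover have "theta (S i) : \<P>" using insert by (intro theta_M_star) auto
 moreover have "(%nu. be i * theta (S i) nu) : \<P>"
  using ns_smult_closed[OF normed_M_star \<open>theta (S i) : \<P>\<close>] by (simp add: M_star_simps)
 moreover have "theta_series F be S : \<P>"
  using insert by (intro theta_series_M_star) auto
 ultimately show ?case using insert a by (simp add: pair_add2 pair_smult2)
qed

text \<open>Absolutely summable coefficients make the series of functionals converge in norm, so the
  bounded functional \<open>pair a\<close> may be applied term by term.\<close>

lemma pair_series:
 assumes a: "a : carrier A" and be: "(%i. norm (be i)) summable_on I" and S: "!!i. i : I ==> compact (S i)"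
 shows "((%i. be i * pair a (theta (S i))) has_sum pair a (theta_series I be S)) I"
proof -
 have sub: "(%i. norm (be i)) summable_on J" if "J \<subseteq> I" for J
  using summable_on_subset_banach[OF be that] .
 have split: "pair a (theta_series I be S) = (\<Sum>i\<in>F. be i * pair a (theta (S i))) + pair a (theta_series (I - F) be S)"
  if F: "finite F" "F \<subseteq> I" for F
 proof -
  have "(\<Sum>\<^sub>\<infinity>i\<in>I. be i * nu (S i)) = (\<Sum>\<^sub>\<infinity>i\<in>F. be i * nu (S i)) + (\<Sum>\<^sub>\<infinity>i\<in>I - F. be i * nu (S i))"
   if nu: "nu : \<M>" for nu
  proof -
   have "(\<Sum>\<^sub>\<infinity>i\<in>F Un (I - F). be i * nu (S i)) = (\<Sum>\<^sub>\<infinity>i\<in>F. be i * nu (S i)) + (\<Sum>\<^sub>\<infinity>i\<in>I - F. be i * nu (S i))"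
    using theta_series_summable(1)[OF sub nu, THEN abs_summable_summable] F
    by (intro infsum_Un_disjoint) auto
   moreover have "F Un (I - F) = I" using F by blast
   ultimately show ?thesis by simp
  qed
  then have "theta_series I be S = (%nu. theta_series F be S nu + theta_series (I - F) be S nu)"
   by (auto simp: theta_series_def)
  moreover have "theta_series F be S : \<P>" "theta_series (I - F) be S : \<P>"
   using F sub S by (auto intro!: theta_series_M_star)
  ultimately show ?thesis using pair_series_finite[OF a F(1), of S be] F S by (simp add: pair_add2[OF a] subset_iff)
 qed
 have tail: "cmod (pair a (theta_series J be S)) <= (\<Sum>\<^sub>\<infinity>i\<in>J. norm (be i)) * nrm A a" if J: "J \<subseteq> I" for J
 proof (rule pair_bound[OF a])
  show "theta_series J be S : \<P>" using J sub S by (intro theta_series_M_star) auto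
  show "cmod (theta_series J be S nu) <= (\<Sum>\<^sub>\<infinity>i\<in>J. norm (be i)) * \<N> nu" if "nu : \<M>" for nu
   using theta_series_summable(2)[OF sub[OF J] that] that by (simp add: theta_series_def)
 qed (simp add: infsum_nonneg)
 show ?thesis
  unfolding has_sum_def
 proof (rule tendstoI)
  fix e :: real assume e: "0 < e"
  have n: "0 <= nrm A a" using ns_nonneg[OF normed_A a] .
  have e': "0 < e / (nrm A a + 1)" using e n by (intro divide_pos_pos add_nonneg_pos) auto
  obtain F where F: "finite F" "F \<subseteq> I" "(\<Sum>\<^sub>\<infinity>i\<in>I - F. norm (be i)) < e / (nrm A a + 1)"
   by (rule infsum_tail_less[OF be _ e']) auto
  have "dist (\<Sum>i\<in>Y. be i * pair a (theta (S i))) (pair a (theta_series I be S)) < e"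
   if Y: "finite Y" "F \<subseteq> Y" "Y \<subseteq> I" for Y
  proof -
   have "dist (\<Sum>i\<in>Y. be i * pair a (theta (S i))) (pair a (theta_series I be S)) = cmod (pair a (theta_series (I - Y) be S))"
    unfolding split[OF Y(1,3)] by (simp add: dist_norm)
   also have "... <= (\<Sum>\<^sub>\<infinity>i\<in>I - Y. norm (be i)) * nrm A a" by (rule tail) auto
   also have "... <= (\<Sum>\<^sub>\<infinity>i\<in>I - F. norm (be i)) * nrm A a"
    using Y sub n by (intro mult_right_mono infsum_mono_neutral) auto
   also have "... <= e / (nrm A a + 1) * nrm A a" using F n by (intro mult_right_mono) auto
   also have "... < e" using e n by (simp add: field_simps)
   finally show ?thesis .
  qed
  then show "\<forall>\<^sub>F Y in finite_subsets_at_top I. dist (\<Sum>i\<in>Y. be i * pair a (theta (S i))) (pair a (theta_series I be S)) < e"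
   using F unfolding eventually_finite_subsets_at_top by blast
 qed
qed

lemma pair_theta_bound:
 assumes a: "a : carrier A" and K: "compact K" shows "cmod (pair a (theta K)) <= nrm A a"
proof -
 have "cmod (pair a (theta K)) <= 1 * nrm A a"
  by (rule pair_bound[OF a theta_M_star[OF K]]) (simp_all add: theta_def cmod_le_nrm)
 then show ?thesis by simp
qed

text \<open>On disjoint compact sets an abstract element behaves like a measure. The test functional
  with coefficients of modulus at most \<open>v i\<close> has norm at most 1, because the sum of
  \<open>v i\<close> times the variation of \<open>S i\<close> stays below the integral of the
  weight.\<close>

lemma pair_summable:
 assumes a: "a : carrier A" and S: "!!i. i : I ==> compact (S i)" and disj: "disjoint_family_on S I"
  and v: "!!i. i : I ==> 0 <= v i" "!!i x. i : I ==> x : S i ==> v i <= om x"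
 shows "(%i. v i * norm (pair a (theta (S i)))) summable_on I"
  "(\<Sum>\<^sub>\<infinity>i\<in>I. v i * norm (pair a (theta (S i)))) <= nrm A a"
proof -
 let ?p = "%i. pair a (theta (S i))"
 have fin: "(\<Sum>i\<in>F. v i * norm (?p i)) <= nrm A a" if F: "finite F" "F \<subseteq> I" for F
 proof -
  \<comment> \<open>The conjugate phase turns each term into its absolute value.\<close>
  define be where "be i = complex_of_real (v i) * cnj (sgn (?p i))" for i
  have "be i * ?p i = complex_of_real (v i * norm (?p i))" for i
  proof -
   have "cnj (sgn z) * z = complex_of_real (norm z)" for z
    by (cases "z = 0") (simp_all add: sgn_eq field_simps complex_norm_square[symmetric] power2_eq_square)
   then show ?thesis by (simp add: be_def mult.assoc)
  qed
  then have "complex_of_real (\<Sum>i\<in>F. v i * norm (?p i)) = pair a (theta_series F be S)"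
   using pair_series_finite[OF a F(1), of S be] F S by (simp add: subset_iff)
  moreover have "cmod (pair a (theta_series F be S)) <= 1 * nrm A a"
  proof (rule pair_bound[OF a])
   show "theta_series F be S : \<P>" using F S by (intro theta_series_M_star) auto
   fix nu assume nu: "nu : \<M>"
   interpret finite_measure "variation nu" using M_carrierD(3)[OF nu] .
   have Sb: "S i : sets borel" if "i : F" for i
    using compact_imp_closed[OF S] that F by (auto intro: borel_closed)
   have "cmod (theta_series F be S nu) <= (\<Sum>i\<in>F. cmod (be i * nu (S i)))"
    using nu F by (simp add: theta_series_def norm_sum)
   also have "... <= (\<Sum>i\<in>F. v i * measure (variation nu) (S i))"
   proof (rule sum_mono)
    fix i assume i: "i : F"
    have "cmod (be i) <= v i" using v(1)[of i] i F by (auto simp: be_def norm_mult norm_sgn)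
    then show "cmod (be i * nu (S i)) <= v i * measure (variation nu) (S i)"
     unfolding norm_mult using cmod_le_measure[OF nu, of "S i"] v(1)[of i] i F by (intro mult_mono) auto
   qed
   also have "... = (LINT x|variation nu. (\<Sum>i\<in>F. v i * indicator (S i) x))"
    using Sb by (subst Bochner_Integration.integral_sum) (auto simp: emeasure_eq_measure)
   also have "... <= (LINT x|variation nu. om x)"
   proof (rule integral_mono)
    show "integrable (variation nu) (%x. \<Sum>i\<in>F. v i * indicator (S i) x)"
     using Sb by (intro Bochner_Integration.integrable_sum) (auto simp: emeasure_eq_measure)
    fix x
    show "(\<Sum>i\<in>F. v i * indicator (S i) x) <= om x"
    proof (cases "EX j:F. x : S j")
     case True
     then obtain j where j: "j : F" "x : S j" by blast
     have "x ~: S i" if "i : F" "i ~= j" for i using disjoint_family_onD[OF disj, of i j] that j F by auto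
     then have "(\<Sum>i\<in>F. v i * indicator (S i) x) = (\<Sum>i\<in>F. if i = j then v j else 0)"
      using j by (intro sum.cong) auto
     also have "... = v j" using j F by simp
     finally show ?thesis using v(2)[of j x] j F by auto
    next
     case False
     then have "(\<Sum>i\<in>F. v i * indicator (S i) x) = 0" by (intro sum.neutral) auto
     then show ?thesis using weightD(2)[of x] by simp
    qed
   qed (rule M_carrierD(4)[OF nu])
   finally show "cmod (theta_series F be S nu) <= 1 * \<N> nu" by (simp add: M_nrm[OF nu])
  qed simp
  ultimately have "cmod (complex_of_real (\<Sum>i\<in>F. v i * norm (?p i))) <= nrm A a" by simp
  then show ?thesis by (simp only: norm_of_real)
 qed
 show s: "(%i. v i * norm (?p i)) summable_on I"
  using fin v(1) by (intro nonneg_bdd_above_summable_on bdd_aboveI2[of _ _ "nrm A a"]) auto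
 show "(\<Sum>\<^sub>\<infinity>i\<in>I. v i * norm (?p i)) <= nrm A a"
  using s fin by (intro infsum_le_finite_sums) auto
qed

lemma pair_norm_summable:
 assumes "a : carrier A" "!!i. i : I ==> compact (S i)" "disjoint_family_on S I"
 shows "(%i. norm (pair a (theta (S i)))) summable_on I" "(\<Sum>\<^sub>\<infinity>i\<in>I. norm (pair a (theta (S i)))) <= nrm A a"
 using pair_summable[OF assms, of "%_. 1"] weightD(1) by auto

lemma functional_measure_theta:
 assumes mu: "mu : \<M>"
 shows "functional_measure om (theta S) mu = (%nu. if nu : \<M> then conv mu nu S else 0)"
 using conv_closed(1)[OF mu] by (auto simp: functional_measure_def theta_def)

text \<open>If a compact \<open>L\<close> carries almost all of \<open>mu\<close>, then only
  measures charging the compact set \<open>- L + S\<close> can contribute more than the small mass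
  of \<open>mu\<close> outside \<open>L\<close>.\<close>

lemma functional_measure_M_star:
 assumes mu: "mu : \<M>" and S: "compact S"
 shows "functional_measure om (theta S) mu : \<P>"
 unfolding functional_measure_theta[OF mu]
proof (rule M_starI[where C = "\<N> mu"])
 fix nu nu' assume "nu : \<M>" "nu' : \<M>"
 then show "(if (%A. nu A + nu' A) : \<M> then conv mu (%A. nu A + nu' A) S else 0) =
  (if nu : \<M> then conv mu nu S else 0) + (if nu' : \<M> then conv mu nu' S else 0)"
  using M_add(1) conv_add_right[OF mu] by simp
next
 fix c nu assume "nu : \<M>"
 then show "(if (%A. c * nu A) : \<M> then conv mu (%A. c * nu A) S else 0) =
  c * (if nu : \<M> then conv mu nu S else 0)"
  using M_smult(1) by (simp add: conv_smult_right)
next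
 fix nu assume nu: "nu : \<M>"
 have "cmod (conv mu nu S) <= \<N> (conv mu nu)" using cmod_le_nrm[OF conv_closed(1)[OF mu nu]] .
 also have "... <= \<N> mu * \<N> nu" using conv_closed(2)[OF mu nu] .
 finally show "cmod (if nu : \<M> then conv mu nu S else 0) <= \<N> mu * \<N> nu" using nu by simp
next
 fix e :: real assume e: "0 < e"
 let ?m = "variation mu"
 interpret m: finite_measure ?m using M_carrierD(3)[OF mu] .
 obtain L where L: "compact L" "measure ?m (UNIV - L) < e"
  using radon_inner[OF M_carrierD(2)[OF mu] _ e, of UNIV] by auto
 let ?K = "{x + y | x y. x : uminus ` L & y : S}"
 have Kc: "compact ?K" by (intro compact_setsum compact_uminus L S)
 have Sb: "S : sets borel" "L : sets borel" "?K : sets borel"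
  using compact_imp_closed[OF S] compact_imp_closed[OF L(1)] compact_imp_closed[OF Kc] by (auto intro: borel_closed)
 have "cmod (conv mu nu S) < e" if nu: "nu : \<M>" "emeasure (variation nu) ?K = 0" "\<N> nu = 1" for nu
 proof -
  interpret n: finite_measure "variation nu" using M_carrierD(3)[OF nu(1)] .
  have pt: "measure (variation nu) {y. x + y : S} <= indicator (UNIV - L) x" for x
  proof (cases "x : L")
   case True
   have "{y. x + y : S} \<subseteq> ?K"
   proof
    fix y assume "y : {y. x + y : S}"
    then have "y = - x + (x + y)" "- x : uminus ` L" "x + y : S" using True by (auto simp: add.assoc[symmetric])
    then show "y : ?K" by blast
   qed
   then have "measure (variation nu) {y. x + y : S} <= measure (variation nu) ?K"
    using Sb by (intro n.finite_measure_mono) auto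
   then show ?thesis using nu(2) True by (simp add: measure_def)
  next
   case False
   then show ?thesis using M_variation_le_nrm[OF nu(1)] nu(3) by simp
  qed
  have "cmod (conv mu nu S) <= measure (variation (conv mu nu)) S"
   using cmod_le_measure[OF conv_closed(1)[OF mu nu(1)]] .
  also have "... <= (LINT x|?m. measure (variation nu) {y. x + y : S})" using cmod_conv_le(2)[OF mu nu(1) Sb(1)] .
  also have "... <= (LINT x|?m. indicator (UNIV - L) x)"
   using cmod_conv_le(1)[OF mu nu(1) Sb(1)] Sb pt by (intro integral_mono) (auto simp: m.emeasure_eq_measure)
  also have "... = measure ?m (UNIV - L)" using Sb by simp
  finally show ?thesis using L by simp
 qed
 then show "EX K. compact K & (ALL nu:\<M>. emeasure (variation nu) K = 0 --> \<N> nu = 1 -->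
   cmod (if nu : \<M> then conv mu nu S else 0) < e)"
  using Kc by (intro exI[of _ ?K]) auto
qed simp

lemma measure_cells_summable:
 assumes nu: "nu : \<M>" and S: "!!i. i : I ==> compact (S i)" "disjoint_family_on S I"
 shows "(%i. norm (nu (S i))) summable_on I"
proof -
 have "(%i. norm (pair (io nu) (theta (S i)))) summable_on I"
  by (rule pair_norm_summable(1)[OF iota_closed[OF nu] S])
 moreover have "pair (io nu) (theta (S i)) = nu (S i)" if "i : I" for i
  using pair_iota[OF nu theta_M_star[OF S(1)[OF that]]] nu by (simp add: theta_def)
 ultimately show ?thesis by (metis (no_types, lifting) summable_on_cong)
qed

text \<open>The functional \<open>mu \<mapsto> pair b (theta S mu)\<close> is itself a series of
  evaluations at the cells, with coefficients \<open>pair b (theta (T i))\<close>;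
  \<open>pair a\<close> is then applied term by term. This is the product formula of measures, valid
  for abstract elements.\<close>

lemma pair_mult_cells:
 assumes a: "a : carrier A" and b: "b : carrier A"
  and c: "!!i. i : I ==> compact (c i)" "disjoint_family_on c I" "(\<Union>i\<in>I. c i) = UNIV"
  and S: "compact S" and T: "!!i x. i : I ==> x : c i ==> {y. x + y : S} = T i"
  and Tc: "!!i. i : I ==> compact (T i)" "disjoint_family_on T I"
 shows "((%i. pair a (theta (c i)) * pair b (theta (T i))) has_sum pair (a \<otimes> b) (theta S)) I"
proof -
 have cb: "c i : sets borel" if "i : I" for i using compact_imp_closed[OF c(1)[OF that]] by (rule borel_closed)
 have Sb: "S : sets borel" using compact_imp_closed[OF S] by (rule borel_closed)
 have "pair b (functional_measure om (theta S) mu) = (\<Sum>\<^sub>\<infinity>i\<in>I. pair b (theta (T i)) * mu (c i))" if mu: "mu : \<M>" for mu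
 proof -
  have "functional_measure om (theta S) mu = theta_series I (%i. mu (c i)) T"
   unfolding functional_measure_theta[OF mu] theta_series_def
  proof (intro ext if_cong refl)
   fix nu assume nu: "nu : \<M>"
   have "((%i. mu (c i) * nu (T i)) has_sum conv mu nu S) I"
    by (rule conv_cells[OF mu nu cb c(2,3) Sb T]) (auto intro: measure_cells_summable[OF nu Tc])
   then show "conv mu nu S = (\<Sum>\<^sub>\<infinity>i\<in>I. mu (c i) * nu (T i))" by (simp add: infsumI)
  qed
  then have "((%i. mu (c i) * pair b (theta (T i))) has_sum pair b (functional_measure om (theta S) mu)) I"
   using pair_series[OF b measure_cells_summable[OF mu c(1,2)] Tc(1)] by simp
  then show ?thesis by (simp add: infsumI mult.commute)
 qed
 then have "pair (a \<otimes> b) (theta S) = pair a (theta_series I (%i. pair b (theta (T i))) c)"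
  unfolding pair_mult[OF a b theta_M_star[OF S]] theta_series_def by (intro arg_cong[of _ _ "pair a"]) auto
 then show ?thesis
  using pair_series[where S = c and I = I, OF a pair_norm_summable(1)[OF b Tc] c(1)] by (simp add: mult.commute)
qed

text \<open>Here the sets \<open>T i\<close> may overlap, as the translates of the Cantor set do.
  Summability becomes a hypothesis, and the right factor comes from a measure, so that
  \<open>pair_iota\<close> evaluates it on the whole functional at once.\<close>

lemma pair_mult_iota:
 assumes a: "a : carrier A" and si: "si : \<M>"
  and c: "!!i. i : I ==> compact (c i)" "disjoint_family_on c I" "(\<Union>i\<in>I. c i) = UNIV"
  and S: "compact S" and T: "!!i x. i : I ==> x : c i ==> {y. x + y : S} = T i"
  and sm: "(%i. norm (si (T i))) summable_on I"
 shows "((%i. pair a (theta (c i)) * si (T i)) has_sum pair (a \<otimes> io si) (theta S)) I"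
proof -
 have cb: "c i : sets borel" if "i : I" for i using compact_imp_closed[OF c(1)[OF that]] by (rule borel_closed)
 have Sb: "S : sets borel" using compact_imp_closed[OF S] by (rule borel_closed)
 have "pair (io si) (functional_measure om (theta S) mu) = (\<Sum>\<^sub>\<infinity>i\<in>I. si (T i) * mu (c i))" if mu: "mu : \<M>" for mu
 proof -
  have "pair (io si) (functional_measure om (theta S) mu) = conv mu si S"
   using pair_iota[OF si functional_measure_M_star[OF mu S]] si by (simp add: functional_measure_theta[OF mu])
  then show ?thesis
   using infsumI[OF conv_cells[OF mu si cb c(2,3) Sb T sm]] by (simp add: mult.commute)
 qed
 then have "pair (a \<otimes> io si) (theta S) = pair a (theta_series I (%i. si (T i)) c)"
  unfolding pair_mult[OF a iota_closed[OF si] theta_M_star[OF S]] theta_series_def by (intro arg_cong[of _ _ "pair a"]) auto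
 then show ?thesis using pair_series[where S = c and I = I, OF a sm c(1)] by (simp add: mult.commute)
qed

end

subsection \<open>Cosets of a compact subgroup\<close>

text \<open>The two-sided translate \<open>g + N + h\<close> (see \<open>cs_image\<close>). Both
  sides are needed: translating such a set by one of its cells leaves a set
  \<open>- k + N + h\<close>.\<close>

definition cs :: "'g::group_add set => 'g => 'g => 'g set" where
 "cs N g h = {x. - g + x - h : N}"

lemma cs_image: "cs N g h = (%n. g + n + h) ` N"
proof (intro equalityI subsetI)
 fix x assume "x : cs N g h"
 moreover have "x = g + (- g + x - h) + h" by (simp add: add.assoc diff_conv_add_uminus minus_add del: add_uminus_conv_diff)
 ultimately show "x : (%n. g + n + h) ` N" unfolding cs_def by blast
next
 fix x assume "x : (%n. g + n + h) ` N"
 then show "x : cs N g h" by (auto simp: cs_def add.assoc diff_conv_add_uminus simp del: add_uminus_conv_diff)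
qed

definition add_subgroup :: "'g::group_add set => bool" where
 "add_subgroup N \<longleftrightarrow> 0 : N & (ALL x:N. ALL y:N. x + y : N) & (ALL x:N. - x : N)"

text \<open>One representative for every coset \<open>N + h\<close>; the side matters since
  \<open>N\<close> need not be normal.\<close>

definition transversal :: "'g::group_add set => 'g set => bool" where
 "transversal N H \<longleftrightarrow> (ALL x. EX! h. h : H & x - h : N)"

lemma transversal_exists:
 assumes N: "add_subgroup N" shows "EX H. transversal N H"
proof -
 define r where "r x = (SOME y. x - y : N)" for x
 have r: "x - r x : N" for x
  unfolding r_def by (rule someI[of _ x]) (use N in \<open>simp add: add_subgroup_def\<close>)
 have eq: "r x = r y" if "x - y : N" for x y
 proof -
  have "x - z : N \<longleftrightarrow> y - z : N" for z
  proof
   assume "x - z : N"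
   moreover have "y - z = - (x - y) + (x - z)" by (simp add: add.assoc diff_conv_add_uminus minus_add del: add_uminus_conv_diff)
   ultimately show "y - z : N" using N that unfolding add_subgroup_def by metis
  next
   assume "y - z : N"
   moreover have "x - z = (x - y) + (y - z)" by (simp add: add.assoc diff_conv_add_uminus minus_add del: add_uminus_conv_diff)
   ultimately show "x - z : N" using N that unfolding add_subgroup_def by metis
  qed
  then show ?thesis by (simp add: r_def)
 qed
 have "EX! h. h : range r & x - h : N" for x
 proof
  show "r x : range r & x - r x : N" using r by blast
  fix h assume "h : range r & x - h : N"
  then obtain z where z: "h = r z" "x - r z : N" by blast
  have "r (r z) = r z" using eq[OF r[of z]] by simp
  then show "h = r x" using eq[OF z(2)] z(1) by simp
 qed
 then show ?thesis unfolding transversal_def by blast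
qed

locale paired_cosets = paired +
 fixes N H :: "'a set"
 assumes cN: "compact N" and sN: "add_subgroup N" and tH: "transversal N H"
begin

lemma N_simps: "0 : N" "x : N ==> y : N ==> x + y : N" "x : N ==> - x : N" "x : N ==> y : N ==> x - y : N"
 using sN unfolding add_subgroup_def by (auto simp: diff_conv_add_uminus simp del: add_uminus_conv_diff)

lemma N_add_left: "n : N ==> n + x : N \<longleftrightarrow> x : N"
 using N_simps(2)[of n x] N_simps(2)[OF N_simps(3)[of n], of "n + x"] by (auto simp: add.assoc[symmetric])

lemma compact_cs: "compact (cs N g h)"
proof -
 have "continuous_on N (%n. g + n + h)" by (intro continuous_intros)
 then show ?thesis unfolding cs_image by (rule compact_continuous_image[OF _ cN])
qed

lemma H_unique: "h : H ==> h' : H ==> x - h : N ==> x - h' : N ==> h = h'"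
 using tH unfolding transversal_def by blast

lemma cs_disjoint: "disjoint_family_on (cs N g) H"
 unfolding disjoint_family_on_def
proof (intro ballI impI)
 fix k k' assume "k : H" "k' : H" "k ~= k'"
 then show "cs N g k Int cs N g k' = {}" using H_unique[of k k'] by (auto simp: cs_def)
qed

lemma cs_cover: "(\<Union>h\<in>H. cs N g h) = UNIV"
proof -
 have "EX h:H. x : cs N g h" for x
 proof -
  obtain h where "h : H" "(- g + x) - h : N" using tH unfolding transversal_def by blast
  then show ?thesis by (auto simp: cs_def)
 qed
 then show ?thesis by auto
qed

lemma cs_translate:
 assumes "x : cs N g k" shows "{y. x + y : cs N g h} = cs N (- k) h"
proof -
 have "- g + (x + y) - h = (- g + x - k) + (k + y - h)" for y
  by (simp add: add.assoc diff_conv_add_uminus minus_add del: add_uminus_conv_diff)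
 then show ?thesis using assms N_add_left by (auto simp: cs_def)
qed

lemma cs_disjoint': "disjoint_family_on (%k. cs N (- k) h) H"
 unfolding disjoint_family_on_def
proof (intro ballI impI)
 fix k k' assume k: "k : H" "k' : H" "k ~= k'"
 show "cs N (- k) h Int cs N (- k') h = {}"
 proof (rule ccontr)
  assume "cs N (- k) h Int cs N (- k') h ~= {}"
  then obtain y where y: "k + y - h : N" "k' + y - h : N" by (auto simp: cs_def)
  have "k - k' = (k + y - h) - (k' + y - h)"
   by (simp add: add.assoc diff_conv_add_uminus minus_add del: add_uminus_conv_diff)
  then have "k - k' : N" using N_simps(4)[OF y] by simp
  then show False using H_unique[of k k' k] k N_simps(1) by simp
 qed
qed

text \<open>Matrix multiplication: the values of an element on the sets \<open>g + N + k\<close> act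
  as its matrix entries, the cells \<open>g + N + k\<close> playing the role of the summation
  index.\<close>

lemma pair_mult_cs:
 assumes "a : carrier A" "b : carrier A"
 shows "((%k. pair a (theta (cs N g k)) * pair b (theta (cs N (- k) h))) has_sum pair (a \<otimes> b) (theta (cs N g h))) H"
 by (rule pair_mult_cells[OF assms compact_cs cs_disjoint cs_cover compact_cs cs_translate compact_cs cs_disjoint'])

text \<open>Equality of all matrix entries. This is the relation that the forms must respect:
  products are compatible with it by \<open>pair_mult_cs\<close>, and modulo it the point mass at 0
  commutes with every element.\<close>

definition eqv :: "'b => 'b => bool" where
 "eqv x x' \<longleftrightarrow> (ALL g h. pair x (theta (cs N g h)) = pair x' (theta (cs N g h)))"

lemma eqv_mult:
 assumes "x : carrier A" "x' : carrier A" "a : carrier A" "eqv x x'"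
 shows "eqv (a \<otimes> x) (a \<otimes> x') & eqv (x \<otimes> a) (x' \<otimes> a)"
 unfolding eqv_def
proof (intro conjI allI)
 fix g h
 show "pair (a \<otimes> x) (theta (cs N g h)) = pair (a \<otimes> x') (theta (cs N g h))"
  using pair_mult_cs[OF assms(3,1), of g h] pair_mult_cs[OF assms(3,2), of g h] assms(4)
  by (auto simp: eqv_def intro: has_sum_unique)
 show "pair (x \<otimes> a) (theta (cs N g h)) = pair (x' \<otimes> a) (theta (cs N g h))"
  using pair_mult_cs[OF assms(1,3), of g h] pair_mult_cs[OF assms(2,3), of g h] assms(4)
  by (auto simp: eqv_def intro: has_sum_unique)
qed

definition e where "e = io (point_mass 0)"

lemma e_closed: "e : carrier A"
 unfolding e_def by (intro iota_closed point_mass_carrier)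

lemma pair_point: "compact K ==> pair (io (point_mass x)) (theta K) = (if x : K then 1 else 0)"
 using pair_iota[OF point_mass_carrier(1) theta_M_star, of K x] point_mass_carrier(1)[of x]
  borel_closed[OF compact_imp_closed, of K]
 by (simp add: theta_def point_mass_def)

lemma has_sum_single:
 fixes f :: "'i => complex"
 assumes "k : I" "!!i. i : I ==> i ~= k ==> f i = 0" "(f has_sum s) I" shows "s = f k"
proof -
 have "(f has_sum f k) {k}" using has_sum_finite[of "{k}" f] by simp
 then have "(f has_sum f k) I" by (rule has_sum_cong_neutral[THEN iffD1, rotated -1]) (use assms in auto)
 from has_sum_unique[OF assms(3) this] show ?thesis .
qed

text \<open>Both products are computed as matrix products, in which only the cell or the translate
  that contains 0 contributes.\<close>

lemma eqv_unit:
 assumes a: "a : carrier A" shows "eqv (a \<otimes> e) (e \<otimes> a)"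
proof -
 have "pair (a \<otimes> e) (theta (cs N g h)) = pair a (theta (cs N g h))" for g h
 proof -
  obtain k where k: "k : H" "h - k : N" using tH unfolding transversal_def by blast
  have kh: "k - h : N" using N_simps(3)[OF k(2)] by simp
  have "pair (a \<otimes> e) (theta (cs N g h)) = pair a (theta (cs N g k)) * pair e (theta (cs N (- k) h))"
  proof (rule has_sum_single[OF k(1) _ pair_mult_cs[OF a e_closed]])
   fix i assume i: "i : H" "i ~= k"
   have "i - h ~: N" using H_unique[of i k h] i k N_simps(3)[of "i - h"] by auto
   then have "0 ~: cs N (- i) h" by (simp add: cs_def)
   then show "pair a (theta (cs N g i)) * pair e (theta (cs N (- i) h)) = 0" by (simp add: e_def pair_point compact_cs)
  qed
  also have "pair e (theta (cs N (- k) h)) = 1" using kh by (simp add: e_def pair_point compact_cs) (simp add: cs_def)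
  also have "cs N g k = cs N g h"
  proof -
   have "(- g + x - k) = (- g + x - h) + (h - k)" "(- g + x - h) = (- g + x - k) + (k - h)" for x
    by (simp_all add: add.assoc diff_conv_add_uminus minus_add del: add_uminus_conv_diff)
   then show ?thesis unfolding cs_def using k(2) kh N_simps(2) by (metis (no_types, lifting))
  qed
  finally show ?thesis by simp
 qed
 moreover have "pair (e \<otimes> a) (theta (cs N g h)) = pair a (theta (cs N g h))" for g h
 proof -
  obtain k where k: "k : H" "- g - k : N" using tH unfolding transversal_def by blast
  have "pair (e \<otimes> a) (theta (cs N g h)) = pair e (theta (cs N g k)) * pair a (theta (cs N (- k) h))"
  proof (rule has_sum_single[OF k(1) _ pair_mult_cs[OF e_closed a]])
   fix i assume i: "i : H" "i ~= k"
   have "- g - i ~: N" using H_unique[of i k "- g"] i k by auto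
   then have "0 ~: cs N g i" by (simp add: cs_def)
   then show "pair e (theta (cs N g i)) * pair a (theta (cs N (- i) h)) = 0" by (simp add: e_def pair_point compact_cs)
  qed
  also have "pair e (theta (cs N g k)) = 1" using k by (simp add: e_def pair_point compact_cs) (simp add: cs_def)
  also have "cs N (- k) h = cs N g h"
  proof -
   have "k + x - h = - (- g - k) + (- g + x - h)" "- g + x - h = (- g - k) + (k + x - h)" for x
    by (simp_all add: add.assoc diff_conv_add_uminus minus_add del: add_uminus_conv_diff)
   then show ?thesis unfolding cs_def using k(2) N_simps by (metis (no_types, lifting) minus_minus)
  qed
  finally show ?thesis by simp
 qed
 ultimately show ?thesis by (simp add: eqv_def)
qed

end

section \<open>Bilinear forms summed over cosets\<close>

lemma infsum_swap_dominated:
 fixes f :: "'i => 'j => complex"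
 assumes u: "(%k. norm (u k :: complex)) summable_on I" and v: "(%h. norm (v h :: complex)) summable_on J"
  and f: "!!k h. k : I ==> h : J ==> norm (f k h) <= B * norm (u k) * norm (v h)" and B: "0 <= B"
 shows "(\<Sum>\<^sub>\<infinity>k\<in>I. \<Sum>\<^sub>\<infinity>h\<in>J. f k h) = (\<Sum>\<^sub>\<infinity>h\<in>J. \<Sum>\<^sub>\<infinity>k\<in>I. f k h)"
proof (rule infsum_swap_banach)
 have in1: "(%h. norm (f k h)) summable_on J" if "k : I" for k
 proof (rule summable_on_comparison_test)
  show "(%h. B * norm (u k) * norm (v h)) summable_on J" using v by (rule summable_on_cmult_right)
 qed (use f[OF that] in auto)
 have "(%k. \<Sum>\<^sub>\<infinity>h\<in>J. norm (f k h)) summable_on I"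
 proof (rule summable_on_comparison_test)
  show "(%k. norm (u k) * (B * (\<Sum>\<^sub>\<infinity>h\<in>J. norm (v h)))) summable_on I" using u by (rule summable_on_cmult_left)
  fix k assume k: "k : I"
  have "(\<Sum>\<^sub>\<infinity>h\<in>J. norm (f k h)) <= (\<Sum>\<^sub>\<infinity>h\<in>J. B * norm (u k) * norm (v h))"
   using in1[OF k] f[OF k] v by (intro infsum_mono summable_on_cmult_right) auto
  also have "... = B * norm (u k) * (\<Sum>\<^sub>\<infinity>h\<in>J. norm (v h))" by (rule infsum_cmult_right) (use v in auto)
  finally show "(\<Sum>\<^sub>\<infinity>h\<in>J. norm (f k h)) <= norm (u k) * (B * (\<Sum>\<^sub>\<infinity>h\<in>J. norm (v h)))" by (simp add: mult_ac)
 qed (auto intro: infsum_nonneg)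
 then have "(%p. norm ((%(k, h). f k h) p)) summable_on I \<times> J"
  using in1 by (subst Infinite_Sum.abs_summable_on_Sigma_iff) (simp add: infsum_nonneg)
 then show "(%(k, h). f k h) summable_on I \<times> J" by (rule abs_summable_summable)
qed

context paired_cosets
begin

text \<open>The common shape of the two kinds of forms used against amenability: coefficients 1 with
  the translates of the Cantor set, and, for \<open>N = {0}\<close>, a coefficient function with
  singletons.\<close>

definition sform :: "('a => complex) => ('a => 'a set) => 'b \<times> 'b => complex" where
 "sform ga T = (%(x, y). if x : carrier A & y : carrier A
  then (\<Sum>\<^sub>\<infinity>k\<in>H. ga k * pair x (theta (cs N 0 k)) * pair y (theta (T k))) else 0)"

context
 fixes ga :: "'a => complex" and T :: "'a => 'a set" and v :: "'a => real" and C :: real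
 assumes Tc: "!!k. k : H ==> compact (T k)"
  and v: "!!k. k : H ==> 0 <= v k" "!!k x. k : H ==> x : cs N 0 k ==> v k <= om x" and C: "0 <= C"
  and bd: "!!k y. k : H ==> y : carrier A ==> norm (ga k) * norm (pair y (theta (T k))) <= C * v k * nrm A y"
begin

lemma sform_summable:
 assumes x: "x : carrier A" and y: "y : carrier A"
 shows "(%k. norm (ga k * pair x (theta (cs N 0 k)) * pair y (theta (T k)))) summable_on H"
  "norm (sform ga T (x, y)) <= C * (nrm A x * nrm A y)"
proof -
 let ?f = "%k. ga k * pair x (theta (cs N 0 k)) * pair y (theta (T k))"
 let ?g = "%k. v k * norm (pair x (theta (cs N 0 k))) * (C * nrm A y)"
 have ny: "0 <= nrm A y" using ns_nonneg[OF normed_A y] .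
 have le: "norm (?f k) <= ?g k" if k: "k : H" for k
 proof -
  have "norm (?f k) = norm (pair x (theta (cs N 0 k))) * (norm (ga k) * norm (pair y (theta (T k))))"
   by (simp add: norm_mult mult_ac)
  also have "... <= norm (pair x (theta (cs N 0 k))) * (C * v k * nrm A y)" using bd[OF k y] by (intro mult_left_mono) auto
  finally show ?thesis by (simp add: mult_ac)
 qed
 note s = pair_summable[where S = "cs N 0" and I = H and v = v, OF x compact_cs cs_disjoint v]
 have gs: "?g summable_on H" using s(1) by (rule summable_on_cmult_left) 
 then show fs: "(%k. norm (?f k)) summable_on H" by (rule summable_on_comparison_test) (use le in auto)
 have "norm (sform ga T (x, y)) <= (\<Sum>\<^sub>\<infinity>k\<in>H. norm (?f k))"
  using norm_infsum_bound[OF fs] x y by (simp add: sform_def)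
 also have "... <= (\<Sum>\<^sub>\<infinity>k\<in>H. ?g k)" using fs gs le by (rule infsum_mono)
 also have "... = (\<Sum>\<^sub>\<infinity>k\<in>H. v k * norm (pair x (theta (cs N 0 k)))) * (C * nrm A y)"
  by (rule infsum_cmult_left) (use s in auto)
 also have "... <= nrm A x * (C * nrm A y)" using s(2) ny C by (intro mult_right_mono) auto
 finally show "norm (sform ga T (x, y)) <= C * (nrm A x * nrm A y)" by (simp add: mult_ac)
qed

lemma sform_bforms: "sform ga T : bforms A eqv"
proof -
 note sm = sform_summable(1)[THEN abs_summable_summable]
 have cl: "x \<oplus> y : carrier A" "c \<odot> x : carrier A" if "x : carrier A" "y : carrier A" for x y c
  using that ns_add_closed[OF normed_A] ns_smult_closed[OF normed_A] by auto
 have th: "theta (cs N 0 k) : \<P>" for k using theta_M_star[OF compact_cs] .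
 have th': "theta (T k) : \<P>" if "k : H" for k using theta_M_star[OF Tc[OF that]] .
 have 1: "sform ga T (x \<oplus> x', y) = sform ga T (x, y) + sform ga T (x', y)"
  if "x : carrier A" "x' : carrier A" "y : carrier A" for x x' y
  using infsum_add[OF sm[OF that(1,3)] sm[OF that(2,3)]] that cl
  by (simp add: sform_def pair_add1 th distrib_left distrib_right)
 have 2: "sform ga T (x, y \<oplus> y') = sform ga T (x, y) + sform ga T (x, y')"
  if "x : carrier A" "y : carrier A" "y' : carrier A" for x y y'
  using infsum_add[OF sm[OF that(1,2)] sm[OF that(1,3)]] that cl
  by (simp add: sform_def pair_add1 th' distrib_left cong: infsum_cong)
 have 3: "sform ga T (c \<odot> x, y) = c * sform ga T (x, y)" if "x : carrier A" "y : carrier A" for c x y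
  using that cl infsum_cmult_right'[of c "%k. ga k * pair x (theta (cs N 0 k)) * pair y (theta (T k))" H]
  by (simp add: sform_def pair_smult1 th mult_ac)
 have 4: "sform ga T (x, c \<odot> y) = c * sform ga T (x, y)" if "x : carrier A" "y : carrier A" for c x y
  using that cl infsum_cmult_right'[of c "%k. ga k * pair x (theta (cs N 0 k)) * pair y (theta (T k))" H]
  by (simp add: sform_def pair_smult1 th' mult_ac cong: infsum_cong)
 have 5: "sform ga T (x, y) = sform ga T (x', y)"
  if "x : carrier A" "x' : carrier A" "y : carrier A" "eqv x x'" for x x' y
  using that by (simp add: sform_def eqv_def)
 have 6: "EX K>=0. ALL x:carrier A. ALL y:carrier A. cmod (sform ga T (x, y)) <= K * (nrm A x * nrm A y)"
  using sform_summable(2) C by blast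
 have 7: "sform ga T (x, y) = 0" if "x ~: carrier A \<or> y ~: carrier A" for x y using that by (auto simp: sform_def)
 show ?thesis
  unfolding bforms_def
  by (intro CollectI conjI ballI allI impI) (fact 6 | (rule 7 1 2 3 4; assumption) | (rule 5; assumption))+
qed

end

text \<open>
 The form \<open>F x y = \<Sum>\<^sub>k \<langle>x, N + k\<rangle> \<langle>y, - k + P\<rangle>\<close> turns the derivation into a contradiction:
 with \<open>a\<close> the element given by \<open>si\<close>, both \<open>F (a x) y\<close> and \<open>F x (y a) - F (x y) a\<close> vanish,
 whereas \<open>F e a = si P\<close>.
\<close>

theorem not_amenable:
 fixes j :: "('b \<times> 'b => complex) => 'e"
 assumes j: "inj j" and si: "si : \<M>" and P: "compact P" "!!n p. n : N ==> p : P ==> n + p : P"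
  and null: "!!k. si (cs N 0 k) = 0" and pos: "si P ~= 0"
  and sm: "(%k. norm (si {z. k + z : P})) summable_on H"
 shows "~ amenable TYPE('e) A"
proof
 assume am: "amenable TYPE('e) A"
 obtain \<T> C where \<T>: "!!F c. F : bforms A eqv ==> \<T> (%p. c * F p) = c * \<T> F"
  "!!F a. F : bforms A eqv ==> a : carrier A ==> - F (e, a) = \<T> (bform_ract A F a) - \<T> (bform_lact A a F)"
  by (rule amenable_bforms[where R = eqv, OF bA eqv_mult am j e_closed eqv_unit]) auto
 define Q where "Q k = {z. k + z : P}" for k
 have Qc: "compact (Q k)" for k unfolding Q_def by (rule compact_translate'[OF P(1)])
 have QN: "n : N ==> n + p : P \<longleftrightarrow> p : P" for n p
  using P(2)[of n p] P(2)[OF N_simps(3)[of n], of "n + p"] by (auto simp: add.assoc[symmetric])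
 let ?F = "sform (%_. 1) Q" and ?a = "io si"
 have a: "?a : carrier A" by (rule iota_closed[OF si])
 have pa: "pair ?a (theta K) = si K" if "compact K" for K
  using pair_iota[OF si theta_M_star[OF that]] si by (simp add: theta_def)
 have bd: "norm (1::complex) * norm (pair y (theta (Q k))) <= 1 * 1 * nrm A y" if "y : carrier A" for y k
  using pair_theta_bound[OF that Qc] by simp
 have F: "?F : bforms A eqv"
  by (rule sform_bforms[where v = "%_. 1" and C = 1]) (use Qc weightD(1) bd in auto)
 \<comment> \<open>Every entry of the product \<open>a x\<close> at \<open>N + k\<close> is a sum
   with factors \<open>si (N + h)\<close>, all of which vanish.\<close>
 have r: "bform_ract A ?F ?a = (%p. 0)"
 proof -
  have "pair (?a \<otimes> x) (theta (cs N 0 k)) = 0" if "x : carrier A" for x k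
   using pair_mult_cs[OF a that, of 0 k] has_sum_0[of H] by (simp add: pa compact_cs null has_sum_unique)
  then show ?thesis by (auto simp: bform_ract_def sform_def)
 qed
 \<comment> \<open>Associativity of the matrix product: both values are the double sum of
   \<open>x_k y_kh si (- h + P)\<close>, taken in the two orders.\<close>
 have l: "bform_lact A ?a ?F = (%p. 0)"
 proof -
  have "?F (x, y \<otimes> ?a) = ?F (x \<otimes> y, ?a)" if x: "x : carrier A" and y: "y : carrier A" for x y
  proof -
   let ?x = "%k. pair x (theta (cs N 0 k))" and ?y = "%k h. pair y (theta (cs N (- k) h))" and ?s = "%h. si (Q h)"
   have e1: "pair (y \<otimes> ?a) (theta (Q k)) = (\<Sum>\<^sub>\<infinity>h\<in>H. ?y k h * ?s h)" for k
   proof -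
    have "((%h. ?y k h * ?s h) has_sum pair (y \<otimes> ?a) (theta (Q k))) H"
    proof (rule pair_mult_iota[OF y si compact_cs cs_disjoint cs_cover Qc])
     fix h z assume "z : cs N (- k) h"
     then have n: "k + z - h : N" by (simp add: cs_def)
     \<comment> \<open>On the cell \<open>- k + N + h\<close> the left translate of
       \<open>- k + P\<close> depends only on \<open>h\<close>, because \<open>P\<close> absorbs
       \<open>N\<close> from the left.\<close>
     have "k + (z + y) = (k + z - h) + (h + y)" for y
      by (simp add: add.assoc diff_conv_add_uminus del: add_uminus_conv_diff)
     then show "{y. z + y : Q k} = Q h" using QN[OF n] by (simp add: Q_def)
    qed (use sm in \<open>simp add: Q_def\<close>)
    then show ?thesis by (simp add: infsumI)
   qed
   have e2: "pair (x \<otimes> y) (theta (cs N 0 h)) = (\<Sum>\<^sub>\<infinity>k\<in>H. ?x k * ?y k h)" for h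
    using pair_mult_cs[OF x y, of 0 h] by (simp add: infsumI)
   have ay: "y \<otimes> ?a : carrier A" "x \<otimes> y : carrier A" using a x y mult_closed by auto
   have "?F (x, y \<otimes> ?a) = (\<Sum>\<^sub>\<infinity>k\<in>H. \<Sum>\<^sub>\<infinity>h\<in>H. ?x k * ?y k h * ?s h)"
    using x ay by (simp add: sform_def e1 infsum_cmult_right' mult.assoc)
   also have "... = (\<Sum>\<^sub>\<infinity>h\<in>H. \<Sum>\<^sub>\<infinity>k\<in>H. ?x k * ?y k h * ?s h)"
   proof (rule infsum_swap_dominated[where B = "nrm A y" and u = ?x and v = ?s])
    show "(%k. norm (?x k)) summable_on H" by (rule pair_norm_summable(1)[OF x compact_cs cs_disjoint])
    show "(%h. norm (?s h)) summable_on H" using sm by (simp add: Q_def)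
    show "norm (?x k * ?y k h * ?s h) <= nrm A y * norm (?x k) * norm (?s h)" for k h
     using mult_right_mono[OF pair_theta_bound[OF y compact_cs[of "- k" h]], of "norm (?x k) * norm (?s h)"]
     by (simp add: norm_mult mult_ac)
   qed (use ns_nonneg[OF normed_A y] in simp)
   also have "... = ?F (x \<otimes> y, ?a)"
    using ay a by (simp add: sform_def e2 pa Qc infsum_cmult_left')
   finally show ?thesis .
  qed
  then show ?thesis by (auto simp: bform_lact_def)
 qed
 have "\<T> (%p. 0) = 0" using \<T>(1)[OF F, of 0] by simp
 then have "?F (e, ?a) = 0" using \<T>(2)[OF F a] r l by simp
 \<comment> \<open>Only the representative \<open>k\<close> of \<open>N\<close> itself has
   \<open>0\<close> in \<open>N + k\<close>, and for it \<open>- k + P = P\<close>.\<close>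
 moreover have "?F (e, ?a) = si P"
 proof -
  obtain k where k: "k : H" "0 - k : N" using tH unfolding transversal_def by blast
  have kN: "k : N" using N_simps(3)[OF k(2)] by simp
  have z: "pair e (theta (cs N 0 i)) = (if i = k then 1 else 0)" if "i : H" for i
  proof -
   have "0 : cs N 0 i \<longleftrightarrow> i = k"
    using H_unique[of i k 0] that k by (auto simp: cs_def)
   then show ?thesis by (simp add: e_def pair_point compact_cs)
  qed
  have "?F (e, ?a) = (\<Sum>\<^sub>\<infinity>i\<in>H. pair e (theta (cs N 0 i)) * si (Q i))"
   using e_closed a by (simp add: sform_def pa Qc)
  also have "... = (\<Sum>\<^sub>\<infinity>i\<in>{k}. pair e (theta (cs N 0 i)) * si (Q i))"
   using k z by (intro infsum_cong_neutral) auto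
  also have "... = si (Q k)" using z[OF k(1)] by simp
  also have "Q k = P" using QN[OF kN] by (auto simp: Q_def)
  finally show ?thesis .
 qed
 ultimately show False using pos by simp
qed

end

section \<open>Invariant functionals from amenability\<close>

context paired
begin

text \<open>Let \<open>F_g\<close> be the form with coefficients \<open>ph\<close> and singletons
  \<open>{- k + g}\<close>. The point mass at \<open>g\<close> acts on it from the right by shifting
  \<open>ph\<close>, which gives a form \<open>F_0\<close>; from the left it produces
  \<open>F_0\<close> for \<open>ph\<close>, minus \<open>ph 0\<close> times \<open>F_0\<close> for
  the constant 1. The derivation identity then says that the value of \<Theta> on \<open>F_0\<close>
  is shift invariant as a functional of \<open>ph\<close>.\<close>

lemma invariant_functional:
 fixes j :: "('a \<times> 'a => complex) => 'e"
 assumes am: "amenable TYPE('e) A" and j: "inj j"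
 obtains m :: "('g => real) => real" and K where
  "!!f g C D. (!!x. \<bar>f x\<bar> <= C * weight_star om x) ==> (!!x. \<bar>g x\<bar> <= D * weight_star om x) ==> m (%x. f x + g x) = m f + m g"
  "!!f C c. (!!x. \<bar>f x\<bar> <= C * weight_star om x) ==> m (%x. c * f x) = c * m f"
  "!!f C. 0 <= C ==> (!!x. \<bar>f x\<bar> <= C * weight_star om x) ==> m f <= K * C"
  "m (%x. 1) = 1"
  "!!f C g. (!!x. \<bar>f x\<bar> <= C * weight_star om x) ==> m (%x. f (g + x)) = m f"
proof -
 have sub: "add_subgroup {0 :: 'g}" by (simp add: add_subgroup_def)
 have tr: "transversal {0 :: 'g} UNIV" by (auto simp: transversal_def)
 interpret P: paired_cosets om A pair io "{0}" UNIV
  by unfold_locales (use sub tr in auto)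
 have cs0: "cs {0} g h = {g + h}" for g h :: 'g
  by (auto simp: cs_image)
 have w1: "1 <= om x" "0 <= om x" for x using weightD(1)[of x] by auto
 have ws: "weight_star om x = om x * om (- x)" for x by (simp add: weight_star_def)
 have ws1: "1 <= weight_star om x" for x
  unfolding ws using mult_mono[of 1 "om x" 1 "om (- x)"] w1 by simp
 obtain \<T> C0 where \<T>: "!!F G. F : bforms A P.eqv ==> G : bforms A P.eqv ==> \<T> (%p. F p + G p) = \<T> F + \<T> G"
  "!!F c. F : bforms A P.eqv ==> \<T> (%p. c * F p) = c * \<T> F"
  "!!F K. F : bforms A P.eqv ==> 0 <= K ==>
   (!!x y. x : carrier A ==> y : carrier A ==> cmod (F (x, y)) <= K * (nrm A x * nrm A y)) ==> cmod (\<T> F) <= C0 * K"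
  "!!F a. F : bforms A P.eqv ==> a : carrier A ==> - F (P.e, a) = \<T> (bform_ract A F a) - \<T> (bform_lact A a F)"
  by (rule amenable_bforms[where R = P.eqv, OF bA P.eqv_mult am j P.e_closed P.eqv_unit]) auto
 define co where "co x s = pair x (theta {s})" for x s
 \<comment> \<open>The mass at \<open>t\<close> is weighted by \<open>om t\<close>; this is what
   allows coefficients \<open>ph\<close> as large as \<open>weight_star om\<close>.\<close>
 have co_bound: "om t * norm (co y t) <= nrm A y" if y: "y : carrier A" for y t
 proof -
  have "cmod (pair y (%nu. complex_of_real (om t) * theta {t} nu)) <= 1 * nrm A y"
  proof (rule pair_bound[OF y])
   show "(%nu. complex_of_real (om t) * theta {t} nu) : \<P>"
    using ns_smult_closed[OF normed_M_star theta_M_star[of "{t}"]] by (simp add: M_star_simps)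
   fix nu assume nu: "nu : \<M>"
   interpret finite_measure "variation nu" using M_carrierD(3)[OF nu] .
   have "cmod (complex_of_real (om t) * theta {t} nu) = om t * cmod (nu {t})"
    using nu w1(2)[of t] by (simp add: theta_def norm_mult)
   also have "... <= om t * measure (variation nu) {t}"
    using cmod_le_measure[OF nu, of "{t}"] w1(2) by (rule mult_left_mono)
   also have "... = (LINT x|variation nu. om t * indicator {t} x)" by simp
   also have "... <= (LINT x|variation nu. om x)"
   proof (rule integral_mono)
    have "integrable (variation nu) (indicator {t} :: 'g => real)"
     by (rule integrable_real_indicator) (auto simp: emeasure_eq_measure)
    then show "integrable (variation nu) (%x. om t * indicator {t} x)" by (rule integrable_mult_right)
   qed (use M_carrierD(4)[OF nu] w1 in \<open>auto simp: indicator_def\<close>)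
   finally show "cmod (complex_of_real (om t) * theta {t} nu) <= 1 * \<N> nu" by (simp add: M_nrm[OF nu])
  qed simp
  then show ?thesis
   using pair_smult2[OF y theta_M_star[of "{t}"], of "complex_of_real (om t)"] w1(2)[of t]
   by (simp add: co_def norm_mult)
 qed
 define F where "F ph g = P.sform (%k. complex_of_real (ph k)) (%k. {- k + g})" for ph :: "'g => real" and g
 have Fe: "F ph g (x, y) = (\<Sum>\<^sub>\<infinity>k. complex_of_real (ph k) * co x k * co y (- k + g))"
  if "x : carrier A" "y : carrier A" for ph g x y
  using that by (simp add: F_def P.sform_def co_def cs0)
 have Fz: "F ph g (x, y) = 0" if "x ~: carrier A \<or> y ~: carrier A" for ph g x y
  using that by (auto simp: F_def P.sform_def)
 have Fprem: "norm (complex_of_real (ph k)) * norm (pair y (theta {- k + g})) <= C * om k * nrm A y"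
  if ph: "!!k. \<bar>ph k\<bar> <= C * (om k * om (- k + g))" and C: "0 <= C" and y: "y : carrier A" for ph C g k y
 proof -
  have "\<bar>ph k\<bar> * norm (co y (- k + g)) <= C * (om k * om (- k + g)) * norm (co y (- k + g))"
   using ph by (rule mult_right_mono) simp
  also have "... = C * om k * (om (- k + g) * norm (co y (- k + g)))" by (simp add: mult_ac)
  also have "... <= C * om k * nrm A y"
   using co_bound[OF y] C w1(2) by (intro mult_left_mono) auto
  finally show ?thesis by (simp add: co_def)
 qed
 have Fb: "F ph g : bforms A P.eqv" if ph: "!!k. \<bar>ph k\<bar> <= C * (om k * om (- k + g))" and C: "0 <= C" for ph C g
  unfolding F_def
  by (rule P.sform_bforms[where v = om and C = C]) (use Fprem[OF ph C] C w1 in \<open>auto simp: cs0\<close>)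
 have Fbd: "cmod (F ph g (x, y)) <= C * (nrm A x * nrm A y)"
  if ph: "!!k. \<bar>ph k\<bar> <= C * (om k * om (- k + g))" and C: "0 <= C" and "x : carrier A" "y : carrier A" for ph C g x y
  unfolding F_def
  by (rule P.sform_summable(2)[where v = om and C = C]) (use Fprem[OF ph C] C w1 that in \<open>auto simp: cs0\<close>)
 have Fs: "(%k. norm (complex_of_real (ph k) * co x k * co y (- k + g))) summable_on UNIV"
  if ph: "!!k. \<bar>ph k\<bar> <= C * (om k * om (- k + g))" and C: "0 <= C" and "x : carrier A" "y : carrier A" for ph C g x y
  using P.sform_summable(1)[where v = om and C = C and ga = "%k. complex_of_real (ph k)" and T = "%k. {- k + g}", OF _ _ _ C _ that(3,4)]
   Fprem[OF ph C] w1 by (simp add: cs0 co_def)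
 \<comment> \<open>Domination by \<open>weight_star om\<close> bounds the form for
   \<open>g = 0\<close>; this inequality shows that it bounds the form for every \<open>g\<close>,
   at the cost of the factor \<open>om (- g)\<close>.\<close>
 have shift: "om k * om (- k) <= om (- g) * (om k * om (- k + g))" for k g
 proof -
  have "om (- k) <= om (- k + g) * om (- g)" using weightD(4)[of "- k + g" "- g"] by (simp add: add.assoc)
  from mult_left_mono[OF this w1(2)[of k]] show ?thesis by (simp add: mult_ac)
 qed
 have prod: "co (x \<otimes> y) s = (\<Sum>\<^sub>\<infinity>k. co x k * co y (- k + s))" if "x : carrier A" "y : carrier A" for x y s
  using P.pair_mult_cs[OF that, of 0 s] by (simp add: cs0 co_def infsumI)
 define d where "d g = io (point_mass g)" for g
 have dA: "d g : carrier A" for g unfolding d_def by (intro iota_closed point_mass_carrier)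
 have cod: "co (d g) s = (if s = g then 1 else 0)" for g s
  by (auto simp: co_def d_def P.pair_point)
 have single: "(\<Sum>\<^sub>\<infinity>k. f k) = f k0" if "!!k. k ~= k0 ==> f k = 0" for f :: "'g => complex" and k0
  using infsum_cong_neutral[of UNIV "{k0}" f f] that by simp
 have left: "co (d g \<otimes> x) s = co x (- g + s)" if x: "x : carrier A" for g x s
  unfolding prod[OF dA x] by (subst single[of g]) (auto simp: cod)
 have right: "co (x \<otimes> d g) s = co x (s - g)" if x: "x : carrier A" for g x s
 proof -
  have "- k + s = g \<longleftrightarrow> k = s - g" for k
   by (metis add.assoc add_minus_cancel diff_add_cancel minus_add_cancel)
  then show ?thesis unfolding prod[OF x dA] by (subst single[of "s - g"]) (auto simp: cod)
 qed
 have kg: "- k + g = g \<longleftrightarrow> k = 0" for k g :: 'g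
  using add_right_cancel[of "- k" g 0] by simp
 have Pe: "P.e = d 0" by (simp add: P.e_def d_def)
 define tt where "tt ph = \<T> (F ph 0)" for ph
 have F0: "F ph 0 : bforms A P.eqv" if "!!x. \<bar>ph x\<bar> <= C * weight_star om x" "0 <= C" for ph C
  using Fb[of ph C 0] that by (simp add: ws)
 have ident: "- complex_of_real (ph 0) = tt (%x. ph (g + x)) - (tt ph - complex_of_real (ph 0) * tt (%x. 1))"
  if ph: "!!x. \<bar>ph x\<bar> <= C * weight_star om x" and C: "0 <= C" for ph C g
 proof -
  have phg: "\<bar>ph k\<bar> <= (C * om (- g)) * (om k * om (- k + g))" for k
   using order_trans[OF ph[of k, unfolded ws] mult_left_mono[OF shift[of k g] C]] by (simp add: mult_ac)
  have Cg: "0 <= C * om (- g)" using C w1 by simp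
  note Fg = Fb[OF phg Cg]
  have "F ph g (P.e, d g) = complex_of_real (ph 0)"
   unfolding Fe[OF P.e_closed dA] by (subst single[of 0]) (auto simp: Pe cod)
  moreover have "bform_ract A (F ph g) (d g) = F (%x. ph (g + x)) 0"
  proof
   fix p :: "'a \<times> 'a"
   obtain x y where p: "p = (x, y)" by fastforce
   have "(\<Sum>\<^sub>\<infinity>k. complex_of_real (ph k) * co x (- g + k) * co y (- k + g)) =
     (\<Sum>\<^sub>\<infinity>u. complex_of_real (ph (g + u)) * co x u * co y (- u + 0))"
    by (rule infsum_reindex_bij_witness[of _ "%u. g + u" "%k. - g + k"]) (auto simp: add.assoc[symmetric] minus_add)
   then show "bform_ract A (F ph g) (d g) p = F (%x. ph (g + x)) 0 p"
    using mult_closed[OF dA] by (auto simp: bform_ract_def p Fe left Fz)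
  qed
  moreover have "bform_lact A (d g) (F ph g) = (%p. F ph 0 p + (- complex_of_real (ph 0)) * F (%x. 1) 0 p)"
  proof
   fix p :: "'a \<times> 'a"
   obtain x y where p: "p = (x, y)" by fastforce
   have "F ph g (x \<otimes> y, d g) = complex_of_real (ph 0) * (\<Sum>\<^sub>\<infinity>k. co x k * co y (- k))"
    if "x : carrier A" "y : carrier A"
    using that mult_closed prod[OF that, of 0] unfolding Fe[OF mult_closed[OF that] dA]
    by (subst single[of 0]) (auto simp: cod kg)
   then show "bform_lact A (d g) (F ph g) p = F ph 0 p + (- complex_of_real (ph 0)) * F (%x. 1) 0 p"
    using mult_closed[OF _ dA] by (auto simp: bform_lact_def p Fe right Fz diff_conv_add_uminus add.assoc simp del: add_uminus_conv_diff)
  qed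
  moreover have "\<T> (%p. F ph 0 p + (- complex_of_real (ph 0)) * F (%x. 1) 0 p) = tt ph - complex_of_real (ph 0) * tt (%x. 1)"
  proof -
   have 1: "F (%x. 1) 0 : bforms A P.eqv" using F0[of "%x. 1" 1] ws1 by simp
   have "ALL c. ALL f:bforms A P.eqv. (%p. c * f p) : bforms A P.eqv"
    using pointwise_bform_space[where R = P.eqv, OF bA P.eqv_mult] by (simp add: pointwise_space_def bform_space_def)
   from bspec[OF spec[OF this] 1]
   have "(%p. (- complex_of_real (ph 0)) * F (%x. 1) 0 p) : bforms A P.eqv" .
   from \<T>(1)[OF F0[OF ph C] this] show ?thesis
    unfolding \<T>(2)[OF 1] tt_def by simp
  qed
  ultimately show ?thesis using \<T>(4)[OF Fg dA[of g]] by (simp add: tt_def)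
 qed
 \<comment> \<open>The constant function at \<open>g = 0\<close> fixes the normalisation. Inserted
   into \<open>ident\<close>, it cancels the terms with \<open>ph 0\<close>; the sign is the reason
   for taking \<open>- Re (tt f)\<close> as the functional.\<close>
 have t1: "tt (%x. 1) = -1"
  using ident[of "%x. 1" 1 0] ws1 by simp
 have inv: "tt (%x. ph (g + x)) = tt ph" if "!!x. \<bar>ph x\<bar> <= C * weight_star om x" "0 <= C" for ph C g
  using ident[OF that, of g] by (simp add: t1)
 \<comment> \<open>The bounds in the conclusion do not fix the sign of \<open>C\<close>; the value
   at 0 does.\<close>
 have Cnn: "0 <= C" if "!!x. \<bar>f x\<bar> <= C * weight_star om x" for f :: "'g => real" and C
 proof -
  have "0 <= C * weight_star om 0" using that[of 0] by (rule order_trans[OF abs_ge_zero])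
  then show ?thesis using ws1[of 0] by (simp add: zero_le_mult_iff)
 qed
 show thesis
 proof (rule that[of "%f. - Re (tt f)" C0])
  fix f g :: "'g => real" and C D
  assume f: "!!x. \<bar>f x\<bar> <= C * weight_star om x" and g: "!!x. \<bar>g x\<bar> <= D * weight_star om x"
  have "F (%x. f x + g x) 0 = (%p. F f 0 p + F g 0 p)"
  proof
   fix p :: "'a \<times> 'a"
   obtain x y where p: "p = (x, y)" by fastforce
   show "F (%x. f x + g x) 0 p = F f 0 p + F g 0 p"
   proof (cases "x : carrier A & y : carrier A")
    case True
    then have "(%k. complex_of_real (f k) * co x k * co y (- k + 0)) summable_on UNIV"
     "(%k. complex_of_real (g k) * co x k * co y (- k + 0)) summable_on UNIV"
     using Fs[of f C 0 x y] Fs[of g D 0 x y] f g Cnn[OF f] Cnn[OF g] by (auto simp: ws intro: abs_summable_summable)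
    from infsum_add[OF this] show ?thesis using True by (simp add: p Fe distrib_right)
   qed (auto simp: p Fz)
  qed
  then show "- Re (tt (%x. f x + g x)) = - Re (tt f) + - Re (tt g)"
   using \<T>(1)[OF F0[OF f Cnn[OF f]] F0[OF g Cnn[OF g]]] by (simp add: tt_def)
 next
  fix f :: "'g => real" and C c assume f: "!!x. \<bar>f x\<bar> <= C * weight_star om x"
  have "F (%x. c * f x) 0 = (%p. complex_of_real c * F f 0 p)"
  proof
   fix p :: "'a \<times> 'a"
   obtain x y where p: "p = (x, y)" by fastforce
   show "F (%x. c * f x) 0 p = complex_of_real c * F f 0 p"
    by (cases "x : carrier A & y : carrier A") (auto simp: p Fe Fz mult.assoc infsum_cmult_right')
  qed
  then show "- Re (tt (%x. c * f x)) = c * - Re (tt f)"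
   using \<T>(2)[OF F0[OF f Cnn[OF f]]] by (simp add: tt_def)
 next
  fix f :: "'g => real" and C assume C: "0 <= C" and f: "!!x. \<bar>f x\<bar> <= C * weight_star om x"
  have "cmod (tt f) <= C0 * C"
   unfolding tt_def by (rule \<T>(3)[OF F0[OF f C] C]) (use Fbd[of f C 0] f C in \<open>simp add: ws\<close>)
  then show "- Re (tt f) <= C0 * C" using abs_Re_le_cmod[of "tt f"] by linarith
 next
  show "- Re (tt (%x. 1)) = 1" by (simp add: t1)
 next
  fix f :: "'g => real" and C g assume f: "!!x. \<bar>f x\<bar> <= C * weight_star om x"
  show "- Re (tt (%x. f (g + x))) = - Re (tt f)" using inv[OF f Cnn[OF f]] by simp
 qed
qed

end

section \<open>From an invariant functional to a bounded \<open>weight_star om\<close> and an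
  invariant mean\<close>

locale star_functional = weighted_group om
 for om :: "'g::{topological_group_add,t2_space} => real" +
 fixes m :: "('g => real) => real" and K :: real
 assumes m_add: "(!!x. \<bar>f x\<bar> <= C * weight_star om x) ==> (!!x. \<bar>g x\<bar> <= D * weight_star om x) ==>
   m (%x. f x + g x) = m f + m g"
  and m_scale: "(!!x. \<bar>f x\<bar> <= C * weight_star om x) ==> m (%x. c * f x) = c * m f"
  and m_bound: "0 <= C ==> (!!x. \<bar>f x\<bar> <= C * weight_star om x) ==> m f <= K * C"
  and m_one: "m (%x. 1) = 1"
  and m_inv: "(!!x. \<bar>f x\<bar> <= C * weight_star om x) ==> m (%x. f (a + x)) = m f"
begin

abbreviation "W == weight_star om"

lemma W1: "1 <= W x"
 unfolding weight_star_def using mult_mono[of 1 "om x" 1 "om (- x)"] weightD(1)[of x] weightD(1)[of "- x"] by simp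

lemma W_submult: "W (x + y) <= W x * W y"
proof -
 have "om (x + y) * om (- y - x) <= (om x * om y) * (om (- y) * om (- x))"
  using weightD(4)[of x y] weightD(4)[of "- y" "- x"] order_trans[OF zero_le_one weightD(1)]
  by (intro mult_mono mult_nonneg_nonneg) auto
 then show ?thesis by (simp add: weight_star_def minus_add mult_ac)
qed

lemma W_minus: "W (- x) = W x" by (simp add: weight_star_def)

text \<open>The functional \<open>m\<close> need not be positive. On nonnegative functions this is
  its positive part in the sense of Riesz; it keeps the invariance, and its value at 1 is still at
  least 1.\<close>

definition p :: "('g => real) => real" where
 "p ph = Sup {m h | h. ALL x. 0 <= h x & h x <= ph x}"

definition dom :: "('g => real) => bool" where
 "dom ph \<longleftrightarrow> (ALL x. 0 <= ph x) & (EX C>=0. ALL x. ph x <= C * W x)"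

lemma p_upper:
 assumes ph: "dom ph" and h: "!!x. 0 <= h x" "!!x. h x <= ph x" shows "m h <= p ph"
 unfolding p_def
proof (rule cSup_upper)
 show "m h : {m h | h. ALL x. 0 <= h x & h x <= ph x}" using h by auto
 obtain C where C: "0 <= C" "!!x. ph x <= C * W x" using ph by (auto simp: dom_def)
 show "bdd_above {m h | h. ALL x. 0 <= h x & h x <= ph x}"
 proof (rule bdd_aboveI[of _ "K * C"], clarify)
  fix h assume h: "ALL x. 0 <= h x & h x <= ph x"
  show "m h <= K * C"
   by (rule m_bound[OF C(1)]) (use h order_trans[OF _ C(2)] in auto)
 qed
qed

lemma p_least:
 assumes ph: "dom ph" and h: "!!h. (!!x. 0 <= h x) ==> (!!x. h x <= ph x) ==> m h <= b" shows "p ph <= b"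
 unfolding p_def
proof (rule cSup_least)
 have "m ph : {m h | h. ALL x. 0 <= h x & h x <= ph x}" using ph by (auto simp: dom_def)
 then show "{m h | h. ALL x. 0 <= h x & h x <= ph x} ~= {}" by auto
qed (use h in auto)

lemma p_nonneg: "dom ph ==> 0 <= p ph"
 using p_upper[of ph "%x. 0"] m_scale[of "%x. 1" 1 0] W1 by (simp add: dom_def)

lemma dom_add: "dom f ==> dom g ==> dom (%x. f x + g x)"
 unfolding dom_def
proof (intro conjI allI; clarify)
 fix C D assume "0 <= C" "ALL x. f x <= C * W x" "0 <= D" "ALL x. g x <= D * W x"
 then show "EX E>=0. ALL x. f x + g x <= E * W x" by (intro exI[of _ "C + D"]) (auto simp: distrib_right intro: add_mono)
qed (simp add: add_nonneg_nonneg)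

lemma dom_scale: "dom f ==> 0 <= c ==> dom (%x. c * f x)"
 unfolding dom_def
proof (intro conjI allI; clarify)
 fix C assume "0 <= c" "0 <= C" "ALL x. f x <= C * W x"
 then show "EX E>=0. ALL x. c * f x <= E * W x" by (intro exI[of _ "c * C"]) (auto simp: mult.assoc intro: mult_left_mono)
qed simp

lemma dom_abs: "dom f ==> (!!x. 0 <= h x) ==> (!!x. h x <= f x) ==> EX C. ALL x. \<bar>h x\<bar> <= C * W x"
proof -
 assume f: "dom f" and h: "!!x. 0 <= h x" "!!x. h x <= f x"
 obtain C where C: "!!x. f x <= C * W x" using f by (auto simp: dom_def)
 show ?thesis by (intro exI[of _ C]) (use h order_trans[OF _ C] in auto)
qed

lemma dom_bounded: "(!!x. 0 <= f x) ==> (!!x. f x <= C) ==> dom f"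
proof -
 assume f: "!!x. 0 <= f x" "!!x. f x <= C"
 have C: "0 <= C" using order_trans[OF f(1) f(2)] .
 have "f x <= C * W x" for x using f(2)[of x] mult_left_mono[OF W1 C, of x] by linarith
 then show "dom f" using f C by (auto simp: dom_def)
qed

lemma dom_shift: "dom f ==> dom (%x. f (g + x))"
proof -
 assume f: "dom f"
 obtain C where C: "0 <= C" "!!x. f x <= C * W x" using f by (auto simp: dom_def)
 have "f (g + x) <= C * W g * W x" for x
  using order_trans[OF C(2)[of "g + x"] mult_left_mono[OF W_submult C(1)]] by (simp add: mult.assoc)
 moreover have "0 <= C * W g" using C W1[of g] by simp
 ultimately show ?thesis using f by (auto simp: dom_def)
qed

lemma dom_W: "dom W"
 using W1 by (auto simp: dom_def intro!: exI[of _ 1] order_trans[OF zero_le_one])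

lemma p_mono:
 assumes "dom f" "dom g" "!!x. f x <= g x" shows "p f <= p g"
proof (rule p_least[OF assms(1)])
 fix h :: "'g => real" assume "!!x. 0 <= h x" "!!x. h x <= f x"
 then show "m h <= p g" using order_trans[OF _ assms(3)] by (intro p_upper[OF assms(2)]) auto
qed

text \<open>The Riesz decomposition: a function \<open>h\<close> between 0 and \<open>f + g\<close>
  splits into \<open>min h f\<close>, which lies below \<open>f\<close>, and a remainder below
  \<open>g\<close>.\<close>

lemma p_add:
 assumes f: "dom f" and g: "dom g" shows "p (%x. f x + g x) = p f + p g"
proof (rule antisym)
 note fg = dom_add[OF f g]
 show "p (%x. f x + g x) <= p f + p g"
 proof (rule p_least[OF fg])
  fix h assume h: "!!x. 0 <= h x" "!!x. h x <= f x + g x"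
  define h1 where "h1 x = min (h x) (f x)" for x
  have f0: "0 <= f x" "0 <= g x" for x using f g by (auto simp: dom_def)
  have h1: "0 <= h1 x" "h1 x <= f x" for x using h f0 by (auto simp: h1_def)
  have h2: "0 <= h x - h1 x" "h x - h1 x <= g x" for x using h[of x] f0[of x] by (auto simp: h1_def)
  obtain C D where CD: "!!x. \<bar>h1 x\<bar> <= C * W x" "!!x. \<bar>h x - h1 x\<bar> <= D * W x"
   using dom_abs[OF f h1] dom_abs[OF g h2] by auto
  have "m (%x. h1 x + (h x - h1 x)) = m h1 + m (%x. h x - h1 x)" by (rule m_add[OF CD])
  then show "m h <= p f + p g" using p_upper[OF f h1] p_upper[OF g h2] by simp
 qed
 have *: "m h + m k <= p (%x. f x + g x)"
  if h: "!!x. 0 <= h x" "!!x. h x <= f x" and k: "!!x. 0 <= k x" "!!x. k x <= g x" for h k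
 proof -
  obtain C D where CD: "!!x. \<bar>h x\<bar> <= C * W x" "!!x. \<bar>k x\<bar> <= D * W x"
   using dom_abs[OF f h] dom_abs[OF g k] by auto
  have "m h + m k = m (%x. h x + k x)" by (rule m_add[OF CD, symmetric])
  also have "... <= p (%x. f x + g x)"
   using h k by (intro p_upper[OF fg] add_nonneg_nonneg add_mono)
  finally show ?thesis .
 qed
 have "p f <= p (%x. f x + g x) - p g"
 proof (rule p_least[OF f])
  fix h assume h: "!!x. 0 <= h x" "!!x. h x <= f x"
  have "p g <= p (%x. f x + g x) - m h"
  proof (rule p_least[OF g])
   fix k assume k: "!!x. 0 <= k x" "!!x. k x <= g x"
   show "m k <= p (%x. f x + g x) - m h" using *[OF h k] by linarith
  qed
  then show "m h <= p (%x. f x + g x) - p g" by linarith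
 qed
 then show "p f + p g <= p (%x. f x + g x)" by linarith
qed

lemma p_scale_pos:
 assumes f: "dom f" and c: "0 < c" shows "p (%x. c * f x) = c * p f"
proof -
 have le: "p f <= p (%x. c * f x) / c" if f: "dom f" and c: "0 < c" for c f
 proof (rule p_least[OF f])
  fix h assume h: "!!x. 0 <= h x" "!!x. h x <= f x"
  obtain C where C: "!!x. \<bar>h x\<bar> <= C * W x" using dom_abs[OF f h] by auto
  have "m (%x. c * h x) <= p (%x. c * f x)"
   using dom_scale[OF f, of c] h c by (intro p_upper) (auto intro: mult_left_mono)
  then show "m h <= p (%x. c * f x) / c"
   using m_scale[OF C, of c] c by (simp add: field_simps)
 qed
 have "p (%x. c * f x) <= p (%x. (1 / c) * (c * f x)) / (1 / c)"
  by (rule le) (use dom_scale[OF f] c in auto)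
 then have "p (%x. c * f x) <= c * p f" using c by (simp add: mult.commute)
 moreover have "c * p f <= p (%x. c * f x)" using le[OF f c] c by (simp add: field_simps)
 ultimately show ?thesis by simp
qed

lemma p_shift:
 assumes f: "dom f" shows "p (%x. f (g + x)) = p f"
proof -
 have le: "p f <= p (%x. f (g + x))" if f: "dom f" for f g
 proof (rule p_least[OF f])
  fix h assume h: "!!x. 0 <= h x" "!!x. h x <= f x"
  obtain C where C: "!!x. \<bar>h x\<bar> <= C * W x" using dom_abs[OF f h] by auto
  have "m (%x. h (g + x)) <= p (%x. f (g + x))" using h by (intro p_upper[OF dom_shift[OF f]])
  then show "m h <= p (%x. f (g + x))" using m_inv[OF C, of g] by simp
 qed
 show ?thesis
  using le[OF f, of g] le[OF dom_shift[OF f, of g], of "- g"] by (simp add: add.assoc[symmetric])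
qed

lemma p_one: "1 <= p (%x. 1)"
 using p_upper[of "%x. 1" "%x. 1"] dom_bounded[of "%x. 1" 1] m_one by simp

text \<open>Put \<open>B = p W\<close>. From \<open>2 <= W / B + B / W\<close>, positivity gives
  \<open>1 <= B * p (1 / W)\<close>. Applying \<open>p\<close> to
  \<open>W g / W x <= W (g + x)\<close> gives \<open>W g * p (1 / W) <= B\<close> by invariance.
  Hence \<open>W g <= B * B\<close> for all \<open>g\<close>.\<close>

lemma star_bounded: "bounded (range W)"
proof -
 define B where "B = p W"
 have d1: "dom (%x. 1)" by (rule dom_bounded) auto
 have W0: "0 < W x" for x using W1[of x] by linarith
 have di: "dom (%x. 1 / W x)" by (rule dom_bounded[of _ 1]) (use W1 W0 in \<open>auto simp: less_imp_le\<close>)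
 have B1: "1 <= B" unfolding B_def using p_mono[OF d1 dom_W W1] p_one by linarith
 have "p (%x. 2 * 1) <= p (%x. (1 / B) * W x + B * (1 / W x))"
 proof (rule p_mono)
  fix x
  have "2 * (B * W x) <= W x * W x + B * B" using sum_squares_bound[of B "W x"] by (simp add: power2_eq_square)
  then show "2 * 1 <= (1 / B) * W x + B * (1 / W x)" using B1 W0[of x] by (simp add: field_simps)
 qed (use d1 di dom_W B1 in \<open>intro dom_add dom_scale; simp\<close>)+
 also have "... = (1 / B) * p W + B * p (%x. 1 / W x)"
  using B1 p_add[OF dom_scale[OF dom_W, of "1 / B"] dom_scale[OF di, of B]]
   p_scale_pos[OF dom_W, of "1 / B"] p_scale_pos[OF di, of B] by simp
 also have "... = 1 + B * p (%x. 1 / W x)" using B1 by (simp add: B_def)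
 finally have q: "1 <= B * p (%x. 1 / W x)" using p_scale_pos[OF d1, of 2] p_one by simp
 have "W g <= B * B" for g
 proof -
  have "p (%x. W g * (1 / W x)) <= p (%x. W (g + x))"
  proof (rule p_mono[OF dom_scale[OF di] dom_shift[OF dom_W]])
   fix x
   have "W g <= W (g + x) * W x" using W_submult[of "g + x" "- x"] by (simp add: W_minus add.assoc)
   then show "W g * (1 / W x) <= W (g + x)" using W0[of x] by (simp add: field_simps)
  qed (use W0[of g] in simp)
  then have 1: "W g * p (%x. 1 / W x) <= B" using p_scale_pos[OF di W0] p_shift[OF dom_W] by (simp add: B_def)
  have "W g <= W g * (B * p (%x. 1 / W x))" using mult_left_mono[OF q, of "W g"] W0[of g] by simp
  also have "... = B * (W g * p (%x. 1 / W x))" by simp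
  also have "... <= B * B" using 1 B1 by (intro mult_left_mono) auto
  finally show ?thesis .
 qed
 then show ?thesis using W0 by (intro boundedI[of _ "B * B"]) (auto simp: less_imp_le abs_of_pos)
qed

text \<open>The positive functional is extended to bounded functions by the difference of its values
  on positive and negative parts, and divided by its value at 1.\<close>

lemma amenable_group: "amenable_group TYPE('g)"
proof -
 define P N where "P f x = max (f x) 0" and "N f x = max (- f x) 0" for f :: "'g => real" and x
 have dom_PN: "dom (P f)" "dom (N f)" if "!!x. \<bar>f x\<bar> <= C" for f C
  by (rule dom_bounded[of _ C]; use that in \<open>auto simp: P_def N_def abs_le_iff\<close>; use order_trans[OF abs_ge_zero that] in auto)+
 define q where "q f = p (P f) - p (N f)" for f
 define M where "M f = q (apply_bcontfun f) / p (%x. 1)" for f :: "'g \<Rightarrow>\<^sub>C real"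
 have bc: "EX C. ALL x. \<bar>apply_bcontfun f x\<bar> <= C" for f :: "'g \<Rightarrow>\<^sub>C real"
  using norm_bounded[of f] by auto
 have q_add: "q (%x. f x + g x) = q f + q g" if fC: "!!x. \<bar>f x\<bar> <= C" and gD: "!!x. \<bar>g x\<bar> <= D" for f g C D
 proof -
  let ?s = "%x. f x + g x"
  have s: "\<bar>?s x\<bar> <= C + D" for x using abs_triangle_ineq[of "f x" "g x"] fC[of x] gD[of x] by linarith
  note d = dom_PN[of f, OF fC] dom_PN[of g, OF gD] dom_PN[of ?s, OF s]
  \<comment> \<open>The decomposition of \<open>f + g\<close> written without subtraction, since
    additivity of \<open>p\<close> is available only for nonnegative functions.\<close>
  have "(%x. P ?s x + (N f x + N g x)) = (%x. N ?s x + (P f x + P g x))"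
   by (rule ext) (simp add: P_def N_def max_def)
  then have "p (P ?s) + (p (N f) + p (N g)) = p (N ?s) + (p (P f) + p (P g))"
   using p_add[OF d(5) dom_add[OF d(2,4)]] p_add[OF d(6) dom_add[OF d(1,3)]] p_add[OF d(2,4)] p_add[OF d(1,3)] by simp
  then show ?thesis by (simp add: q_def)
 qed
 have p0: "p (%x. 0) = 0" using p_add[of "%x. 0" "%x. 0"] dom_bounded[of "%x. 0" 0] by simp
 have q_scale: "q (%x. c * f x) = c * q f" if fC: "!!x. \<bar>f x\<bar> <= C" for f c C
 proof -
  note d = dom_PN[of f, OF fC]
  consider "c = 0" | "0 < c" | "c < 0" by linarith
  then show ?thesis
  proof cases
   case 1
   have "P (%x. 0) = (%x. 0)" "N (%x. 0) = (%x. 0)" by (auto simp: P_def N_def)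
   with 1 show ?thesis by (simp add: q_def p0)
  next
   case 2
   have "P (%x. c * f x) = (%x. c * P f x)" "N (%x. c * f x) = (%x. c * N f x)"
    using 2 by (auto simp: P_def N_def max_def mult_le_0_iff zero_le_mult_iff intro!: ext)
   then show ?thesis using p_scale_pos[OF d(1) 2] p_scale_pos[OF d(2) 2] by (simp add: q_def right_diff_distrib)
  next
   case 3
   then have c: "0 < - c" by simp
   have "P (%x. c * f x) = (%x. (- c) * N f x)" "N (%x. c * f x) = (%x. (- c) * P f x)"
    using 3 by (auto simp: P_def N_def max_def mult_le_0_iff zero_le_mult_iff intro!: ext)
   then show ?thesis
    using p_scale_pos[OF d(1) c] p_scale_pos[OF d(2) c] by (simp only: q_def) (simp add: algebra_simps)
  qed
 qed
 have "linear M"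
 proof (rule linearI)
  fix f g :: "'g \<Rightarrow>\<^sub>C real"
  obtain C D where "!!x. \<bar>apply_bcontfun f x\<bar> <= C" "!!x. \<bar>apply_bcontfun g x\<bar> <= D" using bc by metis
  from q_add[OF this] show "M (f + g) = M f + M g"
   by (simp add: M_def plus_bcontfun.rep_eq add_divide_distrib)
 next
  fix f :: "'g \<Rightarrow>\<^sub>C real" and c
  obtain C where "!!x. \<bar>apply_bcontfun f x\<bar> <= C" using bc by metis
  from q_scale[OF this] show "M (c *\<^sub>R f) = c *\<^sub>R M f"
   by (simp add: M_def scaleR_bcontfun.rep_eq)
 qed
 moreover have "0 <= M f" if f: "ALL x. 0 <= apply_bcontfun f x" for f
 proof -
  obtain C where C: "!!x. \<bar>apply_bcontfun f x\<bar> <= C" using bc by metis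
  have "N (apply_bcontfun f) = (%x. 0)" using f by (auto simp: N_def max_def intro!: ext antisym)
  then show ?thesis using p_nonneg[OF dom_PN(1)[OF C]] p_one by (simp add: M_def q_def p0)
 qed
 moreover have "M (const_bcontfun 1) = 1"
 proof -
  have "P (%x. 1) = (%x. 1)" "N (%x. 1) = (%x. 0)" by (auto simp: P_def N_def)
  then show ?thesis using p_one by (simp add: M_def q_def p0 const_bcontfun.rep_eq)
 qed
 moreover have "M g = M f" if g: "ALL x. apply_bcontfun g x = apply_bcontfun f (a + x)" for a f g
 proof -
  obtain C where C: "!!x. \<bar>apply_bcontfun f x\<bar> <= C" using bc by metis
  have "P (apply_bcontfun g) = (%x. P (apply_bcontfun f) (a + x))" "N (apply_bcontfun g) = (%x. N (apply_bcontfun f) (a + x))"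
   using g by (auto simp: P_def N_def)
  then show ?thesis using p_shift[OF dom_PN(1)[OF C]] p_shift[OF dom_PN(2)[OF C]] by (simp add: M_def q_def)
 qed
 ultimately show ?thesis unfolding amenable_group_def by (intro exI[of _ M]) blast
qed

end

lemma (in paired) amenable_imp_amenable_group:
 fixes j :: "('a \<times> 'a => complex) => 'e"
 assumes am: "amenable TYPE('e) A" and j: "inj j"
 shows "amenable_group TYPE('g)" "bounded (range (weight_star om))"
proof -
 have "EX m K. star_functional om m K"
 proof (rule invariant_functional[OF am j], goal_cases)
  case (1 m K)
  show ?case
   by (intro exI[of _ m] exI[of _ K] star_functional.intro weighted_group_axioms star_functional_axioms.intro)
    (rule 1; assumption)+
 qed
 then obtain m K where m: "star_functional om m K" by blast
 interpret star_functional om m K by (rule m)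
 show "amenable_group TYPE('g)" "bounded (range (weight_star om))" by (rule amenable_group star_bounded)+
qed

section \<open>Radon measures from finitely additive set functions\<close>

lemma compact_separation:
 fixes K L :: "'g::t2_space set"
 assumes "compact K" "compact L" "K Int L = {}"
 obtains U V where "open U" "open V" "K \<subseteq> U" "L \<subseteq> V" "U Int V = {}"
proof -
 have "Hausdorff_space (euclidean :: 'g topology)"
  unfolding Hausdorff_space_def using hausdorff by (metis disjnt_def open_openin)
 from Hausdorff_space_compact_separation[OF this, of K L] assms
 obtain U V :: "'g set" where "openin euclidean U" "openin euclidean V" "K \<subseteq> U" "L \<subseteq> V" "disjnt U V"
  by (auto simp: disjnt_def)
 then show thesis by (intro that[of U V]) (auto simp: disjnt_def)
qed

context
 fixes nu :: "'g::t2_space set => real"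
 assumes nonneg: "!!A. 0 <= nu A" and additive: "!!A B. A Int B = {} ==> nu (A Un B) = nu A + nu B"
begin

lemma content_mono: "A \<subseteq> B ==> nu A <= nu B"
 using additive[of A "B - A"] nonneg[of "B - A"] by (simp add: Un_absorb1)

lemma content_subadd: "nu (A Un B) <= nu A + nu B"
 using additive[of A "B - A"] content_mono[of "B - A" B] by simp

text \<open>A finitely additive \<open>nu\<close> on all subsets may be concentrated badly. Supremum
  over compact subsets of open sets, followed by the infimum over open supersets, keeps the part of
  it that a Radon measure can see.\<close>

definition inner_content :: "'g set => ennreal" where
 "inner_content U = (SUP K\<in>{K. compact K & K \<subseteq> U}. ennreal (nu K))"

definition outer_content :: "'g set => ennreal" where
 "outer_content A = (INF U\<in>{U. open U & A \<subseteq> U}. inner_content U)"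

lemma inner_content_upper: "compact K ==> K \<subseteq> U ==> ennreal (nu K) <= inner_content U"
 unfolding inner_content_def by (rule SUP_upper) auto

lemma inner_content_mono: "U \<subseteq> V ==> inner_content U <= inner_content V"
 unfolding inner_content_def by (rule SUP_subset_mono) auto

lemma inner_content_finite: "inner_content U <= ennreal (nu UNIV)"
 unfolding inner_content_def by (rule SUP_least) (auto intro!: ennreal_leI content_mono)

lemma inner_content_approx:
 assumes "0 < e" obtains K where "compact K" "K \<subseteq> U" "inner_content U < ennreal (nu K) + ennreal e"
proof -
 have fin: "inner_content U < \<infinity>"
  using inner_content_finite[of U] by (rule order_le_less_trans) simp
 have "EX K. compact K & K \<subseteq> U & inner_content U < ennreal (nu K) + ennreal e"
 proof (rule ccontr)
  assume n: "\<nexists>K. compact K & K \<subseteq> U & inner_content U < ennreal (nu K) + ennreal e"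
  have le: "ennreal (nu K) + ennreal e <= inner_content U" if "compact K" "K \<subseteq> U" for K
   using n that by (intro leI notI) auto
  define r where "r = enn2real (inner_content U)"
  have r: "inner_content U = ennreal r" "0 <= r" using fin by (auto simp: r_def)
  have "inner_content U <= ennreal (r - e)"
   unfolding inner_content_def
  proof (rule SUP_least)
   fix K assume "K : {K. compact K & K \<subseteq> U}"
   then have "ennreal (nu K + e) <= ennreal r" using le[of K] r nonneg[of K] assms by (simp add: ennreal_plus)
   then show "ennreal (nu K) <= ennreal (r - e)" using r(2) by (intro ennreal_leI) (simp add: ennreal_le_iff)
  qed
  moreover have "e <= r" using le[of "{}"] r nonneg[of "{}"] assms
   by (simp add: ennreal_plus[symmetric] del: ennreal_plus)
  ultimately have "r <= r - e" using r by (simp add: ennreal_le_iff)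
  then show False using assms by simp
 qed
 then show thesis using that by blast
qed

lemma outer_content_open: "open U ==> outer_content U = inner_content U"
 unfolding outer_content_def by (intro antisym INF_greatest INF_lower) (auto intro: inner_content_mono)

lemma outer_content_le: "open U ==> A \<subseteq> U ==> outer_content A <= inner_content U"
 unfolding outer_content_def by (rule INF_lower) auto

lemma outer_content_greatest: "(!!U. open U ==> A \<subseteq> U ==> b <= inner_content U) ==> b <= outer_content A"
 unfolding outer_content_def by (rule INF_greatest) auto

lemma outer_content_mono: "A \<subseteq> B ==> outer_content A <= outer_content B"
 by (rule outer_content_greatest) (auto intro: outer_content_le)

text \<open>For compact \<open>K\<close> inside \<open>U Un V\<close> the compact sets
  \<open>K - U\<close> and \<open>K - V\<close> are disjoint. Removing disjoint open neighbourhoods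
  of them from \<open>K\<close> leaves compact subsets of \<open>U\<close> and of \<open>V\<close>
  that cover \<open>K\<close>.\<close>

lemma inner_content_Un:
 assumes U: "open U" "open V" shows "inner_content (U Un V) <= inner_content U + inner_content V"
 unfolding inner_content_def[of "U Un V"]
proof (rule SUP_least)
 fix K assume "K : {K. compact K & K \<subseteq> U Un V}"
 then have K: "compact K" "K \<subseteq> U Un V" by auto
 have "compact (K - U)" "compact (K - V)" using compact_diff[OF K(1)] U by auto
 moreover have "(K - U) Int (K - V) = {}" using K by auto
 ultimately obtain W W' where W: "open W" "open W'" "K - U \<subseteq> W" "K - V \<subseteq> W'" "W Int W' = {}"
  by (rule compact_separation)
 have "ennreal (nu K) <= ennreal (nu (K - W) + nu (K - W'))"
 proof (rule ennreal_leI)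
  have "K \<subseteq> (K - W) Un (K - W')" using W(5) by auto
  from order_trans[OF content_mono[OF this] content_subadd] show "nu K <= nu (K - W) + nu (K - W')" .
 qed
 also have "... = ennreal (nu (K - W)) + ennreal (nu (K - W'))" using nonneg by (simp add: ennreal_plus)
 also have "... <= inner_content U + inner_content V"
  using compact_diff[OF K(1)] W by (intro add_mono inner_content_upper) auto
 finally show "ennreal (nu K) <= inner_content U + inner_content V" .
qed

lemma inner_content_UN:
 fixes U :: "nat => 'g set"
 assumes U: "!!i. open (U i)" shows "inner_content (\<Union>i. U i) <= (\<Sum>i. inner_content (U i))"
 unfolding inner_content_def[of "\<Union>i. U i"]
proof (rule SUP_least)
 fix K assume "K : {K. compact K & K \<subseteq> (\<Union>i. U i)}"
 then have K: "compact K" "K \<subseteq> (\<Union>i. U i)" by auto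
 have fin: "inner_content (\<Union>i\<in>I. U i) <= (\<Sum>i\<in>I. inner_content (U i))" if "finite I" for I
  using that
 proof induction
  case empty
  have "nu {} = 0" using additive[of "{}" "{}"] by simp
  then show ?case by (auto simp: inner_content_def intro!: SUP_least)
 next
  case (insert i I)
  have "inner_content (\<Union>i\<in>insert i I. U i) <= inner_content (U i) + inner_content (\<Union>i\<in>I. U i)"
   using inner_content_Un[OF U[of i], of "\<Union>i\<in>I. U i"] U by auto
  also have "... <= inner_content (U i) + (\<Sum>i\<in>I. inner_content (U i))" by (intro add_left_mono insert.IH)
  finally show ?case using insert by simp
 qed
 obtain I where I: "finite I" "K \<subseteq> (\<Union>i\<in>I. U i)" using compactE_image[OF K(1), of UNIV U] U K(2) by metis
 have "ennreal (nu K) <= (\<Sum>i\<in>I. inner_content (U i))"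
  using inner_content_upper[OF K(1) I(2)] fin[OF I(1)] by (rule order_trans)
 also have "... <= (\<Sum>i. inner_content (U i))" using I(1) by (intro sum_le_suminf) auto
 finally show "ennreal (nu K) <= (\<Sum>i. inner_content (U i))" .
qed

lemma outer_measure_space_content: "outer_measure_space (Pow UNIV) outer_content"
 unfolding outer_measure_space_def
proof (intro conjI)
 have "nu {} = 0" using additive[of "{}" "{}"] by simp
 then show "positive (Pow UNIV) outer_content"
  by (auto simp: positive_def outer_content_open inner_content_def intro!: antisym SUP_least)
 show "increasing (Pow UNIV) outer_content" by (auto simp: increasing_def intro: outer_content_mono)
 show "countably_subadditive (Pow UNIV) outer_content"
  unfolding countably_subadditive_def
 proof (intro allI impI)
  fix A :: "nat => 'g set"
  show "outer_content (\<Union>i. A i) <= (\<Sum>i. outer_content (A i))"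
  proof (rule ennreal_le_epsilon)
   fix e :: real assume e: "0 < e"
   have "EX U. open U & A i \<subseteq> U & inner_content U <= outer_content (A i) + ennreal (e * (1/2) ^ Suc i)" for i
   proof (rule ccontr)
    assume n: "\<nexists>U. open U & A i \<subseteq> U & inner_content U <= outer_content (A i) + ennreal (e * (1/2) ^ Suc i)"
    have "outer_content (A i) + ennreal (e * (1/2) ^ Suc i) <= outer_content (A i)"
     by (intro outer_content_greatest leI notI) (use n in \<open>auto dest: less_imp_le\<close>)
    moreover have "outer_content (A i) < \<infinity>"
     using order_trans[OF outer_content_le[of UNIV "A i"] inner_content_finite[of UNIV]] by (simp add: order_le_less_trans[OF _ ennreal_less_top])
    ultimately show False using e by (simp add: ennreal_add_left_cancel_le[of _ _ 0, simplified] not_le)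
   qed
   then obtain U where U: "!!i. open (U i)" "!!i. A i \<subseteq> U i"
    "!!i. inner_content (U i) <= outer_content (A i) + ennreal (e * (1/2) ^ Suc i)" by metis
   have "outer_content (\<Union>i. A i) <= inner_content (\<Union>i. U i)" using U by (intro outer_content_le) auto
   also have "... <= (\<Sum>i. inner_content (U i))" by (rule inner_content_UN[OF U(1)])
   also have "... <= (\<Sum>i. outer_content (A i) + ennreal (e * (1/2) ^ Suc i))" using U(3) by (intro suminf_le) auto
   also have "... = (\<Sum>i. outer_content (A i)) + (\<Sum>i. ennreal (e * (1/2) ^ Suc i))" by (rule suminf_add[symmetric]) auto
   also have "(\<Sum>i. ennreal (e * (1/2) ^ Suc i)) = ennreal e"
    by (rule suminf_ennreal_eq) (use e sums_mult[OF power_half_series, of e] in auto)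
   finally show "outer_content (\<Union>i. A i) <= (\<Sum>i. outer_content (A i)) + ennreal e" .
  qed
 qed
qed

text \<open>A compact \<open>K\<close> is chosen to fill \<open>U Int V\<close>, then
  \<open>L\<close> to fill \<open>V - K\<close>, an open set containing the part of \<open>V\<close>
  outside \<open>U\<close>. The two are disjoint, so their contents add up inside
  \<open>V\<close>.\<close>

lemma lambda_system_open:
 assumes U: "open U" shows "U : lambda_system UNIV (Pow UNIV) outer_content"
 unfolding lambda_system_def
proof (intro CollectI conjI ballI)
 fix A :: "'g set"
 have "outer_content (U Int A) + outer_content ((UNIV - U) Int A) <= outer_content A"
 proof (rule outer_content_greatest)
  fix V assume V: "open V" "A \<subseteq> V"
  show "outer_content (U Int A) + outer_content ((UNIV - U) Int A) <= inner_content V"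
  proof (rule ennreal_le_epsilon)
   fix e :: real assume e: "0 < e"
   then have e2: "0 < e / 2" by simp
   obtain K where K: "compact K" "K \<subseteq> U Int V" "inner_content (U Int V) < ennreal (nu K) + ennreal (e/2)"
    by (rule inner_content_approx[OF e2])
   obtain L where L: "compact L" "L \<subseteq> V - K" "inner_content (V - K) < ennreal (nu L) + ennreal (e/2)"
    by (rule inner_content_approx[OF e2])
   have "outer_content (U Int A) + outer_content ((UNIV - U) Int A) <= inner_content (U Int V) + inner_content (V - K)"
    using U V K compact_imp_closed[OF K(1)] by (intro add_mono outer_content_le) (auto intro: open_Diff)
   also have "... <= (ennreal (nu K) + ennreal (e/2)) + (ennreal (nu L) + ennreal (e/2))"
    using K(3) L(3) by (intro add_mono) auto
   also have "... = ennreal (nu (K Un L)) + ennreal e"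
   proof -
    have "K Int L = {}" using L(2) by auto
    from additive[OF this] show ?thesis
     using nonneg[of K] nonneg[of L] e by (simp add: ennreal_plus[symmetric] del: ennreal_plus)
   qed
   also have "... <= inner_content V + ennreal e"
    using K L by (intro add_right_mono inner_content_upper) auto
   finally show "outer_content (U Int A) + outer_content ((UNIV - U) Int A) <= inner_content V + ennreal e" .
  qed
 qed
 moreover have "outer_content A <= outer_content (U Int A) + outer_content ((UNIV - U) Int A)"
 proof -
  have "subadditive (Pow UNIV) outer_content"
   using outer_measure_space_content ring_of_sets_Pow[of "UNIV :: 'g set"] unfolding outer_measure_space_def
   by (intro ring_of_sets.countably_subadditive_subadditive) auto
  then have "outer_content ((U Int A) Un ((UNIV - U) Int A)) <= outer_content (U Int A) + outer_content ((UNIV - U) Int A)"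
   unfolding subadditive_def by (elim ballE[of _ _ "U Int A"] ballE[of _ _ "(UNIV - U) Int A"] impE) auto
  moreover have "(U Int A) Un ((UNIV - U) Int A) = A" by auto
  ultimately show ?thesis by simp
 qed
 ultimately show "outer_content (U Int A) + outer_content ((UNIV - U) Int A) = outer_content A" by (rule antisym)
qed simp

text \<open>Caratheodory's theorem for \<open>outer_content\<close>: open sets are measurable by
  \<open>lambda_system_open\<close>, hence all Borel sets are, and the values on open sets give the
  inner regularity asked for by \<open>radonI_open\<close>.\<close>

lemma content_radon:
 obtains m :: "'g measure" where "radon m"
  "!!U. open U ==> emeasure m U = (SUP K\<in>{K. compact K & K \<subseteq> U}. ennreal (nu K))"
  "!!A. A : sets borel ==> emeasure m A = (INF U\<in>{U. open U & A \<subseteq> U}. emeasure m U)"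
proof -
 define L where "L = lambda_system (UNIV :: 'g set) (Pow UNIV) outer_content"
 have ms: "measure_space UNIV L outer_content"
  unfolding L_def by (rule sigma_algebra.caratheodory_lemma[OF sigma_algebra_Pow outer_measure_space_content])
 have "sigma_sets UNIV {S :: 'g set. open S} \<subseteq> L"
  using ms lambda_system_open unfolding measure_space_def L_def
  by (intro sigma_algebra.sigma_sets_subset) auto
 then have sub: "sets borel \<subseteq> L" by (simp add: borel_def)
 define m where "m = measure_of UNIV (sets (borel :: 'g measure)) outer_content"
 have sets: "sets m = sets borel" unfolding m_def using sets.sigma_sets_eq[of "borel :: 'g measure"] by simp
 have em: "emeasure m A = outer_content A" if "A : sets borel" for A
 proof (rule emeasure_measure_of[OF m_def])
  show "positive (sets m) outer_content" using ms by (auto simp: measure_space_def positive_def)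
  show "countably_additive (sets m) outer_content"
   unfolding countably_additive_def
  proof (intro allI impI)
   fix F :: "nat => 'g set" assume F: "range F \<subseteq> sets m" "disjoint_family F" "(\<Union>i. F i) : sets m"
   have "countably_additive L outer_content" using ms by (simp add: measure_space_def)
   moreover have "range F \<subseteq> L" "(\<Union>i. F i) : L" using F sub sets by auto
   ultimately show "(\<Sum>i. outer_content (F i)) = outer_content (\<Union>i. F i)"
    using F(2) unfolding countably_additive_def by blast
  qed
 qed (use that sets in auto)
 have op: "emeasure m U = inner_content U" if "open U" for U
  using em[of U] outer_content_open[OF that] that by simp
 have fin: "finite_measure m"
  by (rule finite_measureI) (use op[of UNIV] inner_content_finite[of UNIV] sets_eq_imp_space_eq[OF sets] in \<open>auto simp: top_unique\<close>)
 interpret finite_measure m by (rule fin)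
 show thesis
 proof (rule that)
  show "radon m"
  proof (rule radonI_open[OF sets fin])
   fix U :: "'g set" and e :: real assume U: "open U" and e: "0 < e"
   obtain K where K: "compact K" "K \<subseteq> U" "inner_content U < ennreal (nu K) + ennreal e" by (rule inner_content_approx[OF e])
   have "ennreal (nu K) <= emeasure m K"
    using em[of K] K compact_imp_closed[OF K(1)] by (auto intro!: outer_content_greatest inner_content_upper)
   then have "nu K <= measure m K" using nonneg by (simp add: emeasure_eq_measure)
   moreover have "measure m U < nu K + e"
   proof -
    have "ennreal (measure m U) < ennreal (nu K + e)"
     using K(3) op[OF U] nonneg[of K] e by (simp add: emeasure_eq_measure)
    then show ?thesis by (simp add: ennreal_less_iff)
   qed
   moreover have "measure m (U - K) = measure m U - measure m K"
    using U K compact_imp_closed[OF K(1)] by (intro finite_measure_Diff) (auto simp: sets)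
   ultimately show "EX K. compact K & K \<subseteq> U & measure m (U - K) < e" using K by (intro exI[of _ K]) auto
  qed
  show "emeasure m U = (SUP K\<in>{K. compact K & K \<subseteq> U}. ennreal (nu K))" if "open U" for U
   using op[OF that] by (simp add: inner_content_def)
  show "emeasure m A = (INF U\<in>{U. open U & A \<subseteq> U}. emeasure m U)" if "A : sets borel" for A
   using em[OF that] op by (simp add: outer_content_def)
 qed
qed

end

section \<open>Limits of normalised counting measures\<close>

lemma cluster_content:
 fixes nu :: "nat => 'a set => real"
 assumes b: "!!n A. 0 <= nu n A" "!!n A. nu n A <= 1"
  and additive: "!!n A B. A Int B = {} ==> nu n (A Un B) = nu n A + nu n B"
 obtains mu where "!!A. 0 <= mu A" "!!A B. A Int B = {} ==> mu (A Un B) = mu A + mu B"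
  "!!A r. eventually (%n. nu n A <= r) sequentially ==> mu A <= r"
  "!!A r. eventually (%n. r <= nu n A) sequentially ==> r <= mu A"
proof -
 \<comment> \<open>Tychonoff: set functions with values in the unit interval form a compact space,
   so the sequence \<open>nu\<close> has a cluster point.\<close>
 have "compactin (product_topology (%_. euclidean) UNIV) (PiE UNIV (%_::'a set. {0..1::real}))"
  by (subst compactin_PiE) auto
 then have cpt: "compact (PiE UNIV (%_::'a set. {0..1::real}))" by (simp add: euclidean_product_topology)
 have "filtermap nu sequentially ~= bot" by (simp add: filtermap_bot_iff)
 moreover have "eventually (%f. f : PiE UNIV (%_::'a set. {0..1::real})) (filtermap nu sequentially)"
  using b by (simp add: eventually_filtermap PiE_def)
 ultimately obtain mu where mu: "inf (nhds mu) (filtermap nu sequentially) ~= bot"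
  using cpt unfolding compact_filter by blast
 \<comment> \<open>Closed conditions that hold eventually pass to the cluster point; finite
   additivity and the bounds involve only finitely many coordinates and are closed.\<close>
 have cl: "mu : S" if S: "closed S" and ev: "eventually (%n. nu n : S) sequentially" for S
 proof (rule ccontr)
  assume "mu ~: S"
  then have "eventually (%f. f : - S) (nhds mu)" using S by (intro eventually_nhds_in_open) auto
  moreover have "eventually (%f. f : S) (filtermap nu sequentially)" using ev by (simp add: eventually_filtermap)
  ultimately have "eventually (%f. False) (inf (nhds mu) (filtermap nu sequentially))"
   unfolding eventually_inf by blast
  then show False using mu by (simp add: trivial_limit_def)
 qed
 have co: "continuous_on UNIV (%f :: 'a set => real. f A)" for A by (rule continuous_on_product_coordinates)
 have c1: "closed {f :: 'a set => real. r <= f A}" "closed {f :: 'a set => real. f A <= r}" for A r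
  by (intro closed_Collect_le co continuous_on_const)+
 have c2: "closed {f :: 'a set => real. f A = f B + f C}" for A B C
  by (intro closed_Collect_eq co continuous_on_add)
 show thesis
 proof (rule that)
  fix A B :: "'a set" and r
  show "0 <= mu A" using cl[OF c1(1)[of 0 A]] b by simp
  show "mu (A Un B) = mu A + mu B" if "A Int B = {}"
   using cl[OF c2[of "A Un B" A B]] additive[OF that] by simp
  show "mu A <= r" if "eventually (%n. nu n A <= r) sequentially"
   using cl[OF c1(2)[of A r]] that by simp
  show "r <= mu A" if "eventually (%n. r <= nu n A) sequentially"
   using cl[OF c1(1)[of r A]] that by simp
 qed
qed

text \<open>The limit measure of a sequence \<open>x\<close>, counted along its first
  \<open>2 ^ n\<close> terms. Upper densities bound open sets from above; a compact set that
  attracts the sequence, in the sense that every neighbourhood of it has a compact subset containing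
  all terms, receives full mass.\<close>

lemma equidistributed_radon:
 fixes x :: "nat => 'g::t2_space"
 obtains m :: "'g measure" where "radon m"
  "!!U r. open U ==> 0 <= r ==> eventually (%n. real (card {i. i < 2 ^ n & x i : U}) <= r * 2 ^ n) sequentially ==>
   measure m U <= r"
  "!!K. compact K ==> (!!U. open U ==> K \<subseteq> U ==> EX L. compact L & L \<subseteq> U & range x \<subseteq> L) ==> 1 <= measure m K"
proof -
 define nu where "nu n A = real (card {i. i < 2 ^ n & x i : A}) / 2 ^ n" for n A
 have add: "nu n (A Un B) = nu n A + nu n B" if "A Int B = {}" for n A B
 proof -
  have "{i. i < 2 ^ n & x i : A Un B} = {i. i < 2 ^ n & x i : A} Un {i. i < 2 ^ n & x i : B}" by auto
  moreover have "card ... = card {i. i < 2 ^ n & x i : A} + card {i. i < 2 ^ n & x i : B}"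
   using that by (intro card_Un_disjoint) auto
  ultimately show ?thesis by (simp add: nu_def add_divide_distrib)
 qed
 have le1: "nu n A <= 1" for n A
 proof -
  have "card {i. i < 2 ^ n & x i : A} <= card {..<(2::nat) ^ n}" by (intro card_mono) auto
  then have "real (card {i. i < 2 ^ n & x i : A}) <= 2 ^ n"
   by (metis card_lessThan of_nat_le_iff of_nat_numeral of_nat_power)
  then show ?thesis by (simp add: nu_def)
 qed
 obtain mu where mu: "!!A. 0 <= mu A" "!!A B. A Int B = {} ==> mu (A Un B) = mu A + mu B"
  "!!A r. eventually (%n. nu n A <= r) sequentially ==> mu A <= r"
  "!!A r. eventually (%n. r <= nu n A) sequentially ==> r <= mu A"
  by (rule cluster_content[of nu]) (auto simp: add le1, simp add: nu_def)
 obtain m :: "'g measure" where m: "radon m"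
  "!!U. open U ==> emeasure m U = (SUP K\<in>{K. compact K & K \<subseteq> U}. ennreal (mu K))"
  "!!A. A : sets borel ==> emeasure m A = (INF U\<in>{U. open U & A \<subseteq> U}. emeasure m U)"
 proof (rule content_radon[of mu, OF mu(1,2)], assumption, goal_cases)
  case (1 m)
  show ?case by (rule 1(1)[OF 1(2)]) (rule 1; assumption)+
 qed
 interpret finite_measure m using radon_finite[OF m(1)] .
 show thesis
 proof (rule that[OF m(1)])
  fix U :: "'g set" and r :: real
  assume U: "open U" and r: "0 <= r" and ev: "eventually (%n. real (card {i. i < 2 ^ n & x i : U}) <= r * 2 ^ n) sequentially"
  have "mu U <= r"
   by (rule mu(3)) (use ev in eventually_elim, simp add: nu_def field_simps)
  have "emeasure m U <= ennreal r"
   unfolding m(2)[OF U]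
  proof (rule SUP_least)
   fix K assume "K : {K. compact K & K \<subseteq> U}"
   then have "mu K <= mu U" using mu(2)[of K "U - K"] mu(1)[of "U - K"] by (simp add: Un_absorb1)
   then show "ennreal (mu K) <= ennreal r" using \<open>mu U <= r\<close> by (intro ennreal_leI) simp
  qed
  then show "measure m U <= r" using r by (simp add: emeasure_eq_measure)
 next
  fix K :: "'g set"
  assume K: "compact K" and nb: "!!U. open U ==> K \<subseteq> U ==> EX L. compact L & L \<subseteq> U & range x \<subseteq> L"
  have "ennreal 1 <= emeasure m K"
   unfolding m(3)[OF borel_closed[OF compact_imp_closed[OF K]]]
  proof (rule INF_greatest)
   fix U assume "U : {U. open U & K \<subseteq> U}"
   then have U: "open U" "K \<subseteq> U" by auto
   obtain L where L: "compact L" "L \<subseteq> U" "range x \<subseteq> L" using nb[OF U] by blast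
   have "{i. i < (2::nat) ^ n & x i : L} = {..<2 ^ n}" for n using L(3) by auto
   then have "1 <= mu L" by (intro mu(4)) (simp add: nu_def)
   then have "ennreal 1 <= ennreal (mu L)" by (rule ennreal_leI)
   also have "... <= emeasure m U" unfolding m(2)[OF U(1)] using L by (intro SUP_upper) auto
   finally show "ennreal 1 <= emeasure m U" .
  qed
  then show "1 <= measure m K" by (simp add: emeasure_eq_measure)
 qed
qed

section \<open>Cantor sets with few coincidences among quotients\<close>

text \<open>In a Hausdorff space a finite open set makes its points open, and translating one open
  point makes the group discrete.\<close>

lemma infinite_open_of_nondiscrete:
 fixes U :: "'g::{topological_group_add,t2_space} set"
 assumes nd: "~ discrete_group TYPE('g)" and U: "open U" "U ~= {}" shows "infinite U"
proof
 assume fin: "finite U"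
 obtain x where x: "x : U" using U by blast
 have "open (U - (U - {x}))" using U(1) fin by (intro open_Diff finite_imp_closed) auto
 moreover have "U - (U - {x}) = {x}" using x by auto
 ultimately have ox: "open {x}" by simp
 have oy: "open {y}" for y :: 'g
 proof -
  have "open ((%z. z + (- y + x)) -` {x})"
   by (rule open_vimage[OF ox]) (intro continuous_intros)
  moreover have "(%z. z + (- y + x)) -` {x} = {y}"
  proof -
   have "z + (- y + x) = x \<longleftrightarrow> z = y" for z
    by (metis add.assoc add_left_imp_eq add_minus_cancel add_right_imp_eq minus_add_cancel)
   then show ?thesis by auto
  qed
  ultimately show ?thesis by simp
 qed
 have "open S" for S :: "'g set"
  using open_UN[of S "%y. {y}"] oy by simp
 then have "(euclidean :: 'g topology) = discrete_topology UNIV"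
  by (simp add: topology_eq)
 then show False using nd by (simp add: discrete_group_def)
qed

text \<open>A nonzero difference determines the larger of its two indices. It cannot be asked to
  determine the pair: in a group of exponent 2 the pairs \<open>(i, j)\<close> and
  \<open>(j, i)\<close> have the same difference.\<close>

definition generic :: "(nat => 'g::group_add) => nat => bool" where
 "generic x k \<longleftrightarrow> (ALL i<k. ALL j<k. ALL i'<k. ALL j'<k.
  i ~= j --> x i - x j = x i' - x j' --> i' ~= j' & max i j = max i' j')"

lemma genericD:
 "generic x k ==> i < k ==> j < k ==> i' < k ==> j' < k ==> i ~= j ==> x i - x j = x i' - x j' ==>
  i' ~= j' & max i j = max i' j'"
 unfolding generic_def by blast

text \<open>A new coincidence between a difference containing \<open>y\<close> once and an old
  difference would put \<open>y\<close> into the finite set \<open>B\<close>; coincidences between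
  two differences with \<open>y\<close> on one side have the same larger index anyway.\<close>

lemma generic_extend:
 fixes x :: "nat => 'g::group_add"
 assumes g: "generic x k" and S: "infinite S"
 obtains y where "y : S" "generic (x(k := y)) (Suc k)"
proof -
 define B where "B = (%(a, b, c). x a - x b + x c) ` ({..<k} \<times> {..<k} \<times> {..<k})"
 have "finite B" unfolding B_def by simp
 then obtain y where y: "y : S" "y ~: B" using S by (metis finite_subset subsetI)
 have B: "y ~= x a - x b + x c" if "a < k" "b < k" "c < k" for a b c
  using y(2) that unfolding B_def by (auto simp: image_iff)
 have yB: "y - x c ~= x a - x b" "x c - y ~= x b - x a" if "a < k" "b < k" "c < k" for a b c
 proof -
  show "y - x c ~= x a - x b" using B[OF that] by (auto simp: diff_eq_eq)
  show "x c - y ~= x b - x a"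
  proof
   assume "x c - y = x b - x a"
   then have "- (x c - y) = - (x b - x a)" by simp
   then have "y - x c = x a - x b" by simp
   then show False using B[OF that] by (auto simp: diff_eq_eq)
  qed
 qed
 have y0: "y ~= x c" if "c < k" for c using B[OF that that that] by simp
 have "generic (x(k := y)) (Suc k)"
  unfolding generic_def
 proof (intro allI impI)
  fix i j i' j' assume l: "i < Suc k" "j < Suc k" "i' < Suc k" "j' < Suc k" "i ~= j"
   and eq: "(x(k := y)) i - (x(k := y)) j = (x(k := y)) i' - (x(k := y)) j'"
  have ij: "x i ~= x j" if "i < k" "j < k" using genericD[OF g that(1,2) that(1) that(1)] l(5) by auto
  consider "i < k" "j < k" | "i = k" "j < k" | "i < k" "j = k" using l by linarith
  then show "i' ~= j' & max i j = max i' j'"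
  proof cases
   case 1
   consider "i' < k" "j' < k" | "i' = k" "j' < k" | "i' < k" "j' = k" | "i' = k" "j' = k" using l by linarith
   then show ?thesis
   proof cases
    case a: 1
    then show ?thesis using eq 1 genericD[OF g 1 a l(5)] by simp
   next
    case 2 then show ?thesis using eq 1 yB(1)[of i j j'] by auto
   next
    case 3 then show ?thesis using eq 1 yB(2)[of j i i'] by auto
   next
    case 4 then show ?thesis using eq 1 ij by auto
   qed
  next
   case 2
   consider "i' < k" "j' < k" | "i' = k" "j' < k" | "i' < k" "j' = k" | "i' = k" "j' = k" using l by linarith
   then show ?thesis
   proof cases
    case 1 then show ?thesis using eq 2 yB(1)[of i' j' j] by auto
   next
    case 4 then show ?thesis using eq 2 y0[of j] by auto
   qed (use 2 in auto)
  next
   case 3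
   consider "i' < k" "j' < k" | "i' = k" "j' < k" | "i' < k" "j' = k" | "i' = k" "j' = k" using l by linarith
   then show ?thesis
   proof cases
    case 1 then show ?thesis using eq 3 yB(2)[of j' i' i] by auto
   next
    case 4 then show ?thesis using eq 3 y0[of i] by auto
   qed (use 3 in auto)
  qed
 qed
 then show thesis using that y(1) by blast
qed

text \<open>Doubles the number of points: the point with index \<open>n + i\<close> is chosen in the
  neighbourhood \<open>x i + W\<close> of its parent.\<close>

lemma generic_children:
 fixes x :: "nat => 'g::{topological_group_add,t2_space}"
 assumes nd: "~ discrete_group TYPE('g)" and W: "open W" "0 : W" and g: "generic x n" and k: "k <= n"
 shows "EX y. (ALL i<n. y i = x i) & generic y (n + k) & (ALL i<k. - x i + y (n + i) : W)"
 using k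
proof (induction k)
 case 0 then show ?case using g by (intro exI[of _ x]) auto
next
 case (Suc k)
 then obtain y where y: "ALL i<n. y i = x i" "generic y (n + k)" "ALL i<k. - x i + y (n + i) : W" by auto
 have "open ((%z. - x k + z) -` W)" by (rule open_vimage[OF W(1)]) (intro continuous_intros)
 moreover have "x k : (%z. - x k + z) -` W" using W(2) by simp
 ultimately have "infinite ((%z. - x k + z) -` W)" by (intro infinite_open_of_nondiscrete[OF nd] notI) (simp_all only: empty_iff)
 from generic_extend[OF y(2) this] obtain z where z: "- x k + z : W" "generic (y(n + k := z)) (Suc (n + k))" by auto
 show ?case
 proof (intro exI[of _ "y(n + k := z)"] conjI)
  show "generic (y(n + k := z)) (n + Suc k)" using z(2) by (simp del: fun_upd_apply)
 qed (use y z in \<open>auto simp: less_Suc_eq\<close>)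
qed

lemma common_nbhd:
 fixes P :: "'i => 'g::{topological_space,zero} set => bool"
 assumes "finite I" and ex: "!!i. i : I ==> EX U. open U & 0 : U & P i U"
  and anti: "!!i U U'. i : I ==> P i U ==> U' \<subseteq> U ==> P i U'"
 shows "EX U. open U & 0 : U & (ALL i:I. P i U)"
proof -
 obtain U where U: "!!i. i : I ==> open (U i) & 0 : U i & P i (U i)" using ex by metis
 show ?thesis
 proof (intro exI[of _ "\<Inter>i\<in>I. U i"] conjI ballI)
  show "open (\<Inter>i\<in>I. U i)" using assms(1) U by (intro open_INT) auto
  show "0 : (\<Inter>i\<in>I. U i)" using U by auto
  show "P i (\<Inter>i\<in>I. U i)" if "i : I" for i using U[OF that] anti[OF that, of "U i"] that by blast
 qed
qed

lemma square_nbhd: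
 fixes f :: "'g::{topological_space,zero} \<times> 'g => 'h::topological_space"
 assumes f: "continuous_on UNIV f" and W: "open W" "f (0, 0) : W"
 shows "EX U. open U & 0 : U & (ALL u:U. ALL v:U. f (u, v) : W)"
proof -
 have "open (f -` W)" using f W(1) by (simp add: open_vimage)
 moreover have "(0, 0) : f -` W" using W(2) by simp
 ultimately obtain A B where AB: "open A" "open B" "(0, 0) : A \<times> B" "A \<times> B \<subseteq> f -` W" by (rule open_prod_elim)
 have "f (u, v) : W" if "u : A Int B" "v : A Int B" for u v
  using that AB(4) by (auto dest: subsetD[of _ _ "(u, v)"])
 then show ?thesis using AB by (intro exI[of _ "A Int B"]) auto
qed

text \<open>\<open>V\<close> is so small that the thickened differences
  \<open>x i + V - V - x j\<close> meet only if the differences themselves coincide;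
  \<open>generic\<close> then applies to thickened points.\<close>

definition separated :: "(nat => 'g::group_add) => nat => 'g set => bool" where
 "separated x k V \<longleftrightarrow> (ALL i<k. ALL j<k. ALL i'<k. ALL j'<k. ALL u:V. ALL v:V. ALL u':V. ALL v':V.
  x i + u - v - x j = x i' + u' - v' - x j' --> x i - x j = x i' - x j')"

lemma separated_nbhd:
 fixes x :: "nat => 'g::{topological_group_add,t2_space}"
 shows "EX U. open U & 0 : U & separated x k U"
proof -
 let ?I = "{..<k} \<times> {..<k} \<times> {..<k} \<times> {..<k}"
 let ?P = "%(i, j, i', j') V. ALL u:V. ALL v:V. ALL u':V. ALL v':V.
  x i + u - v - x j = x i' + u' - v' - x j' --> x i - x j = x i' - x j'"
 have "EX U. open U & 0 : U & (ALL p:?I. ?P p U)"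
 proof (rule common_nbhd)
  fix p assume "p : ?I"
  obtain i j i' j' where p: "p = (i, j, i', j')" by (cases p)
  show "EX U. open U & 0 : U & ?P p U"
  proof (cases "x i - x j = x i' - x j'")
   case True then show ?thesis by (intro exI[of _ UNIV]) (simp add: p)
  next
   case False
   from hausdorff[OF this]
   obtain A B where AB: "open A" "open B" "x i - x j : A" "x i' - x j' : B" "A Int B = {}" by auto
   have "continuous_on UNIV (%q. x a + fst q - snd q - x b)" for a b by (intro continuous_intros)
   note sq = square_nbhd[OF this]
   obtain U where U: "open U" "0 : U" "ALL u:U. ALL v:U. x i + u - v - x j : A" using sq[OF AB(1), of i j] AB(3) by auto
   obtain U' where U': "open U'" "0 : U'" "ALL u:U'. ALL v:U'. x i' + u - v - x j' : B" using sq[OF AB(2), of i' j'] AB(4) by auto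
   have "x i + u - v - x j ~= x i' + u' - v' - x j'" if "u : U" "v : U" "u' : U'" "v' : U'" for u v u' v'
   proof
    assume "x i + u - v - x j = x i' + u' - v' - x j'"
    moreover have "x i + u - v - x j : A" "x i' + u' - v' - x j' : B" using U(3) U'(3) that by auto
    ultimately show False using AB(5) by auto
   qed
   then show ?thesis using U U' by (intro exI[of _ "U Int U'"]) (simp add: p open_Int)
  qed
 next
  fix p U U' assume "?P p U" "U' \<subseteq> U"
  then show "?P p U'" by (cases p) (simp, meson subsetD)
 qed simp
 then obtain U where "open U & 0 : U & (ALL p:?I. ?P p U)" by (rule exE)
 then have U: "open U" "0 : U" "ALL p:?I. ?P p U" by simp_all
 have "separated x k U" unfolding separated_def
 proof (intro allI impI ballI)
  fix i j i' j' u v u' v'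
  assume "i < k" "j < k" "i' < k" "j' < k" "u : U" "v : U" "u' : U" "v' : U"
   and "x i + u - v - x j = x i' + u' - v' - x j'"
  then show "x i - x j = x i' - x j'" using bspec[OF U(3), of "(i, j, i', j')"] by simp blast
 qed
 then show ?thesis using U(1,2) by (intro exI[of _ U]) simp
qed

lemma separated_mono: "separated x k V ==> V' \<subseteq> V ==> separated x k V'"
 unfolding separated_def by (meson subsetD)

text \<open>The first clause makes the intersection of all \<open>V n\<close> a subgroup. The
  clauses with \<open>x i\<close> on both sides control conjugation, as the subgroup need not be
  normal. The last one puts the cell at index \<open>i\<close>, with room for one more summand, into
  the interior of its parent cell at \<open>i mod 2 ^ n\<close>.\<close>

definition refines :: "(nat => 'g::topological_group_add) => nat => 'g set => 'g set => bool" where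
 "refines x n V V' \<longleftrightarrow> (ALL u:V'. ALL v:V'. u - v : V & (ALL i<2 ^ Suc n. x i + u - v - x i : V & - x i + u + x i : V &
  - x (i mod 2 ^ n) + (x i + u + v) : interior V))"

lemma refinement:
 fixes x :: "nat => 'g::{topological_group_add,t2_space}"
 assumes lc: "locally_compact_space (euclidean :: 'g topology)" and nd: "~ discrete_group TYPE('g)"
  and g: "generic x (2 ^ n)" and V: "0 : interior V"
 shows "EX x' V'. (ALL i<2 ^ n. x' i = x i) & generic x' (2 ^ Suc n) & compact V' & 0 : interior V' &
  separated x' (2 ^ Suc n) V' & refines x' n V V'"
proof -
 obtain y where y: "ALL i<2 ^ n. y i = x i" "generic y (2 ^ n + 2 ^ n)" "ALL i<2 ^ n. - x i + y (2 ^ n + i) : interior V"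
  using generic_children[OF nd open_interior V g order_refl] by (elim exE conjE)
 have nb: "EX U. open U & 0 : U & (ALL i<2 ^ Suc n. ALL u:U. ALL v:U. f i (u, v) : interior V)"
  if f: "!!i. continuous_on UNIV (f i)" "!!i. i < 2 ^ Suc n ==> f i (0, 0) : interior V" for f :: "nat => 'g \<times> 'g => 'g"
 proof -
  have "EX U. open U & 0 : U & (ALL i:{..<2 ^ Suc n}. ALL u:U. ALL v:U. f i (u, v) : interior V)"
  proof (rule common_nbhd)
   fix i :: nat assume "i : {..<2 ^ Suc n}"
   then show "EX U. open U & 0 : U & (ALL u:U. ALL v:U. f i (u, v) : interior V)"
    using f by (intro square_nbhd) auto
  qed (auto dest: subsetD)
  then show ?thesis by (simp only: Ball_def lessThan_iff)
 qed
 \<comment> \<open>For an old index the parent is the point itself; a new index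
   \<open>2 ^ n + k\<close> has the parent \<open>k\<close>.\<close>
 have par: "- y (i mod 2 ^ n) + y i : interior V" if "i < 2 ^ Suc n" for i
 proof (cases "i < 2 ^ n")
  case True then show ?thesis using V by simp
 next
  case False
  then obtain k where k: "i = 2 ^ n + k" using le_Suc_ex[of "2 ^ n" i] by auto
  then have "k < 2 ^ n" using that by simp
  then show ?thesis using y by (simp add: k)
 qed
 obtain U0 where U0: "open U0" "0 : U0" "separated y (2 ^ Suc n) U0"
  using separated_nbhd[of y "2 ^ Suc n"] by (elim exE conjE)
 obtain U1 where U1: "open U1" "0 : U1" "ALL u:U1. ALL v:U1. u - v : interior V"
 proof -
  have "continuous_on UNIV (%q :: 'g \<times> 'g. fst q - snd q)" by (intro continuous_intros)
  from square_nbhd[OF this open_interior, of V]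
  have "EX U. open U & 0 : U & (ALL u:U. ALL v:U. u - v : interior V)" using V by simp
  then show thesis by (elim exE conjE) (rule that)
 qed
 obtain U2 where U2: "open U2" "0 : U2" "ALL i<2 ^ Suc n. ALL u:U2. ALL v:U2. y i + u - v - y i : interior V"
 proof -
  have "continuous_on UNIV (%q :: 'g \<times> 'g. y i + fst q - snd q - y i)" for i by (intro continuous_intros)
  from nb[of "%i q. y i + fst q - snd q - y i", OF this]
  have "EX U. open U & 0 : U & (ALL i<2 ^ Suc n. ALL u:U. ALL v:U. y i + u - v - y i : interior V)"
   using V by (simp del: power_Suc)
  then show thesis by (elim exE conjE) (rule that)
 qed
 obtain U3 where U3: "open U3" "0 : U3" "ALL i<2 ^ Suc n. ALL u:U3. ALL v:U3. - y i + u + y i : interior V"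
 proof -
  have "continuous_on UNIV (%q :: 'g \<times> 'g. - y i + fst q + y i)" for i by (intro continuous_intros)
  from nb[of "%i q. - y i + fst q + y i", OF this]
  have "EX U. open U & 0 : U & (ALL i<2 ^ Suc n. ALL u:U. ALL v:U. - y i + u + y i : interior V)"
   using V by (simp del: power_Suc)
  then show thesis by (elim exE conjE) (rule that)
 qed
 obtain U4 where U4: "open U4" "0 : U4"
  "ALL i<2 ^ Suc n. ALL u:U4. ALL v:U4. - y (i mod 2 ^ n) + (y i + u + v) : interior V"
 proof -
  have "continuous_on UNIV (%q :: 'g \<times> 'g. - y (i mod 2 ^ n) + (y i + fst q + snd q))" for i by (intro continuous_intros)
  from nb[of "%i q. - y (i mod 2 ^ n) + (y i + fst q + snd q)", OF this]
  have "EX U. open U & 0 : U & (ALL i<2 ^ Suc n. ALL u:U. ALL v:U. - y (i mod 2 ^ n) + (y i + u + v) : interior V)"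
   using par by (simp del: power_Suc)
  then show thesis by (elim exE conjE) (rule that)
 qed
 define U where "U = U0 Int U1 Int U2 Int U3 Int U4"
 have U: "open U" "0 : U" using U0 U1 U2 U3 U4 by (auto simp: U_def)
 obtain W C where W: "open W" "compact C" "0 : W" "W \<subseteq> C" "C \<subseteq> U" by (rule compact_nhd[OF lc U])
 note int = subsetD[OF interior_subset[of V]]
 have "refines y n V C"
  unfolding refines_def
 proof (intro ballI allI impI conjI)
  fix u v and i :: nat assume "u : C" "v : C"
  then have uv: "u : U1" "v : U1" "u : U2" "v : U2" "u : U3" "v : U3" "u : U4" "v : U4"
   using W(5) by (auto simp: U_def)
  show "u - v : V" using U1(3) uv by (auto intro: int)
  assume i: "i < 2 ^ Suc n"
  show "y i + u - v - y i : V" using U2(3)[rule_format, OF i uv(3,4)] by (rule int)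
  show "- y i + u + y i : V" using U3(3)[rule_format, OF i uv(5,6)] by (rule int)
  show "- y (i mod 2 ^ n) + (y i + u + v) : interior V" by (rule U4(3)[rule_format, OF i uv(7,8)])
 qed
 moreover have "0 : interior C" using interior_maximal[OF W(4,1)] W(3) by (rule subsetD)
 moreover have "separated y (2 ^ Suc n) C" using U0(3) by (rule separated_mono) (use W(5) in \<open>auto simp: U_def\<close>)
 moreover have "generic y (2 ^ Suc n)" using y(2) by (simp add: mult_2)
 ultimately show ?thesis using y(1) W(2) by (intro exI[of _ y] exI[of _ C]) simp
qed

lemma generic_cong:
 assumes x: "!!i. i < k ==> y i = x i" and g: "generic x k" shows "generic y k"
 unfolding generic_def
proof (intro allI impI)
 fix i j i' j' assume l: "i < k" "j < k" "i' < k" "j' < k" "i ~= j" "y i - y j = y i' - y j'"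
 then have "x i - x j = x i' - x j'" by (simp only: x)
 with l show "i' ~= j' & max i j = max i' j'" by (intro genericD[OF g])
qed

lemma separated_cong:
 assumes x: "!!i. i < k ==> y i = x i" and g: "separated x k V" shows "separated y k V"
 unfolding separated_def
proof (intro allI impI ballI)
 fix i j i' j' u v u' v'
 assume l: "i < k" "j < k" "i' < k" "j' < k" "u : V" "v : V" "u' : V" "v' : V"
  "y i + u - v - y j = y i' + u' - v' - y j'"
 then have "x i + u - v - x j = x i' + u' - v' - x j'" by (simp only: x)
 with g l have "x i - x j = x i' - x j'" unfolding separated_def by blast
 with l show "y i - y j = y i' - y j'" by (simp only: x)
qed

text \<open>Dependent choice yields point sequences that change from level to level, but level
  \<open>n + 1\<close> keeps the first \<open>2 ^ n\<close> points, so a diagonal sequence serves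
  all levels.\<close>

lemma cantor_scheme:
 assumes lc: "locally_compact_space (euclidean :: 'g::{topological_group_add,t2_space} topology)"
  and nd: "~ discrete_group TYPE('g)"
 shows "EX (x :: nat => 'g) V. ALL n. compact (V n) & 0 : interior (V n) & generic x (2 ^ n) &
  separated x (2 ^ n) (V n) & refines x n (V n) (V (Suc n))"
proof -
 let ?P = "%n (x :: nat => 'g, V). generic x (2 ^ n) & compact V & 0 : interior V & separated x (2 ^ n) V"
 let ?Q = "%n (x :: nat => 'g, V) (x', V'). (ALL i<2 ^ n. x' i = x i) & refines x' n V V'"
 obtain W C where W: "open W" "compact C" "(0 :: 'g) : W" "W \<subseteq> C" "C \<subseteq> UNIV" by (rule compact_nhd[OF lc open_UNIV UNIV_I])
 have "0 : interior C" using interior_maximal[OF W(4,1)] W(3) by (rule subsetD)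
 then have "EX s. ?P 0 s"
  using W(2) by (intro exI[of _ "(%_. 0, C)"]) (simp add: generic_def separated_def)
 moreover have "EX s'. ?P (Suc n) s' & ?Q n s s'" if "?P n s" for n s
 proof -
  obtain x V where s: "s = (x, V)" by (cases s)
  have "generic x (2 ^ n)" "0 : interior V" using that by (simp_all add: s)
  from refinement[OF lc nd this] obtain x' V' where "(ALL i<2 ^ n. x' i = x i)" "generic x' (2 ^ Suc n)" "compact V'" "0 : interior V'"
   "separated x' (2 ^ Suc n) V'" "refines x' n V V'" by (elim exE conjE)
  then show ?thesis by (intro exI[of _ "(x', V')"]) (simp add: s del: power_Suc)
 qed
 ultimately have "EX S. ALL n. ?P n (S n) & ?Q n (S n) (S (Suc n))" by (rule dependent_nat_choice)
 then obtain S where S: "ALL n. ?P n (S n) & ?Q n (S n) (S (Suc n))" by (rule exE)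
 define X V where "X n = fst (S n)" and "V n = snd (S n)" for n
 have S: "generic (X n) (2 ^ n)" "compact (V n)" "0 : interior (V n)" "separated (X n) (2 ^ n) (V n)"
  "ALL i<2 ^ n. X (Suc n) i = X n i" "refines (X (Suc n)) n (V n) (V (Suc n))" for n
  using spec[OF S, of n] by (simp_all add: X_def V_def split_beta)
 have agree: "X (n + k) i = X n i" if "i < 2 ^ n" for i n k
 proof (induction k)
  case (Suc k)
  have "i < 2 ^ (n + k)" using that by (rule less_le_trans) (simp add: power_increasing)
  then show ?case using S(5)[of "n + k"] Suc by simp
 qed simp
 \<comment> \<open>Since \<open>i < 2 ^ i\<close>, point \<open>i\<close> no longer changes from
   level \<open>i\<close> on.\<close>
 define x where "x i = X i i" for i
 have x: "x i = X n i" if i: "i < 2 ^ n" for i n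
 proof -
  have "i < 2 ^ i" by (rule less_exp)
  from agree[OF this, of n] agree[OF i, of i] show ?thesis by (simp add: x_def add.commute)
 qed
 have "generic x (2 ^ n)" for n by (rule generic_cong[OF _ S(1)]) (rule x)
 moreover have "separated x (2 ^ n) (V n)" for n by (rule separated_cong[OF _ S(4)]) (rule x)
 moreover have "refines x n (V n) (V (Suc n))" for n
 proof -
  have "x (i mod 2 ^ n) = X (Suc n) (i mod 2 ^ n)" for i
   by (rule x) (rule less_le_trans[of _ "2 ^ n"], simp_all)
  then show ?thesis using S(6)[of n] unfolding refines_def by (simp add: x[of _ "Suc n"] del: power_Suc)
 qed
 ultimately show ?thesis using S(2,3) by (intro exI[of _ x] exI[of _ V]) simp
qed

section \<open>The Cantor set, its subgroup and its measure\<close>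

locale cantor =
 fixes x :: "nat => 'g::{topological_group_add,t2_space}" and V :: "nat => 'g set"
 assumes compact_V: "compact (V n)" and V0: "0 : interior (V n)" and generic: "generic x (2 ^ n)"
  and separated: "separated x (2 ^ n) (V n)" and refines: "refines x n (V n) (V (Suc n))"
begin

lemma zero_V: "0 : V n" using V0 interior_subset by blast

lemma V_diff: "u : V (Suc n) ==> v : V (Suc n) ==> u - v : V n"
 using refines[of n] unfolding refines_def by blast

lemma V_conj: "i < 2 ^ Suc n ==> u : V (Suc n) ==> v : V (Suc n) ==> x i + u - v - x i : V n"
 using refines[of n] unfolding refines_def by blast

lemma V_conj': "i < 2 ^ Suc n ==> u : V (Suc n) ==> - x i + u + x i : V n"
 using refines[of n] zero_V[of "Suc n"] unfolding refines_def by blast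

lemma V_parent: "i < 2 ^ Suc n ==> u : V (Suc n) ==> v : V (Suc n) ==>
  - x (i mod 2 ^ n) + (x i + u + v) : interior (V n)"
 using refines[of n] unfolding refines_def by blast

lemma V_Suc: "V (Suc n) \<subseteq> V n"
 using V_diff[OF _ zero_V] by auto

lemma V_antimono: "m <= n ==> V n \<subseteq> V m"
 by (rule lift_Suc_antimono_le[of V]) (rule V_Suc)

lemma x_inj: "i < 2 ^ n ==> j < 2 ^ n ==> x i - x j = 0 ==> i = j"
 using genericD[OF generic[of n], of i j i i] by auto

lemma separatedD:
 "i < 2 ^ n ==> j < 2 ^ n ==> i' < 2 ^ n ==> j' < 2 ^ n ==> u : V n ==> v : V n ==> u' : V n ==> v' : V n ==>
  x i + u - v - x j = x i' + u' - v' - x j' ==> x i - x j = x i' - x j'"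
 using separated[of n] unfolding separated_def by blast

definition N where "N = (\<Inter>n. V n)"

definition cell where "cell n i = {z. - x i + z : V n}"

text \<open>The limit measure is bounded from above only on open sets, so each closed cell is
  estimated through the open cell of its parent.\<close>

definition ocell where "ocell n i = {z. - x i + z : interior (V n)}"

definition level where "level n = (\<Union>i<2 ^ n. cell n i)"

definition P where "P = (\<Inter>n. level n)"

lemma cell_compact: "compact (cell n i)"
 unfolding cell_def by (rule compact_translate'[OF compact_V])

lemma ocell_open: "open (ocell n i)"
proof -
 have "continuous_on UNIV (%z. - x i + z)" by (intro continuous_intros)
 from open_vimage[OF open_interior[of "V n"] this] show ?thesis by (simp add: ocell_def vimage_def)
qed

lemma ocell_cell: "ocell n i \<subseteq> cell n i"
 unfolding ocell_def cell_def using interior_subset by blast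

lemma x_cell: "x i : cell n i" by (simp add: cell_def zero_V)

lemma cell_Suc: "i < 2 ^ Suc n ==> cell (Suc n) i \<subseteq> ocell n (i mod 2 ^ n)"
 using V_parent[OF _ _ zero_V] unfolding cell_def ocell_def by fastforce

lemma cell_descend: "i < 2 ^ (n + k) ==> cell (n + k) i \<subseteq> cell n (i mod 2 ^ n)"
proof (induction k arbitrary: i)
 case (Suc k)
 have "cell (n + Suc k) i \<subseteq> ocell (n + k) (i mod 2 ^ (n + k))" using cell_Suc[of i "n + k"] Suc.prems by simp
 also have "... \<subseteq> cell (n + k) (i mod 2 ^ (n + k))" by (rule ocell_cell)
 also have "... \<subseteq> cell n (i mod 2 ^ (n + k) mod 2 ^ n)" by (rule Suc.IH) simp
 also have "i mod 2 ^ (n + k) mod 2 ^ n = i mod 2 ^ n" by (simp add: mod_mod_cancel le_imp_power_dvd)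
 finally show ?case .
qed simp

lemma x_descend: "x i : cell n (i mod 2 ^ n)"
proof -
 have "i < 2 ^ i" by (rule less_exp)
 also have "(2 :: nat) ^ i <= 2 ^ (n + i)" by (rule power_increasing) auto
 finally show ?thesis using cell_descend[of i n i] x_cell by blast
qed

lemma cell_disjoint:
 assumes "i < 2 ^ n" "j < 2 ^ n" "z : cell n i" "z : cell n j" shows "i = j"
proof -
 \<comment> \<open>Compares \<open>x i - x j\<close> with the zero difference at index 0 through
   \<open>separated\<close>.\<close>
 have "x i + (- x i + z) - (- x j + z) - x j = x 0 + 0 - 0 - x 0"
  by (simp add: add.assoc diff_conv_add_uminus minus_add del: add_uminus_conv_diff)
 from separatedD[OF assms(1,2) _ _ _ _ _ _ this] assms zero_V
 have "x i - x j = 0" by (auto simp: cell_def)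
 then show ?thesis using x_inj assms by blast
qed

lemma level_Suc: "level (Suc n) \<subseteq> level n"
proof
 fix z assume "z : level (Suc n)"
 then obtain i where i: "i < 2 ^ Suc n" "z : cell (Suc n) i" by (auto simp: level_def)
 then have "z : cell n (i mod 2 ^ n)" using cell_Suc[OF i(1)] ocell_cell by blast
 then show "z : level n" by (auto simp: level_def)
qed

lemma level_antimono: "m <= n ==> level n \<subseteq> level m"
 by (rule lift_Suc_antimono_le[of level]) (rule level_Suc)

lemma level_compact: "compact (level n)"
 unfolding level_def by (intro compact_UN) (auto simp: cell_compact)

lemma compact_P: "compact P"
proof -
 have "closed P" unfolding P_def using level_compact by (intro closed_INT) (auto intro: compact_imp_closed)
 then have "compact (level 0 Int P)" by (rule compact_Int_closed[OF level_compact])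
 moreover have "level 0 Int P = P" by (auto simp: P_def)
 ultimately show ?thesis by simp
qed

lemma compact_N: "compact N"
proof -
 have "closed N" unfolding N_def using compact_V by (intro closed_INT) (auto intro: compact_imp_closed)
 then have "compact (V 0 Int N)" by (rule compact_Int_closed[OF compact_V])
 moreover have "V 0 Int N = N" by (auto simp: N_def)
 ultimately show ?thesis by simp
qed

lemma N_diff: "u : N ==> v : N ==> u - v : N"
 unfolding N_def using V_diff by blast

lemma subgroup_N: "add_subgroup N"
proof -
 have 0: "0 : N" by (simp add: N_def zero_V)
 have m: "- v : N" if "v : N" for v using N_diff[OF 0 that] by simp
 have "u + v : N" if "u : N" "v : N" for u v using N_diff[OF that(1) m[OF that(2)]] by simp
 then show ?thesis using 0 m by (simp add: add_subgroup_def)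
qed

lemma P_cell: assumes "z : P" obtains i where "i < 2 ^ n" "z : cell n i"
 using assms unfolding P_def level_def by blast

text \<open>Translation from the left by \<open>u\<close> moves a point \<open>x i + v\<close> to
  \<open>x i + (- x i + u + x i) + v\<close>. The conjugate lies in the next larger neighbourhood,
  and the parent cell has room for the extra summand.\<close>

lemma N_P: assumes u: "u : N" and z: "z : P" shows "u + z : P"
proof -
 have "u + z : level n" for n
 proof -
  obtain i where i: "i < 2 ^ Suc n" "z : cell (Suc n) i" by (rule P_cell[OF z])
  have "u : V (Suc (Suc n))" using u by (simp add: N_def)
  then have "- x i + u + x i : V (Suc n)" using i(1) by (intro V_conj') simp
  from V_parent[OF i(1) this, of "- x i + z"] i(2)
  have "- x (i mod 2 ^ n) + (u + z) : interior (V n)" by (simp add: cell_def add.assoc)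
  then have "u + z : cell n (i mod 2 ^ n)" using interior_subset by (auto simp: cell_def)
  then show ?thesis by (auto simp: level_def)
 qed
 then show ?thesis by (simp add: P_def)
qed

text \<open>Two points of \<open>P\<close> in the same coset differ by an element of
  \<open>N\<close>, which is a thickened zero difference. By \<open>separated\<close> the cells of
  the two points have equal centres.\<close>

lemma coset_cell:
 obtains i where "i < 2 ^ n" "{z. z - k : N} Int P \<subseteq> cell n i"
proof (cases "{z. z - k : N} Int P = {}")
 case True then show ?thesis by (intro that[of 0]) auto
next
 case False
 then obtain z0 where z0: "z0 - k : N" "z0 : P" by blast
 obtain i where i: "i < 2 ^ n" "z0 : cell n i" by (rule P_cell[OF z0(2)])
 have "z : cell n i" if z: "z - k : N" "z : P" for z
 proof -
  obtain j where j: "j < 2 ^ n" "z : cell n j" by (rule P_cell[OF z(2)])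
  have "(z - k) - (z0 - k) : N" using N_diff z(1) z0(1) by blast
  moreover have "(z - k) - (z0 - k) = z - z0"
   by (simp add: add.assoc diff_conv_add_uminus minus_add del: add_uminus_conv_diff)
  ultimately have "z - z0 : V (Suc n)" by (simp add: N_def)
  then have w: "- x 0 + (z - z0) + x 0 : V n" by (intro V_conj') simp
  have "x j + (- x j + z) - (- x i + z0) - x i = x 0 + (- x 0 + (z - z0) + x 0) - 0 - x 0"
   by (simp add: add.assoc diff_conv_add_uminus minus_add del: add_uminus_conv_diff)
  from separatedD[OF j(1) i(1) _ _ _ _ w _ this] i(2) j(2) zero_V
  have "x j - x i = 0" by (simp add: cell_def)
  then show ?thesis using x_inj[OF j(1) i(1)] j(2) by simp
 qed
 then show ?thesis using i(1) by (intro that[of i]) auto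
qed

text \<open>If \<open>z\<close> and \<open>k + z\<close> lie in cells \<open>j\<close> and
  \<open>i\<close>, then \<open>k\<close> is a thickened difference of \<open>x i\<close> and
  \<open>x j\<close>, nonzero because \<open>k\<close> is outside \<open>V n\<close>. All such pairs
  have the same larger index \<open>M\<close>: either \<open>j = M\<close>, or \<open>i = M\<close>
  and then \<open>j\<close> is unique. So \<open>z\<close> can lie in two cells at most.\<close>

lemma translate_cells:
 assumes k: "k ~: V n"
 obtains a b where "a < 2 ^ Suc n" "b < 2 ^ Suc n" "{z. k + z : P} Int P \<subseteq> cell (Suc n) a Un cell (Suc n) b"
proof -
 define R where "R i j \<longleftrightarrow> i < 2 ^ Suc n & j < 2 ^ Suc n & (EX u:V (Suc n). EX v:V (Suc n). k = x i + u - v - x j)" for i j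
 have R: "EX i j. R i j & z : cell (Suc n) j" if z: "k + z : P" "z : P" for z
 proof -
  obtain i where i: "i < 2 ^ Suc n" "k + z : cell (Suc n) i" by (rule P_cell[OF z(1)])
  obtain j where j: "j < 2 ^ Suc n" "z : cell (Suc n) j" by (rule P_cell[OF z(2)])
  have "k = x i + (- x i + (k + z)) - (- x j + z) - x j"
   by (simp add: add.assoc diff_conv_add_uminus minus_add del: add_uminus_conv_diff)
  then have "R i j" using i j unfolding R_def cell_def by blast
  then show ?thesis using j(2) by blast
 qed
 \<comment> \<open>For \<open>i = j\<close> the conjugation clause of \<open>refines\<close> would
   place \<open>k\<close> in \<open>V n\<close>.\<close>
 have ne: "i ~= j" if "R i j" for i j
  using that V_conj[of i n] k unfolding R_def by auto
 have eq: "x i - x j = x i' - x j'" if r: "R i j" "R i' j'" for i j i' j'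
 proof -
  obtain u v where 1: "u : V (Suc n)" "v : V (Suc n)" "k = x i + u - v - x j" using r(1) by (auto simp: R_def)
  obtain u' v' where 2: "u' : V (Suc n)" "v' : V (Suc n)" "k = x i' + u' - v' - x j'" using r(2) by (auto simp: R_def)
  show ?thesis
   by (rule separatedD[of i "Suc n" j i' j' u v u' v']) (use r 1 2 in \<open>auto simp: R_def\<close>)
 qed
 have mx: "max i j = max i' j'" if r: "R i j" "R i' j'" for i j i' j'
  using genericD[OF generic[of "Suc n"] _ _ _ _ ne[OF r(1)] eq[OF r]] r unfolding R_def by blast
 have same: "j = j'" if r: "R i j" "R i j'" for i j j'
 proof -
  have "- (x i - x j) = - (x i - x j')" using eq[OF r] by simp
  then have "x j + - x i = x j' + - x i" by simp
  then have "x j = x j'" by (simp only: add_right_cancel)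
  then show ?thesis using x_inj[of j "Suc n" j'] r by (simp add: R_def)
 qed
 show thesis
 proof (cases "EX i j. R i j")
  case False
  then show thesis using R by (intro that[of 0 0]) auto
 next
  case True
  then obtain i0 j0 where r0: "R i0 j0" by blast
  define M where "M = max i0 j0"
  have M: "M < 2 ^ Suc n" using r0 by (auto simp: R_def M_def)
  have cases: "i = M \<or> j = M" if "R i j" for i j using mx[OF that r0] unfolding M_def by linarith
  show thesis
  proof (cases "EX j. R M j")
   case True
   then obtain b where b: "R M b" by blast
   have "j = M \<or> j = b" if "R i j" for i j using cases[OF that] same[OF _ b] that by blast
   then show thesis using R M b by (intro that[of M b]) (auto simp: R_def, blast+)
  next
   case False
   then have "j = M" if "R i j" for i j using cases[OF that] that by blast
   then show thesis using R M by (intro that[of M M]) (auto, blast+)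
  qed
 qed
qed

end

context cantor
begin

text \<open>The points \<open>x\<close> distribute evenly over the cells, so a cell of level
  \<open>n + 1\<close> has mass at most \<open>1 / 2 ^ n\<close>. A coset of \<open>N\<close> meets
  \<open>P\<close> in one cell of each level and a translate by \<open>k\<close> outside
  \<open>N\<close> in at most two, once the level is high enough; both are null.\<close>

lemma cantor_measure:
 obtains m where "radon m" "0 < measure m P" "emeasure m (- P) = 0"
  "!!k. measure m {z. z - k : N} = 0" "!!k. k ~: N ==> measure m {z. k + z : P} = 0"
proof -
 have "EX m. radon m & (ALL U r. open U --> 0 <= r -->
    eventually (%n. real (card {i. i < 2 ^ n & x i : U}) <= r * 2 ^ n) sequentially --> measure m U <= r) &
   (ALL K. compact K --> (ALL U. open U --> K \<subseteq> U --> (EX L. compact L & L \<subseteq> U & range x \<subseteq> L)) --> 1 <= measure m K)"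
 proof (rule equidistributed_radon[of x], goal_cases)
  case (1 m)
  then show ?case by (intro exI[of _ m]) simp
 qed
 then obtain m where m: "radon m"
  and up: "!!U r. open U ==> 0 <= r ==>
    eventually (%n. real (card {i. i < 2 ^ n & x i : U}) <= r * 2 ^ n) sequentially ==> measure m U <= r"
  and low: "!!K. compact K ==> ALL U. open U --> K \<subseteq> U --> (EX L. compact L & L \<subseteq> U & range x \<subseteq> L) ==> 1 <= measure m K"
  by (elim exE conjE) simp
 interpret finite_measure m using radon_finite[OF m] .
 have sets: "sets m = sets borel" using radon_sets[OF m] .
 have bc: "A : sets m" if "compact A" for A
  unfolding sets by (intro borel_closed compact_imp_closed that)
 \<comment> \<open>Among the first \<open>2 ^ l\<close> points only those with index congruent to
   \<open>j\<close> modulo \<open>2 ^ n\<close> can lie in cell \<open>j\<close>, which leaves at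
   most \<open>2 ^ (l - n)\<close>.\<close>
 have oc: "measure m (ocell n j) <= 1 / 2 ^ n" if j: "j < 2 ^ n" for n j
 proof (rule up[OF ocell_open])
  have "real (card {i. i < 2 ^ l & x i : ocell n j}) <= 1 / 2 ^ n * 2 ^ l" if l: "n <= l" for l
  proof -
   obtain q where q: "l = n + q" using l le_Suc_ex by blast
   let ?S = "{i. i < 2 ^ l & x i : ocell n j}"
   have md: "i mod 2 ^ n = j" if "i : ?S" for i
    using that cell_disjoint[of "i mod 2 ^ n" n j "x i"] x_descend[of i n] j ocell_cell by auto
   have "card ?S <= card {..<(2::nat) ^ q}"
   proof (rule card_inj_on_le[of "%i. i div 2 ^ n"])
    show "inj_on (%i. i div 2 ^ n) ?S"
    proof (rule inj_onI)
     fix i i' assume "i : ?S" "i' : ?S" "i div 2 ^ n = i' div 2 ^ n"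
     then show "i = i'" using md div_mult_mod_eq[of i "2 ^ n"] div_mult_mod_eq[of i' "2 ^ n"] by metis
    qed
    show "(%i. i div 2 ^ n) ` ?S \<subseteq> {..<2 ^ q}"
     by (auto simp: q power_add less_mult_imp_div_less mult.commute)
   qed simp
   then have "real (card ?S) <= 2 ^ q" by (metis card_lessThan of_nat_le_iff of_nat_numeral of_nat_power)
   then show ?thesis by (simp add: q power_add)
  qed
  then show "\<forall>\<^sub>F l in sequentially. real (card {i. i < 2 ^ l & x i : ocell n j}) <= 1 / 2 ^ n * 2 ^ l"
   by (rule eventually_sequentiallyI)
 qed simp
 have cb: "measure m (cell (Suc n) i) <= 1 / 2 ^ n" if "i < 2 ^ Suc n" for n i
 proof -
  have "measure m (cell (Suc n) i) <= measure m (ocell n (i mod 2 ^ n))"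
   using cell_Suc[OF that] ocell_open sets by (intro finite_measure_mono) auto
  also have "... <= 1 / 2 ^ n" by (rule oc) simp
  finally show ?thesis .
 qed
 \<comment> \<open>By compactness some level already lies inside a given neighbourhood of
   \<open>P\<close>, and every level contains all points \<open>x i\<close>.\<close>
 have mP: "1 <= measure m P"
 proof (rule low[OF compact_P], intro allI impI)
  fix U :: "'g set" assume U: "open U" "P \<subseteq> U"
  have "compact (level 0 - U)" using level_compact U(1) by (rule compact_diff)
  moreover have "level 0 - U \<subseteq> (\<Union>n\<in>UNIV. - level n)" using U(2) by (auto simp: P_def)
  moreover have "open (- level n)" for n using compact_imp_closed[OF level_compact] by (simp add: open_Compl)
  ultimately obtain F where F: "finite F" "level 0 - U \<subseteq> (\<Union>n\<in>F. - level n)"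
   using compactE_image[of "level 0 - U" UNIV "%n. - level n"] by metis
  define M where "M = Max (insert 0 F)"
  have M: "n <= M" if "n : F" for n using F(1) that by (simp add: M_def)
  have "level M \<subseteq> U"
  proof
   fix z assume z: "z : level M"
   then have "z : level n" if "n : F" for n using level_antimono[OF M[OF that]] by auto
   moreover have "z : level 0" using level_antimono[of 0 M] z by auto
   ultimately show "z : U" using F(2) by auto
  qed
  moreover have "range x \<subseteq> level M"
  proof (intro image_subsetI)
   fix i show "x i : level M" unfolding level_def by (rule UN_I[of "i mod 2 ^ M"]) (simp_all add: x_descend)
  qed
  ultimately show "EX L. compact L & L \<subseteq> U & range x \<subseteq> L" using level_compact[of M] by blast
 qed
 have "measure m UNIV <= 1"
 proof (rule up[OF open_UNIV])
  have "{i. i < 2 ^ n & x i : UNIV} = {..<(2::nat) ^ n}" for n by auto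
  then show "\<forall>\<^sub>F n in sequentially. real (card {i. i < 2 ^ n & x i : UNIV}) <= 1 * 2 ^ n" by simp
 qed simp
 then have "measure m (- P) <= 0"
  using mP finite_measure_compl[OF bc[OF compact_P]] sets_eq_imp_space_eq[OF sets] by (simp add: Compl_eq_Diff_UNIV)
 then have nP: "measure m (- P) = 0" by (simp add: antisym)
 \<comment> \<open>The total mass is at most 1 and \<open>P\<close> carries at least 1, so only
   intersections with \<open>P\<close> count.\<close>
 have inP: "measure m A = measure m (A Int P)" if "A : sets m" for A
 proof -
  have "measure m A <= measure m (A Int P) + measure m (- P)"
  proof -
   have "measure m A <= measure m ((A Int P) Un - P)"
    using that bc[OF compact_P] sets by (intro finite_measure_mono) auto
   also have "... <= measure m (A Int P) + measure m (- P)"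
    using that bc[OF compact_P] sets by (intro measure_Un_le) auto
   finally show ?thesis .
  qed
  moreover have "measure m (A Int P) <= measure m A" using that by (intro finite_measure_mono) auto
  ultimately show ?thesis using nP by simp
 qed
 have small: "r = 0" if "0 <= r" "!!n. n0 <= n ==> r <= 2 * (1 / 2 ^ n)" for r :: real and n0
 proof -
  have "(%n. 2 * (1 / 2 ^ n) :: real) \<longlonglongrightarrow> 2 * 0"
   using LIMSEQ_power_zero[of "1/2 :: real"] by (intro tendsto_mult tendsto_const) (simp add: power_one_over)
  then have "r <= 2 * 0" by (rule LIMSEQ_le_const) (use that(2) in blast)
  then show ?thesis using that(1) by simp
 qed
 have cN: "compact {z. z - k : N}" for k
 proof -
  have "compact ((%z. z + k) ` N)" by (intro compact_continuous_image compact_N continuous_intros)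
  moreover have "(%z. z + k) ` N = {z. z - k : N}"
   by (auto simp: image_iff intro!: bexI[of _ "_ - k"])
  ultimately show ?thesis by simp
 qed
 show thesis
 proof (rule that[OF m])
  show "0 < measure m P" using mP by simp
  show "emeasure m (- P) = 0" using nP by (simp add: emeasure_eq_measure)
  show "measure m {z. z - k : N} = 0" for k
  proof (rule small[of _ 0])
   fix n
   obtain i where i: "i < 2 ^ Suc n" "{z. z - k : N} Int P \<subseteq> cell (Suc n) i" by (rule coset_cell)
   have "measure m {z. z - k : N} = measure m ({z. z - k : N} Int P)" by (rule inP[OF bc[OF cN]])
   also have "... <= measure m (cell (Suc n) i)" by (rule finite_measure_mono[OF i(2) bc[OF cell_compact]])
   also have "... <= 1 / 2 ^ n" by (rule cb[OF i(1)])
   finally show "measure m {z. z - k : N} <= 2 * (1 / 2 ^ n)" by (simp add: field_simps)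
  qed simp
  show "measure m {z. k + z : P} = 0" if k: "k ~: N" for k
  proof -
   obtain n0 where n0: "k ~: V n0" using k by (auto simp: N_def)
   show ?thesis
   proof (rule small[of _ n0])
    fix n assume "n0 <= n"
    then have "k ~: V n" using n0 V_antimono by blast
    then obtain a b where ab: "a < 2 ^ Suc n" "b < 2 ^ Suc n" "{z. k + z : P} Int P \<subseteq> cell (Suc n) a Un cell (Suc n) b"
     by (rule translate_cells)
    have "measure m {z. k + z : P} = measure m ({z. k + z : P} Int P)"
     by (rule inP[OF bc[OF compact_translate'[OF compact_P]]])
    also have "... <= measure m (cell (Suc n) a Un cell (Suc n) b)"
     by (rule finite_measure_mono[OF ab(3)]) (intro sets.Un bc cell_compact)
    also have "... <= measure m (cell (Suc n) a) + measure m (cell (Suc n) b)"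
     by (intro measure_Un_le bc cell_compact)
    also have "... <= 2 * (1 / 2 ^ n)" using cb[OF ab(1)] cb[OF ab(2)] by simp
    finally show "measure m {z. k + z : P} <= 2 * (1 / 2 ^ n)" .
   qed simp
  qed
 qed
qed

end

text \<open>The Cantor measure, taken as a complex measure, satisfies the hypotheses of
  \<open>not_amenable\<close>. It lies in the weighted algebra because it lives on the compact set
  \<open>P\<close>, where the continuous weight is bounded.\<close>

theorem (in paired) amenable_imp_discrete:
 fixes j :: "('a \<times> 'a => complex) => 'e"
 assumes am: "amenable TYPE('e) A" and j: "inj j"
 shows "discrete_group TYPE('g)"
proof (rule ccontr)
 assume nd: "~ discrete_group TYPE('g)"
 obtain x :: "nat => 'g" and V where xV: "cantor x V"
  using cantor_scheme[OF lc nd] unfolding cantor_def by (elim exE) auto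
 interpret C: cantor x V by (rule xV)
 obtain m where m: "radon m" "0 < measure m C.P" "emeasure m (- C.P) = 0"
  "!!k. measure m {z. z - k : C.N} = 0" "!!k. k ~: C.N ==> measure m {z. k + z : C.P} = 0"
  by (rule C.cantor_measure) (rule that; assumption)
 interpret finite_measure m using radon_finite[OF m(1)] .
 have sets: "sets m = sets borel" using radon_sets[OF m(1)] .
 obtain H where H: "transversal C.N H" using transversal_exists[OF C.subgroup_N] by blast
 interpret PC: paired_cosets om A pair io C.N H
  by unfold_locales (rule C.compact_N C.subgroup_N H)+
 have "compact (om ` C.P)"
  using w continuous_on_subset unfolding weight_def by (intro compact_continuous_image C.compact_P) blast
 then have "bounded (om ` C.P)" by (rule compact_imp_bounded)
 then obtain B where B: "!!x. x : C.P ==> norm (om x) <= B" unfolding bounded_iff by blast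
 have cP: "C.P : sets borel" by (intro borel_closed compact_imp_closed C.compact_P)
 have "AE x in m. norm (om x) <= B"
  by (rule AE_I[of _ _ "- C.P"]) (use B m(3) cP sets in auto)
 then have int: "integrable m om"
  using weightD(5) sets by (intro integrable_const_bound[of _ B]) (auto cong: measurable_cong_sets)
 have si: "cm_of m : \<M>"
  using cm_of_variation[OF m(1)] m(1) int by (simp add: M_carrier_iff)
 have "~ amenable TYPE('e) A"
 proof (rule PC.not_amenable[OF j si C.compact_P])
  show "n + p : C.P" if "n : C.N" "p : C.P" for n p using C.N_P that .
  show "cm_of m (cs C.N 0 k) = 0" for k using m(4)[of k] by (simp add: cm_of_def cs_def)
  show "cm_of m C.P ~= 0" using m(2) cP by (simp add: cm_of_def)
  have z: "norm (cm_of m {z. k + z : C.P}) = 0" if "k ~: C.N" for k using m(5)[OF that] by (simp add: cm_of_def)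
  \<comment> \<open>The translates of \<open>P\<close> have positive mass only for \<open>k\<close>
    in \<open>N\<close>, and a transversal has just one such element.\<close>
  have "finite (H Int C.N)"
  proof (rule finite_subset)
   show "H Int C.N \<subseteq> {THE h. h : H & 0 - h : C.N}"
   proof
    fix h assume h: "h : H Int C.N"
    then have "h : H & 0 - h : C.N" using PC.N_simps(1,4) by blast
    moreover have "EX! h. h : H & 0 - h : C.N" using H unfolding transversal_def by blast
    ultimately show "h : {THE h. h : H & 0 - h : C.N}" by (simp add: the1_equality)
   qed
  qed simp
  then have "(%k. norm (cm_of m {z. k + z : C.P})) summable_on (H Int C.N)" by (rule summable_on_finite)
  then show "(%k. norm (cm_of m {z. k + z : C.P})) summable_on H"
   by (rule summable_on_cong_neutral[THEN iffD1, rotated -1]) (use z in auto)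
 qed
 then show False using am by blast
qed

section \<open>Discrete groups\<close>

lemma L1_measure_variation:
 fixes m :: "'g::topological_space measure"
 assumes m: "sets m = sets borel" and f: "integrable m f"
 shows "complex_measure (L1_measure m f)" "variation (L1_measure m f) = density m (%x. ennreal (cmod (f x)))"
proof -
 define m' where "m' = density m (%x. ennreal (cmod (f x)))"
 \<comment> \<open>The value 1 at the zeros of \<open>f\<close> keeps the phase unimodular
   everywhere, as \<open>density_variation\<close> demands; the measure with density
   \<open>cmod (f x)\<close> ignores these points.\<close>
 define h where "h x = (if f x = 0 then 1 else f x / complex_of_real (cmod (f x)))" for x
 have fm: "f : borel_measurable m" using f by auto
 then have fb: "f : borel_measurable borel" using m by (simp cong: measurable_cong_sets)
 have "emeasure m' (space m) = (\<integral>\<^sup>+x. ennreal (cmod (f x)) \<partial>m)"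
  unfolding m'_def using fm by (subst emeasure_density) (auto intro!: nn_integral_cong)
 then have fin: "finite_measure m'"
  using f by (intro finite_measureI) (auto simp: m'_def integrable_iff_bounded)
 have hb: "h : borel_measurable borel" unfolding h_def using fb by measurable
 have h1: "cmod (h x) = 1" for x by (simp add: h_def norm_divide)
 have "L1_measure m f = (%A. if A : sets borel then (LINT x:A|m'. h x) else 0)"
 proof
  fix A show "L1_measure m f A = (if A : sets borel then (LINT x:A|m'. h x) else 0)"
  proof (cases "A : sets borel")
   case True
   have "(LINT x:A|m'. h x) = (LINT x|m. cmod (f x) *\<^sub>R (indicator A x *\<^sub>R h x))"
    unfolding set_lebesgue_integral_def m'_def
    using True hb fm m by (intro integral_density) (auto cong: measurable_cong_sets)
   also have "... = (LINT x:A|m. f x)"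
    unfolding set_lebesgue_integral_def
    by (intro Bochner_Integration.integral_cong) (auto simp: h_def scaleR_conv_of_real)
   finally show ?thesis using True by (simp add: L1_measure_def)
  qed (simp add: L1_measure_def)
 qed
 then show "complex_measure (L1_measure m f)" "variation (L1_measure m f) = m'"
  using density_variation[OF _ fin hb h1] m by (auto simp: m'_def)
qed

lemma abs_summable_iff_integrable:
 fixes f :: "'a => complex"
 shows "(%x. norm (f x)) summable_on A \<longleftrightarrow> integrable (count_space A) f"
 using abs_summable_equivalent[of f A] by (simp add: Infinite_Set_Sum.abs_summable_on_def)

lemma integral_count_space_infsum:
 fixes f :: "'a => complex"
 assumes "(%x. norm (f x)) summable_on A" shows "(LINT x|count_space A. f x) = infsum f A"
 using infsetsum_infsum[of f A] abs_summable_equivalent[of f A] assms by (simp add: infsetsum_def)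

lemma infsum_of_real':
 assumes "f summable_on A" shows "(\<Sum>\<^sub>\<infinity>x\<in>A. complex_of_real (f x)) = complex_of_real (infsum f A)"
 by (rule infsumI, rule has_sum_of_real, rule has_sum_infsum[OF assms])

lemma discrete_group_simps:
 assumes "discrete_group TYPE('g::{topological_group_add,t2_space})"
 shows "open (A :: 'g set)" "(A :: 'g set) : sets borel" "compact (A :: 'g set) \<longleftrightarrow> finite A"
proof -
 show o: "open (A :: 'g set)" for A
  using assms open_openin[of A] by (simp add: discrete_group_def)
 then show "(A :: 'g set) : sets borel" by (rule borel_open)
 show "compact (A :: 'g set) \<longleftrightarrow> finite A"
 proof
  assume c: "compact A"
  have "A \<subseteq> (\<Union>a\<in>A. {a})" by auto
  then obtain F where "F \<subseteq> A" "finite F" "A \<subseteq> (\<Union>a\<in>F. {a})"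
   using compactE_image[OF c, of A "%a. {a}"] o by metis
  then show "finite A" using finite_subset[of A F] by auto
 qed (rule finite_imp_compact)
qed

section \<open>Measures on a discrete group as weighted summable functions\<close>

locale discrete_weighted = locally_compact_weighted om
 for om :: "'g::{topological_group_add,t2_space} => real" +
 assumes disc: "discrete_group TYPE('g)"
begin

lemma sets_discrete: "sets (borel :: 'g measure) = UNIV"
 using discrete_group_simps(2)[OF disc] by blast

definition atomic :: "('g => complex) => 'g cmeasure" where
 "atomic f = (%A. infsum f A)"

definition l1 :: "('g => complex) nspace" where
 "l1 = \<lparr>carrier = {f. (%x. om x * norm (f x)) summable_on UNIV}, mult = undefined, one = undefined,
  zero = (%x. 0), add = (%f g x. f x + g x), smult = (%c f x. c * f x), nrm = (%f. \<Sum>\<^sub>\<infinity>x. om x * norm (f x))\<rparr>"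

lemma l1_iff: "f : carrier l1 \<longleftrightarrow> (%x. om x * norm (f x)) summable_on UNIV"
 by (simp add: l1_def)

lemma l1_norm_summable: "f : carrier l1 ==> (%x. norm (f x)) summable_on A"
proof -
 assume "f : carrier l1"
 then have "(%x. om x * norm (f x)) summable_on UNIV" by (simp add: l1_iff)
 then have "(%x. norm (f x)) summable_on UNIV"
  by (rule summable_on_comparison_test) (use mult_right_mono[OF weightD(1) norm_ge_zero] in auto)
 then show ?thesis by (rule summable_on_subset_banach) simp
qed

lemma nonneg: "0 <= om x * norm (f x)" for f :: "'g => complex"
 using weightD(2)[of x] by (simp add: less_imp_le)

lemma atomic_eq: "f : carrier l1 ==> atomic f = L1_measure (count_space UNIV) f"
proof
 fix A assume f: "f : carrier l1"
 have "(LINT x:A|count_space UNIV. f x) = (LINT x|count_space A. f x)"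
  using integral_restrict_space[of A "count_space UNIV" f] by (simp add: set_lebesgue_integral_def restrict_count_space)
 also have "... = infsum f A" by (rule integral_count_space_infsum[OF l1_norm_summable[OF f]])
 finally show "atomic f A = L1_measure (count_space UNIV) f A"
  by (simp add: atomic_def L1_measure_def sets_discrete)
qed

lemma atomic_M:
 assumes f: "f : carrier l1"
 shows "atomic f : \<M>" "\<N> (atomic f) = (\<Sum>\<^sub>\<infinity>x. om x * norm (f x))"
proof -
 let ?m = "density (count_space UNIV) (%x. ennreal (cmod (f x)))"
 have fi: "integrable (count_space UNIV) f" using l1_norm_summable[OF f] by (simp add: abs_summable_iff_integrable)
 have v: "complex_measure (atomic f)" "variation (atomic f) = ?m"
  using L1_measure_variation[of "count_space UNIV :: 'g measure" f] fi by (simp_all add: atomic_eq[OF f] sets_discrete)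
 have me: "emeasure ?m A = (\<integral>\<^sup>+x\<in>A. ennreal (cmod (f x)) \<partial>count_space UNIV)" for A
  by (subst emeasure_density) auto
 have fin: "finite_measure ?m"
  using fi by (intro finite_measureI) (auto simp: me integrable_iff_bounded)
 have sub: "(%x. norm (complex_of_real (norm (f x)))) summable_on A" for A using l1_norm_summable[OF f] by simp
 have mm: "measure ?m A = (\<Sum>\<^sub>\<infinity>x\<in>A. norm (f x))" for A
 proof -
  have "complex_of_real (measure ?m A) = complex_of_real (LINT x|?m. indicator A x)" by simp
  also have "(LINT x|?m. indicator A x) = (LINT x|count_space UNIV. cmod (f x) *\<^sub>R (indicator A x :: real))"
   by (rule integral_density) auto
  also have "... = (LINT x|count_space A. cmod (f x))"
   using integral_restrict_space[of A "count_space UNIV" "%x. cmod (f x)"]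
   by (simp add: restrict_count_space mult.commute)
  also have "complex_of_real ... = (LINT x|count_space A. complex_of_real (cmod (f x)))" by simp
  also have "... = (\<Sum>\<^sub>\<infinity>x\<in>A. complex_of_real (norm (f x)))" by (rule integral_count_space_infsum[OF sub])
  also have "... = complex_of_real (\<Sum>\<^sub>\<infinity>x\<in>A. norm (f x))" by (rule infsum_of_real'[OF l1_norm_summable[OF f]])
  finally show ?thesis by (simp only: of_real_eq_iff)
 qed
 have rad: "radon ?m"
 proof (rule radonI_open[OF _ fin])
  fix U :: "'g set" and e :: real assume e: "0 < e"
  obtain F where "finite F" "F \<subseteq> U" "(\<Sum>\<^sub>\<infinity>x\<in>U - F. norm (f x)) < e"
   by (rule infsum_tail_less[OF l1_norm_summable[OF f] _ e]) auto
  then show "EX K. compact K & K \<subseteq> U & measure ?m (U - K) < e"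
   by (intro exI[of _ F]) (simp add: mm finite_imp_compact)
 qed (simp add: sets_discrete)
 have "(%x. norm (complex_of_real (om x * norm (f x)))) summable_on UNIV"
  using f nonneg[of _ f] by (simp add: l1_iff del: of_real_mult)
 note i = this[unfolded abs_summable_iff_integrable] integral_count_space_infsum[OF this]
 have io: "integrable (count_space UNIV) (%x. om x * norm (f x))" using i(1) by (simp only: complex_of_real_integrable_eq)
 have "integrable ?m om"
  by (subst integrable_density) (use io in \<open>auto simp: mult.commute\<close>)
 then show cl: "atomic f : \<M>" using v rad by (simp add: M_carrier_iff)
 have "complex_of_real (LINT x|?m. om x) = complex_of_real (LINT x|count_space UNIV. om x * norm (f x))"
  by (subst integral_density) (auto simp: mult.commute)
 also have "... = complex_of_real (\<Sum>\<^sub>\<infinity>x. om x * norm (f x))"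
  using i(2) f unfolding l1_iff by (simp only: infsum_of_real' integral_complex_of_real)
 finally show "\<N> (atomic f) = (\<Sum>\<^sub>\<infinity>x. om x * norm (f x))"
  using M_nrm[OF cl] v by (simp only: of_real_eq_iff)
qed

text \<open>Compact sets are finite, so inner regularity says that a measure is exhausted by its
  atoms, even when the group is uncountable.\<close>

lemma M_atoms:
 assumes mu: "mu : \<M>"
 shows "(%x. mu {x}) : carrier l1" "((%x. mu {x}) has_sum mu A) A" "atomic (%x. mu {x}) = mu"
proof -
 let ?m = "variation mu"
 interpret m: finite_measure ?m using M_carrierD(3)[OF mu] .
 have sm: "sets ?m = UNIV" using radon_sets[OF M_carrierD(2)[OF mu]] by (simp add: sets_discrete)
 have fin: "(\<Sum>x\<in>F. om x * norm (mu {x})) <= \<N> mu" if F: "finite F" for F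
 proof -
  have i: "integrable ?m (%y. om x * indicator {x} y)" for x
   by (rule integrable_mult_right, rule integrable_real_indicator) (auto simp: m.emeasure_eq_measure sm)
  have "(\<Sum>x\<in>F. om x * norm (mu {x})) <= (\<Sum>x\<in>F. om x * measure ?m {x})"
   using cmod_le_measure[OF mu] weightD(2) by (intro sum_mono mult_left_mono) (auto simp: less_imp_le)
  also have "... = (LINT y|?m. (\<Sum>x\<in>F. om x * indicator {x} y))"
   by (subst Bochner_Integration.integral_sum[OF i]) (simp add: sm)
  also have "... <= (LINT y|?m. om y)"
  proof (rule integral_mono)
   show "integrable ?m (%y. \<Sum>x\<in>F. om x * indicator {x} y)" by (intro Bochner_Integration.integrable_sum i)
   show "integrable ?m om" using M_carrierD(4)[OF mu] .
   fix y
   have "(\<Sum>x\<in>F. om x * indicator {x} y) = (\<Sum>x\<in>F. if x = y then om y else 0)" by (intro sum.cong) (auto simp: indicator_def)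
   also have "... <= om y" using F weightD(2)[of y] by simp
   finally show "(\<Sum>x\<in>F. om x * indicator {x} y) <= om y" .
  qed
  finally show ?thesis by (simp add: M_nrm[OF mu])
 qed
 then show c: "(%x. mu {x}) : carrier l1"
  unfolding l1_iff using nonneg by (intro nonneg_bdd_above_summable_on bdd_aboveI) auto
 have fa: "mu F = (\<Sum>x\<in>F. mu {x})" if "finite F" for F
  using that
 proof induction
  case empty
  then show ?case using complex_measure_empty[OF M_carrierD(1)[OF mu]] by simp
 next
  case (insert x F)
  then show ?case using complex_measure_Un[OF M_carrierD(1)[OF mu], of "{x}" F] by (simp add: sets_discrete)
 qed
 show hs: "((%x. mu {x}) has_sum mu A) A" for A
  unfolding has_sum_def
 proof (rule tendstoI)
  fix e :: real assume e: "0 < e"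
  obtain K where K: "compact K" "K \<subseteq> A" "measure ?m (A - K) < e"
   using radon_inner[OF M_carrierD(2)[OF mu] _ e, of A] by (auto simp: sets_discrete)
  have "dist (\<Sum>x\<in>F. mu {x}) (mu A) < e" if F: "finite F" "K \<subseteq> F" "F \<subseteq> A" for F
  proof -
   have "mu A = mu F + mu (A - F)"
    using complex_measure_Un[OF M_carrierD(1)[OF mu], of F "A - F"] F(3) by (simp add: sets_discrete Un_absorb1)
   then have "dist (\<Sum>x\<in>F. mu {x}) (mu A) = cmod (mu (A - F))" using fa[OF F(1)] by (simp add: dist_norm)
   also have "... <= measure ?m (A - F)" by (rule cmod_le_measure[OF mu])
   also have "... <= measure ?m (A - K)" using F sm by (intro m.finite_measure_mono) (blast, simp only: UNIV_I)
   finally show ?thesis using K(3) by simp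
  qed
  then show "\<forall>\<^sub>F F in finite_subsets_at_top A. dist (\<Sum>x\<in>F. mu {x}) (mu A) < e"
   using K discrete_group_simps(3)[OF disc] unfolding eventually_finite_subsets_at_top by blast
 qed
 show "atomic (%x. mu {x}) = mu" using infsumI[OF hs] by (auto simp: atomic_def)
qed

lemma banach_l1: "banach_space l1"
proof (rule pointwise_banachI[where w = "%_. 1"])
 have fin: "(\<Sum>x\<in>F. om x * norm (f x)) <= nrm l1 f" if "f : carrier l1" "finite F" for f F
  using that finite_sum_le_infsum[of "%x. om x * norm (f x)" UNIV F] nonneg[of _ f]
  by (simp add: l1_def)
 have bd: "f : carrier l1 & nrm l1 f <= K" if "!!F. finite F ==> (\<Sum>x\<in>F. om x * norm (f x)) <= K" for f K
 proof -
  have "(%x. om x * norm (f x)) summable_on UNIV"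
   using that nonneg[of _ f] by (intro nonneg_bdd_above_summable_on bdd_aboveI[of _ K]) auto
  moreover from this have "(\<Sum>\<^sub>\<infinity>x. om x * norm (f x)) <= K" by (rule infsum_le_finite_sums) (use that in auto)
  ultimately show ?thesis by (simp add: l1_def)
 qed
 have w0: "0 <= om x" for x using weightD(2)[of x] by simp
 have tri: "(%x. f x + g x) : carrier l1 & nrm l1 (%x. f x + g x) <= nrm l1 f + nrm l1 g"
  if f: "f : carrier l1" and g: "g : carrier l1" for f g
 proof (rule bd)
  fix F :: "'g set" assume F: "finite F"
  have "(\<Sum>x\<in>F. om x * norm (f x + g x)) <= (\<Sum>x\<in>F. om x * norm (f x)) + (\<Sum>x\<in>F. om x * norm (g x))"
   unfolding sum.distrib[symmetric] distrib_left[symmetric]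
   by (intro sum_mono mult_left_mono norm_triangle_ineq w0)
  then show "(\<Sum>x\<in>F. om x * norm (f x + g x)) <= nrm l1 f + nrm l1 g"
   using fin[OF f F] fin[OF g F] by linarith
 qed
 have sm: "(%x. c * f x) : carrier l1 & nrm l1 (%x. c * f x) = cmod c * nrm l1 f"
  if f: "f : carrier l1" for f and c :: complex
 proof -
  have eq: "(%x. om x * norm (c * f x)) = (%x. cmod c * (om x * norm (f x)))" by (simp add: norm_mult mult_ac)
  have s: "(%x. om x * norm (f x)) summable_on UNIV" using f by (simp add: l1_def)
  show ?thesis
   using summable_on_cmult_right[OF s, of "cmod c"] infsum_cmult_right'[of "cmod c" "%x. om x * norm (f x)" UNIV]
   by (simp add: l1_def eq)
 qed
 show "pointwise_space l1"
  unfolding pointwise_space_def using tri sm bd[of "%x. 0" 0] by (auto simp: l1_def)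
 show "0 <= nrm l1 f" if "f : carrier l1" for f using fin[OF that, of "{}"] by simp
 show "nrm l1 (%x. c * f x) = cmod c * nrm l1 f" if "f : carrier l1" for f c using sm[OF that] by simp
 show "nrm l1 (%x. f x + g x) <= nrm l1 f + nrm l1 g"
  if "f : carrier l1" "g : carrier l1" for f g using tri[OF that] by simp
 show "cmod (f x) <= nrm l1 f * 1" if "f : carrier l1" for f x
  using fin[OF that, of "{x}"] mult_right_mono[OF weightD(1)[of x] norm_ge_zero[of "f x"]] by simp
 show "f : carrier l1 & nrm l1 f <= K"
  if s: "!!n::nat. s n : carrier l1" "!!n. nrm l1 (s n) <= K" "!!x. (%n. s n x) \<longlonglongrightarrow> f x" for s f K
 proof (rule bd)
  fix F :: "'g set" assume F: "finite F"
  have "(%n. \<Sum>x\<in>F. om x * norm (s n x)) \<longlonglongrightarrow> (\<Sum>x\<in>F. om x * norm (f x))"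
   by (intro tendsto_sum tendsto_mult tendsto_const tendsto_norm s(3))
  moreover have "(\<Sum>x\<in>F. om x * norm (s n x)) <= K" for n using fin[OF s(1) F] s(2) by (rule order_trans)
  ultimately show "(\<Sum>x\<in>F. om x * norm (f x)) <= K" by (intro LIMSEQ_le_const2) auto
 qed
qed

lemma isometry_atomic: "isometry l1 (malg om) (atomic :: ('g => complex) => 'g cmeasure)"
 unfolding isometry_def
proof (intro conjI ballI allI)
 have at: "atomic f {x} = f x" for f :: "'g => complex" and x by (simp add: atomic_def)
 note s = l1_norm_summable[THEN abs_summable_summable]
 show "bij_betw atomic (carrier l1) (\<M>)"
 proof (rule bij_betw_byWitness[where f' = "%mu x. mu {x}"])
  show "ALL mu:\<M>. atomic (%x. mu {x}) = mu" using M_atoms(3) by blast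
  show "atomic ` carrier l1 \<subseteq> \<M>" using atomic_M(1) by blast
  show "(%mu x. mu {x}) ` \<M> \<subseteq> carrier l1" using M_atoms(1) by blast
 qed (simp add: at)
 show "atomic \<zero>\<^bsub>l1\<^esub> = \<zero>\<^bsub>malg om\<^esub>"
  by (simp add: atomic_def l1_def weighted_measure_algebra_def)
 show "atomic (f \<oplus>\<^bsub>l1\<^esub> g) = atomic f \<oplus>\<^bsub>malg om\<^esub> atomic g"
  if "f : carrier l1" "g : carrier l1" for f g
  using infsum_add[OF s[OF that(1)] s[OF that(2)]]
  by (simp add: atomic_def l1_def weighted_measure_algebra_def)
 show "atomic (c \<odot>\<^bsub>l1\<^esub> f) = c \<odot>\<^bsub>malg om\<^esub> atomic f" for c f
  by (simp add: atomic_def l1_def weighted_measure_algebra_def infsum_cmult_right')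
 show "\<N> (atomic f) = nrm l1 f" if "f : carrier l1" for f
  using atomic_M(2)[OF that] by (simp add: l1_def)
qed

lemma conv_has_sum:
 assumes mu: "mu : \<M>" and nu: "nu : \<M>"
 shows "((%k. mu {k} * nu {- k + x}) has_sum conv mu nu {x}) UNIV"
proof (rule conv_cells[OF mu nu])
 show "disjoint_family_on (%k::'g. {k}) UNIV" by (auto simp: disjoint_family_on_def)
 show "{y. z + y : {x}} = {- k + x}" if "z : {k}" for k z
 proof -
  have "k + y = x \<longleftrightarrow> y = - k + x" for y by (metis add.assoc add_minus_cancel minus_add_cancel)
  then show ?thesis using that by auto
 qed
 have "(%k. norm (nu {k})) summable_on UNIV" by (rule l1_norm_summable[OF M_atoms(1)[OF nu]])
 moreover have "bij (%k. - k + x)"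
  by (rule bij_betw_byWitness[where f' = "%y. x - y"])
   (auto simp: diff_conv_add_uminus minus_add add.assoc simp del: add_uminus_conv_diff)
 ultimately show "(%k. norm (nu {- k + x})) summable_on UNIV"
  using summable_on_reindex_bij_betw[of "%k. - k + x" UNIV UNIV "%k. norm (nu {k})"] by simp
qed (simp_all add: sets_discrete)

lemma M_eqI:
 assumes mu: "mu : \<M>" and nu: "nu : \<M>" and eq: "!!x. mu {x} = nu {x}"
 shows "mu = nu"
proof -
 have "mu = atomic (%x. mu {x})" by (rule M_atoms(3)[OF mu, symmetric])
 also have "... = atomic (%x. nu {x})" by (simp only: eq)
 also have "... = nu" by (rule M_atoms(3)[OF nu])
 finally show ?thesis .
qed

lemma point_mass_singleton: "point_mass a {x :: 'g} = (if x = a then 1 else 0)"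
 by (simp add: point_mass_def sets_discrete)

text \<open>Subtracting finitely many multiples of point masses changes a linear \<open>f\<close> in
  a controlled way; the remainder has no mass on \<open>F\<close>.\<close>

lemma remove_atoms:
 assumes add: "!!mu nu. mu : \<M> ==> nu : \<M> ==> f (%A. mu A + nu A) = f mu + f nu"
  and sm: "!!c mu. mu : \<M> ==> f (%A. c * mu A) = c * f mu"
  and mu: "mu : \<M>" and F: "finite F"
 obtains rho where "rho : \<M>" "!!y. rho {y} = (if y : F then 0 else mu {y})"
  "f rho = f mu - (\<Sum>x\<in>F. f (point_mass x) * mu {x} :: complex)"
proof -
 have "EX rho:\<M>. (ALL y. rho {y} = (if y : F then 0 else mu {y})) & f rho = f mu - (\<Sum>x\<in>F. f (point_mass x) * mu {x})"
  using F
 proof induction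
  case (insert x F)
  then obtain rho where rho: "rho : \<M>" "!!y. rho {y} = (if y : F then 0 else mu {y})"
   "f rho = f mu - (\<Sum>x\<in>F. f (point_mass x) * mu {x})" by blast
  note pm = point_mass_carrier(1)[of x]
  note p = M_smult(1)[OF pm, of "- mu {x}"]
  have "f (%A. rho A + - mu {x} * point_mass x A) = f rho + - mu {x} * f (point_mass x)"
   unfolding add[OF rho(1) p] sm[OF pm] ..
  then show ?case
   by (intro bexI[OF _ M_add(1)[OF rho(1) p]])
    (use insert.hyps in \<open>auto simp: rho(2,3) point_mass_singleton\<close>)
 qed (use mu in auto)
 then show thesis using that by blast
qed

lemma M_nrm_atoms: "mu : \<M> ==> \<N> mu = (\<Sum>\<^sub>\<infinity>x. om x * norm (mu {x}))"
 using atomic_M(2)[OF M_atoms(1)] M_atoms(3) by simp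

text \<open>Removing enough atoms makes the norm of the remainder arbitrarily small without changing
  the value of \<open>f\<close>. Identities that are linear and bounded in a measure therefore need
  checking only at point masses.\<close>

lemma point_mass_dense:
 assumes add: "!!mu nu. mu : \<M> ==> nu : \<M> ==> f (%A. mu A + nu A) = f mu + f nu"
  and sm: "!!c mu. mu : \<M> ==> f (%A. c * mu A) = c * f mu"
  and bd: "!!mu. mu : \<M> ==> cmod (f mu) <= C * \<N> mu"
  and pm: "!!x. f (point_mass x) = 0" and mu: "mu : \<M>"
 shows "f mu = 0"
proof -
 have s: "(%x. om x * norm (mu {x})) summable_on UNIV" using M_atoms(1)[OF mu] by (simp add: l1_iff)
 have "cmod (f mu) <= 0 + e" if e: "0 < e" for e
 proof -
  define d where "d = e / (\<bar>C\<bar> + 1)"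
  have d: "0 < d" using e by (simp add: d_def)
  obtain F where F: "finite F" "(\<Sum>\<^sub>\<infinity>x\<in>UNIV - F. om x * norm (mu {x})) < d"
   by (rule infsum_tail_less[OF s _ d]) (auto intro: nonneg)
  obtain rho where rho: "rho : \<M>" "!!y. rho {y} = (if y : F then 0 else mu {y})"
   "f rho = f mu - (\<Sum>x\<in>F. f (point_mass x) * mu {x})"
   by (rule remove_atoms[where f = f, OF add sm mu F(1)]) (assumption | (rule that; assumption))+
  have "\<N> rho = (\<Sum>\<^sub>\<infinity>x\<in>UNIV - F. om x * norm (mu {x}))"
   unfolding M_nrm_atoms[OF rho(1)] by (rule infsum_cong_neutral) (auto simp: rho(2))
  then have "\<N> rho < d" using F(2) by simp
  have "cmod (f mu) <= C * \<N> rho" using bd[OF rho(1)] by (simp add: rho(3) pm)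
  also have "... <= (\<bar>C\<bar> + 1) * \<N> rho"
   using M_nrm_nonneg[OF rho(1)] by (intro mult_right_mono) auto
  also have "... <= (\<bar>C\<bar> + 1) * d" using \<open>\<N> rho < d\<close> by (intro mult_left_mono) auto
  also have "... = e" by (simp add: d_def add_nonneg_eq_0_iff)
  finally show ?thesis by simp
 qed
 then have "cmod (f mu) <= 0" by (rule field_le_epsilon)
 then show ?thesis by simp
qed

lemma conv_add_left:
 assumes mu: "mu : \<M>" and mu': "mu' : \<M>" and nu: "nu : \<M>"
 shows "conv (%A. mu A + mu' A) nu = (%A. conv mu nu A + conv mu' nu A)"
proof (rule M_eqI)
 note ad = M_add(1)[OF mu mu']
 show "conv (%A. mu A + mu' A) nu : \<M>" by (rule conv_closed(1)[OF ad nu])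
 show "(%A. conv mu nu A + conv mu' nu A) : \<M>"
  by (intro M_add(1) conv_closed(1) mu mu' nu)
 show "conv (%A. mu A + mu' A) nu {x} = conv mu nu {x} + conv mu' nu {x}" for x
  using has_sum_add[OF conv_has_sum[OF mu nu, of x] conv_has_sum[OF mu' nu, of x]] conv_has_sum[OF ad nu, of x]
  by (simp add: distrib_right has_sum_unique)
qed

lemma conv_smult_left:
 assumes mu: "mu : \<M>" and nu: "nu : \<M>"
 shows "conv (%A. c * mu A) nu = (%A. c * conv mu nu A)"
proof (rule M_eqI)
 note sm = M_smult(1)[OF mu, of c]
 show "conv (%A. c * mu A) nu : \<M>" by (rule conv_closed(1)[OF sm nu])
 show "(%A. c * conv mu nu A) : \<M>"
  by (intro M_smult(1) conv_closed(1) mu nu)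
 show "conv (%A. c * mu A) nu {x} = c * conv mu nu {x}" for x
  using has_sum_cmult_right[OF conv_has_sum[OF mu nu, of x], of c] conv_has_sum[OF sm nu, of x]
  by (simp add: mult.assoc has_sum_unique)
qed

lemma conv_point_mass:
 assumes nu: "nu : \<M>" shows "conv (point_mass a) nu {x} = nu {- a + x}"
proof -
 have "((%k. point_mass a {k} * nu {- k + x}) has_sum nu {- a + x}) {a}"
  using has_sum_finite[of "{a}" "%k. point_mass a {k} * nu {- k + x}"] by (simp add: point_mass_singleton)
 then have "((%k. point_mass a {k} * nu {- k + x}) has_sum nu {- a + x}) UNIV"
  by (rule has_sum_cong_neutral[THEN iffD1, rotated -1]) (auto simp: point_mass_singleton)
 then show ?thesis using conv_has_sum[OF point_mass_carrier(1) nu] has_sum_unique by blast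
qed

lemma conv_point_masses: "conv (point_mass a) (point_mass b) = (point_mass (a + b) :: 'g cmeasure)"
proof (rule M_eqI)
 show "conv (point_mass a) (point_mass b) : \<M>"
  by (intro conv_closed(1) point_mass_carrier)
 have "- a + x = b \<longleftrightarrow> x = a + b" for x by (metis add.assoc add_minus_cancel minus_add_cancel)
 then show "conv (point_mass a) (point_mass b) {x} = point_mass (a + b) {x}" for x
  by (simp add: conv_point_mass point_mass_carrier point_mass_singleton)
qed (rule point_mass_carrier)

text \<open>At each singleton the difference of the two sides is a bounded linear functional of
  \<open>mu\<close>. For a point mass it vanishes by a translation of the summation index.\<close>

lemma conv_assoc:
 assumes mu: "mu : \<M>" and nu: "nu : \<M>" and rho: "rho : \<M>"
 shows "conv (conv mu nu) rho = conv mu (conv nu rho)"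
proof (rule M_eqI)
 note cl = conv_closed(1)
 show "conv (conv mu nu) rho : \<M>" "conv mu (conv nu rho) : \<M>"
  by (intro cl mu nu rho)+
 fix x
 have nm: "cmod (ta {x}) <= \<N> ta" if "ta : \<M>" for ta by (rule cmod_le_nrm[OF that])
 have "conv (conv mu nu) rho {x} - conv mu (conv nu rho) {x} = 0"
 proof (rule point_mass_dense[OF _ _ _ _ mu, where f = "%mu. conv (conv mu nu) rho {x} - conv mu (conv nu rho) {x}"])
  fix mu mu' assume m: "mu : \<M>" "mu' : \<M>"
  show "conv (conv (%A. mu A + mu' A) nu) rho {x} - conv (%A. mu A + mu' A) (conv nu rho) {x} =
   conv (conv mu nu) rho {x} - conv mu (conv nu rho) {x} + (conv (conv mu' nu) rho {x} - conv mu' (conv nu rho) {x})"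
   using m nu rho by (simp add: conv_add_left cl)
 next
  fix c mu assume m: "mu : \<M>"
  show "conv (conv (%A. c * mu A) nu) rho {x} - conv (%A. c * mu A) (conv nu rho) {x} =
   c * (conv (conv mu nu) rho {x} - conv mu (conv nu rho) {x})"
   using m nu rho by (simp add: conv_smult_left cl right_diff_distrib)
 next
  fix mu assume m: "mu : \<M>"
  let ?n = "\<N>"
  have "cmod (conv (conv mu nu) rho {x}) <= ?n mu * ?n nu * ?n rho"
   using nm[OF cl[OF cl[OF m nu] rho]] conv_closed(2)[OF cl[OF m nu] rho]
    mult_right_mono[OF conv_closed(2)[OF m nu] M_nrm_nonneg[OF rho]] by linarith
  moreover have "cmod (conv mu (conv nu rho) {x}) <= ?n mu * (?n nu * ?n rho)"
   using nm[OF cl[OF m cl[OF nu rho]]] conv_closed(2)[OF m cl[OF nu rho]]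
    mult_left_mono[OF conv_closed(2)[OF nu rho] M_nrm_nonneg[OF m]] by linarith
  ultimately show "cmod (conv (conv mu nu) rho {x} - conv mu (conv nu rho) {x}) <= (2 * ?n nu * ?n rho) * ?n mu"
   using norm_triangle_ineq4[of "conv (conv mu nu) rho {x}" "conv mu (conv nu rho) {x}"] by (simp add: algebra_simps)
 next
  fix a
  note pa = point_mass_carrier(1)[of a]
  have "((%k. conv (point_mass a) nu {k} * rho {- k + x}) has_sum conv (conv (point_mass a) nu) rho {x}) UNIV"
   by (rule conv_has_sum[OF cl[OF pa nu] rho])
  then have "((%k. nu {- a + k} * rho {- k + x}) has_sum conv (conv (point_mass a) nu) rho {x}) UNIV"
   by (simp add: conv_point_mass[OF nu])
  moreover have "((%k. nu {- a + k} * rho {- k + x}) has_sum conv nu rho {- a + x}) UNIV"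
   using conv_has_sum[OF nu rho, of "- a + x"]
   by (subst has_sum_reindex_bij_witness[of _ "%l. a + l" "%k. - a + k" UNIV "%l. nu {l} * rho {- l + (- a + x)}"])
    (auto simp: add.assoc[symmetric] minus_add)
  ultimately show "conv (conv (point_mass a) nu) rho {x} - conv (point_mass a) (conv nu rho) {x} = 0"
   by (simp add: conv_point_mass[OF cl[OF nu rho]] has_sum_unique)
 qed
 then show "conv (conv mu nu) rho {x} = conv mu (conv nu rho) {x}" by simp
qed

lemma banach_algebra_M:
 shows "banach_algebra (malg om)"
proof -
 note cl = conv_closed
 have s: "mu \<otimes>\<^bsub>malg om\<^esub> nu = conv mu nu" "mu \<oplus>\<^bsub>malg om\<^esub> nu = (%A. mu A + nu A)" "c \<odot>\<^bsub>malg om\<^esub> mu = (%A. c * mu A)" for mu nu c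
  by (simp_all add: weighted_measure_algebra_def)
 show ?thesis
  unfolding banach_algebra_def linear_into_def
  using isometry_banach[OF banach_l1 isometry_atomic]
  by (auto simp: s cl conv_add_left conv_smult_left conv_add_right conv_smult_right conv_assoc)
qed

end

section \<open>Derivations made inner by an invariant mean\<close>

lemma complex_invariant_mean:
 assumes am: "amenable_group TYPE('g::{topological_group_add,t2_space})" and disc: "discrete_group TYPE('g)"
 shows "EX M :: ('g => complex) => complex.
  (ALL f g. bounded (range f) --> bounded (range g) --> M (%t. f t + g t) = M f + M g) &
  (ALL f c. bounded (range f) --> M (%t. c * f t) = c * M f) &
  (ALL f B. (ALL t. cmod (f t) <= B) --> cmod (M f) <= 2 * B) &
  (ALL c. M (%t. c) = c) &
  (ALL f s. bounded (range f) --> M (%t. f (s + t)) = M f)"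
proof -
 obtain M0 :: "('g \<Rightarrow>\<^sub>C real) => real" where M0: "linear M0" "!!f. (ALL x. 0 <= apply_bcontfun f x) ==> 0 <= M0 f"
  "M0 (const_bcontfun 1) = 1" "!!a f g. (ALL x. apply_bcontfun g x = apply_bcontfun f (a + x)) ==> M0 g = M0 f"
  using am unfolding amenable_group_def by auto
 \<comment> \<open>Discreteness makes every bounded function an argument of the mean.\<close>
 have cont: "continuous_on UNIV f" for f :: "'g => real"
  using discrete_group_simps(1)[OF disc] by (simp add: continuous_on_open_vimage)
 have ap: "apply_bcontfun (Bcontfun f) = f" if "bounded (range f)" for f :: "'g => real"
  using that cont by (simp add: Bcontfun_inverse bcontfun_def)
 define m where "m f = M0 (Bcontfun f)" for f :: "'g => real"
 have m_add: "m (%t. f t + g t) = m f + m g" if "bounded (range f)" "bounded (range g)" for f g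
 proof -
  have "bounded (range (%t. f t + g t))" using that by (rule bounded_plus_comp)
  then have "Bcontfun (%t. f t + g t) = Bcontfun f + Bcontfun g"
   using that by (intro bcontfun_eqI) (simp add: ap plus_bcontfun.rep_eq)
  then show ?thesis using linear_add[OF M0(1)] by (simp add: m_def)
 qed
 have m_scale: "m (%t. c * f t) = c * m f" if f: "bounded (range f)" for f c
 proof -
  have "bounded (range (%t. c * f t))"
   using bounded_scaling[OF f, of c] by (simp add: image_image)
  then have "Bcontfun (%t. c * f t) = c *\<^sub>R Bcontfun f"
   using f by (intro bcontfun_eqI) (simp add: ap scaleR_bcontfun.rep_eq)
  then show ?thesis using linear_scale[OF M0(1)] by (simp add: m_def)
 qed
 have m_const: "m (%t. c) = c" for c
 proof -
  have "bounded (range (%t :: 'g. 1 :: real))" by simp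
  from ap[OF this] have "Bcontfun (%t :: 'g. 1 :: real) = const_bcontfun 1"
   by (intro bcontfun_eqI) (simp add: const_bcontfun.rep_eq)
  then have "m (%t. 1) = 1" using M0(3) by (simp add: m_def)
  then show ?thesis using m_scale[of "%t. 1" c] by simp
 qed
 have m_nonneg: "0 <= m f" if "bounded (range f)" "!!t. 0 <= f t" for f
  unfolding m_def using that by (intro M0(2)) (simp add: ap)
 have m_bound: "\<bar>m f\<bar> <= B" if f: "!!t. \<bar>f t\<bar> <= B" for f B
 proof -
  have b: "bounded (range f)" using f by (intro boundedI[of _ B]) auto
  have bm: "bounded (range (%t. (- 1) * f t))" using f by (intro boundedI[of _ B]) auto
  have "0 <= m (%t. B + f t)"
  proof (rule m_nonneg)
   show "bounded (range (%t. B + f t))" by (rule bounded_plus_comp[OF _ b]) simp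
   show "0 <= B + f t" for t using f[of t] by linarith
  qed
  moreover have "0 <= m (%t. B + (- 1) * f t)"
  proof (rule m_nonneg)
   show "bounded (range (%t. B + (- 1) * f t))" by (rule bounded_plus_comp[OF _ bm]) simp
   show "0 <= B + (- 1) * f t" for t using f[of t] by linarith
  qed
  ultimately show ?thesis
   using m_add[of "%t. B" f] m_add[of "%t. B" "%t. (- 1) * f t"] b bm m_const m_scale[OF b, of "- 1"] by simp
 qed
 have m_inv: "m (%t. f (s + t)) = m f" if f: "bounded (range f)" for f s
 proof -
  have "bounded (range (%t. f (s + t)))" by (rule bounded_subset[OF f]) auto
  then show ?thesis using f unfolding m_def by (intro M0(4)[of _ _ s]) (simp add: ap)
 qed
 have re: "bounded (range (%t. Re (f t)))" "bounded (range (%t. Im (f t)))" if fb: "bounded (range f)" for f :: "'g => complex"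
 proof -
  obtain B where B: "!!t. norm (f t) <= B" using fb by (auto simp: bounded_iff)
  show "bounded (range (%t. Re (f t)))" "bounded (range (%t. Im (f t)))"
   using order_trans[OF abs_Re_le_cmod B] order_trans[OF abs_Im_le_cmod B]
   by (auto intro!: boundedI[of _ B])
 qed
 define M where "M f = Complex (m (%t. Re (f t))) (m (%t. Im (f t)))" for f :: "'g => complex"
 show ?thesis
 proof (intro exI[of _ M] conjI allI impI)
  fix f g :: "'g => complex" and c s B
  show "M (%t. f t + g t) = M f + M g" if "bounded (range f)" "bounded (range g)"
   using re[OF that(1)] re[OF that(2)] by (simp add: M_def m_add complex_eq_iff)
  show "M (%t. c * f t) = c * M f" if f: "bounded (range f)"
  proof -
   have b: "bounded (range (%t. d * Re (f t)))" "bounded (range (%t. d * Im (f t)))" for d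
    using re[OF f] bounded_scaling[of "range (%t. Re (f t))" d] bounded_scaling[of "range (%t. Im (f t))" d]
    by (auto simp: image_image)
   have "m (%t. Re c * Re (f t) + (- Im c) * Im (f t)) = Re c * m (%t. Re (f t)) + (- Im c) * m (%t. Im (f t))"
    unfolding m_add[OF b(1)[of "Re c"] b(2)[of "- Im c"]] m_scale[OF re(1)[OF f]] m_scale[OF re(2)[OF f]] ..
   moreover have "m (%t. Re c * Im (f t) + Im c * Re (f t)) = Re c * m (%t. Im (f t)) + Im c * m (%t. Re (f t))"
    unfolding m_add[OF b(2)[of "Re c"] b(1)[of "Im c"]] m_scale[OF re(1)[OF f]] m_scale[OF re(2)[OF f]] ..
   ultimately show ?thesis by (simp add: M_def complex_eq_iff)
  qed
  \<comment> \<open>The factor 2 comes from estimating real and imaginary parts separately.\<close>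
  show "cmod (M f) <= 2 * B" if "ALL t. cmod (f t) <= B"
  proof -
   have "\<bar>m (%t. Re (f t))\<bar> <= B" "\<bar>m (%t. Im (f t))\<bar> <= B"
    using that order_trans[OF abs_Re_le_cmod] order_trans[OF abs_Im_le_cmod] by (auto intro!: m_bound)
   then show ?thesis using cmod_le[of "M f"] by (simp add: M_def)
  qed
  show "M (%t. c) = c" by (simp add: M_def m_const complex_eq_iff)
  show "M (%t. f (s + t)) = M f" if "bounded (range f)"
   using m_inv[OF re(1)[OF that]] m_inv[OF re(2)[OF that]] by (simp add: M_def)
 qed
qed

text \<open>The functional \<open>f\<close> averages the values of
  \<open>D (point_mass (- t))\<close> at \<open>x\<close> acted on by \<open>point_mass t\<close>.
  Invariance of the mean and the derivation rule make it implement \<open>D\<close> on point masses,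
  up to the action of \<open>point_mass 0\<close>; \<open>point_mass_dense\<close> extends the
  result to all measures.\<close>

lemma (in discrete_weighted) amenable_M:
 assumes am: "amenable_group TYPE('g)" and W: "!!x. om x <= W"
 shows "amenable TYPE('e) (malg om)"
 unfolding amenable_def
proof (intro conjI allI impI banach_algebra_M)
 fix E :: "'e nspace" and l r D
 assume mod: "banach_bimodule (malg om) E l r" and D: "continuous_derivation (malg om) E l r D"
 note bm = banach_bimoduleD[OF mod]
 note nE = banach_space_normed[OF bm(1)]
 have mult: "mu \<otimes>\<^bsub>malg om\<^esub> nu = conv mu nu" for mu nu by (simp add: weighted_measure_algebra_def)
 have ad: "mu \<oplus>\<^bsub>malg om\<^esub> nu = (%A. mu A + nu A)" "c \<odot>\<^bsub>malg om\<^esub> mu = (%A. c * mu A)" for mu nu c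
  by (simp_all add: weighted_measure_algebra_def)
 have d: "point_mass t : \<M>" "\<N> (point_mass t) = om t" for t
  by (rule point_mass_carrier)+
 have dd: "conv (point_mass s) (point_mass t) = (point_mass (s + t) :: 'g cmeasure)" for s t
  by (rule conv_point_masses)
 have W0: "0 <= W" using W[of 0] weightD(2)[of 0] by linarith
 have w0: "0 <= om x" for x using weightD(2)[of x] by simp
 have Dl: "D a : carrier (dual_space E)" "D (%A. a A + b A) = (%x. D a x + D b x)" "D (%A. c * a A) = (%x. c * D a x)"
  if "a : \<M>" "b : \<M>" for a b c
  using D that unfolding continuous_derivation_def bounded_linear_into_def linear_into_def by (auto simp: dual_simps ad)
 obtain K0 where K0: "!!a. a : \<M> ==> nrm (dual_space E) (D a) <= K0 * \<N> a"
  using D unfolding continuous_derivation_def bounded_linear_into_def by blast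
 obtain C0 where C0: "!!a x. a : \<M> ==> x : carrier E ==>
   nrm E (l a x) <= C0 * \<N> a * nrm E x & nrm E (r x a) <= C0 * \<N> a * nrm E x"
  using bm(15) by blast
 define K C where "K = \<bar>K0\<bar>" and "C = \<bar>C0\<bar>"
 have K: "cmod (D a x) <= K * \<N> a * nrm E x" if a: "a : \<M>" and x: "x : carrier E" for a x
 proof -
  have "cmod (D a x) <= nrm (dual_space E) (D a) * nrm E x" by (rule dual_nrm_bound[OF nE Dl(1)[OF a a] x])
  also have "... <= (K * \<N> a) * nrm E x"
  proof (rule mult_right_mono[OF _ ns_nonneg[OF nE x]])
   have "K0 * \<N> a <= K * \<N> a"
    unfolding K_def by (intro mult_right_mono M_nrm_nonneg[OF a]) simp
   then show "nrm (dual_space E) (D a) <= K * \<N> a" using K0[OF a] by linarith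
  qed
  finally show ?thesis .
 qed
 have C: "nrm E (l a x) <= C * \<N> a * nrm E x" "nrm E (r x a) <= C * \<N> a * nrm E x"
  if a: "a : \<M>" and x: "x : carrier E" for a x
 proof -
  have "C0 * \<N> a * nrm E x <= C * \<N> a * nrm E x"
   unfolding C_def by (intro mult_right_mono M_nrm_nonneg[OF a] ns_nonneg[OF nE x]) simp
  then show "nrm E (l a x) <= C * \<N> a * nrm E x" "nrm E (r x a) <= C * \<N> a * nrm E x"
   using C0[OF a x] by linarith+
 qed
 have KC0: "0 <= K" "0 <= C" by (simp_all add: K_def C_def)
 have der: "D (conv a b) x = D b (r x a) + D a (l b x)"
  if "a : \<M>" "b : \<M>" "x : carrier E" for a b x
  using D that unfolding continuous_derivation_def by (simp add: mult dual_simps dual_lact_def dual_ract_def)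
 have rr: "r (r x (point_mass s)) (point_mass t) = r x (point_mass (s + t))" if "x : carrier E" for x s t
  using bm(13)[OF d(1)[of s] d(1)[of t] that] by (simp add: mult dd)
 obtain M :: "('g => complex) => complex" where
  M_add: "!!f g. bounded (range f) ==> bounded (range g) ==> M (%t. f t + g t) = M f + M g" and
  M_scale: "!!f c. bounded (range f) ==> M (%t. c * f t) = c * M f" and
  M_bound: "!!f B. ALL t. cmod (f t) <= B ==> cmod (M f) <= 2 * B" and
  M_const: "!!c. M (%t. c) = c" and
  M_inv: "!!f s. bounded (range f) ==> M (%t. f (s + t)) = M f"
  using complex_invariant_mean[OF am disc]
 proof (elim exE conjE, goal_cases)
  case (1 M)
  show ?case
   by (rule 1(1)[of M])
    (rule 1(2)[rule_format] 1(3)[rule_format] 1(4)[rule_format] 1(5)[rule_format] 1(6)[rule_format]; simp)+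
 qed
 define ph where "ph x t = D (point_mass (- t)) (r x (point_mass t))" for x t
 \<comment> \<open>A bound uniform in \<open>t\<close>, where the bounded weight enters: both
   \<open>om t\<close> and \<open>om (- t)\<close> occur.\<close>
 have phb: "cmod (ph x t) <= (K * C * W * W) * nrm E x" if x: "x : carrier E" for x t
 proof -
  have "cmod (ph x t) <= K * om (- t) * nrm E (r x (point_mass t))"
   unfolding ph_def using K[OF d(1) bm(3)[OF d(1) x]] by (simp add: d(2))
  also have "... <= K * om (- t) * (C * om t * nrm E x)"
   using C(2)[OF d(1) x, of t] KC0 w0 by (intro mult_left_mono) (auto simp: d(2))
  also have "... = K * C * nrm E x * (om (- t) * om t)" by (simp add: mult_ac)
  also have "... <= K * C * nrm E x * (W * W)"
   using KC0 W w0 W0 ns_nonneg[OF nE x] by (intro mult_left_mono mult_mono mult_nonneg_nonneg) auto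
  finally show ?thesis by (simp add: mult_ac)
 qed
 have bd: "bounded (range (ph x))" if "x : carrier E" for x
  using phb[OF that] by (intro boundedI) auto
 define f where "f x = (if x : carrier E then M (ph x) else 0)" for x
 have f: "f : carrier (dual_space E)"
 proof (rule dual_carrierI)
  fix x y assume xy: "x : carrier E" "y : carrier E"
  have "ph (x \<oplus>\<^bsub>E\<^esub> y) = (%t. ph x t + ph y t)"
   unfolding ph_def using xy d(1) bm(3) bm(5) dual_carrierD(1)[OF Dl(1)[OF d(1) d(1)]] by simp
  then show "f (x \<oplus>\<^bsub>E\<^esub> y) = f x + f y"
   using M_add[OF bd[OF xy(1)] bd[OF xy(2)]] xy ns_add_closed[OF nE xy] by (simp add: f_def)
 next
  fix c x assume x: "x : carrier E"
  have "ph (c \<odot>\<^bsub>E\<^esub> x) = (%t. c * ph x t)"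
   unfolding ph_def using x d(1) bm(3) bm(7) dual_carrierD(2)[OF Dl(1)[OF d(1) d(1)]] by simp
  then show "f (c \<odot>\<^bsub>E\<^esub> x) = c * f x" using M_scale[OF bd[OF x]] x ns_smult_closed[OF nE x] by (simp add: f_def)
 next
  fix x assume x: "x : carrier E"
  then show "cmod (f x) <= (2 * (K * C * W * W)) * nrm E x"
   using M_bound[of "ph x" "(K * C * W * W) * nrm E x"] phb[OF x] by (simp add: f_def)
 qed (simp add: f_def)
 have shift: "f (r x (point_mass s)) = f (l (point_mass s) x) + D (point_mass s) (r x (point_mass 0))"
  if x: "x : carrier E" for x s
 proof -
  note lx = bm(2)[OF d(1)[of s] x]
  \<comment> \<open>With \<open>u = s + t\<close> and \<open>- t = - u + s\<close>, the derivation
    rule splits off a term that does not depend on \<open>t\<close>; the rest is a shift.\<close>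
  have "ph (r x (point_mass s)) t = ph (l (point_mass s) x) (s + t) + D (point_mass s) (r x (point_mass 0))" for t
  proof -
   let ?u = "s + t"
   have "- t = - ?u + s" by (simp add: minus_add add.assoc)
   then have "ph (r x (point_mass s)) t = D (conv (point_mass (- ?u)) (point_mass s)) (r x (point_mass ?u))"
    by (simp add: ph_def rr[OF x] dd)
   also have "... = D (point_mass s) (r (r x (point_mass ?u)) (point_mass (- ?u))) +
     D (point_mass (- ?u)) (l (point_mass s) (r x (point_mass ?u)))"
    by (rule der[OF d(1) d(1) bm(3)[OF d(1) x]])
   also have "l (point_mass s) (r x (point_mass ?u)) = r (l (point_mass s) x) (point_mass ?u)"
    by (rule bm(14)[OF d(1) d(1) x, symmetric])
   finally show ?thesis by (simp add: ph_def rr[OF x])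
  qed
  then have "ph (r x (point_mass s)) = (%t. ph (l (point_mass s) x) (s + t) + D (point_mass s) (r x (point_mass 0)))" ..
  then have "f (r x (point_mass s)) = M (%t. ph (l (point_mass s) x) (s + t) + D (point_mass s) (r x (point_mass 0)))"
   using bm(3)[OF d(1) x] by (simp add: f_def)
  also have "... = M (%t. ph (l (point_mass s) x) (s + t)) + M (%t. D (point_mass s) (r x (point_mass 0)))"
   by (rule M_add) (use bd[OF lx] in \<open>auto intro: bounded_subset\<close>)
  also have "... = f (l (point_mass s) x) + D (point_mass s) (r x (point_mass 0))"
   using M_inv[OF bd[OF lx], of s] lx by (simp add: M_const f_def)
  finally show ?thesis .
 qed
 define g where "g = D (point_mass 0)"
 have g: "g : carrier (dual_space E)" unfolding g_def by (rule Dl(1)[OF d(1) d(1)])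
 \<comment> \<open>The bimodule need not be unital, and \<open>shift\<close> describes
   \<open>D (point_mass s)\<close> only on \<open>r x (point_mass 0)\<close>. The correction
   supplies the missing summand \<open>D (point_mass 0) (l (point_mass s) x)\<close>.\<close>
 define h where "h x = f x + (- 1) * dual_ract E l g (point_mass 0) x" for x
 have h: "h : carrier (dual_space E)"
 proof -
  note nD = normed_dual_space[OF nE]
  note k = ns_smult_closed[OF nD dual_actions_closed(2)[OF mod g d(1)[of 0]], of "- 1"]
  show ?thesis using ns_add_closed[OF nD f k] by (simp only: dual_simps h_def[abs_def])
 qed
 have hx: "h x = f x - g (l (point_mass 0) x)" if "x : carrier E" for x
  using that by (simp add: h_def dual_ract_def)
 have eq: "D (point_mass s) x = h (r x (point_mass s)) - h (l (point_mass s) x)" if x: "x : carrier E" for x s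
 proof -
  have 1: "g z = g (r z (point_mass 0)) + g (l (point_mass 0) z)" if "z : carrier E" for z
   using der[OF d(1)[of 0] d(1)[of 0] that] by (simp add: dd g_def)
  let ?z = "r x (point_mass s)"
  have z: "?z : carrier E" by (rule bm(3)[OF d(1) x])
  have "r ?z (point_mass 0) = ?z" using rr[OF x, of s 0] by simp
  then have 2: "g (l (point_mass 0) ?z) = 0" using 1[OF z] by simp
  have "l (point_mass 0) (l (point_mass s) x) = l (point_mass s) x"
   using bm(12)[OF d(1)[of 0] d(1)[of s] x] by (simp add: mult dd)
  then have "h ?z - h (l (point_mass s) x) = f ?z - f (l (point_mass s) x) + g (l (point_mass s) x)"
   using hx[OF z] hx[OF bm(2)[OF d(1) x], of s] 2 by simp
  also have "... = D (point_mass s) (r x (point_mass 0)) + D (point_mass 0) (l (point_mass s) x)"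
   using shift[OF x, of s] by (simp add: g_def)
  also have "... = D (point_mass s) x" using der[OF d(1)[of 0] d(1)[of s] x] by (simp add: dd)
  finally show ?thesis by simp
 qed
 obtain H0 where H0: "!!x. x : carrier E ==> cmod (h x) <= H0 * nrm E x" using dual_carrierD(4)[OF h] by blast
 define H where "H = \<bar>H0\<bar>"
 have H: "cmod (h x) <= H * nrm E x" if "x : carrier E" for x
  using H0[OF that] mult_right_mono[OF abs_ge_self[of H0] ns_nonneg[OF nE that]] by (simp add: H_def)
 have all: "D a x - (h (r x a) - h (l a x)) = 0" if a: "a : \<M>" and x: "x : carrier E" for a x
 proof (rule point_mass_dense[OF _ _ _ _ a, where f = "%a. D a x - (h (r x a) - h (l a x))"])
  fix mu nu assume m: "mu : \<M>" "nu : \<M>"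
  show "D (%A. mu A + nu A) x - (h (r x (%A. mu A + nu A)) - h (l (%A. mu A + nu A) x)) =
    D mu x - (h (r x mu) - h (l mu x)) + (D nu x - (h (r x nu) - h (l nu x)))"
   using Dl(2)[OF m] bm(8)[OF m x] bm(9)[OF m x] dual_carrierD(1)[OF h] bm(2,3)[OF m(1) x] bm(2,3)[OF m(2) x]
   by (simp add: ad)
 next
  fix c mu assume m: "mu : \<M>"
  show "D (%A. c * mu A) x - (h (r x (%A. c * mu A)) - h (l (%A. c * mu A) x)) = c * (D mu x - (h (r x mu) - h (l mu x)))"
   using Dl(3)[OF m m] bm(10)[OF m x, of c] bm(11)[OF m x, of c] dual_carrierD(2)[OF h] bm(2,3)[OF m x]
   by (simp add: ad right_diff_distrib)
 next
  fix mu assume m: "mu : \<M>"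
  let ?n = "\<N> mu"
  have H1: "cmod (h (r x mu)) <= H * (C * ?n * nrm E x)" "cmod (h (l mu x)) <= H * (C * ?n * nrm E x)"
   using H[OF bm(3)[OF m x]] H[OF bm(2)[OF m x]] mult_left_mono[OF C(1)[OF m x], of H] mult_left_mono[OF C(2)[OF m x], of H]
   by (auto simp: H_def)
  have "cmod (D mu x - (h (r x mu) - h (l mu x))) <= cmod (D mu x) + (cmod (h (r x mu)) + cmod (h (l mu x)))"
   by (intro order_trans[OF norm_triangle_ineq4] add_mono norm_triangle_ineq4 order_refl)
  also have "... <= K * ?n * nrm E x + (H * (C * ?n * nrm E x) + H * (C * ?n * nrm E x))"
   by (intro add_mono K[OF m x] H1)
  also have "... = (K * nrm E x + 2 * H * C * nrm E x) * ?n" by (simp add: algebra_simps)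
  finally show "cmod (D mu x - (h (r x mu) - h (l mu x))) <= (K * nrm E x + 2 * H * C * nrm E x) * ?n" .
 qed (use eq[OF x] in simp)
 show "inner_derivation (malg om) E l r D"
  unfolding inner_derivation_def
 proof (intro bexI[of _ h] h ballI)
  fix a assume a: "a : \<M>"
  have "D a x = dual_lact E r a h x - dual_ract E l h a x" for x
   using all[OF a, of x] dual_carrierD(3)[OF Dl(1)[OF a a]] by (auto simp: dual_lact_def dual_ract_def)
  then show "D a = dual_lact E r a h \<ominus>\<^bsub>dual_space E\<^esub> dual_ract E l h a"
   using pointwise_minus[OF pointwise_dual_space dual_actions_closed[OF mod h a]] by auto
 qed
qed

section \<open>The dual of \<open>M_star\<close> on a discrete group\<close>

context discrete_weighted
begin

lemma atomic_null:
 assumes f: "f : carrier l1" and A: "!!x. x : A ==> f x = (0::complex)"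
 shows "emeasure (variation (atomic f)) (A :: 'g set) = 0"
proof -
 have fi: "integrable (count_space UNIV) f" using l1_norm_summable[OF f] by (simp add: abs_summable_iff_integrable)
 have "variation (atomic f) = density (count_space UNIV) (%x. ennreal (cmod (f x)))"
  using L1_measure_variation[of "count_space UNIV :: 'g measure" f] fi
  by (simp add: atomic_eq[OF f] sets_discrete)
 moreover have "(\<integral>\<^sup>+x\<in>A. ennreal (cmod (f x)) \<partial>count_space UNIV) = 0"
  by (subst nn_integral_cong[of _ _ "%_. 0"]) (auto simp: A indicator_def)
 ultimately show ?thesis by (simp add: emeasure_density)
qed

lemma vanishes_at_infinityD:
 assumes th: "th : \<P>" and e: "0 < e"
 obtains K where "finite K"
  "ALL mu:\<M>. emeasure (variation mu) K = 0 & \<N> mu = 1 --> cmod (th mu) < e"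
proof -
 have "EX K. compact K & (ALL mu:\<M>. emeasure (variation mu) K = 0 & \<N> mu = 1 --> cmod (th mu) < e)"
  using th e unfolding M_star_carrier vanishes_at_infinity_def by (elim conjE allE[of _ e]) simp
 then obtain K where "compact K" "ALL mu:\<M>. emeasure (variation mu) K = 0 & \<N> mu = 1 --> cmod (th mu) < e"
  by (elim exE conjE)
 then show thesis by (intro that) (simp_all only: discrete_group_simps(3)[OF disc])
qed

text \<open>On a discrete group the functionals vanishing at infinity are norm limits of finite
  combinations of evaluations at points, as in a weighted \<open>c_0\<close>. The atoms in
  \<open>K\<close> are removed from \<open>nu\<close>, and the normalised remainder falls under the
  definition of vanishing.\<close>

lemma M_star_approx:
 assumes th: "th : \<P>" and e: "0 < e"
 obtains K where "finite K"
  "ALL nu:\<M>. cmod (th nu - (\<Sum>x\<in>K. th (point_mass x) * nu {x})) <= e * \<N> nu"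
proof -
 obtain K where fK: "finite K"
  and K: "ALL mu:\<M>. emeasure (variation mu) K = 0 & \<N> mu = 1 --> cmod (th mu) < e"
  by (rule vanishes_at_infinityD[OF th e])
 note thD = M_starD[OF th]
 have "cmod (th nu - (\<Sum>x\<in>K. th (point_mass x) * nu {x})) <= e * \<N> nu" if nu: "nu : \<M>" for nu
 proof -
  obtain rho where rho: "rho : \<M>" and rhox: "!!y. rho {y} = (if y : K then 0 else nu {y})"
   and thrho: "th rho = th nu - (\<Sum>x\<in>K. th (point_mass x) * nu {x})"
   by (rule remove_atoms[where f = th, OF thD(1,2) nu fK]) (assumption | (rule that; assumption))+
  note arho = M_atoms(1)[OF rho] and anu = M_atoms(1)[OF nu]
  have null: "emeasure (variation rho) K = 0"
   using atomic_null[OF arho, of K] rhox M_atoms(3)[OF rho] by simp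
  have le: "\<N> rho <= \<N> nu"
   unfolding M_nrm_atoms[OF rho] M_nrm_atoms[OF nu]
   using arho anu weightD(2) by (intro infsum_mono) (auto simp: l1_iff rhox less_imp_le)
  have "cmod (th rho) <= e * \<N> rho"
  proof (cases "\<N> rho = 0")
   case True
   then have "rho = (%A. 0 * rho A)" using ns_eq_0[OF normed_M rho] by (simp add: weighted_measure_algebra_def)
   then have "th rho = 0" using thD(2)[OF rho, of 0] by simp
   then show ?thesis using True by simp
  next
   case False
   then have n: "0 < \<N> rho" using M_nrm_nonneg[OF rho] by simp
   let ?c = "complex_of_real (1 / \<N> rho)"
   have "emeasure (variation (%A. ?c * rho A)) K = 0"
    using atomic_null[OF M_atoms(1)[OF M_smult(1)[OF rho, of ?c]], of K] rhox
     M_atoms(3)[OF M_smult(1)[OF rho, of ?c]] by simp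
   moreover have "\<N> (%A. ?c * rho A) = 1" using n by (subst M_smult(2)[OF rho]) (simp add: norm_divide)
   ultimately have "cmod (th (%A. ?c * rho A)) < e" using K M_smult(1)[OF rho] by blast
   then have "cmod (th rho) / \<N> rho < e" using n by (subst (asm) thD(2)[OF rho]) (simp add: norm_divide)
   then show ?thesis using n by (simp add: field_simps)
  qed
  also have "... <= e * \<N> nu" using le e by (intro mult_left_mono) auto
  finally show ?thesis by (simp add: thrho)
 qed
 with fK show thesis by (intro that ballI)
qed

lemma M_star_sum:
 assumes "finite K" "!!x. x : K ==> h x : \<P>"
 shows "(%nu. \<Sum>x\<in>K. c x * h x nu) : \<P>"
 using assms
proof induction
 case empty
 then show ?case using ns_zero_closed[OF normed_M_star] by (simp add: M_star_simps)
next
 case (insert x F)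
 then show ?case
  using ns_add_closed[OF normed_M_star ns_smult_closed[OF normed_M_star, of "h x" "c x"], of "%nu. \<Sum>x\<in>F. c x * h x nu"]
  by (simp add: M_star_simps)
qed

lemma theta_M: "compact {x :: 'g}" "theta {x :: 'g} : \<P>"
 by (simp_all add: theta_M_star)

text \<open>By approximation it is enough that the evaluations at points, composed with
  \<open>S\<close>, vanish at infinity. It serves for convolution from either side.\<close>

lemma M_star_compose:
 assumes th: "th : \<P>"
  and S: "!!mu. mu : \<M> ==> S mu : \<M>"
  and S_add: "!!mu nu. mu : \<M> ==> nu : \<M> ==> S (%A. mu A + nu A) = (%A. S mu A + S nu A)"
  and S_sm: "!!c mu. mu : \<M> ==> S (%A. c * mu A) = (%A. c * S mu A)"
  and S_bd: "!!mu. mu : \<M> ==> \<N> (S mu) <= C * \<N> mu" and C: "0 <= C"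
  and S_th: "!!x. (%mu. if mu : \<M> then S mu {x} else 0) : \<P>"
 shows "(%mu. if mu : \<M> then th (S mu) else 0) : \<P>"
proof -
 note thD = M_starD[OF th]
 have "th : carrier (dual_space (malg om))" using th by (simp add: M_star_carrier)
 from dual_carrierD(4)[OF this] obtain B where B: "!!mu. mu : \<M> ==> cmod (th mu) <= B * \<N> mu" by blast
 show ?thesis
 proof (rule M_starI[where C = "\<bar>B\<bar> * C"])
  fix mu nu assume "mu : \<M>" "nu : \<M>"
  then show "(if (%A. mu A + nu A) : \<M> then th (S (%A. mu A + nu A)) else 0) =
    (if mu : \<M> then th (S mu) else 0) + (if nu : \<M> then th (S nu) else 0)"
   using M_add(1) S_add thD(1)[OF S S] by simp
 next
  fix c mu assume "mu : \<M>"
  then show "(if (%A. c * mu A) : \<M> then th (S (%A. c * mu A)) else 0) =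
    c * (if mu : \<M> then th (S mu) else 0)"
   using M_smult(1) S_sm thD(2)[OF S] by simp
 next
  fix mu assume m: "mu : \<M>"
  have "cmod (th (S mu)) <= \<bar>B\<bar> * \<N> (S mu)"
   using B[OF S[OF m]] mult_right_mono[OF abs_ge_self[of B] M_nrm_nonneg[OF S[OF m]]] by linarith
  also have "... <= \<bar>B\<bar> * (C * \<N> mu)" using S_bd[OF m] by (intro mult_left_mono) auto
  finally show "cmod (if mu : \<M> then th (S mu) else 0) <= \<bar>B\<bar> * C * \<N> mu"
   using m by (simp add: mult.assoc)
 next
  fix e :: real assume e: "0 < e"
  \<comment> \<open>Half of \<open>e\<close> is for the approximation error, which the operator
    bound \<open>C\<close> multiplies; \<open>C + 1\<close> keeps the denominator positive.\<close>
  define d where "d = e / (2 * (C + 1))"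
  have d: "0 < d" using e C by (simp add: d_def)
  obtain K where K: "finite K" "ALL nu:\<M>.
    cmod (th nu - (\<Sum>x\<in>K. th (point_mass x) * nu {x})) <= d * \<N> nu"
   by (rule M_star_approx[OF th d])
  define h where "h = (%mu. \<Sum>x\<in>K. th (point_mass x) * (if mu : \<M> then S mu {x} else 0))"
  have h: "h : \<P>" unfolding h_def by (rule M_star_sum[OF K(1) S_th])
  obtain L where L: "finite L" "ALL mu:\<M>. emeasure (variation mu) L = 0 &
    \<N> mu = 1 --> cmod (h mu) < e / 2"
   by (rule vanishes_at_infinityD[OF h half_gt_zero[OF e]])
  have "cmod (th (S mu)) < e" if m: "mu : \<M>" "emeasure (variation mu) L = 0" "\<N> mu = 1" for mu
  proof -
   have "cmod (th (S mu) - h mu) <= d * \<N> (S mu)" using bspec[OF K(2) S[OF m(1)]] m(1) by (simp add: h_def)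
   also have "... <= d * C" using S_bd[OF m(1)] m(3) d by (intro mult_left_mono) auto
   also have "... < d * (C + 1)" using d by simp
   also have "... = e / 2"
   proof -
    have "C + 1 ~= 0" using C by simp
    then show ?thesis unfolding d_def by (simp del: distrib_left_numeral)
   qed
   finally show ?thesis using bspec[OF L(2) m(1)] m norm_triangle_ineq[of "th (S mu) - h mu" "h mu"] by simp
  qed
  then show "EX K. compact K & (ALL mu:\<M>. emeasure (variation mu) K = 0 --> \<N> mu = 1 -->
    cmod (if mu : \<M> then th (S mu) else 0) < e)"
   using finite_imp_compact[OF L(1)] by (intro exI[of _ L]) auto
 qed simp
qed

lemma conv_right_M_star:
 assumes th: "th : \<P>" and nu: "nu : \<M>"
 shows "(%mu. if mu : \<M> then th (conv mu nu) else 0) : \<P>"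
proof (rule M_star_compose[OF th, where S = "%mu. conv mu nu" and C = "\<N> nu"])
 show "(%mu. if mu : \<M> then conv mu nu {x} else 0) : \<P>" for x
 proof -
  have bij: "bij (%k. - k + x)"
   by (rule bij_betw_byWitness[where f' = "%y. x - y"])
    (auto simp: diff_conv_add_uminus minus_add add.assoc simp del: add_uminus_conv_diff)
  have "(%k. norm (nu {k})) summable_on UNIV" by (rule l1_norm_summable[OF M_atoms(1)[OF nu]])
  then have "(%k. norm (nu {- k + x})) summable_on UNIV"
   using summable_on_reindex_bij_betw[OF bij, of "%k. norm (nu {k})"] by simp
  from theta_series_M_star[OF this, of "%k. {k}"]
  have "theta_series UNIV (%k. nu {- k + x}) (%k. {k}) : \<P>" by simp
  moreover have "theta_series UNIV (%k. nu {- k + x}) (%k. {k}) = (%mu. if mu : \<M> then conv mu nu {x} else 0)"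
   using infsumI[OF conv_has_sum[OF _ nu]] by (auto simp: theta_series_def mult.commute)
  ultimately show ?thesis by simp
 qed
qed (use nu in \<open>auto simp: conv_closed conv_add_left conv_smult_left
  M_nrm_nonneg mult.commute[of "\<N> nu"]\<close>)

lemma functional_measure_closed:
 assumes th: "th : \<P>" and mu: "mu : \<M>"
 shows "functional_measure om th mu : \<P>"
 unfolding functional_measure_def
proof (rule M_star_compose[OF th, where S = "conv mu" and C = "\<N> mu"])
 show "(%nu. if nu : \<M> then conv mu nu {x} else 0) : \<P>" for x
 proof -
  have bij: "bij (%k. x - k)"
   by (rule bij_betw_byWitness[where f' = "%y. - y + x"])
    (auto simp: diff_conv_add_uminus minus_add add.assoc simp del: add_uminus_conv_diff)
  have eq: "- (x - k) + x = k" for k by (simp add: diff_conv_add_uminus minus_add add.assoc del: add_uminus_conv_diff)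
  have "(%k. norm (mu {k})) summable_on UNIV" by (rule l1_norm_summable[OF M_atoms(1)[OF mu]])
  then have "(%k. norm (mu {x - k})) summable_on UNIV"
   using summable_on_reindex_bij_betw[OF bij, of "%k. norm (mu {k})"] by simp
  from theta_series_M_star[OF this, of "%k. {k}"]
  have "theta_series UNIV (%k. mu {x - k}) (%k. {k}) : \<P>" by simp
  moreover have "(\<Sum>\<^sub>\<infinity>k. mu {x - k} * nu {k}) = conv mu nu {x}" if nu: "nu : \<M>" for nu
   using infsum_reindex_bij_betw[OF bij, of "%k. mu {k} * nu {- k + x}"] infsumI[OF conv_has_sum[OF mu nu, of x]]
   by (simp add: eq)
  ultimately show ?thesis by (simp add: theta_series_def cong: if_cong)
 qed
qed (use mu in \<open>auto simp: conv_closed conv_add_right conv_smult_right M_nrm_nonneg\<close>)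

text \<open>The inner step of the Arens product with an evaluation is
  \<open>mu \<mapsto> th (conv mu nu)\<close>. The outer evaluation returns this value only on
  \<open>M_star\<close>, so the work is in \<open>conv_right_M_star\<close>.\<close>

lemma evaluation_mult:
 assumes mu: "mu : \<M>" and nu: "nu : \<M>"
 shows "evaluation om (conv mu nu) = arens om (evaluation om mu) (evaluation om nu)"
proof
 fix th
 show "evaluation om (conv mu nu) th = arens om (evaluation om mu) (evaluation om nu) th"
 proof (cases "th : \<P>")
  case True
  have "bifunctional_functional om (evaluation om nu) th = (%mu. if mu : \<M> then th (conv mu nu) else 0)"
  proof -
   have "functional_measure om th mu nu = th (conv mu nu)" for mu using nu by (simp add: functional_measure_def)
   then show ?thesis
    by (auto simp: bifunctional_functional_def evaluation_def functional_measure_closed[OF True])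
  qed
  then show ?thesis
   using True conv_right_M_star[OF True nu] mu by (simp add: arens_def evaluation_def)
 qed (simp add: arens_def evaluation_def)
qed

lemma bidual_sum:
 assumes Ph: "Ph : carrier (dual_space (M_star om))" and F: "finite F"
 shows "Ph (%nu. \<Sum>x\<in>F. c x * theta {x} nu) = (\<Sum>x\<in>F. c x * Ph (theta {x}))"
 using F
proof induction
 case empty
 show ?case using dual_carrierD(2)[OF Ph ns_zero_closed[OF normed_M_star], of 0] by (simp add: M_star_simps)
next
 case (insert x F)
 then show ?case
  using dual_carrierD(1)[OF Ph ns_smult_closed[OF normed_M_star theta_M(2)[of x], of "c x"] M_star_sum[OF insert(1) theta_M(2)]]
   dual_carrierD(2)[OF Ph theta_M(2)[of x], of "c x"]
  by (simp add: M_star_simps)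
qed

text \<open>Test functional with the weights \<open>om x\<close> and phases adapted to
  \<open>Ph\<close>: its norm is at most 1, and \<open>Ph\<close> maps it to the sum on the
  left.\<close>

lemma bidual_atoms:
 assumes Ph: "Ph : carrier (dual_space (M_star om))" and F: "finite (F :: 'g set)"
 shows "(\<Sum>x\<in>F. om x * norm (Ph (theta {x}))) <= nrm (dual_space (M_star om)) Ph"
proof -
 define be where "be x = complex_of_real (om x) * cnj (sgn (Ph (theta {x})))" for x
 define th where "th = (%nu. \<Sum>x\<in>F. be x * theta {x} nu)"
 have th: "th : \<P>" unfolding th_def by (rule M_star_sum[OF F theta_M(2)])
 have "Ph (%nu. \<Sum>x\<in>F. be x * theta {x} nu) = (\<Sum>x\<in>F. be x * Ph (theta {x}))"
  by (rule bidual_sum[OF Ph F])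
 also have "... = (\<Sum>x\<in>F. complex_of_real (om x * norm (Ph (theta {x}))))"
 proof (rule sum.cong)
  have "cnj (sgn z) * z = complex_of_real (norm z)" for z :: complex
   by (cases "z = 0") (auto simp: sgn_div_norm scaleR_conv_of_real mult.commute[of "cnj z"] complex_norm_square[symmetric] power2_eq_square divide_simps)
  then show "be x * Ph (theta {x}) = complex_of_real (om x * norm (Ph (theta {x})))" for x
   by (simp add: be_def mult.assoc)
 qed simp
 finally have "Ph th = complex_of_real (\<Sum>x\<in>F. om x * norm (Ph (theta {x})))" by (simp only: th_def of_real_sum)
 then have eq: "(\<Sum>x\<in>F. om x * norm (Ph (theta {x}))) <= cmod (Ph th)" by (simp only: norm_of_real abs_ge_self)
 have nM: "nrm (M_star om) = nrm (dual_space (malg om))" by (simp add: M_star_def)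
 have "nrm (M_star om) th <= 1"
  unfolding nM
 proof (rule dual_nrm_le[OF normed_M])
  fix nu assume nu: "nu : \<M>"
  note anu = M_atoms(1)[OF nu]
  have "cmod (th nu) <= (\<Sum>x\<in>F. cmod (be x * nu {x}))" using nu by (simp add: th_def theta_def norm_sum)
  also have "... <= (\<Sum>x\<in>F. om x * norm (nu {x}))"
  proof (rule sum_mono)
   fix x
   have "cmod (be x) <= om x" using weightD(2)[of x] by (simp add: be_def norm_mult norm_sgn)
   then show "cmod (be x * nu {x}) <= om x * norm (nu {x})" by (simp add: norm_mult mult_right_mono)
  qed
  also have "... <= (\<Sum>\<^sub>\<infinity>x. om x * norm (nu {x}))"
   using F anu nonneg by (intro finite_sum_le_infsum) (auto simp: l1_iff)
  also have "... = \<N> nu" by (simp only: M_nrm_atoms[OF nu])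
  finally show "cmod (th nu) <= 1 * \<N> nu" by simp
 qed simp
 then have "nrm (dual_space (M_star om)) Ph * nrm (M_star om) th <= nrm (dual_space (M_star om)) Ph * 1"
  by (intro mult_left_mono dual_nrm_nonneg[OF normed_M_star Ph])
 then show ?thesis using eq dual_nrm_bound[OF normed_M_star Ph th] by simp
qed

text \<open>The duality of weighted \<open>c_0\<close> and \<open>l1\<close>. The values of
  \<open>Ph\<close> at the functionals \<open>theta {x}\<close> are summable against the weight, and
  the atomic measure built from them agrees with \<open>Ph\<close> on finite combinations, which are
  dense by \<open>M_star_approx\<close>.\<close>

lemma isometry_evaluation: "isometry (malg om) (M_star_dual om) (evaluation om)"
proof -
 have nM: "nrm (M_star om) = nrm (dual_space (malg om))" by (simp add: M_star_def)
 have sd: "carrier (M_star_dual om) = carrier (dual_space (M_star om))" "nrm (M_star_dual om) = nrm (dual_space (M_star om))"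
  "\<zero>\<^bsub>M_star_dual om\<^esub> = (%x. 0)" "f \<oplus>\<^bsub>M_star_dual om\<^esub> g = (%x. f x + g x)" "c \<odot>\<^bsub>M_star_dual om\<^esub> f = (%x. c * f x)" for f g c
  by (simp_all add: M_star_dual_def dual_space_def)
 note thD = M_starD
 have bd: "cmod (th mu) <= \<N> mu * nrm (M_star om) th"
  if "th : \<P>" "mu : \<M>" for th mu
  using dual_nrm_bound[OF normed_M _ that(2), of th] that(1) by (simp add: nM M_star_carrier mult.commute)
 have cl: "evaluation om mu : carrier (dual_space (M_star om))" if mu: "mu : \<M>" for mu
  by (rule dual_carrierI[where C = "\<N> mu"])
   (use bd[OF _ mu] ns_add_closed[OF normed_M_star] ns_smult_closed[OF normed_M_star]
    in \<open>auto simp: evaluation_def M_star_simps\<close>)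
 have at: "evaluation om mu (theta {x}) = mu {x}" if "mu : \<M>" for mu x
  unfolding evaluation_def if_P[OF theta_M(2)] using that by (simp add: theta_def)
 have onto: "EX mu:\<M>. Ph = evaluation om mu" if Ph: "Ph : carrier (dual_space (M_star om))" for Ph
 proof
  define f where "f x = Ph (theta {x})" for x
  have fl: "f : carrier l1"
   unfolding l1_iff f_def
   by (rule nonneg_bdd_above_summable_on[OF nonneg] bdd_aboveI)+
    (use bidual_atoms[OF Ph] in auto)
  show mu: "atomic f : \<M>" by (rule atomic_M(1)[OF fl])
  let ?mu = "atomic f"
  obtain B where B: "!!th. th : \<P> ==> cmod (Ph th) <= B * nrm (M_star om) th"
   using dual_carrierD(4)[OF Ph] by blast
  have nn: "0 <= nrm (M_star om) th" if "th : \<P>" for th by (rule ns_nonneg[OF normed_M_star that])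
  define C where "C = \<bar>B\<bar> + \<N> ?mu + 1"
  have C: "0 < C" using M_nrm_nonneg[OF mu] by (simp add: C_def)
  have "Ph th - th ?mu = 0" if th: "th : \<P>" for th
  proof -
   have "cmod (Ph th - th ?mu) <= 0 + e" if e: "0 < e" for e
   proof -
    have d: "0 < e / C" using e C by simp
    obtain K where K: "finite K" "ALL nu:\<M>.
    cmod (th nu - (\<Sum>x\<in>K. th (point_mass x) * nu {x})) <= (e / C) * \<N> nu"
     by (rule M_star_approx[OF th d])
    define ta where "ta = (%nu. \<Sum>x\<in>K. th (point_mass x) * theta {x} nu)"
    define rho where "rho = (%nu. th nu + (- 1) * ta nu)"
    have ta: "ta : \<P>" unfolding ta_def by (rule M_star_sum[OF K(1) theta_M(2)])
    note mta = ns_smult_closed[OF normed_M_star ta, of "- 1", unfolded M_star_simps]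
    have rho: "rho : \<P>"
     unfolding rho_def using ns_add_closed[OF normed_M_star th mta] by (simp only: M_star_simps)
    have Phrho: "Ph rho = Ph th - Ph ta"
     using dual_carrierD(1)[OF Ph th mta] dual_carrierD(2)[OF Ph ta, of "- 1"] by (simp add: M_star_simps rho_def)
    have "Ph ta = (\<Sum>x\<in>K. th (point_mass x) * f x)"
     unfolding ta_def f_def by (rule bidual_sum[OF Ph K(1)])
    moreover have "ta ?mu = (\<Sum>x\<in>K. th (point_mass x) * f x)"
     using mu by (simp add: ta_def theta_def) (simp add: atomic_def)
    ultimately have "Ph th - th ?mu = Ph rho - rho ?mu" by (simp add: Phrho) (simp add: rho_def)
    also have "cmod ... <= B * nrm (M_star om) rho + \<N> ?mu * nrm (M_star om) rho"
     by (intro order_trans[OF norm_triangle_ineq4] add_mono B[OF rho] bd[OF rho mu])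
    also have "... <= C * nrm (M_star om) rho"
     unfolding distrib_right[symmetric] C_def by (intro mult_right_mono nn[OF rho]) simp
    also have "nrm (M_star om) rho <= e / C"
     unfolding nM
    proof (rule dual_nrm_le[OF normed_M])
     fix nu assume nu: "nu : \<M>"
     then have "rho nu = th nu - (\<Sum>x\<in>K. th (point_mass x) * nu {x})" by (simp add: rho_def ta_def theta_def)
     then show "cmod (rho nu) <= e / C * \<N> nu" using bspec[OF K(2) nu] by simp
    qed (use d in simp)
    then have "C * nrm (M_star om) rho <= e" using C by (simp add: field_simps)
    finally show ?thesis by simp
   qed
   then have "cmod (Ph th - th ?mu) <= 0" by (rule field_le_epsilon)
   then show ?thesis by simp
  qed
  then show "Ph = evaluation om ?mu" using dual_carrierD(3)[OF Ph] by (auto simp: evaluation_def)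
 qed
 show ?thesis
  unfolding isometry_def
 proof (intro conjI ballI allI)
  show "bij_betw (evaluation om) (\<M>) (carrier (M_star_dual om))"
   unfolding bij_betw_def sd
  proof (intro conjI inj_onI)
   fix mu nu assume m: "mu : \<M>" "nu : \<M>" and eq: "evaluation om mu = evaluation om nu"
   have "mu {x} = nu {x}" for x using at[OF m(1), of x] at[OF m(2), of x] eq by simp
   then show "mu = nu" by (rule M_eqI[OF m])
  next
   show "evaluation om ` \<M> = carrier (dual_space (M_star om))" using cl onto by blast
  qed
  have zero: "(%A. 0) : \<M>"
   using ns_zero_closed[OF normed_M] by (simp add: weighted_measure_algebra_def)
  show "evaluation om \<zero>\<^bsub>malg om\<^esub> = \<zero>\<^bsub>M_star_dual om\<^esub>"
   using thD(2)[OF _ zero, of _ 0] by (auto simp: sd weighted_measure_algebra_def evaluation_def)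
  show "evaluation om (mu \<oplus>\<^bsub>malg om\<^esub> nu) = evaluation om mu \<oplus>\<^bsub>M_star_dual om\<^esub> evaluation om nu"
   if "mu : \<M>" "nu : \<M>" for mu nu
   using thD(1)[OF _ that] by (auto simp: sd weighted_measure_algebra_def evaluation_def)
  show "evaluation om (c \<odot>\<^bsub>malg om\<^esub> mu) = c \<odot>\<^bsub>M_star_dual om\<^esub> evaluation om mu"
   if "mu : \<M>" for c mu
   using thD(2)[OF _ that] by (auto simp: sd weighted_measure_algebra_def evaluation_def)
  show "nrm (M_star_dual om) (evaluation om mu) = \<N> mu" if mu: "mu : \<M>" for mu
  proof (rule antisym)
   show "nrm (M_star_dual om) (evaluation om mu) <= \<N> mu"
    unfolding sd using bd[OF _ mu]
    by (intro dual_nrm_le[OF normed_M_star M_nrm_nonneg[OF mu]]) (simp add: evaluation_def)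
   note amu = M_atoms(1)[OF mu]
   have "\<N> mu = (\<Sum>\<^sub>\<infinity>x. om x * norm (mu {x}))" by (rule M_nrm_atoms[OF mu])
   also have "... <= nrm (M_star_dual om) (evaluation om mu)"
    unfolding sd using bidual_atoms[OF cl[OF mu]] amu
    by (intro infsum_le_finite_sums) (auto simp: l1_iff at[OF mu])
   finally show "\<N> mu <= nrm (M_star_dual om) (evaluation om mu)" .
  qed
 qed
qed

end

section \<open>Haar measure and the group algebra of a discrete group\<close>

lemma left_haar_discrete:
 fixes m :: "'g::{topological_group_add,t2_space} measure"
 assumes m: "left_haar m" and disc: "discrete_group TYPE('g)"
 obtains c where "0 < c" "m = density (count_space UNIV) (%_. ennreal c)"
proof -
 have sets: "sets m = UNIV" using m discrete_group_simps(2)[OF disc] by (auto simp: left_haar_def)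
 have fin: "emeasure m K < \<infinity>" if "finite K" for K
  using m finite_imp_compact[OF that] unfolding left_haar_def by (elim conjE) blast
 have inv: "emeasure m {x} = emeasure m {0}" for x
 proof -
  have "emeasure m ((+) x ` {0}) = emeasure m {0}"
   using m discrete_group_simps(2)[OF disc, of "{0}"] unfolding left_haar_def by blast
  then show ?thesis by simp
 qed
 define c where "c = enn2real (emeasure m {0})"
 have c: "emeasure m {x} = ennreal c" for x using fin[of "{0}"] unfolding c_def inv[of x] by simp
 have c0: "0 <= c" by (simp add: c_def)
 have F: "emeasure m K = ennreal (c * card K)" if K: "finite K" for K
 proof -
  have "emeasure m K = (\<Sum>x\<in>K. emeasure m {x})" using K sets by (intro emeasure_eq_sum_singleton) auto
  then show ?thesis using c0 by (simp add: c ennreal_of_nat_eq_real_of_nat ennreal_mult' mult.commute)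
 qed
 \<comment> \<open>Every set is open and compact sets are finite, so inner regularity on open sets
   determines the measure from its value at one point.\<close>
 have SUP: "emeasure m A = (SUP K\<in>{K. finite K & K \<subseteq> A}. emeasure m K)" for A
 proof -
  have "ALL U. open U --> emeasure m U = (SUP K\<in>{K. compact K & K \<subseteq> U}. emeasure m K)"
   using m unfolding left_haar_def by (elim conjE)
  then have "emeasure m A = (SUP K\<in>{K. compact K & K \<subseteq> A}. emeasure m K)"
   using discrete_group_simps(1)[OF disc, of A] by (elim allE impE)
  then show ?thesis by (simp only: discrete_group_simps(3)[OF disc])
 qed
 have m0: "emeasure m UNIV ~= 0" using m unfolding left_haar_def by (elim conjE)
 have "c ~= 0"
 proof
  assume z: "c = 0"
  have "emeasure m UNIV <= 0" unfolding SUP[of UNIV] by (rule SUP_least) (simp add: F z)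
  then show False using m0 by simp
 qed
 then have cp: "0 < c" using c0 by simp
 have "m = density (count_space UNIV) (%_. ennreal c)"
 proof (rule measure_eqI)
  show "sets m = sets (density (count_space UNIV) (%_. ennreal c))" using sets by simp
  fix A assume "A : sets m"
  have d: "emeasure (density (count_space UNIV) (%_. ennreal c)) A = ennreal c * emeasure (count_space UNIV) A"
   by (rule emeasure_density_const) simp
  show "emeasure m A = emeasure (density (count_space UNIV) (%_. ennreal c)) A"
  proof (cases "finite A")
   case True
   then show ?thesis using c0 by (simp add: d F ennreal_mult' ennreal_of_nat_eq_real_of_nat)
  next
   case False
   have "emeasure m A = \<infinity>"
   proof (rule ccontr)
    assume n: "emeasure m A ~= \<infinity>"
    define r where "r = enn2real (emeasure m A)"
    have r: "emeasure m A = ennreal r" "0 <= r" using n by (simp_all add: r_def top.not_eq_extremum)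
    obtain n :: nat where n: "r < real n * c" using reals_Archimedean3[OF cp] by blast
    obtain K where K: "K \<subseteq> A" "finite K" "card K = n" using infinite_arbitrarily_large[OF False] by blast
    have "emeasure m K <= emeasure m A" using K sets by (intro emeasure_mono) auto
    then show False using n r c0 by (simp add: F[OF K(2)] K(3) ennreal_le_iff mult.commute)
   qed
   then show ?thesis using False cp by (simp add: d ennreal_mult_top)
  qed
 qed
 with cp show thesis by (rule that)
qed

text \<open>Multiplication by the mass \<open>c\<close> of a point turns a density with respect to
  \<open>m\<close> into one with respect to counting measure; then \<open>isometry_atomic\<close>
  and \<open>isometry_evaluation\<close> identify the spaces.\<close>

lemma (in discrete_weighted) L1_of_left_haar:
 assumes W: "!!x. om x <= W" and m: "left_haar m"
 shows "M_star_dual_is_L1 om m"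
proof -
 obtain c where c: "0 < c" and mc: "m = density (count_space UNIV) (%_. ennreal c)"
  by (rule left_haar_discrete[OF m disc])
 have bm: "f : borel_measurable m" for f :: "'g => complex" by (simp add: mc)
 have im: "integrable m f \<longleftrightarrow> integrable (count_space UNIV) (%x. complex_of_real c * f x)" for f :: "'g => complex"
  unfolding mc using c by (subst integrable_density) (auto simp: scaleR_conv_of_real)
 have int: "(LINT x|m. f x) = (LINT x|count_space UNIV. complex_of_real c * f x)" for f :: "'g => complex"
  unfolding mc using c by (subst integral_density) (auto simp: scaleR_conv_of_real)
 have w0: "0 < om x" "1 <= om x" for x using weightD(1,2)[of x] by auto
 have W1: "1 <= W" using W[of 0] weightD(1)[of 0] by simp
 define k where "k ph = (%x. complex_of_real c * ph x)" for ph :: "'g => complex"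
 have L1_1: "ph : L1 m (%x. 1) \<longleftrightarrow> k ph : carrier l1" for ph
 proof -
  have "ph : L1 m (%x. 1) \<longleftrightarrow> (%x. norm (k ph x)) summable_on UNIV"
   by (simp add: L1_def bm im abs_summable_iff_integrable k_def)
  also have "... \<longleftrightarrow> k ph : carrier l1"
  proof
   assume "(%x. norm (k ph x)) summable_on UNIV"
   then have "(%x. W * norm (k ph x)) summable_on UNIV" by (rule summable_on_cmult_right)
   then show "k ph : carrier l1"
    unfolding l1_iff by (rule summable_on_comparison_test) (use W w0 in \<open>auto intro: mult_right_mono simp: less_imp_le\<close>)
  qed (rule l1_norm_summable)
  finally show ?thesis .
 qed
 have L1_eq: "L1 m om = L1 m (%x. 1)"
 proof -
  have "ph : L1 m om \<longleftrightarrow> k ph : carrier l1" for ph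
  proof -
   have "norm (complex_of_real c * (complex_of_real (om x) * ph x)) = om x * norm (k ph x)" for x
    using w0[of x] by (simp add: k_def norm_mult)
   then show ?thesis by (simp add: L1_def bm im abs_summable_iff_integrable[symmetric] l1_iff)
  qed
  then show ?thesis using L1_1 by blast
 qed
 have meas: "L1_measure m ph = atomic (k ph)" if "k ph : carrier l1" for ph
 proof
  fix A
  have "(LINT x:A|m. ph x) = (LINT x:A|count_space UNIV. k ph x)"
   unfolding set_lebesgue_integral_def int by (simp add: k_def mult_ac)
  then show "L1_measure m ph A = atomic (k ph) A"
   by (simp add: atomic_eq[OF that] L1_measure_def)
 qed
 have emb: "L1_embed om m ph = evaluation om (atomic (k ph))" if "k ph : carrier l1" for ph
  by (simp add: L1_embed_def meas[OF that])
 note iso = isometry_evaluation[unfolded isometry_def] and iso' = isometry_atomic[unfolded isometry_def]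
 have at: "atomic f : \<M>" "atomic f {x} = f x" if "f : carrier l1" for f x
  using atomic_M(1)[OF that] by (simp_all add: atomic_def)
 have kinv: "k (%x. f x / complex_of_real c) = f" for f using c by (simp add: k_def)
 have add: "mu \<oplus>\<^bsub>malg om\<^esub> nu = (%A. mu A + nu A)" "d \<odot>\<^bsub>malg om\<^esub> mu = (%A. d * mu A)" for mu nu :: "'g cmeasure" and d
  by (simp_all add: weighted_measure_algebra_def)
 have ladd: "f \<oplus>\<^bsub>l1\<^esub> g = (%x. f x + g x)" "d \<odot>\<^bsub>l1\<^esub> f = (%x. d * f x)" for f g :: "'g => complex" and d
  by (simp_all add: l1_def)
 note nl = banach_space_normed[OF banach_l1]
 have "L1_embed om m ` L1 m (%x. 1) = carrier (M_star_dual om)"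
 proof -
  have "k ` L1 m (%x. 1) = carrier l1"
  proof (intro equalityI subsetI)
   fix f assume "f : carrier l1"
   then show "f : k ` L1 m (%x. 1)" using kinv[of f] L1_1 by (metis image_eqI)
  qed (auto simp: L1_1)
  then have "evaluation om ` atomic ` k ` L1 m (%x. 1) = carrier (M_star_dual om)"
   using iso iso' by (simp add: bij_betw_def)
  moreover have "L1_embed om m ` L1 m (%x. 1) = (%ph. evaluation om (atomic (k ph))) ` L1 m (%x. 1)"
   by (rule image_cong[OF refl], rule emb) (simp only: L1_1)
  ultimately show ?thesis by (simp only: image_image)
 qed
 moreover have "(L1_embed om m ph = L1_embed om m ps) = (AE x in m. ph x = ps x) &
   L1_embed om m (%x. ph x + ps x) = L1_embed om m ph \<oplus>\<^bsub>M_star_dual om\<^esub> L1_embed om m ps &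
   L1_embed om m (L1_conv m ph ps) = L1_embed om m ph \<otimes>\<^bsub>M_star_dual om\<^esub> L1_embed om m ps"
  if "ph : L1 m (%x. 1)" "ps : L1 m (%x. 1)" for ph ps
 proof (intro conjI)
  have f: "k ph : carrier l1" and g: "k ps : carrier l1" using that by (simp_all add: L1_1)
  have AE: "(AE x in m. ph x = ps x) \<longleftrightarrow> ph = ps"
   unfolding mc using c by (subst AE_density) (auto simp: AE_count_space fun_eq_iff)
  have "ph = ps" if "atomic (k ph) = (atomic (k ps) :: 'g cmeasure)"
  proof
   fix x
   have "k ph x = k ps x" using at(2)[OF f, of x] at(2)[OF g, of x] that by simp
   then show "ph x = ps x" using c by (simp add: k_def)
  qed
  then show "(L1_embed om m ph = L1_embed om m ps) = (AE x in m. ph x = ps x)"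
   using iso at(1)[OF f] at(1)[OF g] unfolding AE emb[OF f] emb[OF g] bij_betw_def inj_on_def by blast
  have s: "k (%x. ph x + ps x) = (%x. k ph x + k ps x)" by (simp add: k_def distrib_left)
  have fg: "k (%x. ph x + ps x) : carrier l1" using ns_add_closed[OF nl f g] by (simp add: s ladd)
  have "atomic (k (%x. ph x + ps x)) = atomic (k ph) \<oplus>\<^bsub>malg om\<^esub> atomic (k ps)"
   using iso' f g by (simp add: s ladd)
  then show "L1_embed om m (%x. ph x + ps x) = L1_embed om m ph \<oplus>\<^bsub>M_star_dual om\<^esub> L1_embed om m ps"
   using iso at(1)[OF f] at(1)[OF g] by (simp add: emb[OF f] emb[OF g] emb[OF fg])
  let ?mu = "atomic (k ph)" and ?nu = "atomic (k ps)"
  note cl = conv_closed(1)[OF at(1)[OF f] at(1)[OF g]]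
  \<comment> \<open>One factor \<open>c\<close> comes from the integral, the other from
    \<open>k\<close>; together they match the two factors hidden in the atoms of the
    measures.\<close>
  have kc: "k (L1_conv m ph ps) = (%x. conv ?mu ?nu {x})"
  proof
   fix x
   note hs = conv_has_sum[OF at(1)[OF f] at(1)[OF g], of x]
   have eq: "?mu {y} * ?nu {- y + x} = complex_of_real c * (complex_of_real c * (ph y * ps (- y + x)))" for y
    using at(2)[OF f] at(2)[OF g] by (simp add: k_def mult_ac)
   have "(%y. complex_of_real c * (complex_of_real c * (ph y * ps (- y + x)))) summable_on UNIV"
    using has_sum_imp_summable[OF hs] by (simp only: eq)
   then have s: "(%y. complex_of_real c * (ph y * ps (- y + x))) summable_on UNIV"
    using c by (subst (asm) summable_on_cmult_right') auto
   then have "L1_conv m ph ps x = (\<Sum>\<^sub>\<infinity>y. complex_of_real c * (ph y * ps (- y + x)))"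
    unfolding L1_conv_def int by (intro integral_count_space_infsum) (simp add: summable_on_iff_abs_summable_on_complex)
   then have "k (L1_conv m ph ps) x = (\<Sum>\<^sub>\<infinity>y. complex_of_real c * (complex_of_real c * (ph y * ps (- y + x))))"
    by (simp only: k_def infsum_cmult_right')
   also have "... = conv ?mu ?nu {x}" using infsumI[OF hs] by (simp only: eq)
   finally show "k (L1_conv m ph ps) x = conv ?mu ?nu {x}" .
  qed
  have kl: "k (L1_conv m ph ps) : carrier l1" unfolding kc by (rule M_atoms(1)[OF cl])
  have "L1_embed om m (L1_conv m ph ps) = evaluation om (conv ?mu ?nu)"
   unfolding emb[OF kl] unfolding kc by (simp only: M_atoms(3)[OF cl])
  then show "L1_embed om m (L1_conv m ph ps) = L1_embed om m ph \<otimes>\<^bsub>M_star_dual om\<^esub> L1_embed om m ps"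
   using evaluation_mult[OF at(1)[OF f] at(1)[OF g]] by (simp add: emb[OF f] emb[OF g] M_star_dual_def)
 qed
 moreover have "L1_embed om m (%x. d * ph x) = d \<odot>\<^bsub>M_star_dual om\<^esub> L1_embed om m ph" if "ph : L1 m (%x. 1)" for d ph
 proof -
  have f: "k ph : carrier l1" using that by (simp add: L1_1)
  have s: "k (%x. d * ph x) = (%x. d * k ph x)" by (simp add: k_def mult_ac)
  have df: "k (%x. d * ph x) : carrier l1" using ns_smult_closed[OF nl f, of d] by (simp add: s ladd)
  have "atomic (k (%x. d * ph x)) = d \<odot>\<^bsub>malg om\<^esub> atomic (k ph)" using iso' f by (simp add: s ladd)
  then show ?thesis using iso at(1)[OF f] by (simp add: emb[OF f] emb[OF df])
 qed
 moreover have "EX b>0. EX C. ALL ph:L1 m (%x. 1).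
   b * (LINT x|m. cmod (ph x)) <= nrm (M_star_dual om) (L1_embed om m ph) &
   nrm (M_star_dual om) (L1_embed om m ph) <= C * (LINT x|m. cmod (ph x))"
 \<comment> \<open>The constants 1 and \<open>W\<close> are the bounds
   \<open>1 <= om x <= W\<close>.\<close>
 proof (rule exI[of _ 1], intro conjI zero_less_one, rule exI[of _ W], intro ballI conjI)
  fix ph assume "ph : L1 m (%x. 1)"
  then have f: "k ph : carrier l1" by (simp add: L1_1)
  have n: "nrm (M_star_dual om) (L1_embed om m ph) = (\<Sum>\<^sub>\<infinity>x. om x * norm (k ph x))"
   using iso at(1)[OF f] atomic_M(2)[OF f] by (simp add: emb[OF f])
  have sm: "(%x. norm (k ph x)) summable_on UNIV" "(%x. om x * norm (k ph x)) summable_on UNIV"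
   using l1_norm_summable[OF f] f by (simp_all add: l1_iff)
  have "complex_of_real (LINT x|m. cmod (ph x)) = (LINT x|m. complex_of_real (cmod (ph x)))" by simp
  also have "... = (LINT x|count_space UNIV. complex_of_real (norm (k ph x)))"
   unfolding int k_def using c by (simp add: norm_mult)
  also have "... = (\<Sum>\<^sub>\<infinity>x. complex_of_real (norm (k ph x)))"
   by (rule integral_count_space_infsum) (simp add: sm(1))
  also have "... = complex_of_real (\<Sum>\<^sub>\<infinity>x. norm (k ph x))" by (rule infsum_of_real'[OF sm(1)])
  finally have i: "(LINT x|m. cmod (ph x)) = (\<Sum>\<^sub>\<infinity>x. norm (k ph x))" by (simp only: of_real_eq_iff)
  show "1 * (LINT x|m. cmod (ph x)) <= nrm (M_star_dual om) (L1_embed om m ph)"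
   unfolding n i mult_1 using sm mult_right_mono[OF w0(2) norm_ge_zero] by (intro infsum_mono) auto
  have "(\<Sum>\<^sub>\<infinity>x. om x * norm (k ph x)) <= (\<Sum>\<^sub>\<infinity>x. W * norm (k ph x))"
   using sm W by (intro infsum_mono summable_on_cmult_right mult_right_mono) auto
  also have "... = W * (\<Sum>\<^sub>\<infinity>x. norm (k ph x))" by (rule infsum_cmult_right')
  finally show "nrm (M_star_dual om) (L1_embed om m ph) <= W * (LINT x|m. cmod (ph x))" unfolding n i .
 qed
 ultimately show ?thesis unfolding M_star_dual_is_L1_def using L1_eq by blast
qed

section \<open>The two algebras as paired algebras, and the equivalence\<close>

context locally_compact_weighted
begin

lemma paired_M:
 assumes "banach_algebra (malg om)"
 shows "paired om (malg om) (%a th. th a) (%mu. mu)"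
 by unfold_locales (use lc w assms M_starD in \<open>auto simp: weighted_measure_algebra_def functional_measure_def\<close>)

lemma paired_M_star_dual:
 assumes bA: "banach_algebra (M_star_dual om)"
 shows "paired om (M_star_dual om) (%Ph th. Ph th) (evaluation om)"
proof unfold_locales
 note nS = normed_M_star
 have sd: "carrier (M_star_dual om) = carrier (dual_space (M_star om))" "nrm (M_star_dual om) = nrm (dual_space (M_star om))"
  "f \<oplus>\<^bsub>M_star_dual om\<^esub> g = (%x. f x + g x)" "c \<odot>\<^bsub>M_star_dual om\<^esub> f = (%x. c * f x)"
  "f \<otimes>\<^bsub>M_star_dual om\<^esub> g = arens om f g" for f g c
  by (simp_all add: M_star_dual_def dual_space_def)
 show "banach_algebra (M_star_dual om)" by (rule bA)
 fix a b :: "'g cmeasure_bifunctional" and th th' :: "'g cmeasure_functional" and c and K :: real and mu :: "'g cmeasure"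
 show "(a \<oplus>\<^bsub>M_star_dual om\<^esub> b) th = a th + b th" "(c \<odot>\<^bsub>M_star_dual om\<^esub> a) th = c * a th" by (simp_all add: sd)
 show "(a \<otimes>\<^bsub>M_star_dual om\<^esub> b) th = a (%mu. if mu : \<M> then b (functional_measure om th mu) else 0)"
  if "th : \<P>"
  using that by (simp add: sd arens_def bifunctional_functional_def)
 show "a (%nu. th nu + th' nu) = a th + a th'"
  if "a : carrier (M_star_dual om)" "th : \<P>" "th' : \<P>"
  using dual_carrierD(1)[of a "M_star om" th th'] that by (simp add: sd M_star_simps)
 show "a (%nu. c * th nu) = c * a th" if "a : carrier (M_star_dual om)" "th : \<P>"
  using dual_carrierD(2)[of a "M_star om" th c] that by (simp add: sd M_star_simps)
 show "cmod (a th) <= K * nrm (M_star_dual om) a"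
  if a: "a : carrier (M_star_dual om)" and th: "th : \<P>" and K: "0 <= K"
   "!!nu. nu : \<M> ==> cmod (th nu) <= K * \<N> nu"
 proof -
  have "nrm (M_star om) th <= K" unfolding M_star_simps(4) by (rule dual_nrm_le[OF normed_M K])
  then have "nrm (M_star_dual om) a * nrm (M_star om) th <= nrm (M_star_dual om) a * K"
   using dual_nrm_nonneg[OF nS] a by (intro mult_left_mono) (simp_all add: sd)
  then show ?thesis using dual_nrm_bound[OF nS _ th, of a] a by (simp add: sd mult.commute)
 qed
 show "evaluation om mu : carrier (M_star_dual om)" if mu: "mu : \<M>"
  unfolding sd
  by (rule dual_carrierI[where C = "\<N> mu"])
   (use M_starD(4)[OF _ mu] ns_add_closed[OF nS] ns_smult_closed[OF nS]
    in \<open>auto simp: evaluation_def M_star_simps(1-3) mult.commute\<close>)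
 show "evaluation om mu th = th mu" if "th : \<P>" using that by (simp add: evaluation_def)
qed

end

theorem theorem5p1:
 fixes \<omega> :: "'g::{topological_group_add,t2_space} \<Rightarrow> real"
 assumes "locally_compact_space (euclidean :: 'g topology)"
  and "weight \<omega>"
  and universe: "\<exists>\<iota> :: ('g cmeasure_bifunctional \<Rightarrow> 'g cmeasure_bifunctional \<Rightarrow> complex) \<Rightarrow> 'e. inj \<iota>"
 shows "(amenable TYPE('e) (M_star_dual \<omega>) \<longleftrightarrow> amenable TYPE('e) (weighted_measure_algebra \<omega>)) \<and>
  (amenable TYPE('e) (weighted_measure_algebra \<omega>) \<longleftrightarrow>
   discrete_group TYPE('g) \<and> amenable_group TYPE('g) \<and> bounded (range (weight_star \<omega>))) \<and>
  (amenable TYPE('e) (M_star_dual \<omega>) \<longrightarrow> (\<forall>m. left_haar m \<longrightarrow> M_star_dual_is_L1 \<omega> m))"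
proof -
 interpret locally_compact_weighted \<omega> using assms(1,2) by unfold_locales
 obtain \<iota> :: "('g cmeasure_bifunctional \<Rightarrow> 'g cmeasure_bifunctional \<Rightarrow> complex) \<Rightarrow> 'e" where \<iota>: "inj \<iota>"
  using universe by blast
 let ?c = "discrete_group TYPE('g) \<and> amenable_group TYPE('g) \<and> bounded (range (weight_star \<omega>))"
 have bounded: "\<exists>W. \<forall>x. \<omega> x \<le> W" if b: "bounded (range (weight_star \<omega>))"
 proof -
  obtain W where W: "\<And>x. \<bar>weight_star \<omega> x\<bar> \<le> W" using b by (auto simp: bounded_iff)
  have "\<omega> x \<le> W" for x
  proof -
   have "\<omega> x * 1 \<le> \<omega> x * \<omega> (- x)" using weightD(1,2) by (intro mult_left_mono) (auto simp: less_imp_le)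
   then show ?thesis using W[of x] by (simp add: weight_star_def)
  qed
  then show ?thesis by blast
 qed
 have a_c: "?c" if am: "amenable TYPE('e) (M_star_dual \<omega>)"
 proof -
  interpret paired \<omega> "M_star_dual \<omega>" "\<lambda>\<Phi> \<theta>. \<Phi> \<theta>" "evaluation \<omega>"
   using am by (intro paired_M_star_dual) (simp add: amenable_def)
  \<comment> \<open>The forms on the Arens algebra are functions of pairs; \<open>universe\<close>
    provides room for their curried versions.\<close>
  have "inj (\<lambda>F. \<iota> (\<lambda>x y. F (x, y)))" by (intro injI ext) (auto dest!: injD[OF \<iota>] simp: fun_eq_iff)
  from amenable_imp_discrete[OF am this] amenable_imp_amenable_group[OF am this] show ?thesis by blast
 qed
 have b_c: "?c" if am: "amenable TYPE('e) (weighted_measure_algebra \<omega>)"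
 proof -
  interpret paired \<omega> "malg \<omega>" "\<lambda>a \<theta>. \<theta> a" "\<lambda>\<mu>. \<mu>"
   using am by (intro paired_M) (simp add: amenable_def)
  \<comment> \<open>Measures embed into bifunctionals by evaluation. A left inverse \<open>p\<close>
    pulls forms on measures back to forms on bifunctionals, injectively because \<open>p\<close> is
    onto, so the same universe serves both algebras.\<close>
  define q :: "'g cmeasure \<Rightarrow> 'g cmeasure_bifunctional" where "q \<mu> = (\<lambda>\<theta>. \<theta> \<mu>)" for \<mu>
  define p where "p = inv_into UNIV q"
  have "inj q"
  proof (rule injI)
   fix \<mu> \<nu> assume "q \<mu> = q \<nu>"
   then have "q \<mu> (\<lambda>\<tau>. of_bool (\<tau> = \<mu>)) = q \<nu> (\<lambda>\<tau>. of_bool (\<tau> = \<mu>))" by simp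
   then show "\<mu> = \<nu>" by (simp add: q_def split: if_splits)
  qed
  then have p: "p (q \<mu>) = \<mu>" for \<mu> by (simp add: p_def)
  have "inj (\<lambda>F. \<iota> (\<lambda>x y. F (p x, p y)))"
  proof (intro injI ext)
   fix F G :: "'g cmeasure \<times> 'g cmeasure \<Rightarrow> complex" and z
   assume "\<iota> (\<lambda>x y. F (p x, p y)) = \<iota> (\<lambda>x y. G (p x, p y))"
   then have "(\<lambda>x y. F (p x, p y)) = (\<lambda>x y. G (p x, p y))" by (rule injD[OF \<iota>])
   then have "F (p (q (fst z)), p (q (snd z))) = G (p (q (fst z)), p (q (snd z)))" by meson
   then show "F z = G z" by (simp add: p)
  qed
  from amenable_imp_discrete[OF am this] amenable_imp_amenable_group[OF am this] show ?thesis by blast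
 qed
 have c_b_a: "amenable TYPE('e) (malg \<omega>) \<and> amenable TYPE('e) (M_star_dual \<omega>) \<and> (\<forall>m. left_haar m \<longrightarrow> M_star_dual_is_L1 \<omega> m)"
  if c: ?c
 proof -
  interpret discrete_weighted \<omega> using c by unfold_locales blast
  obtain W where W: "\<And>x. \<omega> x \<le> W" using bounded c by blast
  have M: "amenable TYPE('e) (malg \<omega>)" using amenable_M W c by blast
  have "amenable TYPE('e) (M_star_dual \<omega>)"
   by (rule amenable_isometry[OF M isometry_evaluation])
    (simp add: evaluation_mult weighted_measure_algebra_def M_star_dual_def)
  then show ?thesis using M L1_of_left_haar W by blast
 qed
 show ?thesis using a_c b_c c_b_a by blast
qed

end
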